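(* Let $U\subset\mathbb R^{N_0}$ be compact and assume: (i) the weights $W^{(\ell)}_{ij}$ ($0\le \ell\le L$, $1\le i\le N_{\ell+1}$, $1\le j\le N_\ell$) are independent with $W^{(\ell)}_{ij}\sim\mathcal N(0,\lambda_\ell^{-1})$, $\lambda_\ell\in(0,\infty)$; (ii) $\sigma:\mathbb R\to\mathbb R$ is continuous and there are $A<\infty$ and $r>0$ with $\sigma(x)^2\le A(1+|x|^r)$ for all $x\in\mathbb R$; (iii) $N_0$ and $N_{L+1}=D$ are fixed, while for $\ell=1,\dots,L$, $N_\ell=N_\ell(N)$ satisfies $\lim_{N\to\infty}N_\ell/N=m_\ell\in(0,\infty)$. Then, as $N\to\infty$, $$(\mathsf K^2_{N_1},\dots,\mathsf K^{L+1}_{N_L})\to(\mathsf K^2_\infty,\dots,\mathsf K^{L+1}_\infty)\quad\text{in probability}$$ in $\mathcal L_1^{+,s}\times\dots\times\mathcal L_1^{+,s}$ ($L$ factors) with the trace-norm topology.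
   Context: Network. Fix integers $L,N_0,D\ge1$, a compact $U\subset\mathbb R^{N_0}$, $\lambda_0,\dots,\lambda_L\in(0,\infty)$ and $\sigma:\mathbb R\to\mathbb R$. For each $N$ there are widths $N_1(N),\dots,N_L(N)$ and $N_{L+1}=D$. For $x=(x_1,\dots,x_{N_0})\in U$ set $h^{(1)}_i(x)=N_0^{-1/2}\sum_{j=1}^{N_0}W^{(0)}_{ij}x_j$ for $i\le N_1$, and $h^{(\ell)}_i(x)=N_{\ell-1}^{-1/2}\sum_{j=1}^{N_{\ell-1}}W^{(\ell-1)}_{ij}\sigma(h^{(\ell-1)}_j(x))$ for $i\le N_\ell$, $2\le\ell\le L+1$. Covariance kernels on $U\times U$: $\mathcal K^1_{N_0}(x,x')=\frac1{\lambda_0N_0}\sum_{i=1}^{N_0}x_ix'_i$ (deterministic), and for $\ell=2,\dots,L+1$ the random kernel $\mathcal K^\ell_{N_{\ell-1}}(x,x')=\frac1{\lambda_{\ell-1}N_{\ell-1}}\sum_{i=1}^{N_{\ell-1}}\sigma(h^{(\ell-1)}_i(x))\,\sigma(h^{(\ell-1)}_i(x'))$. Limit kernels (NNGP recursion): $\mathcal K^1_\infty=\mathcal K^1_{N_0}$, and for $\ell=2,\dots,L+1$, $\mathcal K^\ell_\infty(x,x')=\frac1{\lambda_{\ell-1}}\mathbb E[\sigma(h^{\ell-1}_\infty(x))\,\sigma(h^{\ell-1}_\infty(x'))]$, where $h^{\ell-1}_\infty$ is a centered Gaussian process on $U$ with covariance function $\mathcal K^{\ell-1}_\infty$. Operators.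 $H=L^2(U)$ (Lebesgue measure). $\mathcal L_1^{+,s}$ is the set of non-negative, symmetric trace-class operators on $H$ with trace norm $\|K\|_1=\mathrm{tr}|K|$. For a continuous, symmetric, positive definite kernel $\mathscr K$ on $U^2$, $\phi(\mathscr K)\in\mathcal L_1^{+,s}$ is the integral operator $[\phi(\mathscr K)g](x)=\int_U\mathscr K(x,y)g(y)\,dy$. Set $\mathsf K^\ell_{N_{\ell-1}}=\phi(\mathcal K^\ell_{N_{\ell-1}})$ and $\mathsf K^\ell_\infty=\phi(\mathcal K^\ell_\infty)$. *)

theory Defs
  imports "HOL-Probability.Probability"
begin

text \<open>
  The real space L2(M) is represented by its functions; two functions denote the same vector iff
  they agree almost everywhere. An operator is a map on functions, required to be linear up to
  null sets and bounded. Linearity and boundedness together force it to respect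
  almost-everywhere equality, so it descends to the quotient. For U a Borel set,
  L2(U) is the instance M = lebesgue_on U.
\<close>

definition L2 :: "'a measure \<Rightarrow> ('a \<Rightarrow> real) set" where
  "L2 M = {f \<in> borel_measurable M. integrable M (\<lambda>x. (f x)\<^sup>2)}"

definition L2_inner :: "'a measure \<Rightarrow> ('a \<Rightarrow> real) \<Rightarrow> ('a \<Rightarrow> real) \<Rightarrow> real" where
  "L2_inner M f g = (\<integral>x. f x * g x \<partial>M)"

definition L2_norm :: "'a measure \<Rightarrow> ('a \<Rightarrow> real) \<Rightarrow> real" where
  "L2_norm M f = sqrt (L2_inner M f f)"

type_synonym 'a oper = "('a \<Rightarrow> real) \<Rightarrow> 'a \<Rightarrow> real"

definition L2_operator :: "'a measure \<Rightarrow> 'a oper \<Rightarrow> bool" where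
  "L2_operator M T \<longleftrightarrow>
     (\<forall>f\<in>L2 M. T f \<in> L2 M) \<and>
     (\<forall>f\<in>L2 M. \<forall>g\<in>L2 M. \<forall>a b. AE x in M. T (\<lambda>y. a * f y + b * g y) x = a * T f x + b * T g x) \<and>
     (\<exists>C. \<forall>f\<in>L2 M. L2_norm M (T f) \<le> C * L2_norm M f)"

definition L2_symmetric :: "'a measure \<Rightarrow> 'a oper \<Rightarrow> bool" where
  "L2_symmetric M T \<longleftrightarrow> (\<forall>f\<in>L2 M. \<forall>g\<in>L2 M. L2_inner M (T f) g = L2_inner M f (T g))"

definition L2_nonneg :: "'a measure \<Rightarrow> 'a oper \<Rightarrow> bool" where
  "L2_nonneg M T \<longleftrightarrow> (\<forall>f\<in>L2 M. 0 \<le> L2_inner M (T f) f)"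

text \<open>
  The absolute value |T| is the non-negative square root of T*T, the adjoint being written out
  through the inner product. It is unique up to null sets, so the choice is immaterial.
\<close>

definition is_L2_abs :: "'a measure \<Rightarrow> 'a oper \<Rightarrow> 'a oper \<Rightarrow> bool" where
  "is_L2_abs M T S \<longleftrightarrow>
     L2_operator M S \<and> L2_symmetric M S \<and> L2_nonneg M S \<and>
     (\<forall>f\<in>L2 M. \<forall>g\<in>L2 M. L2_inner M (S (S f)) g = L2_inner M (T f) (T g))"

definition L2_abs :: "'a measure \<Rightarrow> 'a oper \<Rightarrow> 'a oper" where
  "L2_abs M T = (SOME S. is_L2_abs M T S)"

definition L2_orthonormal_basis :: "'a measure \<Rightarrow> ('a \<Rightarrow> real) set \<Rightarrow> bool" where
  "L2_orthonormal_basis M E \<longleftrightarrow>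
     E \<subseteq> L2 M \<and>
     (\<forall>e\<in>E. \<forall>e'\<in>E. L2_inner M e e' = (if e = e' then 1 else 0)) \<and>
     (\<forall>f\<in>L2 M. (\<forall>e\<in>E. L2_inner M f e = 0) \<longrightarrow> (AE x in M. f x = 0))"

text \<open>
  The trace of a non-negative operator, with values in [0, infinity]; it does not depend on the
  chosen basis.
\<close>

definition L2_trace :: "'a measure \<Rightarrow> 'a oper \<Rightarrow> ennreal" where
  "L2_trace M S = (\<Sum>\<^sub>\<infinity>e\<in>(SOME E. L2_orthonormal_basis M E). ennreal (L2_inner M (S e) e))"

definition trace_norm :: "'a measure \<Rightarrow> 'a oper \<Rightarrow> ennreal" where
  "trace_norm M T = L2_trace M (L2_abs M T)"

definition trace_class_nonneg_sym :: "'a measure \<Rightarrow> 'a oper set" where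
  "trace_class_nonneg_sym M =
     {T. L2_operator M T \<and> L2_symmetric M T \<and> L2_nonneg M T \<and> trace_norm M T < \<infinity>}"

definition integral_operator :: "'a measure \<Rightarrow> ('a \<Rightarrow> 'a \<Rightarrow> real) \<Rightarrow> 'a oper" where
  "integral_operator M K g = (\<lambda>x. \<integral>y. K x y * g y \<partial>M)"

text \<open>
  The maximum metric on tuples of operators indexed by I; it induces the product topology of the
  trace-norm topologies when I is finite. Components outside I are ignored.
\<close>

definition trace_dist :: "'a measure \<Rightarrow> nat set \<Rightarrow> (nat \<Rightarrow> 'a oper) \<Rightarrow> (nat \<Rightarrow> 'a oper) \<Rightarrow> ennreal" where
  "trace_dist M I S T = (SUP l\<in>I. trace_norm M (\<lambda>f x. S l f x - T l f x))"

text \<open>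
  Convergence in probability, in a space S with metric d, to a deterministic limit.
  The N-th random element lives on its own probability space P N. The relevant events are required
  to be measurable, since the measure of a non-measurable set is 0 by convention.
\<close>

definition tendsto_in_probability ::
  "'b set \<Rightarrow> ('b \<Rightarrow> 'b \<Rightarrow> ennreal) \<Rightarrow> (nat \<Rightarrow> 'w measure) \<Rightarrow> (nat \<Rightarrow> 'w \<Rightarrow> 'b) \<Rightarrow> 'b \<Rightarrow> bool" where
  "tendsto_in_probability S d P X Y \<longleftrightarrow>
     (\<forall>N. \<forall>\<omega>\<in>space (P N). X N \<omega> \<in> S) \<and> Y \<in> S \<and>
     (\<forall>\<epsilon>>0::real.
        (\<forall>N. {\<omega>\<in>space (P N). d (X N \<omega>) Y > ennreal \<epsilon>} \<in> sets (P N)) \<and>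
        (\<lambda>N. measure (P N) {\<omega>\<in>space (P N). d (X N \<omega>) Y > ennreal \<epsilon>}) \<longlonglongrightarrow> 0)"

text \<open>Degenerate (almost surely constant) variables count as Gaussian.\<close>

definition gaussian_rv :: "'w measure \<Rightarrow> ('w \<Rightarrow> real) \<Rightarrow> bool" where
  "gaussian_rv P X \<longleftrightarrow>
     X \<in> borel_measurable P \<and>
     ((\<exists>\<mu>. AE \<omega> in P. X \<omega> = \<mu>) \<or> (\<exists>\<mu> s. 0 < s \<and> distributed P lborel X (normal_density \<mu> s)))"

definition centered_gaussian_process ::
  "'w measure \<Rightarrow> 'a set \<Rightarrow> ('a \<Rightarrow> 'w \<Rightarrow> real) \<Rightarrow> ('a \<Rightarrow> 'a \<Rightarrow> real) \<Rightarrow> bool" where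
  "centered_gaussian_process P U h K \<longleftrightarrow>
     prob_space P \<and>
     (\<forall>F c. finite F \<and> F \<subseteq> U \<longrightarrow> gaussian_rv P (\<lambda>\<omega>. \<Sum>x\<in>F. c x * h x \<omega>)) \<and>
     (\<forall>x\<in>U. (\<integral>\<omega>. h x \<omega> \<partial>P) = 0) \<and>
     (\<forall>x\<in>U. \<forall>y\<in>U. (\<integral>\<omega>. h x \<omega> * h y \<omega> \<partial>P) = K x y)"

text \<open>
  preact ix sig n w l i x is the i-th pre-activation of layer l at input x, for widths n, weights
  w l i j and activation sig. Neurons are numbered from 1; ix numbers the
  coordinates of the input space. Layer 0 is the input itself (sig is not applied to it).
\<close>

fun preact :: "(nat \<Rightarrow> 'n) \<Rightarrow> (real \<Rightarrow> real) \<Rightarrow> (nat \<Rightarrow> nat) \<Rightarrow> (nat \<Rightarrow> nat \<Rightarrow> nat \<Rightarrow> real) \<Rightarrow>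
    nat \<Rightarrow> nat \<Rightarrow> real^'n::finite \<Rightarrow> real" where
  "preact ix sig n w 0 i x = x $ ix i"
| "preact ix sig n w (Suc 0) i x =
     (\<Sum>j=1..n 0. w 0 i j * x $ ix j) / sqrt (real (n 0))"
| "preact ix sig n w (Suc (Suc l)) i x =
     (\<Sum>j=1..n (Suc l). w (Suc l) i j * sig (preact ix sig n w (Suc l) j x)) / sqrt (real (n (Suc l)))"

definition input_kernel :: "(nat \<Rightarrow> real) \<Rightarrow> real^'n::finite \<Rightarrow> real^'n \<Rightarrow> real" where
  "input_kernel lam x y = (\<Sum>i\<in>UNIV. x $ i * y $ i) / (lam 0 * real CARD('n))"

text \<open>Meaningful for l at least 2 only; the kernel of layer 1 is input_kernel.\<close>

definition layer_kernel :: "(nat \<Rightarrow> 'n) \<Rightarrow> (real \<Rightarrow> real) \<Rightarrow> (nat \<Rightarrow> real) \<Rightarrow> (nat \<Rightarrow> nat) \<Rightarrow>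
    (nat \<Rightarrow> nat \<Rightarrow> nat \<Rightarrow> real) \<Rightarrow> nat \<Rightarrow> real^'n::finite \<Rightarrow> real^'n \<Rightarrow> real" where
  "layer_kernel ix sig lam n w l x y =
     (\<Sum>i=1..n (l-1). sig (preact ix sig n w (l-1) i x) * sig (preact ix sig n w (l-1) i y))
       / (lam (l-1) * real (n (l-1)))"

end

theory Submission
  imports Defs "HOL-Complex_Analysis.Great_Picard"
begin

text \<open>Two facts are combined. The kernel of layer l + 1 is an average over the neurons of layer l, and
  given the earlier layers these neurons are independent Gaussian processes whose covariance is the
  kernel before; so a law of large numbers can be carried from layer to layer. And for non-negative
  operators, convergence of the kernels in mean square, both on U x U and on the diagonal, already
  forces convergence in trace norm.

  The law of large numbers says that the expectation of (K_N(x,y) - K_inf(x,y))^2 tends to 0 for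
  all x and y in U. Given the earlier layers, the mean of a product of activations at x and y is a
  function of the covariance of a Gaussian pair. This function is continuous: an activation of
  polynomial growth is approximated by polynomials in sin(u/R), and Gaussian expectations of
  trigonometric polynomials can be read off the characteristic function
  (\<open>gauss2_product_tendsto\<close>). Continuity together with moment bounds gives an
  estimate that can be integrated over random covariances (\<open>gauss2_product_stability\<close>),
  so the conditional mean inherits the mean-square convergence of the previous layer; the
  fluctuation around it costs 1 / width (\<open>ker_variance_step\<close>). All moments of the
  kernels are bounded uniformly in the widths, so dominated convergence integrates the pointwise
  statement over U x U and over the diagonal (\<open>kernel_error_tendsto\<close>).

  For the operators, Arzela-Ascoli yields an eigenvector expansion of the integral operator of a
  continuous symmetric kernel. From it the absolute value and its trace are computed, and the trace
  norm becomes the supremum of the sums of |<Tf, f>| over finite orthonormal families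
  (\<open>trace_norm_kernel\<close>). The trace of a non-negative operator is the integral of its
  kernel over the diagonal. A finite family that captures almost all of the trace of the limit
  therefore captures almost all of the trace of a nearby operator; outside its span both operators
  are small, and on the span the Hilbert-Schmidt distance controls the difference
  (\<open>trace_psd_continuity\<close>). What is used of the trace formula is an inequality that
  Gram kernels satisfy by Bessel's inequality and that limits inherit, so the limit kernels satisfy
  it as well (\<open>Kinf_trace_psd\<close>).

  Markov's inequality then gives convergence in probability. The events concerned are measurable
  because the error in trace norm is a supremum of continuous functions of the weights.\<close>

section \<open>Square-integrable functions as a semi-inner-product space\<close>

lemma L2_measurable: "f \<in> L2 M \<Longrightarrow> f \<in> borel_measurable M"
  by (simp add: L2_def)

lemma L2_integrable_square: "f \<in> L2 M \<Longrightarrow> integrable M (\<lambda>x. (f x)\<^sup>2)"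
  by (simp add: L2_def)

lemma L2_integrable_mult:
  assumes "f \<in> L2 M" "g \<in> L2 M"
  shows "integrable M (\<lambda>x. f x * g x)"
proof (rule Bochner_Integration.integrable_bound)
  show "integrable M (\<lambda>x. (f x)\<^sup>2 + (g x)\<^sup>2)"
    using assms by (auto simp: L2_def)
  show "(\<lambda>x. f x * g x) \<in> borel_measurable M"
    using assms by (auto simp: L2_def)
  show "AE x in M. norm (f x * g x) \<le> norm ((f x)\<^sup>2 + (g x)\<^sup>2)"
  proof (rule AE_I2)
    fix x
    have "2 * \<bar>f x * g x\<bar> \<le> (f x)\<^sup>2 + (g x)\<^sup>2"
      using sum_squares_bound[of "\<bar>f x\<bar>" "\<bar>g x\<bar>"] by (simp add: abs_mult)
    then have "\<bar>f x * g x\<bar> \<le> (f x)\<^sup>2 + (g x)\<^sup>2" using abs_ge_zero[of "f x * g x"] by linarith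
    then show "norm (f x * g x) \<le> norm ((f x)\<^sup>2 + (g x)\<^sup>2)" by simp
  qed
qed

lemma L2_lincomb:
  assumes "f \<in> L2 M" "g \<in> L2 M"
  shows "(\<lambda>x. a * f x + b * g x) \<in> L2 M"
proof -
  have "integrable M (\<lambda>x. a\<^sup>2 * (f x)\<^sup>2 + b\<^sup>2 * (g x)\<^sup>2 + 2 * a * b * (f x * g x))"
    using assms L2_integrable_mult[OF assms]
    by (intro Bochner_Integration.integrable_add integrable_mult_right) (auto simp: L2_def)
  moreover have "a\<^sup>2 * (f x)\<^sup>2 + b\<^sup>2 * (g x)\<^sup>2 + 2 * a * b * (f x * g x) = (a * f x + b * g x)\<^sup>2" for x
    by (simp add: power2_eq_square algebra_simps)
  ultimately show ?thesis using assms by (auto simp: L2_def)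
qed

lemma L2_zero [simp]: "(\<lambda>x. 0) \<in> L2 M"
  by (simp add: L2_def)

lemma L2_scale: "f \<in> L2 M \<Longrightarrow> (\<lambda>x. c * f x) \<in> L2 M"
  using L2_lincomb[of f M f c 0] by simp

lemma L2_add: "f \<in> L2 M \<Longrightarrow> g \<in> L2 M \<Longrightarrow> (\<lambda>x. f x + g x) \<in> L2 M"
  using L2_lincomb[of f M g 1 1] by simp

lemma L2_diff: "f \<in> L2 M \<Longrightarrow> g \<in> L2 M \<Longrightarrow> (\<lambda>x. f x - g x) \<in> L2 M"
  using L2_lincomb[of f M g 1 "-1"] by simp

lemma L2_sum: "(\<And>i. i \<in> I \<Longrightarrow> f i \<in> L2 M) \<Longrightarrow> (\<lambda>x. \<Sum>i\<in>I. c i * f i x) \<in> L2 M"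
proof (induction I rule: infinite_finite_induct)
  case (insert i I)
  then show ?case using L2_add[of "\<lambda>x. c i * f i x" M "\<lambda>x. \<Sum>i\<in>I. c i * f i x"] L2_scale[of "f i" M "c i"] by simp
qed simp_all

lemma L2_inner_commute: "L2_inner M f g = L2_inner M g f"
  by (simp add: L2_inner_def mult.commute)

lemma L2_inner_lincomb:
  assumes "f \<in> L2 M" "g \<in> L2 M" "h \<in> L2 M"
  shows "L2_inner M (\<lambda>x. a * f x + b * g x) h = a * L2_inner M f h + b * L2_inner M g h"
proof -
  have "L2_inner M (\<lambda>x. a * f x + b * g x) h = (\<integral>x. a * (f x * h x) + b * (g x * h x) \<partial>M)"
    by (simp add: L2_inner_def algebra_simps)
  also have "\<dots> = a * L2_inner M f h + b * L2_inner M g h"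
    using assms L2_integrable_mult[of f M h] L2_integrable_mult[of g M h] by (simp add: L2_inner_def)
  finally show ?thesis .
qed

lemma L2_inner_scale: "L2_inner M (\<lambda>x. a * f x) h = a * L2_inner M f h"
  by (simp add: L2_inner_def mult.assoc)

lemma L2_inner_scale_right: "L2_inner M h (\<lambda>x. a * f x) = a * L2_inner M h f"
  by (simp add: L2_inner_def mult.left_commute)

lemma L2_inner_add:
  "f \<in> L2 M \<Longrightarrow> g \<in> L2 M \<Longrightarrow> h \<in> L2 M \<Longrightarrow>
    L2_inner M (\<lambda>x. f x + g x) h = L2_inner M f h + L2_inner M g h"
  using L2_inner_lincomb[of f M g h 1 1] by simp

lemma L2_inner_diff:
  "f \<in> L2 M \<Longrightarrow> g \<in> L2 M \<Longrightarrow> h \<in> L2 M \<Longrightarrow>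
    L2_inner M (\<lambda>x. f x - g x) h = L2_inner M f h - L2_inner M g h"
  using L2_inner_lincomb[of f M g h 1 "-1"] by simp

lemma L2_inner_diff_right:
  "f \<in> L2 M \<Longrightarrow> g \<in> L2 M \<Longrightarrow> h \<in> L2 M \<Longrightarrow>
    L2_inner M h (\<lambda>x. f x - g x) = L2_inner M h f - L2_inner M h g"
  using L2_inner_diff[of f M g h] by (simp add: L2_inner_commute)

lemma L2_inner_zero [simp]: "L2_inner M (\<lambda>x. 0) h = 0" "L2_inner M h (\<lambda>x. 0) = 0"
  by (simp_all add: L2_inner_def)

lemma L2_inner_sum:
  assumes "\<And>i. i \<in> I \<Longrightarrow> f i \<in> L2 M" "h \<in> L2 M"
  shows "L2_inner M (\<lambda>x. \<Sum>i\<in>I. c i * f i x) h = (\<Sum>i\<in>I. c i * L2_inner M (f i) h)"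
  using assms(1)
proof (induction I rule: infinite_finite_induct)
  case (insert i I)
  have "L2_inner M (\<lambda>x. c i * f i x + (\<Sum>i\<in>I. c i * f i x)) h
      = L2_inner M (\<lambda>x. c i * f i x) h + L2_inner M (\<lambda>x. \<Sum>i\<in>I. c i * f i x) h"
    using insert.prems assms(2) by (intro L2_inner_add L2_scale L2_sum) auto
  then show ?case using insert by (simp add: L2_inner_scale)
qed simp_all

lemma L2_inner_sum_right:
  assumes "\<And>i. i \<in> I \<Longrightarrow> f i \<in> L2 M" "h \<in> L2 M"
  shows "L2_inner M h (\<lambda>x. \<Sum>i\<in>I. c i * f i x) = (\<Sum>i\<in>I. c i * L2_inner M h (f i))"
  using L2_inner_sum[OF assms] by (simp add: L2_inner_commute)

lemma L2_inner_nonneg [simp]: "0 \<le> L2_inner M f f"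
  by (simp add: L2_inner_def)

lemma L2_norm_nonneg [simp]: "0 \<le> L2_norm M f"
  by (simp add: L2_norm_def)

lemma L2_norm_square: "(L2_norm M f)\<^sup>2 = L2_inner M f f"
  by (simp add: L2_norm_def)

lemma L2_AE_zero_iff:
  assumes "f \<in> L2 M"
  shows "L2_inner M f f = 0 \<longleftrightarrow> (AE x in M. f x = 0)"
  using integral_nonneg_eq_0_iff_AE[OF L2_integrable_square[OF assms]]
  by (simp add: L2_inner_def power2_eq_square)

lemma L2_Cauchy_Schwarz_square:
  assumes f: "f \<in> L2 M" and g: "g \<in> L2 M"
  shows "(L2_inner M f g)\<^sup>2 \<le> L2_inner M f f * L2_inner M g g"
proof -
  let ?a = "L2_inner M f f" and ?b = "L2_inner M f g" and ?c = "L2_inner M g g"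
  have q: "0 \<le> s\<^sup>2 * ?a + 2 * s * t * ?b + t\<^sup>2 * ?c" for s t
  proof -
    have "0 \<le> L2_inner M (\<lambda>x. s * f x + t * g x) (\<lambda>x. s * f x + t * g x)" by simp
    also have "\<dots> = s * L2_inner M f (\<lambda>x. s * f x + t * g x) + t * L2_inner M g (\<lambda>x. s * f x + t * g x)"
      by (intro L2_inner_lincomb L2_lincomb f g)
    also have "\<dots> = s\<^sup>2 * ?a + 2 * s * t * ?b + t\<^sup>2 * ?c"
      using L2_inner_lincomb[OF f g f, of s t] L2_inner_lincomb[OF f g g, of s t]
      by (simp add: L2_inner_commute power2_eq_square algebra_simps)
    finally show ?thesis .
  qed
  show ?thesis
  proof (cases "?c = 0")
    case True
    have "?b = 0"
    proof (rule ccontr)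
      assume "?b \<noteq> 0"
      then show False using q[of 1 "- (?a + 1) / (2 * ?b)"] True by (simp add: field_simps)
    qed
    then show ?thesis using True by simp
  next
    case False
    then have "0 < ?c" by (metis L2_inner_nonneg less_eq_real_def)
    moreover have "0 \<le> ?c * (?a * ?c - ?b\<^sup>2)"
      using q[of ?c "- ?b"] by (simp add: power2_eq_square algebra_simps)
    ultimately show ?thesis by (simp add: zero_le_mult_iff)
  qed
qed

lemma L2_Cauchy_Schwarz:
  assumes "f \<in> L2 M" "g \<in> L2 M"
  shows "\<bar>L2_inner M f g\<bar> \<le> L2_norm M f * L2_norm M g"
  using L2_Cauchy_Schwarz_square[OF assms]
  by (metis L2_norm_def real_sqrt_abs real_sqrt_le_mono real_sqrt_mult)

lemma L2_norm_lincomb_square: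
  assumes "f \<in> L2 M" "g \<in> L2 M"
  shows "L2_inner M (\<lambda>x. a * f x + b * g x) (\<lambda>x. a * f x + b * g x)
       = a\<^sup>2 * L2_inner M f f + 2 * a * b * L2_inner M f g + b\<^sup>2 * L2_inner M g g"
  using L2_inner_lincomb[OF assms L2_lincomb[OF assms], of a b a b]
    L2_inner_lincomb[OF assms assms(1), of a b] L2_inner_lincomb[OF assms assms(2), of a b]
  by (simp add: L2_inner_commute power2_eq_square algebra_simps)

lemma L2_norm_triangle:
  assumes "f \<in> L2 M" "g \<in> L2 M"
  shows "L2_norm M (\<lambda>x. f x + g x) \<le> L2_norm M f + L2_norm M g"
proof -
  have "(L2_norm M (\<lambda>x. f x + g x))\<^sup>2 \<le> (L2_norm M f + L2_norm M g)\<^sup>2"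
    using L2_norm_lincomb_square[OF assms, of 1 1] L2_Cauchy_Schwarz[OF assms]
    by (simp add: L2_norm_square power2_sum)
  then show ?thesis by (rule power2_le_imp_le) simp
qed

definition orthonormal :: "'a measure \<Rightarrow> ('a \<Rightarrow> real) set \<Rightarrow> bool" where
  "orthonormal M E \<longleftrightarrow> E \<subseteq> L2 M \<and> (\<forall>e\<in>E. \<forall>e'\<in>E. L2_inner M e e' = (if e = e' then 1 else 0))"

lemma orthonormal_empty [simp]: "orthonormal M {}"
  by (simp add: orthonormal_def)

lemma orthonormal_subset: "orthonormal M E \<Longrightarrow> F \<subseteq> E \<Longrightarrow> orthonormal M F"
  by (auto simp: orthonormal_def subset_iff)

lemma orthonormal_L2: "orthonormal M E \<Longrightarrow> e \<in> E \<Longrightarrow> e \<in> L2 M"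
  by (auto simp: orthonormal_def)

text \<open>For finite orthonormal F, the projection of f onto the orthogonal complement of the span.\<close>

definition residual :: "'a measure \<Rightarrow> ('a \<Rightarrow> real) set \<Rightarrow> ('a \<Rightarrow> real) \<Rightarrow> 'a \<Rightarrow> real" where
  "residual M F f x = f x - (\<Sum>e\<in>F. L2_inner M f e * e x)"

lemma L2_expansion: "orthonormal M F \<Longrightarrow> (\<lambda>x. \<Sum>e\<in>F. c e * e x) \<in> L2 M"
  by (intro L2_sum) (auto dest: orthonormal_L2)

lemma residual_L2: "orthonormal M F \<Longrightarrow> f \<in> L2 M \<Longrightarrow> residual M F f \<in> L2 M"
  unfolding residual_def[abs_def] by (intro L2_diff L2_expansion)

lemma L2_inner_expansion:
  assumes F: "finite F" "orthonormal M F" and e: "e \<in> F"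
  shows "L2_inner M (\<lambda>x. \<Sum>e\<in>F. c e * e x) e = c e"
proof -
  have "L2_inner M (\<lambda>x. \<Sum>e\<in>F. c e * e x) e = (\<Sum>d\<in>F. c d * L2_inner M d e)"
    using F e by (intro L2_inner_sum) (auto dest: orthonormal_L2)
  also have "\<dots> = (\<Sum>d\<in>F. if d = e then c d else 0)"
    using F e by (intro sum.cong) (auto simp: orthonormal_def)
  also have "\<dots> = c e" using F e by simp
  finally show ?thesis .
qed

lemma L2_expansion_inner:
  assumes F: "finite F" "orthonormal M F"
  shows "L2_inner M (\<lambda>x. \<Sum>e\<in>F. c e * e x) (\<lambda>x. \<Sum>e\<in>F. d e * e x) = (\<Sum>e\<in>F. c e * d e)"
proof -
  have "L2_inner M (\<lambda>x. \<Sum>e\<in>F. c e * e x) (\<lambda>x. \<Sum>e\<in>F. d e * e x)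
      = (\<Sum>e\<in>F. d e * L2_inner M (\<lambda>x. \<Sum>e\<in>F. c e * e x) e)"
    using F by (intro L2_inner_sum_right L2_expansion) (auto dest: orthonormal_L2)
  also have "\<dots> = (\<Sum>e\<in>F. c e * d e)"
    using F by (intro sum.cong) (auto simp: L2_inner_expansion)
  finally show ?thesis .
qed

lemma residual_inner:
  assumes F: "finite F" "orthonormal M F" and f: "f \<in> L2 M" and g: "g \<in> L2 M"
  shows "L2_inner M (residual M F f) g = L2_inner M f g - (\<Sum>e\<in>F. L2_inner M f e * L2_inner M e g)"
  unfolding residual_def
  using L2_inner_diff[OF f L2_expansion[OF F(2)] g] L2_inner_sum[of F "\<lambda>e. e" M g "L2_inner M f"] F g
  by (auto dest: orthonormal_L2)

lemma residual_symmetric: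
  assumes F: "finite F" "orthonormal M F" and f: "f \<in> L2 M" and g: "g \<in> L2 M"
  shows "L2_inner M (residual M F f) g = L2_inner M f (residual M F g)"
proof -
  have "(\<Sum>e\<in>F. L2_inner M f e * L2_inner M e g) = (\<Sum>e\<in>F. L2_inner M g e * L2_inner M e f)"
    by (intro sum.cong refl) (simp add: L2_inner_commute[of M g] L2_inner_commute[of M f])
  then show ?thesis
    using residual_inner[OF F f g] residual_inner[OF F g f]
    by (simp add: L2_inner_commute[of M f "residual M F g"] L2_inner_commute[of M g f])
qed

lemma residual_norm:
  assumes F: "finite F" "orthonormal M F" and f: "f \<in> L2 M"
  shows "L2_inner M (residual M F f) (residual M F f)
       = L2_inner M f f - (\<Sum>e\<in>F. (L2_inner M f e)\<^sup>2)"
proof -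
  have "L2_inner M (residual M F f) e = 0" if "e \<in> F" for e
  proof -
    have eL: "e \<in> L2 M" using that F by (auto dest: orthonormal_L2)
    have "(\<Sum>d\<in>F. L2_inner M f d * L2_inner M d e) = (\<Sum>d\<in>F. if d = e then L2_inner M f d else 0)"
      using F that by (intro sum.cong) (auto simp: orthonormal_def)
    then show ?thesis using residual_inner[OF F f eL] F that by simp
  qed
  then have 0: "L2_inner M (residual M F f) (\<lambda>x. \<Sum>e\<in>F. L2_inner M f e * e x) = 0"
    using L2_inner_sum_right[of F "\<lambda>e. e" M "residual M F f" "L2_inner M f"] F
      residual_L2[OF F(2) f] by (auto dest: orthonormal_L2)
  have r: "residual M F f = (\<lambda>x. f x - (\<Sum>e\<in>F. L2_inner M f e * e x))"
    by (simp add: residual_def fun_eq_iff)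
  have "L2_inner M (residual M F f) (\<lambda>x. f x - (\<Sum>e\<in>F. L2_inner M f e * e x))
      = L2_inner M (residual M F f) f"
    using L2_inner_diff_right[OF f L2_expansion[OF F(2)] residual_L2[OF F(2) f]] 0 by simp
  then have "L2_inner M (residual M F f) (residual M F f) = L2_inner M (residual M F f) f"
    by (simp flip: r)
  also have "\<dots> = L2_inner M f f - (\<Sum>e\<in>F. (L2_inner M f e)\<^sup>2)"
  proof -
    have "(\<Sum>e\<in>F. L2_inner M f e * L2_inner M e f) = (\<Sum>e\<in>F. (L2_inner M f e)\<^sup>2)"
      by (intro sum.cong refl) (subst L2_inner_commute, rule power2_eq_square[symmetric])
    then show ?thesis using residual_inner[OF F f f] by simp
  qed
  finally show ?thesis .
qed

lemma Bessel:
  assumes "finite F" "orthonormal M F" "f \<in> L2 M"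
  shows "(\<Sum>e\<in>F. (L2_inner M f e)\<^sup>2) \<le> L2_inner M f f"
  using residual_norm[OF assms] L2_inner_nonneg[of M "residual M F f"] by simp

text \<open>Zorn's lemma gives a maximal orthonormal set; a non-null vector orthogonal to it could be
  normalised and added.\<close>

lemma L2_basis_exists: "\<exists>E. L2_orthonormal_basis M E"
proof -
  have "\<exists>E\<in>Collect (orthonormal M). \<forall>X\<in>Collect (orthonormal M). E \<subseteq> X \<longrightarrow> X = E"
  proof (rule subset_Zorn_nonempty)
    show "Collect (orthonormal M) \<noteq> {}" by (auto intro!: exI[of _ "{}"])
    fix C assume C: "C \<noteq> {}" "subset.chain (Collect (orthonormal M)) C"
    then have CO: "orthonormal M X" if "X \<in> C" for X
      using that by (auto simp: subset.chain_def)
    show "\<Union> C \<in> Collect (orthonormal M)"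
      unfolding orthonormal_def mem_Collect_eq
    proof (intro conjI ballI)
      show "\<Union> C \<subseteq> L2 M" using CO by (auto simp: orthonormal_def subset_iff)
      fix e e' assume "e \<in> \<Union> C" "e' \<in> \<Union> C"
      then obtain X Y where XY: "X \<in> C" "Y \<in> C" "e \<in> X" "e' \<in> Y" by auto
      then have "X \<subseteq> Y \<or> Y \<subseteq> X" using C(2) by (auto simp: subset.chain_def)
      then obtain Z where "Z \<in> C" "e \<in> Z" "e' \<in> Z" using XY by blast
      then show "L2_inner M e e' = (if e = e' then 1 else 0)"
        using CO[of Z] by (simp add: orthonormal_def)
    qed
  qed
  then obtain E where E: "orthonormal M E" and max: "\<And>X. orthonormal M X \<Longrightarrow> E \<subseteq> X \<Longrightarrow> X = E"
    by auto
  have "AE x in M. f x = 0" if f: "f \<in> L2 M" and perp: "\<forall>e\<in>E. L2_inner M f e = 0" for f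
  proof (rule ccontr)
    assume "\<not> (AE x in M. f x = 0)"
    then have pos: "0 < L2_inner M f f"
      using L2_AE_zero_iff[OF f] L2_inner_nonneg[of M f] by linarith
    define c where "c = 1 / L2_norm M f"
    define g where "g = (\<lambda>x. c * f x)"
    have "c * c * L2_inner M f f = 1"
      using pos by (simp add: c_def L2_norm_def)
    then have "L2_inner M g g = 1"
      by (simp add: g_def L2_inner_scale L2_inner_scale_right mult.assoc)
    moreover have "L2_inner M g e = 0" "L2_inner M e g = 0" if "e \<in> E" for e
      using perp that L2_inner_commute[of M e f]
      by (auto simp: g_def L2_inner_scale L2_inner_scale_right)
    moreover have "g \<in> L2 M" unfolding g_def using f by (rule L2_scale)
    ultimately have "orthonormal M (insert g E)" "g \<notin> E"
      using E by (auto simp: orthonormal_def)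
    then show False using max[of "insert g E"] by auto
  qed
  then have "L2_orthonormal_basis M E"
    using E unfolding L2_orthonormal_basis_def orthonormal_def by blast
  then show ?thesis by (rule exI)
qed

lemma (in finite_measure) L2_const: "(\<lambda>x. c) \<in> L2 M"
  by (simp add: L2_def)

lemma (in finite_measure) L2_integral_abs_le:
  assumes f: "f \<in> L2 M"
  shows "integrable M (\<lambda>x. \<bar>f x\<bar>)" "(\<integral>x. \<bar>f x\<bar> \<partial>M) \<le> L2_norm M f * sqrt (measure M (space M))"
proof -
  have af: "(\<lambda>x. \<bar>f x\<bar>) \<in> L2 M" using f by (auto simp: L2_def intro: borel_measurable_abs)
  show "integrable M (\<lambda>x. \<bar>f x\<bar>)" using L2_integrable_mult[OF af L2_const[of 1]] by simp
  have "L2_inner M (\<lambda>x. \<bar>f x\<bar>) (\<lambda>x. 1) \<le> L2_norm M (\<lambda>x. \<bar>f x\<bar>) * L2_norm M (\<lambda>x. 1)"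
    using L2_Cauchy_Schwarz[OF af L2_const[of 1]] by simp
  then show "(\<integral>x. \<bar>f x\<bar> \<partial>M) \<le> L2_norm M f * sqrt (measure M (space M))"
    by (simp add: L2_inner_def L2_norm_def)
qed

text \<open>The completeness argument of Riesz and Fischer: the increments are summable in L1, hence
  pointwise almost everywhere, and Fatou's lemma bounds the distance to the pointwise limit.\<close>

lemma (in finite_measure) L2_complete:
  assumes s: "\<And>n. s n \<in> L2 M"
    and fast: "\<And>n. L2_norm M (\<lambda>x. s (Suc n) x - s n x) \<le> (1/2)^n"
  obtains g where "g \<in> L2 M" "(\<lambda>n. L2_norm M (\<lambda>x. g x - s n x)) \<longlonglongrightarrow> 0"
proof -
  define c where "c = sqrt (measure M (space M))"
  have c0: "0 \<le> c" by (simp add: c_def)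
  have sm [measurable]: "s n \<in> borel_measurable M" for n using s by (rule L2_measurable)
  have "(\<integral>\<^sup>+x. (\<Sum>n. ennreal \<bar>s (Suc n) x - s n x\<bar>) \<partial>M) = (\<Sum>n. \<integral>\<^sup>+x. ennreal \<bar>s (Suc n) x - s n x\<bar> \<partial>M)"
    by (intro nn_integral_suminf) simp
  also have "\<dots> \<le> (\<Sum>n. ennreal ((1/2)^n * c))"
  proof (intro suminf_le allI summableI)
    fix n
    note d = L2_integral_abs_le[OF L2_diff[OF s[of "Suc n"] s[of n]]]
    have "(\<integral>\<^sup>+x. ennreal \<bar>s (Suc n) x - s n x\<bar> \<partial>M) = ennreal (\<integral>x. \<bar>s (Suc n) x - s n x\<bar> \<partial>M)"
      using d(1) by (intro nn_integral_eq_integral) auto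
    also have "\<dots> \<le> ennreal ((1/2)^n * c)"
      using d(2) mult_right_mono[OF fast[of n] c0] by (intro ennreal_leI) (auto simp: c_def)
    finally show "(\<integral>\<^sup>+x. ennreal \<bar>s (Suc n) x - s n x\<bar> \<partial>M) \<le> ennreal ((1/2)^n * c)" .
  qed
  also have "\<dots> = ennreal (\<Sum>n. (1/2)^n * c)"
    using c0 by (intro suminf_ennreal2 summable_mult2 summable_geometric) auto
  finally have "(\<integral>\<^sup>+x. (\<Sum>n. ennreal \<bar>s (Suc n) x - s n x\<bar>) \<partial>M) \<noteq> \<infinity>"
    by (auto simp: top_unique)
  then have "AE x in M. (\<Sum>n. ennreal \<bar>s (Suc n) x - s n x\<bar>) \<noteq> \<infinity>"
    by (intro nn_integral_noteq_infinite) auto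
  then have conv: "AE x in M. convergent (\<lambda>n. s n x)"
  proof (eventually_elim)
    case (elim x)
    have "summable (\<lambda>n. \<bar>s (Suc n) x - s n x\<bar>)"
      using elim by (intro summable_suminf_not_top) auto
    then have "summable (\<lambda>n. s (Suc n) x - s n x)" by (rule summable_rabs_cancel)
    then have "convergent (\<lambda>n. \<Sum>i<n. s (Suc i) x - s i x)" by (simp add: summable_iff_convergent)
    moreover have "(\<Sum>i<n. s (Suc i) x - s i x) = s n x - s 0 x" for n by (rule sum_lessThan_telescope)
    ultimately have "convergent (\<lambda>n. s n x - s 0 x)" by simp
    then show ?case using convergent_add[OF _ convergent_const[of "s 0 x"]] by fastforce
  qed
  define g where "g = (\<lambda>x. lim (\<lambda>n. s n x))"
  have gm [measurable]: "g \<in> borel_measurable M" unfolding g_def by measurable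
  have tele: "L2_norm M (\<lambda>x. s (n + k) x - s n x) \<le> 2 * (1/2)^n - 2 * (1/2)^(n + k)" for n k
  proof (induction k)
    case 0 then show ?case by (simp add: L2_norm_def)
  next
    case (Suc k)
    have "L2_norm M (\<lambda>x. (s (n + k) x - s n x) + (s (Suc (n + k)) x - s (n + k) x))
        \<le> L2_norm M (\<lambda>x. s (n + k) x - s n x) + L2_norm M (\<lambda>x. s (Suc (n + k)) x - s (n + k) x)"
      using s by (intro L2_norm_triangle L2_diff)
    then show ?case using Suc fast[of "n + k"] by simp
  qed
  have gs: "(\<integral>\<^sup>+x. ennreal ((g x - s n x)\<^sup>2) \<partial>M) \<le> ennreal ((2 * (1/2)^n)\<^sup>2)" for n
  proof -
    have "(\<integral>\<^sup>+x. ennreal ((g x - s n x)\<^sup>2) \<partial>M)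
        = (\<integral>\<^sup>+x. liminf (\<lambda>k. ennreal ((s (n + k) x - s n x)\<^sup>2)) \<partial>M)"
    proof (intro nn_integral_cong_AE)
      show "AE x in M. ennreal ((g x - s n x)\<^sup>2) = liminf (\<lambda>k. ennreal ((s (n + k) x - s n x)\<^sup>2))"
        using conv
      proof eventually_elim
        case (elim x)
        then have "(\<lambda>k. s k x) \<longlonglongrightarrow> g x" by (simp add: g_def convergent_LIMSEQ_iff)
        then have "(\<lambda>k. s (n + k) x) \<longlonglongrightarrow> g x"
          by (subst add.commute) (rule LIMSEQ_ignore_initial_segment)
        then have "(\<lambda>k. ennreal ((s (n + k) x - s n x)\<^sup>2)) \<longlonglongrightarrow> ennreal ((g x - s n x)\<^sup>2)"
          by (intro tendsto_intros)
        then show ?case by (intro lim_imp_Liminf[symmetric]) simp_all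
      qed
    qed
    also have "\<dots> \<le> liminf (\<lambda>k. \<integral>\<^sup>+x. ennreal ((s (n + k) x - s n x)\<^sup>2) \<partial>M)"
      by (intro nn_integral_liminf) simp
    also have "\<dots> \<le> ennreal ((2 * (1/2)^n)\<^sup>2)"
    proof (intro Liminf_le always_eventually allI)
      fix k
      have d: "(\<lambda>x. s (n + k) x - s n x) \<in> L2 M" using s by (intro L2_diff)
      have "(\<integral>\<^sup>+x. ennreal ((s (n + k) x - s n x)\<^sup>2) \<partial>M) = ennreal ((L2_norm M (\<lambda>x. s (n + k) x - s n x))\<^sup>2)"
        using L2_integrable_square[OF d] unfolding L2_norm_square L2_inner_def
        by (subst nn_integral_eq_integral) (auto simp: power2_eq_square)
      also have "\<dots> \<le> ennreal ((2 * (1/2)^n)\<^sup>2)"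
      proof (intro ennreal_leI power_mono)
        have "(0::real) \<le> 2 * (1/2)^(n + k)" by simp
        then show "L2_norm M (\<lambda>x. s (n + k) x - s n x) \<le> 2 * (1/2)^n" using tele[of n k] by linarith
      qed simp
      finally show "(\<integral>\<^sup>+x. ennreal ((s (n + k) x - s n x)\<^sup>2) \<partial>M) \<le> ennreal ((2 * (1/2)^n)\<^sup>2)" .
    qed simp
    finally show ?thesis .
  qed
  have dL: "(\<lambda>x. g x - s n x) \<in> L2 M" for n
  proof -
    have "(\<integral>\<^sup>+x. ennreal ((g x - s n x)\<^sup>2) \<partial>M) < \<infinity>" using gs[of n] le_less_trans by fastforce
    then show ?thesis unfolding L2_def by (auto intro!: integrableI_bounded)
  qed
  have "g \<in> L2 M" using L2_add[OF dL[of 0] s[of 0]] by simp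
  moreover have "(\<lambda>n. L2_norm M (\<lambda>x. g x - s n x)) \<longlonglongrightarrow> 0"
  proof (rule real_tendsto_sandwich[OF _ _ tendsto_const])
    show "\<forall>\<^sub>F n in sequentially. L2_norm M (\<lambda>x. g x - s n x) \<le> 2 * (1/2)^n"
    proof (intro always_eventually allI)
      fix n
      have "ennreal ((L2_norm M (\<lambda>x. g x - s n x))\<^sup>2) = (\<integral>\<^sup>+x. ennreal ((g x - s n x)\<^sup>2) \<partial>M)"
        using L2_integrable_square[OF dL] unfolding L2_norm_square L2_inner_def
        by (subst nn_integral_eq_integral) (auto simp: power2_eq_square)
      then have "(L2_norm M (\<lambda>x. g x - s n x))\<^sup>2 \<le> (2 * (1/2)^n)\<^sup>2"
        using gs[of n] by (metis ennreal_le_iff zero_le_power2)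
      then show "L2_norm M (\<lambda>x. g x - s n x) \<le> 2 * (1/2)^n" by (rule power2_le_imp_le) simp
    qed
    show "(\<lambda>n. 2 * (1/2)^n :: real) \<longlonglongrightarrow> 0"
      using tendsto_mult[OF tendsto_const[of 2] LIMSEQ_power_zero[of "1/2::real"]] by simp
  qed simp
  ultimately show ?thesis using that by blast
qed

text \<open>The sums of squared coefficients over finite subsets of E approach their supremum along some
  F n.  The expansions s n over F n are then a Cauchy sequence, and their limit g has the same
  coefficients as f: a vector e outside F n has a small coefficient, since adding e to F n cannot
  push the sum above the supremum.  So f - g is orthogonal to the basis.\<close>

lemma (in finite_measure) L2_Parseval:
  assumes E: "L2_orthonormal_basis M E" and f: "f \<in> L2 M" and "0 < \<epsilon>"
  obtains F where "finite F" "F \<subseteq> E" "L2_inner M f f - \<epsilon> \<le> (\<Sum>e\<in>F. (L2_inner M f e)\<^sup>2)"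
proof -
  define q where "q F = (\<Sum>e\<in>F. (L2_inner M f e)\<^sup>2)" for F
  define \<F> where "\<F> = {F. finite F \<and> F \<subseteq> E}"
  have on: "orthonormal M E" using E by (simp add: L2_orthonormal_basis_def orthonormal_def)
  have onF: "orthonormal M F" if "F \<subseteq> E" for F using on that by (rule orthonormal_subset)
  have bdd: "bdd_above (q ` \<F>)"
    using Bessel[OF _ onF f] by (intro bdd_aboveI[of _ "L2_inner M f f"]) (auto simp: \<F>_def q_def)
  have ne: "\<F> \<noteq> {}" by (auto simp: \<F>_def)
  define S where "S = (SUP F\<in>\<F>. q F)"
  have qS: "q F \<le> S" if "F \<in> \<F>" for F
    unfolding S_def by (rule cSUP_upper[OF that bdd])
  \<comment> \<open>A defect of (1/4)^n makes consecutive expansions differ by at most (1/2)^n in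
    norm.\<close>
  have "\<exists>F\<in>\<F>. S - (1/4)^n < q F" for n
    using less_cSUP_iff[OF ne bdd, of "S - (1/4)^n"] by (auto simp: S_def)
  then obtain F0 where F0: "\<And>n. F0 n \<in> \<F>" "\<And>n. S - (1/4)^n < q (F0 n)" by metis
  define F where "F n = (\<Union>k\<le>n. F0 k)" for n
  have FF: "finite (F n)" "F n \<subseteq> E" "F n \<in> \<F>" for n using F0 by (auto simp: F_def \<F>_def)
  have qF: "S - (1/4)^n \<le> q (F n)" for n
  proof -
    have "q (F0 n) \<le> q (F n)"
      unfolding q_def using FF(1) by (intro sum_mono2) (auto simp: F_def)
    then show ?thesis using F0(2)[of n] by simp
  qed
  define s where "s n = (\<lambda>x. \<Sum>e\<in>F n. L2_inner M f e * e x)" for n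
  have sL: "s n \<in> L2 M" for n unfolding s_def by (intro L2_expansion onF FF)
  have res: "residual M (F n) f = (\<lambda>x. f x - s n x)" for n
    by (simp add: residual_def fun_eq_iff s_def)
  have quarter: "sqrt ((1/4)^n) = (1/2)^n" for n
  proof -
    have "((1/4)^n :: real) = ((1/2)^n)\<^sup>2"
      by (simp add: power_mult_distrib power_divide power2_eq_square flip: power_mult_distrib)
    then show ?thesis by simp
  qed
  have "L2_norm M (\<lambda>x. s (Suc n) x - s n x) \<le> (1/2)^n" for n
  proof -
    have sub: "F n \<subseteq> F (Suc n)" by (auto simp: F_def atMost_Suc)
    have eq: "(\<lambda>x. s (Suc n) x - s n x) = (\<lambda>x. \<Sum>e\<in>F (Suc n) - F n. L2_inner M f e * e x)"
      using sub FF(1) by (simp add: s_def fun_eq_iff sum_diff)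
    have "L2_inner M (\<lambda>x. s (Suc n) x - s n x) (\<lambda>x. s (Suc n) x - s n x) = q (F (Suc n) - F n)"
      unfolding eq q_def using FF by (subst L2_expansion_inner) (auto intro!: onF simp: power2_eq_square)
    also have "\<dots> = q (F (Suc n)) - q (F n)" unfolding q_def using sub FF(1) by (simp add: sum_diff)
    also have "\<dots> \<le> (1/4)^n" using qS[OF FF(3), of "Suc n"] qF[of n] by linarith
    finally show ?thesis unfolding L2_norm_def using quarter[of n] real_sqrt_le_mono by metis
  qed
  from L2_complete[OF sL this] obtain g where g: "g \<in> L2 M" and lim: "(\<lambda>n. L2_norm M (\<lambda>x. g x - s n x)) \<longlonglongrightarrow> 0"
    by blast
  have h: "(\<lambda>x. f x - g x) \<in> L2 M" using f g by (rule L2_diff)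
  have "L2_inner M (\<lambda>x. f x - g x) e = 0" if e: "e \<in> E" for e
  proof -
    have eL: "e \<in> L2 M" "L2_norm M e = 1" using e on by (auto simp: orthonormal_def L2_norm_def)
    have "\<bar>L2_inner M (\<lambda>x. f x - g x) e\<bar> \<le> (1/2)^n + L2_norm M (\<lambda>x. g x - s n x)" for n
    proof -
      have "(L2_inner M (\<lambda>x. f x - s n x) e)\<^sup>2 \<le> (1/4)^n"
      proof (cases "e \<in> F n")
        case True
        have "L2_inner M (s n) e = L2_inner M f e" unfolding s_def
          using FF(1,2) True by (intro L2_inner_expansion onF) auto
        then show ?thesis using L2_inner_diff[OF f sL eL(1)] by simp
      next
        case False
        have "L2_inner M (s n) e = (\<Sum>d\<in>F n. L2_inner M f d * L2_inner M d e)"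
          unfolding s_def using FF(2)[of n] on eL by (intro L2_inner_sum) (auto dest: orthonormal_L2)
        also have "\<dots> = 0"
        proof (intro sum.neutral ballI)
          fix d assume "d \<in> F n"
          then have "L2_inner M d e = 0" using FF(2)[of n] on e False by (auto simp: orthonormal_def)
          then show "L2_inner M f d * L2_inner M d e = 0" by simp
        qed
        finally have "L2_inner M (\<lambda>x. f x - s n x) e = L2_inner M f e" using L2_inner_diff[OF f sL eL(1)] by simp
        moreover have "(L2_inner M f e)\<^sup>2 + q (F n) \<le> S"
          using qS[of "insert e (F n)"] FF[of n] e False by (simp add: q_def \<F>_def)
        ultimately show ?thesis using qF[of n] by simp
      qed
      then have "\<bar>L2_inner M (\<lambda>x. f x - s n x) e\<bar> \<le> (1/2)^n"
        using real_sqrt_le_mono quarter by (metis real_sqrt_abs)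
      moreover have "\<bar>L2_inner M (\<lambda>x. g x - s n x) e\<bar> \<le> L2_norm M (\<lambda>x. g x - s n x)"
        using L2_Cauchy_Schwarz[OF L2_diff[OF g sL] eL(1)] eL(2) by simp
      moreover have "L2_inner M (\<lambda>x. f x - g x) e
          = L2_inner M (\<lambda>x. f x - s n x) e - L2_inner M (\<lambda>x. g x - s n x) e"
        using L2_inner_diff[OF f g eL(1)] L2_inner_diff[OF f sL eL(1)] L2_inner_diff[OF g sL eL(1)] by simp
      ultimately show ?thesis by linarith
    qed
    moreover have "(\<lambda>n. (1/2)^n + L2_norm M (\<lambda>x. g x - s n x)) \<longlonglongrightarrow> 0 + 0"
      by (intro tendsto_add lim LIMSEQ_power_zero) simp
    ultimately have "\<bar>L2_inner M (\<lambda>x. f x - g x) e\<bar> \<le> 0"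
      by (intro LIMSEQ_le_const[where X="\<lambda>n. (1/2)^n + L2_norm M (\<lambda>x. g x - s n x)"]) auto
    then show ?thesis by simp
  qed
  then have "AE x in M. f x - g x = 0" using E h by (auto simp: L2_orthonormal_basis_def)
  then have h0: "L2_norm M (\<lambda>x. f x - g x) = 0" using L2_AE_zero_iff[OF h] by (simp add: L2_norm_def)
  from LIMSEQ_D[OF lim, of "sqrt \<epsilon>"] \<open>0 < \<epsilon>\<close> obtain n where n: "L2_norm M (\<lambda>x. g x - s n x) < sqrt \<epsilon>"
    by auto
  have "L2_norm M (\<lambda>x. (f x - g x) + (g x - s n x)) \<le> L2_norm M (\<lambda>x. f x - g x) + L2_norm M (\<lambda>x. g x - s n x)"
    by (intro L2_norm_triangle h L2_diff g sL)
  then have "L2_norm M (\<lambda>x. f x - s n x) \<le> sqrt \<epsilon>" using h0 n by simp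
  then have "(L2_norm M (\<lambda>x. f x - s n x))\<^sup>2 \<le> (sqrt \<epsilon>)\<^sup>2" by (intro power_mono) auto
  then have "L2_inner M f f - q (F n) \<le> \<epsilon>"
    using residual_norm[OF FF(1) onF[OF FF(2)] f, of n] \<open>0 < \<epsilon>\<close> by (simp add: L2_norm_square res q_def)
  then show ?thesis using that[OF FF(1,2), of n] by (simp add: q_def)
qed

section \<open>Integral operators with continuous symmetric kernels\<close>

text \<open>An abstraction of Lebesgue measure on a compact set.  The second axiom is what makes functions
  continuous on the space measurable.\<close>

locale compact_measure = finite_measure M for M :: "'a::euclidean_space measure" +
  assumes compact_space: "compact (space M)"
    and id_measurable: "(\<lambda>x. x) \<in> M \<rightarrow>\<^sub>M borel"
begin

definition sym_kernel :: "('a \<Rightarrow> 'a \<Rightarrow> real) \<Rightarrow> bool" where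
  "sym_kernel K \<longleftrightarrow> continuous_on (space M \<times> space M) (\<lambda>(x, y). K x y) \<and>
     (\<forall>x\<in>space M. \<forall>y\<in>space M. K x y = K y x)"

abbreviation mass :: real where "mass \<equiv> sqrt (measure M (space M))"

lemma continuous_measurable:
  fixes f :: "'a \<Rightarrow> real"
  assumes "continuous_on (space M) f"
  shows "f \<in> borel_measurable M"
proof -
  have "(\<lambda>x. x) \<in> M \<rightarrow>\<^sub>M restrict_space borel (space M)"
    using id_measurable by (intro measurable_restrict_space2) auto
  from measurable_compose[OF this borel_measurable_continuous_on_restrict[OF assms]]
  show ?thesis by simp
qed

lemma sym_kernel_measurable:
  assumes "continuous_on (space M \<times> space M) (\<lambda>(x, y). K x y :: real)"
  shows "(\<lambda>(x, y). K x y) \<in> borel_measurable (M \<Otimes>\<^sub>M M)"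
proof -
  have "(\<lambda>p. (fst p, snd p)) \<in> M \<Otimes>\<^sub>M M \<rightarrow>\<^sub>M borel \<Otimes>\<^sub>M borel"
    by (intro measurable_Pair measurable_compose[OF measurable_fst id_measurable]
        measurable_compose[OF measurable_snd id_measurable])
  then have "(\<lambda>p. p) \<in> M \<Otimes>\<^sub>M M \<rightarrow>\<^sub>M restrict_space borel (space M \<times> space M)"
    by (intro measurable_restrict_space2) (auto simp: space_pair_measure borel_prod)
  from measurable_compose[OF this borel_measurable_continuous_on_restrict[OF assms]]
  show ?thesis by simp
qed

lemma bounded_L2:
  assumes "f \<in> borel_measurable M" "\<And>x. x \<in> space M \<Longrightarrow> \<bar>f x\<bar> \<le> B"
  shows "f \<in> L2 M" "L2_norm M f \<le> B * mass"
proof -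
  have sq: "(f x)\<^sup>2 \<le> B\<^sup>2" if "x \<in> space M" for x
    using assms(2)[OF that] by (metis abs_ge_zero power2_abs power_mono)
  have int: "integrable M (\<lambda>x. (f x)\<^sup>2)"
    using assms(1) sq by (intro integrable_const_bound[of _ "B\<^sup>2"]) auto
  then show "f \<in> L2 M" using assms(1) by (simp add: L2_def)
  have "L2_inner M f f \<le> (\<integral>x. B\<^sup>2 \<partial>M)"
    unfolding L2_inner_def power2_eq_square[symmetric] using int sq by (intro integral_mono) auto
  then have le: "L2_inner M f f \<le> B\<^sup>2 * measure M (space M)" by (simp add: mult.commute)
  show "L2_norm M f \<le> B * mass"
  proof (cases "space M = {}")
    case True
    then show ?thesis by (simp add: L2_norm_def L2_inner_def Bochner_Integration.integral_empty)
  next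
    case False
    then have "0 \<le> B" using assms(2) by fastforce
    then show ?thesis using real_sqrt_le_mono[OF le] by (simp add: L2_norm_def real_sqrt_mult)
  qed
qed

lemma continuous_bound:
  fixes f :: "'a \<Rightarrow> real"
  assumes "continuous_on (space M) f"
  obtains B where "0 \<le> B" "\<And>x. x \<in> space M \<Longrightarrow> \<bar>f x\<bar> \<le> B"
proof -
  have "bounded (f ` space M)" using compact_continuous_image[OF assms compact_space] compact_imp_bounded by blast
  then obtain B where "0 < B" "\<forall>y\<in>f ` space M. norm y \<le> B" by (auto simp: bounded_pos)
  then show ?thesis using that[of B] by auto
qed

lemma continuous_L2:
  fixes f :: "'a \<Rightarrow> real"
  assumes "continuous_on (space M) f"
  shows "f \<in> L2 M"
  using continuous_bound[OF assms] bounded_L2(1)[OF continuous_measurable[OF assms]] by metis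

lemma sym_kernel_bound:
  assumes "sym_kernel K"
  obtains B where "0 \<le> B" "\<And>x y. x \<in> space M \<Longrightarrow> y \<in> space M \<Longrightarrow> \<bar>K x y\<bar> \<le> B"
proof -
  have "bounded ((\<lambda>(x, y). K x y) ` (space M \<times> space M))"
    using assms unfolding sym_kernel_def
    by (intro compact_imp_bounded compact_continuous_image compact_Times compact_space) auto
  then obtain B where "0 < B" "\<forall>y\<in>(\<lambda>(x, y). K x y) ` (space M \<times> space M). norm y \<le> B"
    by (auto simp: bounded_pos)
  then show ?thesis using that[of B] by auto
qed

lemma sym_kernel_section:
  assumes "sym_kernel K" "x \<in> space M"
  shows "continuous_on (space M) (K x)"
proof -
  have c: "continuous_on (space M \<times> space M) (\<lambda>(x, y). K x y)"
    using assms(1) by (simp add: sym_kernel_def)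
  have "continuous_on (space M) (\<lambda>y. (x, y))" by (intro continuous_intros)
  from continuous_on_compose2[OF c this] assms(2)
  have "continuous_on (space M) (\<lambda>y. (\<lambda>(x, y). K x y) (x, y))" by blast
  then show ?thesis by simp
qed

lemmas sym_kernel_L2 = continuous_L2[OF sym_kernel_section]

lemma integral_operator_inner: "integral_operator M K f x = L2_inner M (K x) f"
  by (simp add: integral_operator_def L2_inner_def)

lemma L2_inner_cong:
  "(\<And>x. x \<in> space M \<Longrightarrow> f x = f' x) \<Longrightarrow> (\<And>x. x \<in> space M \<Longrightarrow> g x = g' x) \<Longrightarrow>
    L2_inner M f g = L2_inner M f' g'"
  unfolding L2_inner_def by (intro Bochner_Integration.integral_cong) auto

lemma integral_operator_lincomb:
  assumes "sym_kernel K" "x \<in> space M" "f \<in> L2 M" "g \<in> L2 M"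
  shows "integral_operator M K (\<lambda>y. a * f y + b * g y) x
       = a * integral_operator M K f x + b * integral_operator M K g x"
  using L2_inner_lincomb[OF assms(3,4) sym_kernel_L2[OF assms(1,2)], of a b]
  by (simp add: integral_operator_inner L2_inner_commute)

lemma integral_operator_bound:
  assumes "\<And>x y. x \<in> space M \<Longrightarrow> y \<in> space M \<Longrightarrow> \<bar>K x y\<bar> \<le> B" "sym_kernel K"
    and "x \<in> space M" "f \<in> L2 M"
  shows "\<bar>integral_operator M K f x\<bar> \<le> B * mass * L2_norm M f"
proof -
  have "\<bar>L2_inner M (K x) f\<bar> \<le> L2_norm M (K x) * L2_norm M f"
    by (intro L2_Cauchy_Schwarz sym_kernel_L2 assms)
  also have "\<dots> \<le> B * mass * L2_norm M f"
    using assms by (intro mult_right_mono bounded_L2(2) L2_measurable[OF sym_kernel_L2]) auto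
  finally show ?thesis by (simp add: integral_operator_inner)
qed

text \<open>Uniform continuity of the kernel makes the image of a bounded set of L2 equicontinuous; this is
  the source of compactness for the spectral theory.\<close>

lemma integral_operator_equicontinuous:
  assumes K: "sym_kernel K" and "0 < \<epsilon>"
  obtains d where "0 < d" "\<And>x x' f. x \<in> space M \<Longrightarrow> x' \<in> space M \<Longrightarrow> dist x x' < d \<Longrightarrow> f \<in> L2 M \<Longrightarrow>
    \<bar>integral_operator M K f x - integral_operator M K f x'\<bar> \<le> \<epsilon> * L2_norm M f"
proof -
  define \<eta> where "\<eta> = \<epsilon> / (mass + 1)"
  have m0: "0 < mass + 1" by (simp add: add_nonneg_pos)
  then have "0 < \<eta>" using \<open>0 < \<epsilon>\<close> by (simp add: \<eta>_def)
  have "\<eta> * mass \<le> \<eta> * (mass + 1)" using \<open>0 < \<eta>\<close> by simp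
  also have "\<dots> = \<epsilon>" using m0 by (simp add: \<eta>_def)
  finally have \<eta>m: "\<eta> * mass \<le> \<epsilon>" .
  have "uniformly_continuous_on (space M \<times> space M) (\<lambda>(x, y). K x y)"
    using K compact_Times[OF compact_space compact_space] unfolding sym_kernel_def
    by (intro compact_uniformly_continuous) auto
  then obtain d where d: "0 < d" "\<And>p p'. p \<in> space M \<times> space M \<Longrightarrow> p' \<in> space M \<times> space M \<Longrightarrow> dist p' p < d \<Longrightarrow>
      dist ((\<lambda>(x, y). K x y) p') ((\<lambda>(x, y). K x y) p) < \<eta>"
    using \<open>0 < \<eta>\<close> unfolding uniformly_continuous_on_def by metis
  show ?thesis
  proof (rule that[OF d(1)])
    fix x x' f assume x: "x \<in> space M" "x' \<in> space M" "dist x x' < d" and f: "f \<in> L2 M"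
    have le: "\<bar>K x y - K x' y\<bar> \<le> \<eta>" if "y \<in> space M" for y
      using d(2)[of "(x', y)" "(x, y)"] x that by (simp add: dist_Pair_Pair dist_real_def)
    have "\<bar>L2_inner M (\<lambda>y. K x y - K x' y) f\<bar> \<le> L2_norm M (\<lambda>y. K x y - K x' y) * L2_norm M f"
      by (intro L2_Cauchy_Schwarz L2_diff sym_kernel_L2[OF K] x f)
    also have "\<dots> \<le> \<epsilon> * L2_norm M f"
    proof (intro mult_right_mono L2_norm_nonneg)
      have "L2_norm M (\<lambda>y. K x y - K x' y) \<le> \<eta> * mass"
        using K x le by (intro bounded_L2(2) L2_measurable[OF L2_diff] sym_kernel_L2) auto
      then show "L2_norm M (\<lambda>y. K x y - K x' y) \<le> \<epsilon>" using \<eta>m by simp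
    qed
    finally show "\<bar>integral_operator M K f x - integral_operator M K f x'\<bar> \<le> \<epsilon> * L2_norm M f"
      using L2_inner_diff[OF sym_kernel_L2[OF K x(1)] sym_kernel_L2[OF K x(2)] f]
      by (simp add: integral_operator_inner)
  qed
qed

lemma integral_operator_continuous:
  assumes K: "sym_kernel K" and f: "f \<in> L2 M"
  shows "continuous_on (space M) (integral_operator M K f)"
  unfolding continuous_on_iff
proof (intro ballI allI impI)
  fix x \<epsilon> :: real and x0 assume x: "x0 \<in> space M" and e: "0 < (\<epsilon>::real)"
  define \<eta> where "\<eta> = \<epsilon> / (L2_norm M f + 1)"
  have m0: "0 < L2_norm M f + 1" by (simp add: add_nonneg_pos)
  then have "0 < \<eta>" using e by (simp add: \<eta>_def)
  have "\<eta> * L2_norm M f < \<eta> * (L2_norm M f + 1)" using \<open>0 < \<eta>\<close> by simp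
  also have "\<dots> = \<epsilon>" using m0 by (simp add: \<eta>_def)
  finally have lt: "\<eta> * L2_norm M f < \<epsilon>" .
  from integral_operator_equicontinuous[OF K \<open>0 < \<eta>\<close>] obtain d where d: "0 < d"
    "\<And>x x' f. x \<in> space M \<Longrightarrow> x' \<in> space M \<Longrightarrow> dist x x' < d \<Longrightarrow> f \<in> L2 M \<Longrightarrow>
    \<bar>integral_operator M K f x - integral_operator M K f x'\<bar> \<le> \<eta> * L2_norm M f" by metis
  show "\<exists>d>0. \<forall>x'\<in>space M. dist x' x0 < d \<longrightarrow> dist (integral_operator M K f x') (integral_operator M K f x0) < \<epsilon>"
    using d(1) d(2)[OF _ x _ f] lt by (force simp: dist_real_def intro!: exI[of _ d])
qed

lemmas integral_operator_L2 = continuous_L2[OF integral_operator_continuous]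

lemma integral_operator_inner_lincomb:
  assumes K: "sym_kernel K" and "f \<in> L2 M" "g \<in> L2 M" "h \<in> L2 M"
  shows "L2_inner M (integral_operator M K (\<lambda>y. a * f y + b * g y)) h
       = a * L2_inner M (integral_operator M K f) h + b * L2_inner M (integral_operator M K g) h"
  using L2_inner_lincomb[OF integral_operator_L2[OF K assms(2)] integral_operator_L2[OF K assms(3)] assms(4), of a b]
    L2_inner_cong[of "integral_operator M K (\<lambda>y. a * f y + b * g y)"
      "\<lambda>x. a * integral_operator M K f x + b * integral_operator M K g x" h h]
    integral_operator_lincomb[OF K _ assms(2,3)]
  by simp

lemma kernel_product_integrable:
  assumes K: "sym_kernel K" and f: "f \<in> L2 M" and g: "g \<in> L2 M"
  shows "integrable (M \<Otimes>\<^sub>M M) (\<lambda>(x, y). K x y * f y * g x)"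
proof -
  interpret P: pair_sigma_finite M M by standard
  obtain B where B: "0 \<le> B" "\<And>x y. x \<in> space M \<Longrightarrow> y \<in> space M \<Longrightarrow> \<bar>K x y\<bar> \<le> B"
    using sym_kernel_bound[OF K] by blast
  have [measurable]: "f \<in> borel_measurable M" "g \<in> borel_measurable M" using f g L2_measurable by auto
  have [measurable]: "(\<lambda>(x, y). K x y) \<in> borel_measurable (M \<Otimes>\<^sub>M M)"
    using K by (intro sym_kernel_measurable) (simp add: sym_kernel_def)
  note fi = L2_integral_abs_le(1)[OF f] and gi = L2_integral_abs_le(1)[OF g]
  have "integrable (M \<Otimes>\<^sub>M M) (\<lambda>(x, y). \<bar>g x\<bar> * \<bar>f y\<bar>)"
    by (rule P.Fubini_integrable) (use fi gi in \<open>auto simp: abs_mult\<close>)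
  then have "integrable (M \<Otimes>\<^sub>M M) (\<lambda>p. B * (\<lambda>(x, y). \<bar>g x\<bar> * \<bar>f y\<bar>) p)" by (rule integrable_mult_right)
  then show ?thesis
  proof (rule Bochner_Integration.integrable_bound)
    show "AE p in M \<Otimes>\<^sub>M M. norm ((\<lambda>(x, y). K x y * f y * g x) p) \<le> norm (B * (\<lambda>(x, y). \<bar>g x\<bar> * \<bar>f y\<bar>) p)"
    proof (rule AE_I2)
      fix p assume "p \<in> space (M \<Otimes>\<^sub>M M)"
      then obtain x y where p: "p = (x, y)" "x \<in> space M" "y \<in> space M" by (auto simp: space_pair_measure)
      have "\<bar>K x y\<bar> * (\<bar>f y\<bar> * \<bar>g x\<bar>) \<le> B * (\<bar>f y\<bar> * \<bar>g x\<bar>)" using B(2) p by (intro mult_right_mono) auto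
      then show "norm ((\<lambda>(x, y). K x y * f y * g x) p) \<le> norm (B * (\<lambda>(x, y). \<bar>g x\<bar> * \<bar>f y\<bar>) p)"
        using B(1) p by (simp add: abs_mult mult_ac)
    qed
  qed measurable
qed

lemma integral_operator_form:
  assumes K: "sym_kernel K" and f: "f \<in> L2 M" and g: "g \<in> L2 M"
  shows "L2_inner M (integral_operator M K f) g = (\<integral>p. (\<lambda>(x, y). K x y * f y * g x) p \<partial>(M \<Otimes>\<^sub>M M))"
proof -
  interpret P: pair_sigma_finite M M by standard
  have "L2_inner M (integral_operator M K f) g = (\<integral>x. (\<integral>y. K x y * f y * g x \<partial>M) \<partial>M)"
    by (simp add: L2_inner_def integral_operator_def)
  then show ?thesis using P.integral_fst'[OF kernel_product_integrable[OF assms]] by simp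
qed

lemma integral_operator_symmetric:
  assumes K: "sym_kernel K" and f: "f \<in> L2 M" and g: "g \<in> L2 M"
  shows "L2_inner M (integral_operator M K f) g = L2_inner M f (integral_operator M K g)"
proof -
  interpret P: pair_sigma_finite M M by standard
  have "L2_inner M (integral_operator M K f) g = (\<integral>x. (\<integral>y. K x y * f y * g x \<partial>M) \<partial>M)"
    by (simp add: L2_inner_def integral_operator_def)
  also have "\<dots> = (\<integral>y. (\<integral>x. K x y * f y * g x \<partial>M) \<partial>M)"
    using P.Fubini_integral[OF kernel_product_integrable[OF assms]] by simp
  also have "\<dots> = (\<integral>y. (\<integral>x. K y x * g x * f y \<partial>M) \<partial>M)"
    using K unfolding sym_kernel_def
    by (intro Bochner_Integration.integral_cong refl) (simp add: mult_ac)
  also have "\<dots> = L2_inner M f (integral_operator M K g)"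
    by (simp add: L2_inner_def integral_operator_def mult.commute)
  finally show ?thesis .
qed

text \<open>The norm of a symmetric operator is controlled by its quadratic form: the forms at f + t Tf and
  at f - t Tf differ by 4 t |Tf|^2.\<close>

lemma integral_operator_norm_le_form:
  assumes K: "sym_kernel K" and "0 \<le> m"
    and form: "\<And>f. f \<in> L2 M \<Longrightarrow> \<bar>L2_inner M (integral_operator M K f) f\<bar> \<le> m * L2_inner M f f"
    and f: "f \<in> L2 M"
  shows "L2_norm M (integral_operator M K f) \<le> m * L2_norm M f"
proof -
  let ?T = "integral_operator M K"
  define N where "N = L2_inner M (?T f) (?T f)"
  have Tf: "?T f \<in> L2 M" by (rule integral_operator_L2[OF K f])
  have N0: "0 \<le> N" by (simp add: N_def)
  have key: "4 * t * N \<le> 2 * m * (L2_inner M f f + t\<^sup>2 * N)" for t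
  proof -
    let ?p = "\<lambda>x. 1 * f x + t * ?T f x" and ?q = "\<lambda>x. 1 * f x + (- t) * ?T f x"
    have pq: "?p \<in> L2 M" "?q \<in> L2 M" by (intro L2_lincomb f Tf)+
    have exp: "L2_inner M (?T (\<lambda>x. 1 * f x + s * ?T f x)) (\<lambda>x. 1 * f x + s * ?T f x)
        = L2_inner M (?T f) f + 2 * s * N + s\<^sup>2 * L2_inner M (?T (?T f)) (?T f)" for s
    proof -
      let ?r = "\<lambda>x. 1 * f x + s * ?T f x"
      have r: "?r \<in> L2 M" by (intro L2_lincomb f Tf)
      have "L2_inner M (?T ?r) ?r = L2_inner M (?T f) ?r + s * L2_inner M (?T (?T f)) ?r"
        using integral_operator_inner_lincomb[OF K f Tf r, of 1 s] by simp
      moreover have "L2_inner M (?T f) ?r = L2_inner M (?T f) f + s * N"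
        using L2_inner_lincomb[OF f Tf Tf, of 1 s] by (simp add: L2_inner_commute N_def)
      moreover have "L2_inner M (?T (?T f)) ?r = N + s * L2_inner M (?T (?T f)) (?T f)"
        using L2_inner_lincomb[OF f Tf integral_operator_L2[OF K Tf], of 1 s]
          integral_operator_symmetric[OF K Tf f]
        by (simp add: L2_inner_commute[of M _ "?T (?T f)"] N_def)
      ultimately show ?thesis by (simp add: power2_eq_square algebra_simps)
    qed
    have "4 * t * N = L2_inner M (?T ?p) ?p - L2_inner M (?T ?q) ?q"
      using exp[of t] exp[of "- t"] by simp
    also have "\<dots> \<le> m * L2_inner M ?p ?p + m * L2_inner M ?q ?q"
      using form[OF pq(1)] form[OF pq(2)] by linarith
    also have "\<dots> = m * (L2_inner M ?p ?p + L2_inner M ?q ?q)" by (simp add: distrib_left)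
    also have "L2_inner M ?p ?p + L2_inner M ?q ?q = 2 * (L2_inner M f f + t\<^sup>2 * N)"
      unfolding L2_norm_lincomb_square[OF f Tf] by (simp add: N_def)
    also have "m * (2 * (L2_inner M f f + t\<^sup>2 * N)) = 2 * m * (L2_inner M f f + t\<^sup>2 * N)" by simp
    finally show ?thesis .
  qed
  have "N \<le> m\<^sup>2 * L2_inner M f f"
  proof (cases "m = 0")
    case True then show ?thesis using key[of 1] N0 by simp
  next
    case False
    then have "0 < m" using \<open>0 \<le> m\<close> by simp
    \<comment> \<open>With t = 1 / m the two sides agree when |Tf| = m |f|.\<close>
    define i where "i = 1 / m"
    have mi: "m * i = 1" using \<open>0 < m\<close> by (simp add: i_def)
    have "m * (4 * i * N) \<le> m * (2 * m * (L2_inner M f f + i\<^sup>2 * N))"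
      by (rule mult_left_mono[OF key \<open>0 \<le> m\<close>])
    moreover have "m * (4 * i * N) = 4 * (m * i) * N" by (simp only: mult_ac)
    moreover have "m * (2 * m * (F + i\<^sup>2 * N)) = 2 * (m\<^sup>2 * F) + 2 * ((m * i)\<^sup>2 * N)" for F
      by (simp only: power2_eq_square distrib_left mult_ac)
    ultimately have "4 * N \<le> 2 * (m\<^sup>2 * L2_inner M f f) + 2 * N" unfolding mi by simp
    then show ?thesis by linarith
  qed
  then have "(L2_norm M (?T f))\<^sup>2 \<le> (m * L2_norm M f)\<^sup>2"
    by (simp add: N_def L2_norm_square power_mult_distrib)
  then show ?thesis by (rule power2_le_imp_le) (simp add: \<open>0 \<le> m\<close>)
qed

lemma L2_norm_diff_triangle:
  assumes "f \<in> L2 M" "g \<in> L2 M" "h \<in> L2 M"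
  shows "L2_norm M (\<lambda>x. f x - h x) \<le> L2_norm M (\<lambda>x. f x - g x) + L2_norm M (\<lambda>x. g x - h x)"
  using L2_norm_triangle[OF L2_diff[OF assms(1,2)] L2_diff[OF assms(2,3)]] by simp

lemma L2_norm_scale: "L2_norm M (\<lambda>x. c * f x) = \<bar>c\<bar> * L2_norm M f"
proof -
  have "c * (c * L2_inner M f f) = c\<^sup>2 * L2_inner M f f" by (simp add: power2_eq_square)
  then show ?thesis by (simp add: L2_norm_def L2_inner_scale L2_inner_scale_right real_sqrt_mult)
qed

lemma integral_operator_zero_form:
  assumes K: "sym_kernel K" and f: "f \<in> L2 M" "L2_inner M f f = 0"
  shows "L2_inner M (integral_operator M K f) f = 0"
  using L2_Cauchy_Schwarz[OF integral_operator_L2[OF K f(1)] f(1)] f(2) by (simp add: L2_norm_def)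

text \<open>The supremum m of |<Tf, f>| over the unit ball is attained.  By Arzela-Ascoli the images of a
  maximising sequence have a uniformly convergent subsequence; with l the limit of the forms,
  so that |l| = m, one has |Tf - l f|^2 <= 2 m^2 - 2 l <Tf, f>, which tends to 0 along the
  sequence, and the limit of the images is an eigenvector.  For m = 0 the zero function is
  returned, so that eigenpairs can be extracted indefinitely.\<close>

lemma eigenpair_exists:
  assumes K: "sym_kernel K"
  shows "\<exists>\<mu> e. continuous_on (space M) e \<and> (\<forall>x\<in>space M. integral_operator M K e x = \<mu> * e x) \<and>
    (\<forall>f\<in>L2 M. \<bar>L2_inner M (integral_operator M K f) f\<bar> \<le> \<bar>\<mu>\<bar> * L2_inner M f f) \<and>
    (if \<mu> = 0 then e = (\<lambda>x. 0) else L2_inner M e e = 1)"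
proof -
  let ?T = "integral_operator M K"
  define A where "A = {f \<in> L2 M. L2_inner M f f \<le> 1}"
  define q where "q f = \<bar>L2_inner M (?T f) f\<bar>" for f
  obtain B where B: "0 \<le> B" "\<And>x y. x \<in> space M \<Longrightarrow> y \<in> space M \<Longrightarrow> \<bar>K x y\<bar> \<le> B"
    using sym_kernel_bound[OF K] by blast
  have A1: "L2_norm M f \<le> 1" if "f \<in> A" for f using that by (simp add: A_def L2_norm_def)
  have Tb: "\<bar>?T f x\<bar> \<le> B * mass * L2_norm M f" if "f \<in> L2 M" "x \<in> space M" for f x
    using integral_operator_bound[OF B(2) K that(2,1)] .
  have TA: "\<bar>?T f x\<bar> \<le> B * mass" if "f \<in> A" "x \<in> space M" for f x
  proof -
    have "B * mass * L2_norm M f \<le> B * mass * 1" using B(1) A1[OF that(1)] by (intro mult_left_mono) auto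
    then show ?thesis using Tb[of f x] that by (simp add: A_def)
  qed
  have TL: "?T f \<in> L2 M" if "f \<in> L2 M" for f using integral_operator_L2[OF K that] .
  have qA: "q f \<le> B * mass * mass" if f: "f \<in> A" for f
  proof -
    have fL: "f \<in> L2 M" using f by (simp add: A_def)
    have "q f \<le> L2_norm M (?T f) * L2_norm M f" unfolding q_def by (intro L2_Cauchy_Schwarz TL fL)
    also have "\<dots> \<le> (B * mass * mass) * 1"
      using B(1) A1[OF f] TA[OF f] L2_measurable[OF TL[OF fL]] by (intro mult_mono bounded_L2(2)) auto
    finally show ?thesis by simp
  qed
  have ne: "A \<noteq> {}" by (auto simp: A_def intro!: exI[of _ "\<lambda>x. 0"])
  have bdd: "bdd_above (q ` A)" using qA by (intro bdd_aboveI[of _ "B * mass * mass"]) auto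
  define m where "m = (SUP f\<in>A. q f)"
  have qm: "q f \<le> m" if "f \<in> A" for f unfolding m_def by (rule cSUP_upper[OF that bdd])
  have m0: "0 \<le> m" using qm[of "\<lambda>x. 0"] by (simp add: A_def q_def)
  have form: "\<bar>L2_inner M (?T f) f\<bar> \<le> m * L2_inner M f f" if f: "f \<in> L2 M" for f
  proof (cases "L2_inner M f f = 0")
    case True then show ?thesis using integral_operator_zero_form[OF K f] by simp
  next
    case False
    then have pos: "0 < L2_inner M f f" by (metis L2_inner_nonneg less_eq_real_def)
    define c where "c = 1 / L2_norm M f"
    have c2: "c * c * L2_inner M f f = 1" using pos by (simp add: c_def L2_norm_def)
    let ?g = "\<lambda>x. c * f x + 0 * f x"
    have gL: "?g \<in> L2 M" by (intro L2_lincomb f)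
    have "L2_inner M ?g ?g = 1" using c2 by (simp add: L2_inner_scale L2_inner_scale_right mult.assoc)
    then have "q ?g \<le> m" using gL by (intro qm) (simp add: A_def)
    moreover have "L2_inner M (?T ?g) ?g = c * c * L2_inner M (?T f) f"
      using integral_operator_inner_lincomb[OF K f f gL, of c 0] by (simp add: L2_inner_scale_right)
    ultimately have "c * c * \<bar>L2_inner M (?T f) f\<bar> \<le> m * (c * c * L2_inner M f f)"
      using c2 by (simp add: q_def abs_mult)
    moreover have "0 < c * c" using pos by (simp add: c_def L2_norm_def)
    ultimately show ?thesis by (metis mult.left_commute mult_le_cancel_left_pos)
  qed
  show ?thesis
  proof (cases "m = 0")
    case True
    then show ?thesis using form
      by (intro exI[of _ 0] exI[of _ "\<lambda>x. 0"]) (auto simp: integral_operator_def)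
  next
    case False
    then have mpos: "0 < m" using m0 by simp
    have "\<exists>f\<in>A. m - 1 / Suc n < q f" for n
      using less_cSUP_iff[OF ne bdd, of "m - 1 / Suc n"] by (simp add: m_def)
    then obtain f0 where f0: "\<And>n. f0 n \<in> A" "\<And>n. m - 1 / Suc n < q (f0 n)" by metis
    define a0 where "a0 n = L2_inner M (?T (f0 n)) (f0 n)" for n
    have "bounded (range a0)"
      using qm[OF f0(1)] by (intro boundedI[of _ m]) (auto simp: a0_def q_def)
    from bounded_imp_convergent_subsequence[OF this] obtain l r where r: "strict_mono r" "(a0 \<circ> r) \<longlonglongrightarrow> l" by blast
    have "(\<lambda>n. m - 1 / real (Suc n)) \<longlonglongrightarrow> m - 0" by (intro tendsto_diff tendsto_const LIMSEQ_Suc lim_1_over_n)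
    then have lim: "(\<lambda>n. m - 1 / real (Suc n)) \<longlonglongrightarrow> m" by simp
    have "(\<lambda>n. q (f0 n)) \<longlonglongrightarrow> m"
    proof (rule real_tendsto_sandwich[OF _ _ lim tendsto_const])
      show "\<forall>\<^sub>F n in sequentially. m - 1 / real (Suc n) \<le> q (f0 n)"
        using f0(2) by (intro always_eventually allI less_imp_le)
      show "\<forall>\<^sub>F n in sequentially. q (f0 n) \<le> m" using qm[OF f0(1)] by simp
    qed
    then have "(\<lambda>n. \<bar>a0 n\<bar>) \<longlonglongrightarrow> m" by (simp add: q_def a0_def)
    from LIMSEQ_subseq_LIMSEQ[OF this r(1)] tendsto_rabs[OF r(2)]
    have lam: "\<bar>l\<bar> = m" using LIMSEQ_unique by (fastforce simp: o_def)
    have equi: "\<exists>d. 0 < d \<and> (\<forall>n y. y \<in> space M \<and> norm (x - y) < d \<longrightarrow> norm (?T (f0 (r n)) x - ?T (f0 (r n)) y) < \<epsilon>)"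
      if "x \<in> space M" "0 < \<epsilon>" for x \<epsilon>
    proof -
      from that have "0 < \<epsilon> / 2" by simp
      from integral_operator_equicontinuous[OF K this] obtain d where d: "0 < d"
        "\<And>x x' f. x \<in> space M \<Longrightarrow> x' \<in> space M \<Longrightarrow> dist x x' < d \<Longrightarrow> f \<in> L2 M \<Longrightarrow>
          \<bar>?T f x - ?T f x'\<bar> \<le> \<epsilon> / 2 * L2_norm M f" by metis
      have "\<bar>?T (f0 (r n)) x - ?T (f0 (r n)) y\<bar> < \<epsilon>" if y: "y \<in> space M" "norm (x - y) < d" for n y
      proof -
        have "f0 (r n) \<in> L2 M" using f0(1) by (simp add: A_def)
        from d(2)[OF \<open>x \<in> space M\<close> y(1) _ this] y(2)
        have "\<bar>?T (f0 (r n)) x - ?T (f0 (r n)) y\<bar> \<le> \<epsilon> / 2 * L2_norm M (f0 (r n))" by (simp add: dist_norm)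
        also have "\<dots> \<le> \<epsilon> / 2 * 1" using A1[OF f0(1)] \<open>0 < \<epsilon>\<close> by (intro mult_left_mono) auto
        also have "\<dots> < \<epsilon>" using \<open>0 < \<epsilon>\<close> by simp
        finally show ?thesis .
      qed
      then show ?thesis using d(1) by (intro exI[of _ d]) auto
    qed
    obtain g k where g: "continuous_on (space M) g" and k: "strict_mono (k :: nat \<Rightarrow> nat)"
      and unif: "\<And>\<epsilon>. 0 < \<epsilon> \<Longrightarrow> \<exists>N. \<forall>n x. n \<ge> N \<and> x \<in> space M \<longrightarrow> norm (?T (f0 (r (k n))) x - g x) < \<epsilon>"
      by (rule Arzela_Ascoli[OF compact_space, of "\<lambda>n. ?T (f0 (r n))" "B * mass"])
        (use TA[OF f0(1)] equi in auto)
    define \<phi> where "\<phi> n = f0 (r (k n))" for n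
    have \<phi>A: "\<phi> n \<in> A" for n using f0(1) by (simp add: \<phi>_def)
    then have \<phi>L: "\<phi> n \<in> L2 M" for n by (simp add: A_def)
    have gL: "g \<in> L2 M" by (rule continuous_L2[OF g])
    have a: "(\<lambda>n. L2_inner M (?T (\<phi> n)) (\<phi> n)) \<longlonglongrightarrow> l"
      using LIMSEQ_subseq_LIMSEQ[OF r(2) k] by (simp add: o_def a0_def \<phi>_def)
    have Tg: "(\<lambda>n. L2_norm M (\<lambda>x. g x - ?T (\<phi> n) x)) \<longlonglongrightarrow> 0"
    proof (rule LIMSEQ_I)
      fix \<epsilon> :: real assume "0 < \<epsilon>"
      have mp: "0 < mass + 1" by (simp add: add_nonneg_pos)
      then have "0 < \<epsilon> / (mass + 1)" using \<open>0 < \<epsilon>\<close> by simp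
      from unif[OF this] obtain N where N: "\<And>n x. n \<ge> N \<Longrightarrow> x \<in> space M \<Longrightarrow> \<bar>?T (\<phi> n) x - g x\<bar> < \<epsilon> / (mass + 1)"
        by (auto simp: \<phi>_def)
      have "L2_norm M (\<lambda>x. g x - ?T (\<phi> n) x) < \<epsilon>" if "n \<ge> N" for n
      proof -
        have "L2_norm M (\<lambda>x. g x - ?T (\<phi> n) x) \<le> \<epsilon> / (mass + 1) * mass"
          using N[OF that] by (intro bounded_L2(2) L2_measurable[OF L2_diff] gL TL \<phi>L)
            (auto simp: abs_minus_commute intro: less_imp_le)
        also have "\<dots> < \<epsilon> / (mass + 1) * (mass + 1)" using \<open>0 < \<epsilon> / (mass + 1)\<close> by (intro mult_strict_left_mono) auto
        also have "\<dots> = \<epsilon>" using mp by simp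
        finally show ?thesis .
      qed
      then show "\<exists>N. \<forall>n\<ge>N. norm (L2_norm M (\<lambda>x. g x - ?T (\<phi> n) x) - 0) < \<epsilon>" by auto
    qed
    have Tl: "(\<lambda>n. L2_norm M (\<lambda>x. ?T (\<phi> n) x - l * \<phi> n x)) \<longlonglongrightarrow> 0"
    proof -
      have le: "(L2_norm M (\<lambda>x. ?T (\<phi> n) x - l * \<phi> n x))\<^sup>2 \<le> 2 * m\<^sup>2 - 2 * l * L2_inner M (?T (\<phi> n)) (\<phi> n)" for n
      proof -
        have "L2_norm M (?T (\<phi> n)) \<le> m * L2_norm M (\<phi> n)"
          by (rule integral_operator_norm_le_form[OF K m0 form \<phi>L])
        also have "\<dots> \<le> m * 1" using m0 A1[OF \<phi>A] by (intro mult_left_mono) auto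
        finally have "(L2_norm M (?T (\<phi> n)))\<^sup>2 \<le> m\<^sup>2" by (intro power_mono) auto
        moreover have "l\<^sup>2 * L2_inner M (\<phi> n) (\<phi> n) \<le> l\<^sup>2 * 1" using \<phi>A[of n] by (intro mult_left_mono) (auto simp: A_def)
        moreover have "l\<^sup>2 = m\<^sup>2" using lam by (metis power2_abs)
        ultimately show ?thesis
          using L2_norm_lincomb_square[OF TL[OF \<phi>L] \<phi>L, of 1 n "- l" n] by (simp add: L2_norm_square)
      qed
      have "(\<lambda>n. 2 * m\<^sup>2 - 2 * l * L2_inner M (?T (\<phi> n)) (\<phi> n)) \<longlonglongrightarrow> 2 * m\<^sup>2 - 2 * l * l"
        by (intro tendsto_intros a)
      moreover have "m\<^sup>2 = l * l" using lam by (metis power2_abs power2_eq_square)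
      then have "2 * m\<^sup>2 - 2 * l * l = 0" by simp
      ultimately have lim0: "(\<lambda>n. 2 * m\<^sup>2 - 2 * l * L2_inner M (?T (\<phi> n)) (\<phi> n)) \<longlonglongrightarrow> 0" by simp
      have "(\<lambda>n. (L2_norm M (\<lambda>x. ?T (\<phi> n) x - l * \<phi> n x))\<^sup>2) \<longlonglongrightarrow> 0"
        by (rule real_tendsto_sandwich[OF always_eventually[OF allI[OF zero_le_power2]]
              always_eventually[OF allI[OF le]] tendsto_const lim0])
      from tendsto_real_sqrt[OF this] show ?thesis by simp
    qed
    have gl: "(\<lambda>n. L2_norm M (\<lambda>x. g x - l * \<phi> n x)) \<longlonglongrightarrow> 0"
    proof (rule real_tendsto_sandwich[OF _ _ tendsto_const])
      show "\<forall>\<^sub>F n in sequentially. L2_norm M (\<lambda>x. g x - l * \<phi> n x)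
          \<le> L2_norm M (\<lambda>x. g x - ?T (\<phi> n) x) + L2_norm M (\<lambda>x. ?T (\<phi> n) x - l * \<phi> n x)"
        by (intro always_eventually allI L2_norm_diff_triangle gL TL \<phi>L L2_scale)
      show "(\<lambda>n. L2_norm M (\<lambda>x. g x - ?T (\<phi> n) x) + L2_norm M (\<lambda>x. ?T (\<phi> n) x - l * \<phi> n x)) \<longlonglongrightarrow> 0"
        using tendsto_add[OF Tg Tl] by simp
    qed simp
    have eig: "?T g x = l * g x" if x: "x \<in> space M" for x
    proof -
      have b: "\<bar>?T g x - l * g x\<bar> \<le> B * mass * L2_norm M (\<lambda>x. g x - l * \<phi> n x) + \<bar>l\<bar> * \<bar>?T (\<phi> n) x - g x\<bar>" for n
      proof -
        have "?T (\<lambda>y. g y - l * \<phi> n y) x = ?T g x - l * ?T (\<phi> n) x"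
          using integral_operator_lincomb[OF K x gL \<phi>L, of 1 "- l" n] by simp
        moreover have "\<bar>?T (\<lambda>y. g y - l * \<phi> n y) x\<bar> \<le> B * mass * L2_norm M (\<lambda>x. g x - l * \<phi> n x)"
          using x by (intro Tb L2_diff gL L2_scale \<phi>L)
        moreover have "?T g x - l * g x = (?T g x - l * ?T (\<phi> n) x) + l * (?T (\<phi> n) x - g x)"
          by (simp add: algebra_simps)
        ultimately show ?thesis
          using abs_triangle_ineq[of "?T g x - l * ?T (\<phi> n) x" "l * (?T (\<phi> n) x - g x)"]
          unfolding abs_mult by linarith
      qed
      have "(\<lambda>n. ?T (\<phi> n) x - g x) \<longlonglongrightarrow> 0"
      proof (rule LIMSEQ_I)
        fix \<epsilon> :: real assume "0 < \<epsilon>"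
        from unif[OF this] show "\<exists>N. \<forall>n\<ge>N. norm (?T (\<phi> n) x - g x - 0) < \<epsilon>" using x by (auto simp: \<phi>_def)
      qed
      then have "(\<lambda>n. B * mass * L2_norm M (\<lambda>x. g x - l * \<phi> n x) + \<bar>l\<bar> * \<bar>?T (\<phi> n) x - g x\<bar>) \<longlonglongrightarrow> B * mass * 0 + \<bar>l\<bar> * \<bar>0\<bar>"
        by (intro tendsto_intros gl)
      then have "\<bar>?T g x - l * g x\<bar> \<le> B * mass * 0 + \<bar>l\<bar> * \<bar>0\<bar>"
        using b by (intro LIMSEQ_le_const) auto
      then show ?thesis by simp
    qed
    \<comment> \<open>If g were null, then l \<phi> n would tend to 0, and so would the forms,
      whose limit is l.\<close>
    have gnz: "L2_inner M g g \<noteq> 0"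
    proof
      assume "L2_inner M g g = 0"
      then have g0: "L2_norm M g = 0" by (simp add: L2_norm_def)
      have "\<bar>L2_inner M (?T (\<phi> n)) (\<phi> n)\<bar> \<le> L2_norm M (\<lambda>x. g x - l * \<phi> n x)" for n
      proof -
        have "L2_norm M (\<lambda>x. l * \<phi> n x - 0) \<le> L2_norm M (\<lambda>x. l * \<phi> n x - g x) + L2_norm M (\<lambda>x. g x - 0)"
          by (intro L2_norm_diff_triangle L2_scale \<phi>L gL) simp
        moreover have "L2_norm M (\<lambda>x. l * \<phi> n x - g x) = L2_norm M (\<lambda>x. (- 1) * (g x - l * \<phi> n x))" by simp
        ultimately have "m * L2_norm M (\<phi> n) \<le> L2_norm M (\<lambda>x. g x - l * \<phi> n x)"
          using g0 lam unfolding L2_norm_scale by (simp add: L2_norm_scale)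
        moreover have "\<bar>L2_inner M (?T (\<phi> n)) (\<phi> n)\<bar> \<le> m * L2_norm M (\<phi> n)"
        proof -
          have "L2_inner M (\<phi> n) (\<phi> n) \<le> L2_norm M (\<phi> n)"
            using A1[OF \<phi>A[of n]] mult_left_le[of "L2_norm M (\<phi> n)" "L2_norm M (\<phi> n)"]
            by (simp add: power2_eq_square flip: L2_norm_square)
          then have "m * L2_inner M (\<phi> n) (\<phi> n) \<le> m * L2_norm M (\<phi> n)" using m0 by (intro mult_left_mono)
          then show ?thesis using form[OF \<phi>L, of n] by simp
        qed
        ultimately show ?thesis by simp
      qed
      then have "\<bar>l\<bar> \<le> 0" using tendsto_rabs[OF a] gl by (intro LIMSEQ_le) auto
      then show False using lam mpos by simp
    qed
    define c where "c = 1 / L2_norm M g"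
    have c2: "c * c * L2_inner M g g = 1" using gnz by (simp add: c_def L2_norm_def)
    have "l \<noteq> 0" using lam mpos by auto
    moreover have "continuous_on (space M) (\<lambda>x. c * g x)" by (intro continuous_intros g)
    moreover have "?T (\<lambda>x. c * g x) x = l * (c * g x)" if "x \<in> space M" for x
      using eig[OF that] by (simp add: integral_operator_inner L2_inner_scale_right)
    moreover have "L2_inner M (\<lambda>x. c * g x) (\<lambda>x. c * g x) = 1"
      using c2 by (simp add: L2_inner_scale L2_inner_scale_right mult.assoc)
    ultimately show ?thesis using form lam by (intro exI[of _ l] exI[of _ "\<lambda>x. c * g x"]) simp
  qed
qed

text \<open>Deflation: subtract \<mu> e(x) e(y) for an extremal eigenpair and repeat.  The form of the n-th
  deflated operator is bounded by |\<mu> n|, hence so is its norm, which is the remainder estimate.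
  The eigenvalues tend to 0 because their squares are summable: \<mu> k e k x is a coefficient of
  the section K x, so Bessel's inequality bounds the sum of (\<mu> k e k x)^2 uniformly in x.\<close>

lemma spectral_decomposition:
  assumes K: "sym_kernel K"
  obtains \<mu> e where
    "\<And>k. continuous_on (space M) (e k)"
    "\<And>k x. x \<in> space M \<Longrightarrow> integral_operator M K (e k) x = \<mu> k * e k x"
    "\<And>i j. L2_inner M (e i) (e j) = (if i = j \<and> \<mu> i \<noteq> 0 then 1 else 0)"
    "\<And>k. \<mu> k = 0 \<Longrightarrow> e k = (\<lambda>x. 0)"
    "\<mu> \<longlonglongrightarrow> 0"
    "\<And>f n. f \<in> L2 M \<Longrightarrow> L2_norm M (\<lambda>x. integral_operator M K f x - (\<Sum>k<n. (\<mu> k * L2_inner M (e k) f) * e k x))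
      \<le> \<bar>\<mu> n\<bar> * L2_norm M f"
proof -
  define P where "P K \<mu> e \<longleftrightarrow> continuous_on (space M) e \<and> (\<forall>x\<in>space M. integral_operator M K e x = \<mu> * e x) \<and>
    (\<forall>f\<in>L2 M. \<bar>L2_inner M (integral_operator M K f) f\<bar> \<le> \<bar>\<mu>\<bar> * L2_inner M f f) \<and>
    (if \<mu> = 0 then e = (\<lambda>x. 0) else L2_inner M e e = 1)" for K \<mu> and e :: "'a \<Rightarrow> real"
  have "\<exists>q. sym_kernel K \<longrightarrow> P K (fst q) (snd q)" for K
    using eigenpair_exists[of K] unfolding P_def[symmetric] by (metis fst_conv snd_conv)
  then obtain q where q: "\<And>K. sym_kernel K \<Longrightarrow> P K (fst (q K)) (snd (q K))" by metis
  define mu where "mu K = fst (q K)" for K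
  define ev where "ev K = snd (q K)" for K
  have ep: "continuous_on (space M) (ev K)"
    "\<And>x. x \<in> space M \<Longrightarrow> integral_operator M K (ev K) x = mu K * ev K x"
    "\<And>f. f \<in> L2 M \<Longrightarrow> \<bar>L2_inner M (integral_operator M K f) f\<bar> \<le> \<bar>mu K\<bar> * L2_inner M f f"
    "mu K = 0 \<Longrightarrow> ev K = (\<lambda>x. 0)"
    "mu K \<noteq> 0 \<Longrightarrow> L2_inner M (ev K) (ev K) = 1" if "sym_kernel K" for K
    using q[OF that] unfolding P_def mu_def ev_def by (simp_all split: if_splits)
  define D where "D = rec_nat K (\<lambda>n K'. (\<lambda>x y. K' x y - mu K' * ev K' x * ev K' y))"
  define \<mu> where "\<mu> n = mu (D n)" for n
  define e where "e n = ev (D n)" for n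
  have D0: "D 0 = K" by (simp add: D_def)
  have DS: "D (Suc n) = (\<lambda>x y. D n x y - \<mu> n * e n x * e n y)" for n
    by (simp add: D_def \<mu>_def e_def)
  have Dk: "sym_kernel (D n)" for n
  proof (induction n)
    case 0 then show ?case using K by (simp add: D0)
  next
    case (Suc n)
    have ec: "continuous_on (space M) (e n)" unfolding e_def by (rule ep(1)[OF Suc])
    have "continuous_on (space M \<times> space M) (\<lambda>p. e n (fst p))" "continuous_on (space M \<times> space M) (\<lambda>p. e n (snd p))"
      by (rule continuous_on_compose2[OF ec], auto intro!: continuous_intros)+
    then have "continuous_on (space M \<times> space M) (\<lambda>p. (\<lambda>(x, y). D n x y) p - \<mu> n * e n (fst p) * e n (snd p))"
      using Suc unfolding sym_kernel_def by (intro continuous_intros) auto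
    then show ?case using Suc by (simp add: sym_kernel_def DS case_prod_unfold)
  qed
  have ec: "continuous_on (space M) (e n)" for n unfolding e_def by (rule ep(1)[OF Dk])
  have eL: "e n \<in> L2 M" for n by (rule continuous_L2[OF ec])
  have TD: "integral_operator M (D n) f x = integral_operator M K f x - (\<Sum>k<n. (\<mu> k * L2_inner M (e k) f) * e k x)"
    if f: "f \<in> L2 M" and x: "x \<in> space M" for n f x
  proof (induction n)
    case (Suc n)
    have "L2_inner M (\<lambda>y. 1 * D n x y + (- (\<mu> n * e n x)) * e n y) f
        = 1 * L2_inner M (D n x) f + (- (\<mu> n * e n x)) * L2_inner M (e n) f"
      by (intro L2_inner_lincomb sym_kernel_L2[OF Dk x] eL f)
    then show ?case using Suc by (simp add: integral_operator_inner DS)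
  qed (simp add: D0)
  have De: "integral_operator M (D n) (e n) x = \<mu> n * e n x" if "x \<in> space M" for n x
    using ep(2)[OF Dk that] by (simp add: e_def \<mu>_def)
  have z: "e n = (\<lambda>x. 0)" if "\<mu> n = 0" for n
    using ep(4)[OF Dk] that by (simp add: e_def \<mu>_def)
  have one: "L2_inner M (e n) (e n) = 1" if "\<mu> n \<noteq> 0" for n
    using ep(5)[OF Dk] that by (simp add: e_def \<mu>_def)
  \<comment> \<open>Earlier eigenvectors lie in the kernel of every later deflated operator.\<close>
  have null: "j < n \<Longrightarrow> (\<forall>x\<in>space M. integral_operator M (D n) (e j) x = 0) \<and> L2_inner M (e n) (e j) = 0" for j n
  proof (induction n)
    case (Suc n)
    have TS: "integral_operator M (D (Suc n)) (e j) x
        = integral_operator M (D n) (e j) x - (\<mu> n * L2_inner M (e n) (e j)) * e n x" if "x \<in> space M" for x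
      using TD[OF eL that, of "Suc n" j] TD[OF eL that, of n j] by simp
    have null': "integral_operator M (D (Suc n)) (e j) x = 0" if x: "x \<in> space M" for x
    proof (cases "j = n")
      case True
      then show ?thesis using TS[OF x] De[OF x] z[of n] one[of n]
        by (cases "\<mu> n = 0") (auto simp: integral_operator_inner)
    next
      case False
      then have "j < n" using Suc.prems by simp
      then show ?thesis using Suc.IH TS[OF x] x by simp
    qed
    have "\<mu> (Suc n) * L2_inner M (e (Suc n)) (e j) = 0"
    proof -
      have "\<mu> (Suc n) * L2_inner M (e (Suc n)) (e j) = L2_inner M (\<lambda>x. \<mu> (Suc n) * e (Suc n) x) (e j)"
        by (simp add: L2_inner_scale)
      also have "\<dots> = L2_inner M (integral_operator M (D (Suc n)) (e (Suc n))) (e j)"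
        by (rule L2_inner_cong) (simp_all add: De)
      also have "\<dots> = L2_inner M (e (Suc n)) (integral_operator M (D (Suc n)) (e j))"
        by (rule integral_operator_symmetric[OF Dk eL eL])
      also have "\<dots> = L2_inner M (e (Suc n)) (\<lambda>x. 0)"
        by (rule L2_inner_cong) (simp_all add: null')
      finally show ?thesis by simp
    qed
    then have "L2_inner M (e (Suc n)) (e j) = 0" using z[of "Suc n"] by auto
    then show ?case using null' by auto
  qed simp
  have orth: "L2_inner M (e i) (e j) = (if i = j \<and> \<mu> i \<noteq> 0 then 1 else 0)" for i j
  proof (cases "i = j")
    case True then show ?thesis using one[of i] z[of i] by (cases "\<mu> i = 0") auto
  next
    case False
    then consider "i < j" | "j < i" by linarith
    then show ?thesis using null[of i j] null[of j i] False
      by cases (auto simp: L2_inner_commute[of M "e i" "e j"])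
  qed
  have Te: "integral_operator M K (e j) x = \<mu> j * e j x" if x: "x \<in> space M" for j x
  proof -
    have "(\<Sum>k<j. (\<mu> k * L2_inner M (e k) (e j)) * e k x) = 0" by (rule sum.neutral) (auto simp: orth)
    then show ?thesis using TD[OF eL x, of j j] De[OF x] by simp
  qed
  have rem: "L2_norm M (\<lambda>x. integral_operator M K f x - (\<Sum>k<n. (\<mu> k * L2_inner M (e k) f) * e k x))
      \<le> \<bar>\<mu> n\<bar> * L2_norm M f" if f: "f \<in> L2 M" for f n
  proof -
    have "L2_norm M (integral_operator M (D n) f) \<le> \<bar>\<mu> n\<bar> * L2_norm M f"
      using ep(3)[OF Dk] by (intro integral_operator_norm_le_form[OF Dk _ _ f]) (auto simp: \<mu>_def)
    moreover have "L2_norm M (integral_operator M (D n) f)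
        = L2_norm M (\<lambda>x. integral_operator M K f x - (\<Sum>k<n. (\<mu> k * L2_inner M (e k) f) * e k x))"
      unfolding L2_norm_def by (intro arg_cong[where f=sqrt] L2_inner_cong TD[OF f])
    ultimately show ?thesis by simp
  qed
  have lim: "\<mu> \<longlonglongrightarrow> 0"
  proof -
    obtain B where B: "0 \<le> B" "\<And>x y. x \<in> space M \<Longrightarrow> y \<in> space M \<Longrightarrow> \<bar>K x y\<bar> \<le> B"
      using sym_kernel_bound[OF K] by blast
    have bound: "(\<Sum>k<n. (\<mu> k)\<^sup>2) \<le> (B * mass)\<^sup>2 * measure M (space M)" for n
    proof -
      let ?J = "{k. k < n \<and> \<mu> k \<noteq> 0}"
      have inj: "inj_on e ?J"
      proof (rule inj_onI)
        fix i j assume ij: "i \<in> ?J" "j \<in> ?J" "e i = e j"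
        then show "i = j" using orth[of i j] orth[of i i] by (auto split: if_splits)
      qed
      have "e i = e j \<longleftrightarrow> i = j" if "i \<in> ?J" "j \<in> ?J" for i j using inj that by (rule inj_on_eq_iff)
      then have on: "orthonormal M (e ` ?J)" using eL orth by (auto simp: orthonormal_def)
      have pt: "(\<Sum>k<n. (\<mu> k)\<^sup>2 * (e k x)\<^sup>2) \<le> (B * mass)\<^sup>2" if x: "x \<in> space M" for x
      proof -
        have "(\<Sum>k<n. (\<mu> k)\<^sup>2 * (e k x)\<^sup>2) = (\<Sum>k\<in>?J. (\<mu> k)\<^sup>2 * (e k x)\<^sup>2)"
          by (intro sum.mono_neutral_right) auto
        also have "\<dots> = (\<Sum>k\<in>?J. (L2_inner M (K x) (e k))\<^sup>2)"
          using Te[OF x] by (simp add: integral_operator_inner power_mult_distrib)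
        also have "\<dots> = (\<Sum>d\<in>e ` ?J. (L2_inner M (K x) d)\<^sup>2)" by (simp add: sum.reindex[OF inj])
        also have "\<dots> \<le> L2_inner M (K x) (K x)" by (intro Bessel on sym_kernel_L2[OF K x]) simp
        also have "\<dots> = (L2_norm M (K x))\<^sup>2" by (simp add: L2_norm_square)
        also have "\<dots> \<le> (B * mass)\<^sup>2"
          using B x by (intro power_mono bounded_L2(2) L2_measurable[OF sym_kernel_L2[OF K x]]) auto
        finally show ?thesis .
      qed
      have "(\<Sum>k<n. (\<mu> k)\<^sup>2) = (\<Sum>k<n. (\<mu> k)\<^sup>2 * L2_inner M (e k) (e k))"
        by (intro sum.cong) (auto simp: orth)
      also have "\<dots> = (\<Sum>k<n. \<integral>x. (\<mu> k)\<^sup>2 * (e k x)\<^sup>2 \<partial>M)"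
        by (simp add: L2_inner_def power2_eq_square)
      also have "\<dots> = (\<integral>x. (\<Sum>k<n. (\<mu> k)\<^sup>2 * (e k x)\<^sup>2) \<partial>M)"
        using L2_integrable_square[OF eL] by (intro Bochner_Integration.integral_sum[symmetric]) simp
      also have "\<dots> \<le> (\<integral>x. (B * mass)\<^sup>2 \<partial>M)"
        using L2_integrable_square[OF eL] pt by (intro integral_mono) auto
      finally show ?thesis by (simp add: mult.commute)
    qed
    have "summable (\<lambda>k. (\<mu> k)\<^sup>2)" by (rule summableI_nonneg_bounded[OF _ bound]) simp
    then have "(\<lambda>k. (\<mu> k)\<^sup>2) \<longlonglongrightarrow> 0" by (rule summable_LIMSEQ_zero)
    from tendsto_real_sqrt[OF this] have "(\<lambda>k. \<bar>\<mu> k\<bar>) \<longlonglongrightarrow> 0" by simp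
    then show ?thesis by (rule tendsto_rabs_zero_cancel)
  qed
  show ?thesis by (rule that[of e \<mu>]) (fact ec Te orth z lim rem)+
qed

end

section \<open>The trace norm of a continuous kernel\<close>

locale spectral_kernel = compact_measure M for M :: "'a::euclidean_space measure" +
  fixes K :: "'a \<Rightarrow> 'a \<Rightarrow> real" and \<mu> :: "nat \<Rightarrow> real" and e :: "nat \<Rightarrow> 'a \<Rightarrow> real"
  assumes K: "sym_kernel K"
    and e_continuous: "\<And>k. continuous_on (space M) (e k)"
    and eigen: "\<And>k x. x \<in> space M \<Longrightarrow> integral_operator M K (e k) x = \<mu> k * e k x"
    and orth: "\<And>i j. L2_inner M (e i) (e j) = (if i = j \<and> \<mu> i \<noteq> 0 then 1 else 0)"
    and e_zero: "\<And>k. \<mu> k = 0 \<Longrightarrow> e k = (\<lambda>x. 0)"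
    and \<mu>_lim: "\<mu> \<longlonglongrightarrow> 0"
    and remainder: "\<And>f n. f \<in> L2 M \<Longrightarrow>
      L2_norm M (\<lambda>x. integral_operator M K f x - (\<Sum>k<n. (\<mu> k * L2_inner M (e k) f) * e k x))
      \<le> \<bar>\<mu> n\<bar> * L2_norm M f"
begin

abbreviation "T \<equiv> integral_operator M K"

lemma e_L2: "e k \<in> L2 M"
  by (rule continuous_L2[OF e_continuous])

lemma T_L2: "f \<in> L2 M \<Longrightarrow> T f \<in> L2 M"
  by (rule integral_operator_L2[OF K])

lemma eigen_orthonormal:
  assumes "J \<subseteq> {k. \<mu> k \<noteq> 0}"
  shows "inj_on e J" "orthonormal M (e ` J)"
proof -
  show "inj_on e J"
  proof (rule inj_onI)
    fix i j assume ij: "i \<in> J" "j \<in> J" "e i = e j"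
    then show "i = j" using orth[of i j] orth[of i i] assms by (auto split: if_splits)
  qed
  then have "e i = e j \<longleftrightarrow> i = j" if "i \<in> J" "j \<in> J" for i j using that by (rule inj_on_eq_iff)
  then show "orthonormal M (e ` J)" using e_L2 orth assms by (auto simp: orthonormal_def)
qed

lemma eigen_Bessel:
  assumes "finite J" "f \<in> L2 M"
  shows "(\<Sum>k\<in>J. (L2_inner M (e k) f)\<^sup>2) \<le> L2_inner M f f"
proof -
  let ?J = "{k\<in>J. \<mu> k \<noteq> 0}"
  have sub: "?J \<subseteq> {k. \<mu> k \<noteq> 0}" by auto
  have "(\<Sum>k\<in>J. (L2_inner M (e k) f)\<^sup>2) = (\<Sum>k\<in>?J. (L2_inner M (e k) f)\<^sup>2)"
    using assms e_zero by (intro sum.mono_neutral_right) auto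
  also have "\<dots> = (\<Sum>d\<in>e ` ?J. (L2_inner M f d)\<^sup>2)"
    by (simp add: sum.reindex[OF eigen_orthonormal(1)[OF sub]] L2_inner_commute[of M f])
  also have "\<dots> \<le> L2_inner M f f" using assms by (intro Bessel eigen_orthonormal(2)[OF sub]) auto
  finally show ?thesis .
qed

lemma T_inner_eigen: "f \<in> L2 M \<Longrightarrow> L2_inner M (e k) (T f) = \<mu> k * L2_inner M (e k) f"
  using integral_operator_symmetric[OF K e_L2, of f k] L2_inner_cong[of "T (e k)" "\<lambda>x. \<mu> k * e k x" f f] eigen
  by (simp add: L2_inner_scale)

lemma T_inner_sums:
  assumes f: "f \<in> L2 M" and g: "g \<in> L2 M"
  shows "(\<lambda>k. \<mu> k * L2_inner M (e k) f * L2_inner M (e k) g) sums L2_inner M (T f) g"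
proof -
  have b: "\<bar>(\<Sum>k<n. \<mu> k * L2_inner M (e k) f * L2_inner M (e k) g) - L2_inner M (T f) g\<bar>
      \<le> \<bar>\<mu> n\<bar> * (L2_norm M f * L2_norm M g)" for n
  proof -
    let ?p = "\<lambda>x. \<Sum>k<n. (\<mu> k * L2_inner M (e k) f) * e k x"
    have p: "?p \<in> L2 M" by (intro L2_sum e_L2)
    have "L2_inner M (\<lambda>x. T f x - ?p x) g = L2_inner M (T f) g - L2_inner M ?p g"
      by (intro L2_inner_diff T_L2 f g p)
    moreover have "L2_inner M ?p g = (\<Sum>k<n. (\<mu> k * L2_inner M (e k) f) * L2_inner M (e k) g)"
      by (intro L2_inner_sum e_L2 g)
    moreover have "\<bar>L2_inner M (\<lambda>x. T f x - ?p x) g\<bar> \<le> L2_norm M (\<lambda>x. T f x - ?p x) * L2_norm M g"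
      by (intro L2_Cauchy_Schwarz L2_diff T_L2 f g p)
    moreover have "\<dots> \<le> (\<bar>\<mu> n\<bar> * L2_norm M f) * L2_norm M g"
      by (intro mult_right_mono remainder f) simp
    ultimately show ?thesis by (simp add: mult.assoc)
  qed
  have "(\<lambda>n. \<bar>\<mu> n\<bar> * (L2_norm M f * L2_norm M g)) \<longlonglongrightarrow> \<bar>0\<bar> * (L2_norm M f * L2_norm M g)"
    by (intro tendsto_intros \<mu>_lim)
  then have lim0: "(\<lambda>n. \<bar>\<mu> n\<bar> * (L2_norm M f * L2_norm M g)) \<longlonglongrightarrow> 0" by simp
  have "(\<lambda>n. \<bar>(\<Sum>k<n. \<mu> k * L2_inner M (e k) f * L2_inner M (e k) g) - L2_inner M (T f) g\<bar>) \<longlonglongrightarrow> 0"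
    by (rule real_tendsto_sandwich[OF always_eventually[OF allI[OF abs_ge_zero]]
          always_eventually[OF allI[OF b]] tendsto_const lim0])
  from LIM_zero_cancel[OF tendsto_rabs_zero_cancel[OF this]] show ?thesis unfolding sums_def .
qed

text \<open>The absolute value of T, by functional calculus on the eigenvectors.\<close>

definition S :: "('a \<Rightarrow> real) \<Rightarrow> 'a \<Rightarrow> real" where
  "S f x = (\<Sum>k. \<bar>\<mu> k\<bar> * L2_inner M (e k) f * e k x)"

text \<open>The numbers \<mu> k * e k x are the coefficients of the section K x in the eigenvectors, so this
  is Bessel's inequality.\<close>

lemma eigen_pointwise_bound:
  assumes x: "x \<in> space M"
  shows "(\<Sum>k<n. (\<bar>\<mu> k\<bar> * e k x)\<^sup>2) \<le> L2_inner M (K x) (K x)"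
proof -
  have "(\<bar>\<mu> k\<bar> * e k x)\<^sup>2 = (L2_inner M (e k) (K x))\<^sup>2" for k
    using eigen[OF x, of k] by (simp add: integral_operator_inner power_mult_distrib L2_inner_commute)
  then show ?thesis using eigen_Bessel[OF _ sym_kernel_L2[OF K x], of "{..<n}"] by simp
qed

lemma S_partial_bound:
  assumes x: "x \<in> space M" and f: "f \<in> L2 M"
  shows "(\<Sum>k<n. \<bar>\<bar>\<mu> k\<bar> * L2_inner M (e k) f * e k x\<bar>) \<le> L2_inner M (K x) (K x) + L2_inner M f f"
proof -
  have "(\<Sum>k<n. \<bar>\<bar>\<mu> k\<bar> * L2_inner M (e k) f * e k x\<bar>) \<le> (\<Sum>k<n. (\<bar>\<mu> k\<bar> * e k x)\<^sup>2 + (L2_inner M (e k) f)\<^sup>2)"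
  proof (rule sum_mono)
    fix k
    have "2 * \<bar>\<bar>\<mu> k\<bar> * e k x\<bar> * \<bar>L2_inner M (e k) f\<bar> \<le> (\<bar>\<mu> k\<bar> * e k x)\<^sup>2 + (L2_inner M (e k) f)\<^sup>2"
      using sum_squares_bound[of "\<bar>\<bar>\<mu> k\<bar> * e k x\<bar>" "\<bar>L2_inner M (e k) f\<bar>"] by (simp only: power2_abs)
    moreover have "\<bar>\<bar>\<mu> k\<bar> * L2_inner M (e k) f * e k x\<bar> = \<bar>\<bar>\<mu> k\<bar> * e k x\<bar> * \<bar>L2_inner M (e k) f\<bar>"
      by (simp only: abs_mult mult_ac)
    moreover have "0 \<le> \<bar>\<bar>\<mu> k\<bar> * e k x\<bar> * \<bar>L2_inner M (e k) f\<bar>" by simp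
    ultimately show "\<bar>\<bar>\<mu> k\<bar> * L2_inner M (e k) f * e k x\<bar> \<le> (\<bar>\<mu> k\<bar> * e k x)\<^sup>2 + (L2_inner M (e k) f)\<^sup>2"
      by linarith
  qed
  also have "\<dots> \<le> L2_inner M (K x) (K x) + L2_inner M f f"
    unfolding sum.distrib by (intro add_mono eigen_pointwise_bound[OF x] eigen_Bessel f) simp
  finally show ?thesis .
qed

lemma S_summable:
  assumes "x \<in> space M" "f \<in> L2 M"
  shows "summable (\<lambda>k. \<bar>\<mu> k\<bar> * L2_inner M (e k) f * e k x)"
proof (rule summable_rabs_cancel)
  show "summable (\<lambda>k. \<bar>\<bar>\<mu> k\<bar> * L2_inner M (e k) f * e k x\<bar>)"
    by (rule summableI_nonneg_bounded[OF _ S_partial_bound[OF assms]]) simp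
qed

text \<open>The partial sums are bounded uniformly on the space, so inner products pass to the limit by
  dominated convergence.\<close>

lemma
  assumes f: "f \<in> L2 M"
  shows S_L2: "S f \<in> L2 M"
    and S_inner_sums: "g \<in> L2 M \<Longrightarrow> (\<lambda>k. \<bar>\<mu> k\<bar> * L2_inner M (e k) f * L2_inner M (e k) g) sums L2_inner M (S f) g"
proof -
  obtain B where B: "0 \<le> B" "\<And>x y. x \<in> space M \<Longrightarrow> y \<in> space M \<Longrightarrow> \<bar>K x y\<bar> \<le> B"
    using sym_kernel_bound[OF K] by blast
  define C where "C = (B * mass)\<^sup>2 + L2_inner M f f"
  define s where "s n x = (\<Sum>k<n. \<bar>\<mu> k\<bar> * L2_inner M (e k) f * e k x)" for n x
  have lim: "(\<lambda>n. s n x) \<longlonglongrightarrow> S f x" if "x \<in> space M" for x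
    using summable_LIMSEQ[OF S_summable[OF that f]] by (simp add: s_def S_def)
  have sb: "\<bar>s n x\<bar> \<le> C" if x: "x \<in> space M" for n x
  proof -
    have "L2_inner M (K x) (K x) = (L2_norm M (K x))\<^sup>2" by (simp add: L2_norm_square)
    also have "\<dots> \<le> (B * mass)\<^sup>2"
      using B x by (intro power_mono bounded_L2(2) L2_measurable[OF sym_kernel_L2[OF K x]]) auto
    finally have "L2_inner M (K x) (K x) \<le> (B * mass)\<^sup>2" .
    moreover have "\<bar>s n x\<bar> \<le> (\<Sum>k<n. \<bar>\<bar>\<mu> k\<bar> * L2_inner M (e k) f * e k x\<bar>)"
      unfolding s_def by (rule sum_abs)
    ultimately show ?thesis using S_partial_bound[OF x f, of n] unfolding C_def by linarith
  qed
  have sL: "s n \<in> L2 M" for n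
    unfolding s_def[abs_def] by (intro L2_sum e_L2)
  have sm: "s n \<in> borel_measurable M" for n by (rule L2_measurable[OF sL])
  have Sm [measurable]: "S f \<in> borel_measurable M"
    using lim by (intro borel_measurable_LIMSEQ_real[of M s, OF _ sm]) auto
  have "\<bar>S f x\<bar> \<le> C" if x: "x \<in> space M" for x
    using tendsto_rabs[OF lim[OF x]] sb[OF x] by (intro LIMSEQ_le_const2[of "\<lambda>n. \<bar>s n x\<bar>"]) auto
  then show "S f \<in> L2 M" using bounded_L2(1)[OF Sm] by blast
  show "(\<lambda>k. \<bar>\<mu> k\<bar> * L2_inner M (e k) f * L2_inner M (e k) g) sums L2_inner M (S f) g" if g: "g \<in> L2 M"
  proof -
    have "(\<lambda>n. \<integral>x. s n x * g x \<partial>M) \<longlonglongrightarrow> (\<integral>x. S f x * g x \<partial>M)"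
    proof (rule integral_dominated_convergence[where w="\<lambda>x. C * \<bar>g x\<bar>"])
      show "(\<lambda>x. S f x * g x) \<in> borel_measurable M" "\<And>n. (\<lambda>x. s n x * g x) \<in> borel_measurable M"
        using L2_measurable[OF g] Sm sm by auto
      show "integrable M (\<lambda>x. C * \<bar>g x\<bar>)" using L2_integral_abs_le(1)[OF g] by simp
      show "AE x in M. (\<lambda>n. s n x * g x) \<longlonglongrightarrow> S f x * g x"
        using lim by (intro AE_I2 tendsto_intros)
      show "AE x in M. norm (s n x * g x) \<le> C * \<bar>g x\<bar>" for n
        using sb by (intro AE_I2) (auto simp: abs_mult intro: mult_right_mono)
    qed
    moreover have "(\<integral>x. s n x * g x \<partial>M) = (\<Sum>k<n. \<bar>\<mu> k\<bar> * L2_inner M (e k) f * L2_inner M (e k) g)" for n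
    proof -
      have "L2_inner M (s n) g = (\<Sum>k<n. \<bar>\<mu> k\<bar> * L2_inner M (e k) f * L2_inner M (e k) g)"
        unfolding s_def[abs_def] by (intro L2_inner_sum e_L2 g)
      then show ?thesis by (simp add: L2_inner_def[of M "s n" g])
    qed
    ultimately show ?thesis by (simp add: sums_def L2_inner_def[of M "S f" g])
  qed
qed

lemma S_symmetric:
  assumes "f \<in> L2 M" "g \<in> L2 M"
  shows "L2_inner M (S f) g = L2_inner M f (S g)"
proof -
  have "(\<lambda>k. \<bar>\<mu> k\<bar> * L2_inner M (e k) f * L2_inner M (e k) g) sums L2_inner M (S g) f"
    using S_inner_sums[OF assms(2,1)] by (simp add: mult_ac)
  then have "L2_inner M (S f) g = L2_inner M (S g) f"
    using S_inner_sums[OF assms] sums_unique2 by blast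
  then show ?thesis using L2_inner_commute[of M "S g" f] by simp
qed

lemma S_inner_eigen:
  assumes g: "g \<in> L2 M"
  shows "L2_inner M (e k) (S g) = \<bar>\<mu> k\<bar> * L2_inner M (e k) g"
proof -
  have "(\<lambda>j. \<bar>\<mu> j\<bar> * L2_inner M (e j) g * L2_inner M (e j) (e k))
      = (\<lambda>j. if j = k then \<bar>\<mu> k\<bar> * L2_inner M (e k) g else 0)"
    by (auto simp: orth)
  then have "(\<lambda>j. if j = k then \<bar>\<mu> k\<bar> * L2_inner M (e k) g else 0) sums L2_inner M (S g) (e k)"
    using S_inner_sums[OF g e_L2, of k] by simp
  from sums_unique2[OF this sums_single] show ?thesis by (simp add: L2_inner_commute[of M "e k" "S g"])
qed

lemma S_square:
  assumes f: "f \<in> L2 M" and g: "g \<in> L2 M"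
  shows "L2_inner M (S f) (S g) = L2_inner M (T f) (T g)"
proof -
  have 1: "(\<lambda>k. \<bar>\<mu> k\<bar> * L2_inner M (e k) f * (\<bar>\<mu> k\<bar> * L2_inner M (e k) g)) sums L2_inner M (S f) (S g)"
    using S_inner_sums[OF f S_L2[OF g]] by (simp only: S_inner_eigen[OF g])
  have 2: "(\<lambda>k. \<mu> k * L2_inner M (e k) f * (\<mu> k * L2_inner M (e k) g)) sums L2_inner M (T f) (T g)"
    using T_inner_sums[OF f T_L2[OF g]] by (simp only: T_inner_eigen[OF g])
  have "\<bar>m\<bar> * a * (\<bar>m\<bar> * b) = m * a * (m * b)" for m a b :: real
    by (cases "0 \<le> m") auto
  then have "(\<lambda>k. \<bar>\<mu> k\<bar> * L2_inner M (e k) f * (\<bar>\<mu> k\<bar> * L2_inner M (e k) g))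
      = (\<lambda>k. \<mu> k * L2_inner M (e k) f * (\<mu> k * L2_inner M (e k) g))" by (intro ext)
  then show ?thesis using sums_unique2[OF 1] 2 by simp
qed

lemma S_lincomb:
  assumes "x \<in> space M" "f \<in> L2 M" "g \<in> L2 M"
  shows "S (\<lambda>y. a * f y + b * g y) x = a * S f x + b * S g x"
proof -
  have "(\<lambda>k. a * (\<bar>\<mu> k\<bar> * L2_inner M (e k) f * e k x) + b * (\<bar>\<mu> k\<bar> * L2_inner M (e k) g * e k x))
      sums (a * S f x + b * S g x)"
    unfolding S_def using assms by (intro sums_add sums_mult summable_sums S_summable)
  moreover have "a * (\<bar>\<mu> k\<bar> * L2_inner M (e k) f * e k x) + b * (\<bar>\<mu> k\<bar> * L2_inner M (e k) g * e k x)
      = \<bar>\<mu> k\<bar> * L2_inner M (e k) (\<lambda>y. a * f y + b * g y) * e k x" for k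
    using L2_inner_lincomb[OF assms(2,3) e_L2, of a b k]
    by (simp add: L2_inner_commute[of M "e k"] algebra_simps)
  ultimately have "(\<lambda>k. \<bar>\<mu> k\<bar> * L2_inner M (e k) (\<lambda>y. a * f y + b * g y) * e k x) sums (a * S f x + b * S g x)"
    by (simp only:)
  from sums_unique[OF this] S_def[of "\<lambda>y. a * f y + b * g y" x] show ?thesis by simp
qed

lemma T_norm_bound: "\<exists>C. \<forall>f\<in>L2 M. L2_norm M (T f) \<le> C * L2_norm M f"
proof -
  have "L2_norm M (T f) \<le> \<bar>\<mu> 0\<bar> * L2_norm M f" if "f \<in> L2 M" for f
    using remainder[OF that, of 0] by simp
  then show ?thesis by blast
qed

text \<open>Agreement is required on L2 only: for other f the integrals may take default values, and then the
  difference of two integral operators is not the operator of the difference of the kernels.\<close>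

definition represents :: "'a oper \<Rightarrow> bool" where
  "represents T' \<longleftrightarrow> (\<forall>f\<in>L2 M. \<forall>x\<in>space M. T' f x = T f x)"

lemma represents_inner:
  assumes "represents T'" "f \<in> L2 M" "g \<in> L2 M"
  shows "L2_inner M (T' f) (T' g) = L2_inner M (T f) (T g)"
  using assms by (intro L2_inner_cong) (auto simp: represents_def)

lemma S_is_abs:
  assumes "represents T'"
  shows "is_L2_abs M T' S"
  unfolding is_L2_abs_def L2_operator_def L2_symmetric_def L2_nonneg_def
proof (intro conjI ballI allI)
  show "S f \<in> L2 M" if "f \<in> L2 M" for f using that by (rule S_L2)
  show "AE x in M. S (\<lambda>y. a * f y + b * g y) x = a * S f x + b * S g x"
    if "f \<in> L2 M" "g \<in> L2 M" for f g a b using that by (intro AE_I2 S_lincomb)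
  obtain C where C: "\<And>f. f \<in> L2 M \<Longrightarrow> L2_norm M (T f) \<le> C * L2_norm M f" using T_norm_bound by blast
  show "\<exists>C. \<forall>f\<in>L2 M. L2_norm M (S f) \<le> C * L2_norm M f"
    using C S_square by (intro exI[of _ C]) (simp add: L2_norm_def)
  show "L2_inner M (S f) g = L2_inner M f (S g)" if "f \<in> L2 M" "g \<in> L2 M" for f g
    using that by (rule S_symmetric)
  show "0 \<le> L2_inner M (S f) f" if f: "f \<in> L2 M" for f
    using S_inner_sums[OF f f] by (rule sums_le[OF _ sums_zero, rotated]) (simp add: mult.assoc)
  show "L2_inner M (S (S f)) g = L2_inner M (T' f) (T' g)" if "f \<in> L2 M" "g \<in> L2 M" for f g
    using that S_symmetric[OF S_L2, of f g] S_square represents_inner[OF assms] by simp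
qed

text \<open>Absolute values are unique only up to null sets, but the quadratic form is determined.  Every
  absolute value S' acts on an eigenvector e with eigenvalue \<mu> as multiplication by |\<mu>|: for
  g = S' e - |\<mu>| e one has (S' + |\<mu>|) g = 0, and S' is non-negative, so g is null if \<mu> is
  nonzero.  Off the first n eigenvectors S' is as small as T.\<close>

lemma abs_form_sums:
  assumes T': "represents T'" and S': "is_L2_abs M T' S'" and f: "f \<in> L2 M"
  shows "(\<lambda>k. \<bar>\<mu> k\<bar> * (L2_inner M (e k) f)\<^sup>2) sums L2_inner M (S' f) f"
proof -
  have SL: "S' h \<in> L2 M" if "h \<in> L2 M" for h
    using S' that by (simp add: is_L2_abs_def L2_operator_def)
  have sym: "L2_inner M (S' h) g = L2_inner M h (S' g)" if "h \<in> L2 M" "g \<in> L2 M" for h g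
    using S' that by (simp add: is_L2_abs_def L2_symmetric_def)
  have nonneg: "0 \<le> L2_inner M (S' h) h" if "h \<in> L2 M" for h
    using S' that by (simp add: is_L2_abs_def L2_nonneg_def)
  have sq: "L2_inner M (S' h) (S' g) = L2_inner M (T h) (T g)" if "h \<in> L2 M" "g \<in> L2 M" for h g
    using S' that sym[OF SL, of h g] represents_inner[OF T' that] by (simp add: is_L2_abs_def)
  have eig': "L2_inner M (S' (e k)) h = \<bar>\<mu> k\<bar> * L2_inner M (e k) h" if h: "h \<in> L2 M" for k h
  proof (cases "\<mu> k = 0")
    case True
    have "L2_inner M (T (e k)) (T (e k)) = \<mu> k * L2_inner M (e k) (T (e k))"
      using L2_inner_cong[of "T (e k)" "\<lambda>x. \<mu> k * e k x" "T (e k)" "T (e k)"] eigen by (simp add: L2_inner_scale)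
    then have "L2_norm M (S' (e k)) = 0" using sq[OF e_L2 e_L2, of k k] True by (simp add: L2_norm_def)
    then show ?thesis using L2_Cauchy_Schwarz[OF SL[OF e_L2] h, of k] True by simp
  next
    case False
    define g where "g = (\<lambda>x. 1 * S' (e k) x + (- \<bar>\<mu> k\<bar>) * e k x)"
    have gL: "g \<in> L2 M" unfolding g_def by (intro L2_lincomb SL e_L2)
    have ig: "L2_inner M g h = L2_inner M (S' (e k)) h - \<bar>\<mu> k\<bar> * L2_inner M (e k) h" if "h \<in> L2 M" for h
      unfolding g_def using L2_inner_lincomb[OF SL[OF e_L2] e_L2 that, of 1 k "- \<bar>\<mu> k\<bar>" k] by simp
    have "L2_inner M (S' (e k)) (S' g) = \<mu> k * (\<mu> k * L2_inner M (e k) g)"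
    proof -
      have "L2_inner M (S' (e k)) (S' g) = L2_inner M (\<lambda>x. \<mu> k * e k x) (T g)"
        unfolding sq[OF e_L2 gL] by (rule L2_inner_cong) (simp_all add: eigen)
      then show ?thesis by (simp add: L2_inner_scale T_inner_eigen[OF gL])
    qed
    then have "L2_inner M (S' g) g = \<mu> k * (\<mu> k * L2_inner M (e k) g) - \<bar>\<mu> k\<bar> * L2_inner M (S' (e k)) g"
      using sym[OF gL gL] ig[OF SL[OF gL]] sym[OF e_L2 gL, of k] by simp
    also have "\<mu> k * (\<mu> k * L2_inner M (e k) g) = \<bar>\<mu> k\<bar> * (\<bar>\<mu> k\<bar> * L2_inner M (e k) g)"
      using abs_mult_self[of "\<mu> k"] by (metis mult.assoc)
    finally have "L2_inner M (S' g) g = - (\<bar>\<mu> k\<bar> * L2_inner M g g)"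
      using ig[OF gL] by (simp add: right_diff_distrib)
    moreover have "0 \<le> \<bar>\<mu> k\<bar> * L2_inner M g g" by simp
    ultimately have "\<bar>\<mu> k\<bar> * L2_inner M g g = 0" using nonneg[OF gL] by linarith
    then have "L2_norm M g = 0" using False by (simp add: L2_norm_def)
    then have "L2_inner M g h = 0" using L2_Cauchy_Schwarz[OF gL h] by simp
    then show ?thesis using ig[OF h] by simp
  qed
  have b: "\<bar>(\<Sum>k<n. \<bar>\<mu> k\<bar> * (L2_inner M (e k) f)\<^sup>2) - L2_inner M (S' f) f\<bar> \<le> \<bar>\<mu> n\<bar> * (L2_norm M f * L2_norm M f)" for n
  proof -
    let ?p = "\<lambda>x. \<Sum>k<n. L2_inner M (e k) f * e k x"
    let ?q = "\<lambda>x. f x - ?p x"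
    have p: "?p \<in> L2 M" by (intro L2_sum e_L2)
    have q: "?q \<in> L2 M" by (intro L2_diff f p)
    have "L2_inner M (S' f) ?p = (\<Sum>k<n. L2_inner M (e k) f * L2_inner M (S' f) (e k))"
      by (intro L2_inner_sum_right e_L2 SL f)
    also have "\<dots> = (\<Sum>k<n. \<bar>\<mu> k\<bar> * (L2_inner M (e k) f)\<^sup>2)"
    proof (rule sum.cong[OF refl])
      fix k
      have "L2_inner M (S' f) (e k) = L2_inner M (S' (e k)) f"
        using sym[OF f e_L2, of k] by (simp add: L2_inner_commute[of M f])
      then show "L2_inner M (e k) f * L2_inner M (S' f) (e k) = \<bar>\<mu> k\<bar> * (L2_inner M (e k) f)\<^sup>2"
        using eig'[OF f, of k] by (simp add: power2_eq_square)
    qed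
    finally have "L2_inner M (S' f) ?q = L2_inner M (S' f) f - (\<Sum>k<n. \<bar>\<mu> k\<bar> * (L2_inner M (e k) f)\<^sup>2)"
      using L2_inner_diff_right[OF f p SL[OF f]] by simp
    moreover have "\<bar>L2_inner M (S' f) ?q\<bar> \<le> L2_norm M f * (\<bar>\<mu> n\<bar> * L2_norm M f)"
    proof -
      have "\<bar>L2_inner M (S' f) ?q\<bar> = \<bar>L2_inner M f (S' ?q)\<bar>" using sym[OF f q] by simp
      also have "\<dots> \<le> L2_norm M f * L2_norm M (S' ?q)" by (intro L2_Cauchy_Schwarz f SL q)
      also have "L2_norm M (S' ?q) = L2_norm M (T ?q)" using sq[OF q q] by (simp add: L2_norm_def)
      also have "L2_norm M (T ?q) = L2_norm M (\<lambda>x. T f x - (\<Sum>k<n. (\<mu> k * L2_inner M (e k) f) * e k x))"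
        unfolding L2_norm_def
      proof (intro arg_cong[where f=sqrt] L2_inner_cong)
        fix x assume x: "x \<in> space M"
        have "T ?q x = L2_inner M (K x) f - L2_inner M (K x) ?p"
          unfolding integral_operator_inner by (intro L2_inner_diff_right f p sym_kernel_L2[OF K x])
        also have "L2_inner M (K x) ?p = (\<Sum>k<n. L2_inner M (e k) f * L2_inner M (K x) (e k))"
          by (intro L2_inner_sum_right e_L2 sym_kernel_L2[OF K x])
        also have "\<dots> = (\<Sum>k<n. (\<mu> k * L2_inner M (e k) f) * e k x)"
          using eigen[OF x] by (intro sum.cong refl) (simp add: integral_operator_inner)
        finally show "T ?q x = T f x - (\<Sum>k<n. (\<mu> k * L2_inner M (e k) f) * e k x)"
          by (simp add: integral_operator_inner)
        \<comment> \<open>Both arguments of the inner product are to be rewritten.\<close>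
        then show "T ?q x = T f x - (\<Sum>k<n. (\<mu> k * L2_inner M (e k) f) * e k x)" .
      qed
      also have "L2_norm M f * \<dots> \<le> L2_norm M f * (\<bar>\<mu> n\<bar> * L2_norm M f)"
        by (intro mult_left_mono remainder f) simp
      finally show ?thesis .
    qed
    ultimately show ?thesis by (simp add: mult.left_commute abs_minus_commute)
  qed
  have "(\<lambda>n. \<bar>\<mu> n\<bar> * (L2_norm M f * L2_norm M f)) \<longlonglongrightarrow> \<bar>0\<bar> * (L2_norm M f * L2_norm M f)"
    by (intro tendsto_intros \<mu>_lim)
  then have lim0: "(\<lambda>n. \<bar>\<mu> n\<bar> * (L2_norm M f * L2_norm M f)) \<longlonglongrightarrow> 0" by simp
  have "(\<lambda>n. \<bar>(\<Sum>k<n. \<bar>\<mu> k\<bar> * (L2_inner M (e k) f)\<^sup>2) - L2_inner M (S' f) f\<bar>) \<longlonglongrightarrow> 0"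
    by (rule real_tendsto_sandwich[OF always_eventually[OF allI[OF abs_ge_zero]]
          always_eventually[OF allI[OF b]] tendsto_const lim0])
  from LIM_zero_cancel[OF tendsto_rabs_zero_cancel[OF this]] show ?thesis unfolding sums_def .
qed

lemma abs_form_eigenvalues:
  assumes "represents T'" "is_L2_abs M T' S'" "orthonormal M F" "finite F"
  shows "(\<Sum>f\<in>F. L2_inner M (S' f) f) = (\<Sum>k. \<bar>\<mu> k\<bar> * (\<Sum>f\<in>F. (L2_inner M (e k) f)\<^sup>2))"
    "summable (\<lambda>k. \<bar>\<mu> k\<bar> * (\<Sum>f\<in>F. (L2_inner M (e k) f)\<^sup>2))"
proof -
  have "(\<lambda>k. \<Sum>f\<in>F. \<bar>\<mu> k\<bar> * (L2_inner M (e k) f)\<^sup>2) sums (\<Sum>f\<in>F. L2_inner M (S' f) f)"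
    using assms by (intro sums_sum abs_form_sums) (auto dest: orthonormal_L2)
  then have "(\<lambda>k. \<bar>\<mu> k\<bar> * (\<Sum>f\<in>F. (L2_inner M (e k) f)\<^sup>2)) sums (\<Sum>f\<in>F. L2_inner M (S' f) f)"
    by (simp only: sum_distrib_left)
  then show "(\<Sum>f\<in>F. L2_inner M (S' f) f) = (\<Sum>k. \<bar>\<mu> k\<bar> * (\<Sum>f\<in>F. (L2_inner M (e k) f)\<^sup>2))"
    "summable (\<lambda>k. \<bar>\<mu> k\<bar> * (\<Sum>f\<in>F. (L2_inner M (e k) f)\<^sup>2))"
    by (auto simp: sums_iff)
qed

lemma coefficient_sum_le_1:
  assumes "orthonormal M F" "finite F"
  shows "(\<Sum>f\<in>F. (L2_inner M (e k) f)\<^sup>2) \<le> (if \<mu> k = 0 then 0 else 1)"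
  using Bessel[OF assms(2,1) e_L2, of k] orth[of k k] by (auto simp: e_zero)

definition eigenvalue_sum :: ennreal where
  "eigenvalue_sum = (\<Sum>k. ennreal \<bar>\<mu> k\<bar>)"

lemma abs_form_le_eigenvalue_sum:
  assumes T': "represents T'" and S': "is_L2_abs M T' S'" and F: "orthonormal M F" "finite F"
  shows "ennreal (\<Sum>f\<in>F. L2_inner M (S' f) f) \<le> eigenvalue_sum"
proof -
  have "ennreal (\<Sum>f\<in>F. L2_inner M (S' f) f) = (\<Sum>k. ennreal (\<bar>\<mu> k\<bar> * (\<Sum>f\<in>F. (L2_inner M (e k) f)\<^sup>2)))"
    unfolding abs_form_eigenvalues(1)[OF assms] using abs_form_eigenvalues(2)[OF assms]
    by (intro suminf_ennreal2[symmetric] mult_nonneg_nonneg sum_nonneg) auto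
  also have "\<dots> \<le> (\<Sum>k. ennreal \<bar>\<mu> k\<bar>)"
  proof (intro suminf_le allI summableI ennreal_leI)
    fix k
    have "(\<Sum>f\<in>F. (L2_inner M (e k) f)\<^sup>2) \<le> 1"
      using coefficient_sum_le_1[OF F, of k] by (simp split: if_splits)
    then show "\<bar>\<mu> k\<bar> * (\<Sum>f\<in>F. (L2_inner M (e k) f)\<^sup>2) \<le> \<bar>\<mu> k\<bar>"
      using mult_left_mono[of _ 1 "\<bar>\<mu> k\<bar>"] by simp
  qed
  finally show ?thesis by (simp add: eigenvalue_sum_def)
qed

text \<open>Parseval's identity for each eigenvector exchanges the sum over the basis with the sum over the
  eigenvalues.\<close>

lemma trace_abs_eq:
  assumes T': "represents T'" and S': "is_L2_abs M T' S'"
  shows "L2_trace M S' = eigenvalue_sum"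
proof -
  define E where "E = (SOME E. L2_orthonormal_basis M E)"
  have basis: "L2_orthonormal_basis M E" unfolding E_def using someI_ex[OF L2_basis_exists] .
  have onE: "orthonormal M E" using basis by (simp add: L2_orthonormal_basis_def orthonormal_def)
  have nonneg: "0 \<le> L2_inner M (S' h) h" if "h \<in> L2 M" for h
    using S' that by (simp add: is_L2_abs_def L2_nonneg_def)
  have finsum: "(\<Sum>f\<in>F. ennreal (L2_inner M (S' f) f)) = ennreal (\<Sum>f\<in>F. L2_inner M (S' f) f)" if "F \<subseteq> E" for F
    using that onE by (intro sum_ennreal nonneg) (auto dest: orthonormal_L2)
  have tr: "L2_trace M S' = (SUP F\<in>{F. finite F \<and> F \<subseteq> E}. ennreal (\<Sum>f\<in>F. L2_inner M (S' f) f))"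
  proof -
    have "L2_trace M S' = (SUP F\<in>{F. finite F \<and> F \<subseteq> E}. (\<Sum>f\<in>F. ennreal (L2_inner M (S' f) f)))"
      unfolding L2_trace_def E_def[symmetric] by (rule nonneg_infsum_complete) simp
    also have "\<dots> = (SUP F\<in>{F. finite F \<and> F \<subseteq> E}. ennreal (\<Sum>f\<in>F. L2_inner M (S' f) f))"
      by (intro SUP_cong refl finsum) auto
    finally show ?thesis .
  qed
  show ?thesis
  proof (rule antisym)
    show "L2_trace M S' \<le> eigenvalue_sum"
      unfolding tr using onE
      by (intro SUP_least abs_form_le_eigenvalue_sum[OF assms]) (auto intro: orthonormal_subset)
    show "eigenvalue_sum \<le> L2_trace M S'"
      unfolding eigenvalue_sum_def
    proof (rule suminf_le_const[OF summableI])
      fix n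
      show "(\<Sum>k<n. ennreal \<bar>\<mu> k\<bar>) \<le> L2_trace M S'"
      proof (rule ennreal_le_epsilon)
        fix \<epsilon> :: real assume "0 < \<epsilon>"
        define s where "s = (\<Sum>k<n. \<bar>\<mu> k\<bar>)"
        have s0: "0 \<le> s" by (simp add: s_def)
        define \<eta> where "\<eta> = \<epsilon> / (s + 1)"
        have "0 < \<eta>" using \<open>0 < \<epsilon>\<close> s0 by (simp add: \<eta>_def)
        have "\<eta> * s \<le> \<eta> * (s + 1)" using \<open>0 < \<eta>\<close> by simp
        also have "\<dots> = \<epsilon>" using s0 by (simp add: \<eta>_def)
        finally have \<eta>s: "\<eta> * s \<le> \<epsilon>" .
        have "\<forall>k. \<exists>F. finite F \<and> F \<subseteq> E \<and> L2_inner M (e k) (e k) - \<eta> \<le> (\<Sum>f\<in>F. (L2_inner M (e k) f)\<^sup>2)"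
          using L2_Parseval[OF basis e_L2 \<open>0 < \<eta>\<close>] by metis
        then obtain F0 where F0: "\<And>k. finite (F0 k)" "\<And>k. F0 k \<subseteq> E"
          "\<And>k. L2_inner M (e k) (e k) - \<eta> \<le> (\<Sum>f\<in>F0 k. (L2_inner M (e k) f)\<^sup>2)" by metis
        define F where "F = (\<Union>k<n. F0 k)"
        have F: "finite F" "F \<subseteq> E" using F0 by (auto simp: F_def)
        have onF: "orthonormal M F" by (rule orthonormal_subset[OF onE F(2)])
        have lower: "\<bar>\<mu> k\<bar> - \<bar>\<mu> k\<bar> * \<eta> \<le> \<bar>\<mu> k\<bar> * (\<Sum>f\<in>F. (L2_inner M (e k) f)\<^sup>2)" if "k < n" for k
        proof (cases "\<mu> k = 0")
          case False
          have "(\<Sum>f\<in>F0 k. (L2_inner M (e k) f)\<^sup>2) \<le> (\<Sum>f\<in>F. (L2_inner M (e k) f)\<^sup>2)"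
            using that F by (intro sum_mono2) (auto simp: F_def)
          then have "1 - \<eta> \<le> (\<Sum>f\<in>F. (L2_inner M (e k) f)\<^sup>2)" using F0(3)[of k] orth[of k k] False by simp
          then have "\<bar>\<mu> k\<bar> * (1 - \<eta>) \<le> \<bar>\<mu> k\<bar> * (\<Sum>f\<in>F. (L2_inner M (e k) f)\<^sup>2)" by (rule mult_left_mono) simp
          then show ?thesis by (simp add: right_diff_distrib)
        qed simp
        have "s - \<epsilon> \<le> s - \<eta> * s" using \<eta>s by simp
        also have "\<dots> = (\<Sum>k<n. \<bar>\<mu> k\<bar> - \<bar>\<mu> k\<bar> * \<eta>)"
          by (simp add: s_def sum_subtractf sum_distrib_left mult.commute)
        also have "\<dots> \<le> (\<Sum>k<n. \<bar>\<mu> k\<bar> * (\<Sum>f\<in>F. (L2_inner M (e k) f)\<^sup>2))" by (intro sum_mono lower) simp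
        also have "\<dots> \<le> (\<Sum>k. \<bar>\<mu> k\<bar> * (\<Sum>f\<in>F. (L2_inner M (e k) f)\<^sup>2))"
          using abs_form_eigenvalues(2)[OF assms onF F(1)]
          by (rule sum_le_suminf) (auto intro!: mult_nonneg_nonneg sum_nonneg)
        also have "\<dots> = (\<Sum>f\<in>F. L2_inner M (S' f) f)" by (rule abs_form_eigenvalues(1)[OF assms onF F(1), symmetric])
        finally have "s \<le> (\<Sum>f\<in>F. L2_inner M (S' f) f) + \<epsilon>" by simp
        moreover have "0 \<le> (\<Sum>f\<in>F. L2_inner M (S' f) f)"
          using onF by (intro sum_nonneg nonneg) (auto dest: orthonormal_L2)
        ultimately have "ennreal s \<le> ennreal (\<Sum>f\<in>F. L2_inner M (S' f) f) + ennreal \<epsilon>"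
          using \<open>0 < \<epsilon>\<close> by (simp add: ennreal_leI flip: ennreal_plus)
        also have "\<dots> \<le> L2_trace M S' + ennreal \<epsilon>"
          unfolding tr using F by (intro add_right_mono SUP_upper) auto
        finally show "(\<Sum>k<n. ennreal \<bar>\<mu> k\<bar>) \<le> L2_trace M S' + ennreal \<epsilon>" by (simp add: s_def)
      qed
    qed
  qed
qed

text \<open>The form of T is dominated by the form of its absolute value S, which bounds every sum; families
  of eigenvectors attain the partial sums of the eigenvalues.\<close>

lemma form_SUP_eq:
  "(SUP F\<in>{F. finite F \<and> orthonormal M F}. ennreal (\<Sum>f\<in>F. \<bar>L2_inner M (T f) f\<bar>)) = eigenvalue_sum"
proof (rule antisym)
  have T: "represents T" by (simp add: represents_def)
  show "(SUP F\<in>{F. finite F \<and> orthonormal M F}. ennreal (\<Sum>f\<in>F. \<bar>L2_inner M (T f) f\<bar>)) \<le> eigenvalue_sum"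
  proof (intro SUP_least)
    fix F assume "F \<in> {F. finite F \<and> orthonormal M F}"
    then have F: "finite F" "orthonormal M F" by auto
    have "\<bar>L2_inner M (T f) f\<bar> \<le> L2_inner M (S f) f" if "f \<in> F" for f
    proof -
      have f: "f \<in> L2 M" using that F by (auto dest: orthonormal_L2)
      note t = T_inner_sums[OF f f] and s = S_inner_sums[OF f f]
      have le: "\<mu> k * L2_inner M (e k) f * L2_inner M (e k) f \<le> \<bar>\<mu> k\<bar> * L2_inner M (e k) f * L2_inner M (e k) f"
        "- (\<mu> k * L2_inner M (e k) f * L2_inner M (e k) f) \<le> \<bar>\<mu> k\<bar> * L2_inner M (e k) f * L2_inner M (e k) f" for k
      proof -
        have "\<mu> k * (L2_inner M (e k) f)\<^sup>2 \<le> \<bar>\<mu> k\<bar> * (L2_inner M (e k) f)\<^sup>2" by (intro mult_right_mono) auto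
        then show "\<mu> k * L2_inner M (e k) f * L2_inner M (e k) f \<le> \<bar>\<mu> k\<bar> * L2_inner M (e k) f * L2_inner M (e k) f"
          by (simp add: power2_eq_square mult.assoc)
        have "(- \<mu> k) * (L2_inner M (e k) f)\<^sup>2 \<le> \<bar>\<mu> k\<bar> * (L2_inner M (e k) f)\<^sup>2" by (intro mult_right_mono) auto
        then show "- (\<mu> k * L2_inner M (e k) f * L2_inner M (e k) f) \<le> \<bar>\<mu> k\<bar> * L2_inner M (e k) f * L2_inner M (e k) f"
          by (simp add: power2_eq_square mult.assoc)
      qed
      have "L2_inner M (T f) f \<le> L2_inner M (S f) f" by (rule sums_le[OF le(1) t s])
      moreover have "- L2_inner M (T f) f \<le> L2_inner M (S f) f" by (rule sums_le[OF le(2) sums_minus[OF t] s])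
      ultimately show ?thesis by linarith
    qed
    then have "ennreal (\<Sum>f\<in>F. \<bar>L2_inner M (T f) f\<bar>) \<le> ennreal (\<Sum>f\<in>F. L2_inner M (S f) f)"
      by (intro ennreal_leI sum_mono)
    also have "\<dots> \<le> eigenvalue_sum" by (rule abs_form_le_eigenvalue_sum[OF T S_is_abs[OF T] F(2,1)])
    finally show "ennreal (\<Sum>f\<in>F. \<bar>L2_inner M (T f) f\<bar>) \<le> eigenvalue_sum" .
  qed
  show "eigenvalue_sum \<le> (SUP F\<in>{F. finite F \<and> orthonormal M F}. ennreal (\<Sum>f\<in>F. \<bar>L2_inner M (T f) f\<bar>))"
    unfolding eigenvalue_sum_def
  proof (rule suminf_le_const[OF summableI])
    fix n
    let ?J = "{k. k < n \<and> \<mu> k \<noteq> 0}"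
    have J: "?J \<subseteq> {k. \<mu> k \<noteq> 0}" by auto
    have "(\<Sum>k<n. \<bar>\<mu> k\<bar>) = (\<Sum>k\<in>?J. \<bar>\<mu> k\<bar>)" by (intro sum.mono_neutral_right) auto
    also have "\<dots> = (\<Sum>k\<in>?J. \<bar>L2_inner M (T (e k)) (e k)\<bar>)"
    proof (rule sum.cong[OF refl])
      fix k assume "k \<in> ?J"
      moreover have "L2_inner M (T (e k)) (e k) = L2_inner M (\<lambda>x. \<mu> k * e k x) (e k)"
        by (rule L2_inner_cong) (simp_all add: eigen)
      ultimately show "\<bar>\<mu> k\<bar> = \<bar>L2_inner M (T (e k)) (e k)\<bar>" by (simp add: L2_inner_scale orth)
    qed
    also have "\<dots> = (\<Sum>f\<in>e ` ?J. \<bar>L2_inner M (T f) f\<bar>)" by (simp add: sum.reindex[OF eigen_orthonormal(1)[OF J]])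
    finally have "(\<Sum>k<n. ennreal \<bar>\<mu> k\<bar>) = ennreal (\<Sum>f\<in>e ` ?J. \<bar>L2_inner M (T f) f\<bar>)" by simp
    also have "\<dots> \<le> (SUP F\<in>{F. finite F \<and> orthonormal M F}. ennreal (\<Sum>f\<in>F. \<bar>L2_inner M (T f) f\<bar>))"
      using eigen_orthonormal(2)[OF J] by (intro SUP_upper) auto
    finally show "(\<Sum>k<n. ennreal \<bar>\<mu> k\<bar>) \<le> (SUP F\<in>{F. finite F \<and> orthonormal M F}. ennreal (\<Sum>f\<in>F. \<bar>L2_inner M (T f) f\<bar>))" .
  qed
qed

end

context compact_measure
begin

text \<open>The right-hand side mentions neither eigenvectors nor the absolute value, and reduces estimates in
  trace norm to estimates of quadratic forms.\<close>

lemma trace_norm_kernel: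
  assumes K: "sym_kernel K"
    and T': "\<And>f x. f \<in> L2 M \<Longrightarrow> x \<in> space M \<Longrightarrow> T' f x = integral_operator M K f x"
  shows "trace_norm M T' = (SUP F\<in>{F. finite F \<and> orthonormal M F}.
    ennreal (\<Sum>f\<in>F. \<bar>L2_inner M (integral_operator M K f) f\<bar>))"
proof -
  obtain e \<mu> where d: "\<And>k. continuous_on (space M) (e k)"
    "\<And>k x. x \<in> space M \<Longrightarrow> integral_operator M K (e k) x = \<mu> k * e k x"
    "\<And>i j. L2_inner M (e i) (e j) = (if i = j \<and> \<mu> i \<noteq> 0 then 1 else 0)"
    "\<And>k. \<mu> k = 0 \<Longrightarrow> e k = (\<lambda>x. 0)"
    "\<mu> \<longlonglongrightarrow> 0"
    "\<And>f n. f \<in> L2 M \<Longrightarrow> L2_norm M (\<lambda>x. integral_operator M K f x - (\<Sum>k<n. (\<mu> k * L2_inner M (e k) f) * e k x))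
      \<le> \<bar>\<mu> n\<bar> * L2_norm M f"
    by (rule spectral_decomposition[OF K]) rule
  interpret spectral_kernel M K \<mu> e
    by unfold_locales (fact K d)+
  have rep: "represents T'" using T' by (simp add: represents_def)
  have "is_L2_abs M T' (L2_abs M T')"
    unfolding L2_abs_def by (rule someI[of "is_L2_abs M T'", OF S_is_abs[OF rep]])
  from trace_abs_eq[OF rep this] show ?thesis by (simp add: trace_norm_def form_SUP_eq)
qed

section \<open>Trace-norm convergence of non-negative kernel operators\<close>

definition form :: "('a \<Rightarrow> 'a \<Rightarrow> real) \<Rightarrow> ('a \<Rightarrow> real) \<Rightarrow> ('a \<Rightarrow> real) \<Rightarrow> real" where
  "form K f g = L2_inner M (integral_operator M K f) g"

text \<open>The trace of the operator when the kernel is non-negative, by Mercer's theorem.\<close>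

definition diagonal_trace :: "('a \<Rightarrow> 'a \<Rightarrow> real) \<Rightarrow> real" where
  "diagonal_trace K = (\<integral>x. K x x \<partial>M)"

text \<open>The last clause is one half of the trace formula: the trace on the span of F0 and the trace of the
  compression to its complement add up to at most the integral over the diagonal.  It is phrased
  with finite families because in this form it passes to limits of kernels.\<close>

definition trace_psd :: "('a \<Rightarrow> 'a \<Rightarrow> real) \<Rightarrow> bool" where
  "trace_psd K \<longleftrightarrow> sym_kernel K \<and> (\<forall>f\<in>L2 M. 0 \<le> form K f f) \<and>
    (\<forall>F F0. finite F \<longrightarrow> orthonormal M F \<longrightarrow> finite F0 \<longrightarrow> orthonormal M F0 \<longrightarrow>
      (\<Sum>f\<in>F. form K (residual M F0 f) (residual M F0 f)) + (\<Sum>e\<in>F0. form K e e) \<le> diagonal_trace K)"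

lemma trace_psdD:
  assumes "trace_psd K" "finite F" "orthonormal M F" "finite F0" "orthonormal M F0"
  shows "(\<Sum>f\<in>F. form K (residual M F0 f) (residual M F0 f)) + (\<Sum>e\<in>F0. form K e e) \<le> diagonal_trace K"
  using assms unfolding trace_psd_def by blast

lemma trace_psd_form_sum:
  assumes "trace_psd K" "finite F" "orthonormal M F"
  shows "(\<Sum>f\<in>F. form K f f) \<le> diagonal_trace K"
proof -
  have "residual M {} f = f" for f by (simp add: residual_def fun_eq_iff)
  then show ?thesis using trace_psdD[OF assms finite.emptyI orthonormal_empty] by simp
qed

lemma form_commute: "sym_kernel K \<Longrightarrow> f \<in> L2 M \<Longrightarrow> g \<in> L2 M \<Longrightarrow> form K f g = form K g f"
  unfolding form_def by (metis L2_inner_commute integral_operator_symmetric)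

lemma form_lincomb:
  assumes "sym_kernel K" "f \<in> L2 M" "g \<in> L2 M" "h \<in> L2 M"
  shows "form K (\<lambda>y. a * f y + b * g y) h = a * form K f h + b * form K g h"
  unfolding form_def by (rule integral_operator_inner_lincomb[OF assms])

lemma form_square:
  assumes K: "sym_kernel K" and f: "f \<in> L2 M" and g: "g \<in> L2 M"
  shows "form K (\<lambda>y. a * f y + b * g y) (\<lambda>y. a * f y + b * g y)
       = a\<^sup>2 * form K f f + 2 * a * b * form K f g + b\<^sup>2 * form K g g"
proof -
  let ?h = "\<lambda>y. a * f y + b * g y"
  have h: "?h \<in> L2 M" by (intro L2_lincomb f g)
  have "form K ?h ?h = a * form K f ?h + b * form K g ?h" by (rule form_lincomb[OF K f g h])
  also have "form K f ?h = a * form K f f + b * form K f g"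
    using form_lincomb[OF K f g f, of a b] form_commute[OF K f h] form_commute[OF K g f] by simp
  also have "form K g ?h = a * form K f g + b * form K g g"
    using form_lincomb[OF K f g g, of a b] form_commute[OF K g h] by simp
  finally show ?thesis by (simp add: power2_eq_square algebra_simps)
qed

lemma diagonal_continuous:
  assumes "sym_kernel K"
  shows "continuous_on (space M) (\<lambda>x. K x x)"
proof -
  have c: "continuous_on (space M \<times> space M) (\<lambda>(x, y). K x y)"
    using assms by (simp add: sym_kernel_def)
  have "continuous_on (space M) (\<lambda>x. (x, x))" by (intro continuous_intros)
  from continuous_on_compose2[OF c this]
  have "continuous_on (space M) (\<lambda>x. (\<lambda>(x, y). K x y) (x, x))" by blast
  then show ?thesis by simp
qed

lemma L2_integrable: "f \<in> L2 M \<Longrightarrow> integrable M f"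
  using L2_integrable_mult[OF _ L2_const[of 1]] by simp

lemmas diagonal_integrable = L2_integrable[OF continuous_L2[OF diagonal_continuous]]

lemma sym_kernel_diff:
  assumes "sym_kernel K" "sym_kernel K'"
  shows "sym_kernel (\<lambda>x y. K x y - K' x y)"
proof -
  have "continuous_on (space M \<times> space M) (\<lambda>p. (\<lambda>(x, y). K x y) p - (\<lambda>(x, y). K' x y) p)"
    using assms by (intro continuous_on_diff) (auto simp: sym_kernel_def)
  then show ?thesis using assms by (simp add: sym_kernel_def case_prod_unfold)
qed

lemma integral_operator_diff:
  assumes "sym_kernel K" "sym_kernel K'" "f \<in> L2 M" "x \<in> space M"
  shows "integral_operator M (\<lambda>x y. K x y - K' x y) f x = integral_operator M K f x - integral_operator M K' f x"
  unfolding integral_operator_inner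
  by (intro L2_inner_diff sym_kernel_L2[OF assms(1)] sym_kernel_L2[OF assms(2)] assms(3,4))

lemma form_diff:
  assumes "sym_kernel K" "sym_kernel K'" "f \<in> L2 M" "g \<in> L2 M"
  shows "form (\<lambda>x y. K x y - K' x y) f g = form K f g - form K' f g"
proof -
  have "form (\<lambda>x y. K x y - K' x y) f g
      = L2_inner M (\<lambda>x. integral_operator M K f x - integral_operator M K' f x) g"
    unfolding form_def using assms by (intro L2_inner_cong integral_operator_diff) auto
  then show ?thesis unfolding form_def using assms by (simp add: L2_inner_diff integral_operator_L2)
qed

text \<open>The squared Hilbert-Schmidt distance of the operators.\<close>

definition square_dist :: "('a \<Rightarrow> 'a \<Rightarrow> real) \<Rightarrow> ('a \<Rightarrow> 'a \<Rightarrow> real) \<Rightarrow> real" where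
  "square_dist K K' = (\<integral>p. (K (fst p) (snd p) - K' (fst p) (snd p))\<^sup>2 \<partial>(M \<Otimes>\<^sub>M M))"

definition diagonal_dist :: "('a \<Rightarrow> 'a \<Rightarrow> real) \<Rightarrow> ('a \<Rightarrow> 'a \<Rightarrow> real) \<Rightarrow> real" where
  "diagonal_dist K K' = (\<integral>x. (K x x - K' x x)\<^sup>2 \<partial>M)"

lemma sym_kernel_product_L2:
  assumes "sym_kernel K"
  shows "(\<lambda>p. K (fst p) (snd p)) \<in> L2 (M \<Otimes>\<^sub>M M)"
proof -
  interpret P: finite_measure "M \<Otimes>\<^sub>M M"
    by (intro finite_measure_pair_measure finite_measure_axioms)
  obtain B where B: "0 \<le> B" "\<And>x y. x \<in> space M \<Longrightarrow> y \<in> space M \<Longrightarrow> \<bar>K x y\<bar> \<le> B"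
    using sym_kernel_bound[OF assms] by blast
  have m: "(\<lambda>p. K (fst p) (snd p)) \<in> borel_measurable (M \<Otimes>\<^sub>M M)"
    using sym_kernel_measurable[of K] assms by (simp add: sym_kernel_def case_prod_unfold)
  have "AE p in M \<Otimes>\<^sub>M M. norm ((K (fst p) (snd p))\<^sup>2) \<le> B\<^sup>2"
  proof (rule AE_I2)
    fix p assume "p \<in> space (M \<Otimes>\<^sub>M M)"
    then have "\<bar>K (fst p) (snd p)\<bar> \<le> B" using B(2) by (auto simp: space_pair_measure)
    then have "\<bar>K (fst p) (snd p)\<bar>\<^sup>2 \<le> B\<^sup>2" by (intro power_mono) auto
    then show "norm ((K (fst p) (snd p))\<^sup>2) \<le> B\<^sup>2" by simp
  qed
  then have "integrable (M \<Otimes>\<^sub>M M) (\<lambda>p. (K (fst p) (snd p))\<^sup>2)"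
    using m by (intro P.integrable_const_bound) auto
  then show ?thesis using m by (simp add: L2_def)
qed

lemma tensor_L2:
  assumes f: "f \<in> L2 M" and g: "g \<in> L2 M"
  shows "(\<lambda>p. f (snd p) * g (fst p)) \<in> L2 (M \<Otimes>\<^sub>M M)"
    and "L2_norm (M \<Otimes>\<^sub>M M) (\<lambda>p. f (snd p) * g (fst p)) = L2_norm M f * L2_norm M g"
proof -
  interpret P: pair_sigma_finite M M by standard
  have [measurable]: "f \<in> borel_measurable M" "g \<in> borel_measurable M" using f g L2_measurable by auto
  note fi = L2_integrable_square[OF f] and gi = L2_integrable_square[OF g]
  have int: "integrable (M \<Otimes>\<^sub>M M) (\<lambda>(x, y). (g x)\<^sup>2 * (f y)\<^sup>2)"
    by (rule P.Fubini_integrable) (use fi gi in \<open>auto simp: abs_mult\<close>)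
  have eq: "(f (snd p) * g (fst p))\<^sup>2 = (\<lambda>(x, y). (g x)\<^sup>2 * (f y)\<^sup>2) p" for p
    by (simp add: power_mult_distrib case_prod_unfold mult.commute)
  then have eqf: "(\<lambda>p. (f (snd p) * g (fst p))\<^sup>2) = (\<lambda>(x, y). (g x)\<^sup>2 * (f y)\<^sup>2)" by (rule ext)
  show "(\<lambda>p. f (snd p) * g (fst p)) \<in> L2 (M \<Otimes>\<^sub>M M)"
    using int unfolding L2_def mem_Collect_eq eqf by simp
  have "L2_inner (M \<Otimes>\<^sub>M M) (\<lambda>p. f (snd p) * g (fst p)) (\<lambda>p. f (snd p) * g (fst p))
      = (\<integral>p. (\<lambda>(x, y). (g x)\<^sup>2 * (f y)\<^sup>2) p \<partial>(M \<Otimes>\<^sub>M M))"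
    unfolding L2_inner_def power2_eq_square[symmetric] eq ..
  also have "\<dots> = (\<integral>x. (\<integral>y. (g x)\<^sup>2 * (f y)\<^sup>2 \<partial>M) \<partial>M)" using P.integral_fst'[OF int] by simp
  also have "\<dots> = L2_inner M g g * L2_inner M f f" by (simp add: L2_inner_def power2_eq_square)
  finally show "L2_norm (M \<Otimes>\<^sub>M M) (\<lambda>p. f (snd p) * g (fst p)) = L2_norm M f * L2_norm M g"
    by (simp add: L2_norm_def real_sqrt_mult mult.commute)
qed

lemma form_bound:
  assumes K: "sym_kernel K" and f: "f \<in> L2 M" and g: "g \<in> L2 M"
  shows "\<bar>form K f g\<bar> \<le> L2_norm (M \<Otimes>\<^sub>M M) (\<lambda>p. K (fst p) (snd p)) * (L2_norm M f * L2_norm M g)"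
proof -
  have "form K f g = L2_inner (M \<Otimes>\<^sub>M M) (\<lambda>p. K (fst p) (snd p)) (\<lambda>p. f (snd p) * g (fst p))"
  proof -
    have "form K f g = (\<integral>p. (\<lambda>(x, y). K x y * f y * g x) p \<partial>(M \<Otimes>\<^sub>M M))"
      unfolding form_def by (rule integral_operator_form[OF assms])
    then show ?thesis by (simp add: L2_inner_def case_prod_unfold mult.assoc)
  qed
  then show ?thesis
    using L2_Cauchy_Schwarz[OF sym_kernel_product_L2[OF K] tensor_L2(1)[OF f g]] tensor_L2(2)[OF f g] by simp
qed

lemma form_close:
  assumes "sym_kernel K" "sym_kernel K'" "f \<in> L2 M" "g \<in> L2 M"
  shows "\<bar>form K f g - form K' f g\<bar> \<le> sqrt (square_dist K K') * (L2_norm M f * L2_norm M g)"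
  using form_bound[OF sym_kernel_diff[OF assms(1,2)] assms(3,4)] form_diff[OF assms]
  by (simp add: L2_norm_def L2_inner_def square_dist_def power2_eq_square)

lemma diagonal_close:
  assumes "sym_kernel K" "sym_kernel K'"
  shows "\<bar>diagonal_trace K - diagonal_trace K'\<bar> \<le> sqrt (diagonal_dist K K') * mass"
proof -
  have L: "(\<lambda>x. K x x - K' x x) \<in> L2 M"
    using assms by (intro L2_diff continuous_L2 diagonal_continuous)
  have "diagonal_trace K - diagonal_trace K' = (\<integral>x. K x x - K' x x \<partial>M)"
    unfolding diagonal_trace_def using assms
    by (intro Bochner_Integration.integral_diff[symmetric] diagonal_integrable)
  then have "\<bar>diagonal_trace K - diagonal_trace K'\<bar> \<le> (\<integral>x. \<bar>K x x - K' x x\<bar> \<partial>M)"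
    using integral_abs_bound[of M "\<lambda>x. K x x - K' x x"] by simp
  also have "\<dots> \<le> L2_norm M (\<lambda>x. K x x - K' x x) * mass" by (rule L2_integral_abs_le(2)[OF L])
  finally show ?thesis by (simp add: L2_norm_def L2_inner_def diagonal_dist_def power2_eq_square)
qed

text \<open>For one summand g(x) g(y) the trace inequality is Bessel's inequality for the residual of g,
  because the projection is symmetric.\<close>

lemma gram_kernel_trace_psd:
  assumes g: "\<And>i. i \<in> I \<Longrightarrow> continuous_on (space M) (g i)" and c: "0 \<le> c"
    and Kdef: "\<And>x y. x \<in> space M \<Longrightarrow> y \<in> space M \<Longrightarrow> K x y = c * (\<Sum>i\<in>I. g i x * g i y)"
  shows "trace_psd K"
proof -
  have gL: "g i \<in> L2 M" if "i \<in> I" for i using g[OF that] by (rule continuous_L2)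
  have K: "sym_kernel K"
    unfolding sym_kernel_def
  proof (intro conjI ballI)
    have "continuous_on (space M \<times> space M) (\<lambda>p. g i (fst p))" "continuous_on (space M \<times> space M) (\<lambda>p. g i (snd p))" if "i \<in> I" for i
      by (rule continuous_on_compose2[OF g[OF that]], auto intro!: continuous_intros)+
    then have "continuous_on (space M \<times> space M) (\<lambda>p. c * (\<Sum>i\<in>I. g i (fst p) * g i (snd p)))"
      by (intro continuous_intros)
    then show "continuous_on (space M \<times> space M) (\<lambda>(x, y). K x y)"
      by (rule continuous_on_eq) (auto simp: Kdef)
  qed (simp add: Kdef mult.commute)
  have fm: "form K f h = c * (\<Sum>i\<in>I. L2_inner M (g i) f * L2_inner M (g i) h)" if f: "f \<in> L2 M" and h: "h \<in> L2 M" for f h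
  proof -
    have "integral_operator M K f x = c * (\<Sum>i\<in>I. L2_inner M (g i) f * g i x)" if x: "x \<in> space M" for x
    proof -
      have "integral_operator M K f x = L2_inner M (\<lambda>y. c * (\<Sum>i\<in>I. g i x * g i y)) f"
        unfolding integral_operator_inner using x by (intro L2_inner_cong) (auto simp: Kdef)
      also have "\<dots> = c * (\<Sum>i\<in>I. g i x * L2_inner M (g i) f)"
        unfolding L2_inner_scale by (simp add: L2_inner_sum[OF gL f])
      finally show ?thesis by (simp add: mult.commute)
    qed
    then have "form K f h = L2_inner M (\<lambda>x. c * (\<Sum>i\<in>I. L2_inner M (g i) f * g i x)) h"
      unfolding form_def by (intro L2_inner_cong) auto
    then show ?thesis unfolding L2_inner_scale by (simp add: L2_inner_sum[OF gL h])
  qed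
  have nonneg: "0 \<le> form K f f" if "f \<in> L2 M" for f
    unfolding fm[OF that that] by (intro mult_nonneg_nonneg[OF c] sum_nonneg zero_le_square)
  have tr: "diagonal_trace K = c * (\<Sum>i\<in>I. L2_inner M (g i) (g i))"
  proof -
    have "diagonal_trace K = (\<integral>x. c * (\<Sum>i\<in>I. g i x * g i x) \<partial>M)"
      unfolding diagonal_trace_def by (intro Bochner_Integration.integral_cong) (auto simp: Kdef)
    also have "\<dots> = c * (\<Sum>i\<in>I. \<integral>x. g i x * g i x \<partial>M)"
      using L2_integrable_mult[OF gL gL] by (simp add: Bochner_Integration.integral_sum)
    finally show ?thesis by (simp add: L2_inner_def)
  qed
  have bound: "(\<Sum>f\<in>F. form K (residual M F0 f) (residual M F0 f)) + (\<Sum>e\<in>F0. form K e e) \<le> diagonal_trace K"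
    if F: "finite F" "orthonormal M F" and F0: "finite F0" "orthonormal M F0" for F F0
  proof -
    have FL: "f \<in> L2 M" if "f \<in> F" for f using F that by (auto dest: orthonormal_L2)
    have F0L: "f \<in> L2 M" if "f \<in> F0" for f using F0 that by (auto dest: orthonormal_L2)
    have "(\<Sum>f\<in>F. form K (residual M F0 f) (residual M F0 f)) + (\<Sum>e\<in>F0. form K e e)
        = (\<Sum>f\<in>F. c * (\<Sum>i\<in>I. (L2_inner M (g i) (residual M F0 f))\<^sup>2)) + (\<Sum>e\<in>F0. c * (\<Sum>i\<in>I. (L2_inner M (g i) e)\<^sup>2))"
      by (intro arg_cong2[where f="(+)"] sum.cong refl) (simp_all add: fm FL F0L residual_L2[OF F0(2)] power2_eq_square)
    also have "\<dots> = c * (\<Sum>i\<in>I. (\<Sum>f\<in>F. (L2_inner M (g i) (residual M F0 f))\<^sup>2) + (\<Sum>e\<in>F0. (L2_inner M (g i) e)\<^sup>2))"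
      unfolding sum.distrib sum_distrib_left[symmetric] sum.swap[of _ I F] sum.swap[of _ I F0] by (simp add: distrib_left)
    also have "\<dots> \<le> c * (\<Sum>i\<in>I. L2_inner M (g i) (g i))"
    proof (intro mult_left_mono sum_mono c)
      fix i assume i: "i \<in> I"
      have "(\<Sum>f\<in>F. (L2_inner M (g i) (residual M F0 f))\<^sup>2) = (\<Sum>f\<in>F. (L2_inner M (residual M F0 (g i)) f)\<^sup>2)"
        using residual_symmetric[OF F0 gL[OF i] FL] by (intro sum.cong) auto
      also have "\<dots> \<le> L2_inner M (residual M F0 (g i)) (residual M F0 (g i))"
        by (intro Bessel F residual_L2 F0 gL i)
      also have "\<dots> = L2_inner M (g i) (g i) - (\<Sum>e\<in>F0. (L2_inner M (g i) e)\<^sup>2)"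
        by (rule residual_norm[OF F0 gL[OF i]])
      finally show "(\<Sum>f\<in>F. (L2_inner M (g i) (residual M F0 f))\<^sup>2) + (\<Sum>e\<in>F0. (L2_inner M (g i) e)\<^sup>2)
          \<le> L2_inner M (g i) (g i)" by simp
    qed
    finally show ?thesis by (simp add: tr)
  qed
  show ?thesis unfolding trace_psd_def using K nonneg bound by blast
qed

text \<open>The forms and the diagonal trace are continuous in the two distances, and every instance of the
  trace inequality involves finitely many forms.\<close>

lemma trace_psd_closed:
  assumes K: "sym_kernel K"
    and approx: "\<And>\<epsilon>. 0 < \<epsilon> \<Longrightarrow> \<exists>K'. trace_psd K' \<and> square_dist K' K < \<epsilon> \<and> diagonal_dist K' K < \<epsilon>"
  shows "trace_psd K"
proof -
  have "\<exists>K'. trace_psd K' \<and> square_dist K' K < 1 / Suc n \<and> diagonal_dist K' K < 1 / Suc n" for n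
    by (rule approx) simp
  then obtain k where k: "\<And>n. trace_psd (k n)" "\<And>n. square_dist (k n) K < 1 / Suc n" "\<And>n. diagonal_dist (k n) K < 1 / Suc n"
    by metis
  have ks: "sym_kernel (k n)" for n using k(1) by (simp add: trace_psd_def)
  have lim0: "(\<lambda>n. sqrt (1 / Suc n)) \<longlonglongrightarrow> 0"
    using tendsto_real_sqrt[OF LIMSEQ_Suc[OF lim_1_over_n]] by simp
  have fl: "(\<lambda>n. form (k n) f g) \<longlonglongrightarrow> form K f g" if f: "f \<in> L2 M" and g: "g \<in> L2 M" for f g
  proof -
    have b: "\<bar>form (k n) f g - form K f g\<bar> \<le> sqrt (1 / Suc n) * (L2_norm M f * L2_norm M g)" for n
    proof -
      have "sqrt (square_dist (k n) K) * (L2_norm M f * L2_norm M g) \<le> sqrt (1 / Suc n) * (L2_norm M f * L2_norm M g)"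
        by (intro mult_right_mono real_sqrt_le_mono[OF less_imp_le[OF k(2)]]) simp
      then show ?thesis using form_close[OF ks K f g, of n] by linarith
    qed
    have "(\<lambda>n. sqrt (1 / Suc n) * (L2_norm M f * L2_norm M g)) \<longlonglongrightarrow> 0"
      using tendsto_mult_right[OF lim0, of "L2_norm M f * L2_norm M g"] by simp
    from real_tendsto_sandwich[OF always_eventually[OF allI[OF abs_ge_zero]] always_eventually[OF allI[OF b]] tendsto_const this]
    show ?thesis by (rule LIM_zero_cancel[OF tendsto_rabs_zero_cancel])
  qed
  have tl: "(\<lambda>n. diagonal_trace (k n)) \<longlonglongrightarrow> diagonal_trace K"
  proof -
    have b: "\<bar>diagonal_trace (k n) - diagonal_trace K\<bar> \<le> sqrt (1 / Suc n) * mass" for n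
    proof -
      have "sqrt (diagonal_dist (k n) K) * mass \<le> sqrt (1 / Suc n) * mass"
        by (intro mult_right_mono real_sqrt_le_mono[OF less_imp_le[OF k(3)]]) simp
      then show ?thesis using diagonal_close[OF ks K, of n] by linarith
    qed
    have "(\<lambda>n. sqrt (1 / Suc n) * mass) \<longlonglongrightarrow> 0"
      using tendsto_mult_right[OF lim0, of mass] by simp
    from real_tendsto_sandwich[OF always_eventually[OF allI[OF abs_ge_zero]] always_eventually[OF allI[OF b]] tendsto_const this]
    show ?thesis by (rule LIM_zero_cancel[OF tendsto_rabs_zero_cancel])
  qed
  show ?thesis
    unfolding trace_psd_def
  proof (intro conjI ballI allI impI K)
    show "0 \<le> form K f f" if f: "f \<in> L2 M" for f
      using fl[OF f f] k(1) f by (intro LIMSEQ_le_const[of _ "form K f f"]) (auto simp: trace_psd_def)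
    fix F F0 assume F: "finite F" "orthonormal M F" and F0: "finite F0" "orthonormal M F0"
    have "(\<lambda>n. (\<Sum>f\<in>F. form (k n) (residual M F0 f) (residual M F0 f)) + (\<Sum>e\<in>F0. form (k n) e e)) \<longlonglongrightarrow>
        (\<Sum>f\<in>F. form K (residual M F0 f) (residual M F0 f)) + (\<Sum>e\<in>F0. form K e e)"
      using F F0 by (intro tendsto_add tendsto_sum fl residual_L2) (auto dest: orthonormal_L2)
    from LIMSEQ_le[OF this tl] trace_psdD[OF k(1) F F0]
    show "(\<Sum>f\<in>F. form K (residual M F0 f) (residual M F0 f)) + (\<Sum>e\<in>F0. form K e e) \<le> diagonal_trace K"
      by blast
  qed
qed

text \<open>The other half of the trace formula.  Cut the space into cells of small diameter; on the square of
  a cell the kernel is close to its values on the diagonal, so the form at the normalised indicator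
  of the cell is close to the integral of the diagonal over the cell.\<close>

lemma diagonal_trace_approx:
  assumes K: "sym_kernel K" and "0 < \<delta>"
  obtains F0 where "finite F0" "orthonormal M F0" "diagonal_trace K - \<delta> \<le> (\<Sum>e\<in>F0. form K e e)"
proof -
  define \<eta> where "\<eta> = \<delta> / (measure M (space M) + 1)"
  have m1: "0 < measure M (space M) + 1" by (simp add: add_nonneg_pos)
  have "0 < \<eta>" using \<open>0 < \<delta>\<close> m1 by (simp add: \<eta>_def)
  have "\<eta> * measure M (space M) \<le> \<eta> * (measure M (space M) + 1)" using \<open>0 < \<eta>\<close> by simp
  also have "\<dots> = \<delta>" using m1 by (simp add: \<eta>_def)
  finally have \<eta>m: "\<eta> * measure M (space M) \<le> \<delta>" .
  have "uniformly_continuous_on (space M \<times> space M) (\<lambda>(x, y). K x y)"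
    using K compact_Times[OF compact_space compact_space] unfolding sym_kernel_def
    by (intro compact_uniformly_continuous) auto
  then obtain d where d: "0 < d" "\<And>p p'. p \<in> space M \<times> space M \<Longrightarrow> p' \<in> space M \<times> space M \<Longrightarrow> dist p' p < d \<Longrightarrow>
      dist ((\<lambda>(x, y). K x y) p') ((\<lambda>(x, y). K x y) p) < \<eta>"
    using \<open>0 < \<eta>\<close> unfolding uniformly_continuous_on_def by metis
  have close: "K x x - \<eta> \<le> K x y" if "x \<in> space M" "y \<in> space M" "dist y x < d" for x y
    using d(2)[of "(x, x)" "(x, y)"] that by (simp add: dist_Pair_Pair dist_real_def)
  obtain C where C: "finite C" "space M \<subseteq> (\<Union>x\<in>C. ball x (d / 2))"
  proof -
    have "\<exists>k. finite k \<and> space M \<subseteq> (\<Union>x\<in>k. ball x (d / 2))"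
      using compact_space d(1) unfolding compact_eq_totally_bounded by simp
    then show ?thesis using that by blast
  qed
  obtain c where c: "C = set c" using finite_list[OF C(1)] by blast
  define N where "N = length c"
  define B where "B i = (if i < N then ball (c ! i) (d / 2) \<inter> space M else {})" for i
  define cell where "cell = disjointed B"
  have Bm: "B i \<in> sets M" for i
  proof (cases "i < N")
    case True
    have "(\<lambda>x. x) -` ball (c ! i) (d / 2) \<inter> space M \<in> sets M"
      by (rule measurable_sets[OF id_measurable]) simp
    then show ?thesis using True by (simp add: B_def)
  qed (simp add: B_def)
  have cm [measurable]: "cell i \<in> sets M" for i
    unfolding cell_def using sets.range_disjointed_sets[of B] Bm by auto
  have cB: "cell i \<subseteq> B i" for i unfolding cell_def by (rule disjointed_subset)
  have csp: "cell i \<subseteq> space M" for i using cm sets.sets_into_space by blast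
  have disj: "cell i \<inter> cell j = {}" if "i \<noteq> j" for i j
    using disjoint_family_disjointed[of B] that by (auto simp: cell_def disjoint_family_on_def)
  have un: "(\<Union>i<N. cell i) = space M"
  proof -
    have "i < N" if "x \<in> cell i" for i x using cB[of i] that by (auto simp: B_def split: if_splits)
    then have "(\<Union>i<N. cell i) = (\<Union>i. cell i)" by blast
    also have "\<dots> = (\<Union>i. B i)" unfolding cell_def by (rule UN_disjointed_eq)
    also have "\<dots> = (\<Union>i<N. B i)" by (auto simp: B_def split: if_splits)
    also have "\<dots> = space M"
    proof
      show "space M \<subseteq> (\<Union>i<N. B i)"
      proof
        fix x assume x: "x \<in> space M"
        then obtain y where "y \<in> C" "x \<in> ball y (d / 2)" using C(2) by auto
        then obtain i where "i < N" "c ! i = y" by (auto simp: c N_def in_set_conv_nth)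
        then show "x \<in> (\<Union>i<N. B i)" using x \<open>x \<in> ball y (d / 2)\<close> by (auto simp: B_def)
      qed
    qed (auto simp: B_def)
    finally show ?thesis .
  qed
  have small: "dist y x < d" if "x \<in> cell i" "y \<in> cell i" for x y i
  proof -
    have "x \<in> B i" "y \<in> B i" using that cB by blast+
    then have "dist (c ! i) x < d / 2" "dist (c ! i) y < d / 2" by (auto simp: B_def split: if_splits)
    then show ?thesis using dist_triangle_half_r[of "c ! i" y d x] by (simp add: dist_commute)
  qed
  define v where "v i = measure M (cell i)" for i
  \<comment> \<open>Null cells cannot be normalised, and they contribute nothing to the integrals.\<close>
  define J where "J = {i. i < N \<and> 0 < v i}"
  define e where "e i = (\<lambda>x. indicator (cell i) x / sqrt (v i))" for i
  have eL: "e i \<in> L2 M" for i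
  proof (rule bounded_L2(1))
    show "e i \<in> borel_measurable M" unfolding e_def by measurable
    show "\<bar>e i x\<bar> \<le> 1 / sqrt (v i)" for x by (simp add: e_def v_def indicator_def)
  qed
  have ee: "L2_inner M (e i) (e j) = (if i = j then 1 else 0)" if "i \<in> J" "j \<in> J" for i j
  proof (cases "i = j")
    case True
    have "e i x * e i x = (1 / v i) * indicator (cell i) x" for x
      using that by (simp add: e_def indicator_def J_def)
    then show ?thesis using True that csp[of i] by (simp add: L2_inner_def v_def J_def Int_absorb2)
  next
    case False
    have "(\<lambda>x. e i x * e j x) = (\<lambda>x. 0)"
    proof
      fix x
      have "x \<notin> cell i \<or> x \<notin> cell j" using disj[OF False] by blast
      then show "e i x * e j x = 0" by (auto simp: e_def)
    qed
    then show ?thesis using False by (simp only: L2_inner_def) simp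
  qed
  have inj: "inj_on e J"
  proof (rule inj_onI)
    fix i j assume "i \<in> J" "j \<in> J" "e i = e j"
    then show "i = j" using ee[of i j] ee[of i i] by (auto split: if_splits)
  qed
  have ed: "e i = e j \<longleftrightarrow> i = j" if "i \<in> J" "j \<in> J" for i j using inj that by (rule inj_on_eq_iff)
  have on: "orthonormal M (e ` J)" using eL ee ed by (auto simp: orthonormal_def)
  have dint: "integrable M (\<lambda>x. (K x x - \<eta>) * indicator A x)" if "A \<in> sets M" for A
    using that diagonal_integrable[OF K] by (intro integrable_real_mult_indicator) auto
  have fe: "(\<integral>x. (K x x - \<eta>) * indicator (cell i) x \<partial>M) \<le> form K (e i) (e i)" if i: "i \<in> J" for i
  proof -
    have vi: "0 < v i" using i by (simp add: J_def)
    have "(K x x - \<eta>) * indicator (cell i) x \<le> integral_operator M K (e i) x * e i x" if x: "x \<in> space M" for x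
    proof (cases "x \<in> cell i")
      case True
      have "(K x x - \<eta>) * v i = (\<integral>y. (K x x - \<eta>) * indicator (cell i) y \<partial>M)"
        using csp[of i] by (simp add: v_def Int_absorb2)
      also have "\<dots> \<le> (\<integral>y. K x y * indicator (cell i) y \<partial>M)"
      proof (rule integral_mono)
        show "integrable M (\<lambda>y. (K x x - \<eta>) * indicator (cell i) y)"
          by (intro integrable_real_mult_indicator cm) simp
        have "indicator (cell i) \<in> L2 M" by (rule bounded_L2(1)[of _ 1]) (auto simp: indicator_def)
        then show "integrable M (\<lambda>y. K x y * indicator (cell i) y)"
          using L2_integrable_mult[OF sym_kernel_L2[OF K x]] by blast
        show "(K x x - \<eta>) * indicator (cell i) y \<le> K x y * indicator (cell i) y" if "y \<in> space M" for y
          using close[OF x that] small[OF True] by (auto simp: indicator_def)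
      qed
      also have "\<dots> = sqrt (v i) * integral_operator M K (e i) x"
        using vi by (simp add: integral_operator_def e_def)
      finally have "(K x x - \<eta>) * v i \<le> sqrt (v i) * integral_operator M K (e i) x" .
      then have "(K x x - \<eta>) * (sqrt (v i) * sqrt (v i)) \<le> sqrt (v i) * integral_operator M K (e i) x"
        using vi by simp
      then have "sqrt (v i) * ((K x x - \<eta>) * sqrt (v i)) \<le> sqrt (v i) * integral_operator M K (e i) x"
        by (simp only: mult_ac)
      then have "(K x x - \<eta>) * sqrt (v i) \<le> integral_operator M K (e i) x"
        using vi by (metis mult_le_cancel_left_pos real_sqrt_gt_zero)
      then show ?thesis using True vi by (simp add: e_def pos_le_divide_eq)
    qed (simp add: e_def)
    then show ?thesis unfolding form_def L2_inner_def
      using dint[OF cm] L2_integrable_mult[OF integral_operator_L2[OF K eL] eL] by (intro integral_mono) auto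
  qed
  have "diagonal_trace K - \<delta> \<le> diagonal_trace K - \<eta> * measure M (space M)" using \<eta>m by simp
  also have "\<dots> = (\<integral>x. K x x - \<eta> \<partial>M)"
    using diagonal_integrable[OF K] by (simp add: diagonal_trace_def mult.commute)
  also have "\<dots> = (\<integral>x. (\<Sum>i<N. (K x x - \<eta>) * indicator (cell i) x) \<partial>M)"
  proof (rule Bochner_Integration.integral_cong[OF refl])
    fix x assume "x \<in> space M"
    then have "x \<in> (\<Union>i<N. cell i)" by (simp add: un)
    then obtain i where i: "i < N" "x \<in> cell i" by auto
    have "(\<Sum>j<N. (K x x - \<eta>) * indicator (cell j) x) = (\<Sum>j<N. if j = i then K x x - \<eta> else 0)"
      using i disj by (intro sum.cong) (auto simp: indicator_def)
    then show "K x x - \<eta> = (\<Sum>j<N. (K x x - \<eta>) * indicator (cell j) x)" using i by simp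
  qed
  also have "\<dots> = (\<Sum>i<N. \<integral>x. (K x x - \<eta>) * indicator (cell i) x \<partial>M)"
    using dint[OF cm] by (rule Bochner_Integration.integral_sum)
  also have "\<dots> = (\<Sum>i\<in>J. \<integral>x. (K x x - \<eta>) * indicator (cell i) x \<partial>M)"
  proof (rule sum.mono_neutral_right)
    show "\<forall>i\<in>{..<N} - J. (\<integral>x. (K x x - \<eta>) * indicator (cell i) x \<partial>M) = 0"
    proof
      fix i assume "i \<in> {..<N} - J"
      then have "v i = 0" by (auto simp: J_def v_def not_less measure_le_0_iff)
      then have "cell i \<in> null_sets M" by (simp add: v_def null_sets_def emeasure_eq_measure)
      then have "AE x in M. x \<notin> cell i" by (rule AE_not_in)
      then have "AE x in M. (K x x - \<eta>) * indicator (cell i) x = 0" by eventually_elim simp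
      then show "(\<integral>x. (K x x - \<eta>) * indicator (cell i) x \<partial>M) = 0" by (rule integral_eq_zero_AE)
    qed
  qed (auto simp: J_def)
  also have "\<dots> \<le> (\<Sum>i\<in>J. form K (e i) (e i))" by (intro sum_mono fe)
  also have "\<dots> = (\<Sum>f\<in>e ` J. form K f f)" by (simp add: sum.reindex[OF inj])
  finally show ?thesis using that[of "e ` J"] on by (simp add: J_def)
qed

text \<open>Write f = p + q with p in the span of F0 and q its residual.  The form changes by the mixed term
  and by the form at q.  The mixed term is split by the Cauchy-Schwarz inequality for the form, with
  weight \<eta> on p, and the forms at the residuals add up to at most the trace missed by F0.\<close>

lemma form_truncation:
  assumes K: "trace_psd K" and F: "finite F" "orthonormal M F" and F0: "finite F0" "orthonormal M F0"
    and \<eta>: "0 < \<eta>" "\<eta> \<le> 1"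
  shows "(\<Sum>f\<in>F. \<bar>form K f f - form K (\<lambda>x. \<Sum>e\<in>F0. L2_inner M f e * e x) (\<lambda>x. \<Sum>e\<in>F0. L2_inner M f e * e x)\<bar>)
    \<le> 2 * \<eta> * diagonal_trace K + (3 + 1 / \<eta>) * (diagonal_trace K - (\<Sum>e\<in>F0. form K e e))"
proof -
  have Ks: "sym_kernel K" and nonneg: "\<And>f. f \<in> L2 M \<Longrightarrow> 0 \<le> form K f f" using K by (auto simp: trace_psd_def)
  let ?p = "\<lambda>f x. \<Sum>e\<in>F0. L2_inner M f e * e x"
  let ?q = "residual M F0"
  have pt: "\<bar>form K f f - form K (?p f) (?p f)\<bar> \<le> 2 * \<eta> * form K f f + (3 + 1 / \<eta>) * form K (?q f) (?q f)" if f: "f \<in> F" for f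
  proof -
    have fL: "f \<in> L2 M" using F f by (auto dest: orthonormal_L2)
    have pL: "?p f \<in> L2 M" by (rule L2_expansion[OF F0(2)])
    have qL: "?q f \<in> L2 M" by (rule residual_L2[OF F0(2) fL])
    define a b c where "a = form K (?p f) (?p f)" and "b = form K (?p f) (?q f)" and "c = form K (?q f) (?q f)"
    have c0: "0 \<le> c" unfolding c_def by (rule nonneg[OF qL])
    have f1: "form K f f = a + 2 * b + c"
      using form_square[OF Ks pL qL, of 1 1] by (simp add: residual_def a_def b_def c_def)
    have "a = form K f f - 2 * form K f (?q f) + c"
      using form_square[OF Ks fL qL, of 1 "- 1"] by (simp add: residual_def a_def c_def)
    moreover have "0 \<le> form K f f + 2 * form K f (?q f) + c"
      using form_square[OF Ks fL qL, of 1 1] nonneg[OF L2_lincomb[OF fL qL, of 1 1]] by (simp add: c_def)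
    ultimately have a2: "a \<le> 2 * form K f f + 2 * c" by linarith
    have sq: "0 \<le> \<eta>\<^sup>2 * a + 2 * \<eta> * t * b + t\<^sup>2 * c" for t
      using form_square[OF Ks pL qL, of \<eta> t] nonneg[OF L2_lincomb[OF pL qL, of \<eta> t]] by (simp add: a_def b_def c_def)
    define r where "r = c / \<eta>"
    have r: "\<eta> * r = c" using \<eta> by (simp add: r_def)
    have "0 \<le> \<eta> * (\<eta> * a + 2 * b + r)" "0 \<le> \<eta> * (\<eta> * a - 2 * b + r)"
      using sq[of 1] sq[of "- 1"] unfolding r[symmetric] by (simp_all add: power2_eq_square algebra_simps)
    then have "0 \<le> \<eta> * a + 2 * b + c / \<eta>" "0 \<le> \<eta> * a - 2 * b + c / \<eta>"
      using \<eta>(1) unfolding r_def by (simp_all only: zero_le_mult_iff) auto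
    then have "\<bar>2 * b\<bar> \<le> \<eta> * a + c / \<eta>" by linarith
    also have "\<eta> * a \<le> \<eta> * (2 * form K f f + 2 * c)" using a2 \<eta> by (intro mult_left_mono) auto
    also have "\<eta> * (2 * form K f f + 2 * c) \<le> 2 * \<eta> * form K f f + 2 * c"
      using mult_right_mono[OF \<eta>(2) c0] by (simp add: algebra_simps)
    finally have "\<bar>2 * b\<bar> \<le> 2 * \<eta> * form K f f + 2 * c + c / \<eta>" by simp
    moreover have "form K f f - a = 2 * b + c" using f1 by simp
    moreover have "(3 + 1 / \<eta>) * c = 3 * c + c / \<eta>" by (simp add: distrib_right)
    ultimately show ?thesis unfolding a_def[symmetric] c_def[symmetric] using c0 by linarith
  qed
  have tail: "(\<Sum>f\<in>F. form K (?q f) (?q f)) \<le> diagonal_trace K - (\<Sum>e\<in>F0. form K e e)"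
    using trace_psdD[OF K F F0] by linarith
  note tr = trace_psd_form_sum[OF K F]
  have "(\<Sum>f\<in>F. \<bar>form K f f - form K (?p f) (?p f)\<bar>) \<le> (\<Sum>f\<in>F. 2 * \<eta> * form K f f + (3 + 1 / \<eta>) * form K (?q f) (?q f))"
    by (intro sum_mono pt)
  also have "\<dots> = 2 * \<eta> * (\<Sum>f\<in>F. form K f f) + (3 + 1 / \<eta>) * (\<Sum>f\<in>F. form K (?q f) (?q f))"
    by (simp add: sum.distrib sum_distrib_left)
  also have "\<dots> \<le> 2 * \<eta> * diagonal_trace K + (3 + 1 / \<eta>) * (diagonal_trace K - (\<Sum>e\<in>F0. form K e e))"
    using \<eta> by (intro add_mono mult_left_mono tr tail) auto
  finally show ?thesis .
qed

text \<open>The theorem of Gruemm for kernel operators: for non-negative operators, convergence in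
  Hilbert-Schmidt norm and of the traces implies convergence in trace norm.  A finite family F0 that
  captures almost all of the trace of K0 captures almost all of the trace of a nearby K, so both
  forms may be truncated to the span of F0, where they are compared directly.  The estimate does not
  depend on F.\<close>

lemma trace_psd_continuity:
  assumes K0: "trace_psd K0" and "0 < \<epsilon>"
  obtains \<delta> where "0 < \<delta>" "\<And>K F. trace_psd K \<Longrightarrow> square_dist K K0 \<le> \<delta> \<Longrightarrow> diagonal_dist K K0 \<le> \<delta> \<Longrightarrow>
    finite F \<Longrightarrow> orthonormal M F \<Longrightarrow> (\<Sum>f\<in>F. \<bar>form K f f - form K0 f f\<bar>) \<le> \<epsilon>"
proof -
  have K0s: "sym_kernel K0" using K0 by (simp add: trace_psd_def)
  define \<tau> where "\<tau> = diagonal_trace K0"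
  have tr0: "0 \<le> diagonal_trace K" if "trace_psd K" for K
  proof -
    show ?thesis using trace_psd_form_sum[OF that, of "{}"] by simp
  qed
  have \<tau>0: "0 \<le> \<tau>" unfolding \<tau>_def by (rule tr0[OF K0])
  \<comment> \<open>Three small parameters: \<eta> absorbs the traces, \<delta>0 is the trace of
    K0 missed by F0, and s is chosen last, in terms of the size of F0.\<close>
  define \<eta> where "\<eta> = min 1 (\<epsilon> / (8 * (2 * \<tau> + 1)))"
  have \<eta>: "0 < \<eta>" "\<eta> \<le> 1" using \<open>0 < \<epsilon>\<close> \<tau>0 by (auto simp: \<eta>_def)
  have \<eta>b: "2 * \<eta> * (2 * \<tau> + 1) \<le> \<epsilon> / 4"
  proof -
    have "\<eta> \<le> \<epsilon> / (8 * (2 * \<tau> + 1))" by (simp add: \<eta>_def)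
    then have "\<eta> * (8 * (2 * \<tau> + 1)) \<le> \<epsilon>" using \<tau>0 by (simp add: pos_le_divide_eq)
    moreover have "\<eta> * (8 * (2 * \<tau> + 1)) = 4 * (2 * \<eta> * (2 * \<tau> + 1))" by (simp only: mult_ac)
    ultimately show ?thesis by linarith
  qed
  define c where "c = 3 + 1 / \<eta>"
  have c: "0 < c" using \<eta> by (simp add: c_def add_pos_pos)
  define \<delta>0 where "\<delta>0 = \<epsilon> / (8 * c)"
  have "0 < \<delta>0" using \<open>0 < \<epsilon>\<close> c by (simp add: \<delta>0_def)
  obtain F0 where F0: "finite F0" "orthonormal M F0" and near: "diagonal_trace K0 - \<delta>0 \<le> (\<Sum>e\<in>F0. form K0 e e)"
    by (rule diagonal_trace_approx[OF K0s \<open>0 < \<delta>0\<close>])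
  define X where "X = real (card F0) + c * (mass + card F0) + mass + 1"
  have X: "0 < X" using c by (simp add: X_def add_nonneg_pos)
  define s where "s = min 1 (\<epsilon> / 4) / X"
  have s: "0 < s" using X \<open>0 < \<epsilon>\<close> by (simp add: s_def)
  have sX: "s * X = min 1 (\<epsilon> / 4)" using X by (simp add: s_def)
  show ?thesis
  proof (rule that[of "s\<^sup>2"])
    show "0 < s\<^sup>2" using s by simp
    fix K F assume K: "trace_psd K" and sd: "square_dist K K0 \<le> s\<^sup>2" and dd: "diagonal_dist K K0 \<le> s\<^sup>2"
      and F: "finite F" "orthonormal M F"
    have Ks: "sym_kernel K" using K by (simp add: trace_psd_def)
    have sd': "sqrt (square_dist K K0) \<le> s" using real_sqrt_le_mono[OF sd] s by simp
    have dd': "sqrt (diagonal_dist K K0) \<le> s" using real_sqrt_le_mono[OF dd] s by simp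
    have fc: "\<bar>form K f g - form K0 f g\<bar> \<le> s * (L2_norm M f * L2_norm M g)" if "f \<in> L2 M" "g \<in> L2 M" for f g
      using form_close[OF Ks K0s that] mult_right_mono[OF sd', of "L2_norm M f * L2_norm M g"] by simp
    have "sqrt (diagonal_dist K K0) * mass \<le> s * mass" by (rule mult_right_mono[OF dd']) simp
    then have dc: "\<bar>diagonal_trace K - \<tau>\<bar> \<le> s * mass"
      using diagonal_close[OF Ks K0s] unfolding \<tau>_def by linarith
    have c1: "\<bar>(\<Sum>e\<in>F0. form K e e) - (\<Sum>e\<in>F0. form K0 e e)\<bar> \<le> s * card F0"
    proof -
      have "\<bar>(\<Sum>e\<in>F0. form K e e - form K0 e e)\<bar> \<le> (\<Sum>e\<in>F0. \<bar>form K e e - form K0 e e\<bar>)" by (rule sum_abs)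
      also have "\<dots> \<le> (\<Sum>e\<in>F0. s)"
      proof (rule sum_mono)
        fix e assume "e \<in> F0"
        then have "e \<in> L2 M" "L2_norm M e = 1" using F0 by (auto simp: orthonormal_def L2_norm_def)
        then show "\<bar>form K e e - form K0 e e\<bar> \<le> s" using fc[of e e] by simp
      qed
      finally show ?thesis by (simp add: sum_subtractf mult.commute)
    qed
    let ?p = "\<lambda>f x. \<Sum>e\<in>F0. L2_inner M f e * e x"
    have mid: "(\<Sum>f\<in>F. \<bar>form K (?p f) (?p f) - form K0 (?p f) (?p f)\<bar>) \<le> s * card F0"
    proof -
      have "(\<Sum>f\<in>F. \<bar>form K (?p f) (?p f) - form K0 (?p f) (?p f)\<bar>) \<le> (\<Sum>f\<in>F. s * (\<Sum>e\<in>F0. (L2_inner M f e)\<^sup>2))"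
      proof (rule sum_mono)
        fix f
        have "L2_norm M (?p f) * L2_norm M (?p f) = (\<Sum>e\<in>F0. (L2_inner M f e)\<^sup>2)"
          using L2_expansion_inner[OF F0, of "L2_inner M f" "L2_inner M f"]
          by (simp add: power2_eq_square flip: L2_norm_square)
        then show "\<bar>form K (?p f) (?p f) - form K0 (?p f) (?p f)\<bar> \<le> s * (\<Sum>e\<in>F0. (L2_inner M f e)\<^sup>2)"
          using fc[OF L2_expansion[OF F0(2)] L2_expansion[OF F0(2)], of "L2_inner M f" "L2_inner M f"] by simp
      qed
      also have "\<dots> = s * (\<Sum>e\<in>F0. \<Sum>f\<in>F. (L2_inner M e f)\<^sup>2)"
        by (simp add: sum_distrib_left[symmetric] sum.swap[of _ F F0] L2_inner_commute)
      also have "\<dots> \<le> s * (\<Sum>e\<in>F0. 1)"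
      proof (intro mult_left_mono sum_mono)
        fix e assume "e \<in> F0"
        then have "e \<in> L2 M" "L2_inner M e e = 1" using F0 by (auto simp: orthonormal_def)
        then show "(\<Sum>f\<in>F. (L2_inner M e f)\<^sup>2) \<le> 1" using Bessel[OF F, of e] by simp
      qed (use s in simp)
      finally show ?thesis by simp
    qed
    have "(\<Sum>f\<in>F. \<bar>form K f f - form K0 f f\<bar>)
        \<le> (\<Sum>f\<in>F. \<bar>form K f f - form K (?p f) (?p f)\<bar> + \<bar>form K0 f f - form K0 (?p f) (?p f)\<bar>
            + \<bar>form K (?p f) (?p f) - form K0 (?p f) (?p f)\<bar>)"
      by (intro sum_mono) linarith
    also have "\<dots> \<le> (2 * \<eta> * diagonal_trace K + c * (diagonal_trace K - (\<Sum>e\<in>F0. form K e e)))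
        + (2 * \<eta> * \<tau> + c * (\<tau> - (\<Sum>e\<in>F0. form K0 e e))) + s * card F0"
      unfolding sum.distrib c_def \<tau>_def
      by (intro add_mono mid form_truncation[OF K F F0 \<eta>] form_truncation[OF K0 F F0 \<eta>])
    also have "\<dots> \<le> (2 * \<eta> * (\<tau> + 1) + c * (\<delta>0 + s * (mass + card F0))) + (2 * \<eta> * \<tau> + c * \<delta>0) + s * card F0"
    proof (intro add_mono mult_left_mono order_refl)
      have "s * mass \<le> s * X" using s c by (intro mult_left_mono) (auto simp: X_def)
      then show "diagonal_trace K \<le> \<tau> + 1" using dc sX by linarith
      show "diagonal_trace K - (\<Sum>e\<in>F0. form K e e) \<le> \<delta>0 + s * (mass + card F0)"
        using dc c1 near unfolding distrib_left \<tau>_def by linarith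
      show "\<tau> - (\<Sum>e\<in>F0. form K0 e e) \<le> \<delta>0" using near by (simp add: \<tau>_def)
    qed (use \<eta> c s in auto)
    also have "\<dots> = 2 * \<eta> * (2 * \<tau> + 1) + 2 * (c * \<delta>0) + s * (c * (mass + card F0) + card F0)"
      by (simp add: algebra_simps)
    also have "\<dots> \<le> \<epsilon> / 4 + \<epsilon> / 4 + \<epsilon> / 4"
    proof (intro add_mono \<eta>b)
      show "2 * (c * \<delta>0) \<le> \<epsilon> / 4" using c by (simp add: \<delta>0_def)
      have "s * (c * (mass + card F0) + card F0) \<le> s * X" using s by (intro mult_left_mono) (auto simp: X_def)
      then show "s * (c * (mass + card F0) + card F0) \<le> \<epsilon> / 4" using sX by linarith
    qed
    also have "\<dots> \<le> \<epsilon>" using \<open>0 < \<epsilon>\<close> by simp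
    finally show "(\<Sum>f\<in>F. \<bar>form K f f - form K0 f f\<bar>) \<le> \<epsilon>" .
  qed
qed

lemma trace_norm_diff:
  assumes "sym_kernel K" "sym_kernel K0"
  shows "trace_norm M (\<lambda>f x. integral_operator M K f x - integral_operator M K0 f x)
    = (SUP F\<in>{F. finite F \<and> orthonormal M F}. ennreal (\<Sum>f\<in>F. \<bar>form K f f - form K0 f f\<bar>))"
proof -
  have "trace_norm M (\<lambda>f x. integral_operator M K f x - integral_operator M K0 f x)
    = (SUP F\<in>{F. finite F \<and> orthonormal M F}. ennreal (\<Sum>f\<in>F. \<bar>form (\<lambda>x y. K x y - K0 x y) f f\<bar>))"
    unfolding form_def
    by (rule trace_norm_kernel[OF sym_kernel_diff[OF assms]]) (simp add: integral_operator_diff[OF assms])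
  also have "\<dots> = (SUP F\<in>{F. finite F \<and> orthonormal M F}. ennreal (\<Sum>f\<in>F. \<bar>form K f f - form K0 f f\<bar>))"
    using form_diff[OF assms] by (intro SUP_cong refl arg_cong[where f=ennreal] sum.cong) (auto dest: orthonormal_L2)
  finally show ?thesis .
qed

lemma trace_psd_trace_class:
  assumes "trace_psd K"
  shows "integral_operator M K \<in> trace_class_nonneg_sym M"
proof -
  have K: "sym_kernel K" and nonneg: "\<And>f. f \<in> L2 M \<Longrightarrow> 0 \<le> form K f f" using assms by (auto simp: trace_psd_def)
  obtain B where B: "0 \<le> B" "\<And>x y. x \<in> space M \<Longrightarrow> y \<in> space M \<Longrightarrow> \<bar>K x y\<bar> \<le> B"
    using sym_kernel_bound[OF K] by blast
  have op: "L2_operator M (integral_operator M K)"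
    unfolding L2_operator_def
  proof (intro conjI ballI allI)
    show "integral_operator M K f \<in> L2 M" if "f \<in> L2 M" for f using integral_operator_L2[OF K that] .
    show "AE x in M. integral_operator M K (\<lambda>y. a * f y + b * g y) x = a * integral_operator M K f x + b * integral_operator M K g x"
      if "f \<in> L2 M" "g \<in> L2 M" for f g a b using that by (intro AE_I2 integral_operator_lincomb[OF K])
    have "L2_norm M (integral_operator M K f) \<le> (B * mass * mass) * L2_norm M f" if f: "f \<in> L2 M" for f
      using bounded_L2(2)[OF L2_measurable[OF integral_operator_L2[OF K f]] integral_operator_bound[OF B(2) K _ f]]
      by (simp add: mult_ac)
    then show "\<exists>C. \<forall>f\<in>L2 M. L2_norm M (integral_operator M K f) \<le> C * L2_norm M f" by blast
  qed
  have "trace_norm M (integral_operator M K) = (SUP F\<in>{F. finite F \<and> orthonormal M F}. ennreal (\<Sum>f\<in>F. \<bar>form K f f\<bar>))"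
    unfolding form_def by (rule trace_norm_kernel[OF K refl])
  also have "\<dots> \<le> ennreal (diagonal_trace K)"
  proof (intro SUP_least ennreal_leI)
    fix F assume "F \<in> {F. finite F \<and> orthonormal M F}"
    then have F: "finite F" "orthonormal M F" by auto
    have "(\<Sum>f\<in>F. \<bar>form K f f\<bar>) = (\<Sum>f\<in>F. form K f f)"
      using nonneg F by (intro sum.cong) (auto dest: orthonormal_L2)
    then show "(\<Sum>f\<in>F. \<bar>form K f f\<bar>) \<le> diagonal_trace K"
      using trace_psd_form_sum[OF assms F] by simp
  qed
  finally have "trace_norm M (integral_operator M K) < \<infinity>" by (auto intro: le_less_trans)
  then show ?thesis
    using op nonneg integral_operator_symmetric[OF K]
    by (simp add: trace_class_nonneg_sym_def L2_symmetric_def L2_nonneg_def form_def)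
qed

end

section \<open>Gaussian pairs\<close>

text \<open>A centred Gaussian pair with covariance entries a, b, c, described by its characteristic function
  so that degenerate covariances are included.\<close>

definition gauss2 :: "(real \<times> real) measure \<Rightarrow> real \<Rightarrow> real \<Rightarrow> real \<Rightarrow> bool" where
  "gauss2 \<mu> a b c \<longleftrightarrow> prob_space \<mu> \<and> sets \<mu> = sets borel \<and> 0 \<le> a \<and> 0 \<le> c \<and>
    (\<forall>s t. (\<integral>p. cis (s * fst p + t * snd p) \<partial>\<mu>) =
      complex_of_real (exp (- (s\<^sup>2 * a + 2 * s * t * b + t\<^sup>2 * c) / 2)))"

definition normal_moment :: "nat \<Rightarrow> real" where
  "normal_moment q = (\<integral>z. z ^ (2 * q) \<partial>std_normal_distribution)"

lemma normal_moment_nonneg: "0 \<le> normal_moment q"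
  unfolding normal_moment_def by (intro integral_nonneg_AE) (simp add: power_mult)

text \<open>By Levy's uniqueness theorem X is distributed like sqrt a times a standard normal variable.\<close>

lemma gaussian_even_moment:
  assumes "prob_space Q" and X: "X \<in> borel_measurable Q" and "0 \<le> a"
    and ch: "\<And>s. (\<integral>\<omega>. cis (s * X \<omega>) \<partial>Q) = complex_of_real (exp (- (s\<^sup>2 * a) / 2))"
  shows "integrable Q (\<lambda>\<omega>. X \<omega> ^ (2 * q))" "(\<integral>\<omega>. X \<omega> ^ (2 * q) \<partial>Q) = a ^ q * normal_moment q"
proof -
  interpret Q: prob_space Q by fact
  interpret N: prob_space std_normal_distribution by (rule prob_space_normal_density) simp
  let ?Y = "\<lambda>z. sqrt a * z"
  have cX: "char (distr Q borel X) s = complex_of_real (exp (- (s\<^sup>2 * a) / 2))" for s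
  proof -
    have "char (distr Q borel X) s = (\<integral>\<omega>. iexp (s * X \<omega>) \<partial>Q)"
      unfolding char_def using X by (intro integral_distr) auto
    then show ?thesis using ch[of s] by (simp add: cis_conv_exp)
  qed
  have cY: "char (distr std_normal_distribution borel ?Y) s = complex_of_real (exp (- (s\<^sup>2 * a) / 2))" for s
  proof -
    have "char (distr std_normal_distribution borel ?Y) s = (\<integral>z. iexp (s * (sqrt a * z)) \<partial>std_normal_distribution)"
      unfolding char_def by (intro integral_distr) auto
    also have "\<dots> = char std_normal_distribution (s * sqrt a)"
      by (simp add: char_def mult.assoc)
    also have "\<dots> = complex_of_real (exp (- (s * sqrt a)\<^sup>2 / 2))" by (simp only: char_std_normal_distribution)
    finally show ?thesis using \<open>0 \<le> a\<close> by (simp add: power_mult_distrib)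
  qed
  have eq: "distr Q borel X = distr std_normal_distribution borel ?Y"
  proof (rule Levy_uniqueness)
    show "real_distribution (distr Q borel X)" using X by (rule Q.real_distribution_distr)
    show "real_distribution (distr std_normal_distribution borel ?Y)" by (intro N.real_distribution_distr) simp
    show "char (distr Q borel X) = char (distr std_normal_distribution borel ?Y)" using cX cY by (intro ext) simp
  qed
  have Yq: "(sqrt a * z) ^ (2 * q) = a ^ q * z ^ (2 * q)" for z
    using \<open>0 \<le> a\<close> by (simp add: power_mult_distrib power_mult)
  have "integrable (distr std_normal_distribution borel ?Y) (\<lambda>y. y ^ (2 * q))"
    using integrable_std_normal_distribution_moment[of "2 * q"] by (simp add: integrable_distr_eq Yq)
  then have "integrable (distr Q borel X) (\<lambda>y. y ^ (2 * q))" by (simp add: eq)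
  then show "integrable Q (\<lambda>\<omega>. X \<omega> ^ (2 * q))" using X by (simp add: integrable_distr_eq)
  have "(\<integral>\<omega>. X \<omega> ^ (2 * q) \<partial>Q) = (\<integral>y. y ^ (2 * q) \<partial>distr Q borel X)"
    using X by (intro integral_distr[symmetric]) auto
  also have "\<dots> = (\<integral>z. (sqrt a * z) ^ (2 * q) \<partial>std_normal_distribution)"
    unfolding eq by (intro integral_distr) auto
  finally show "(\<integral>\<omega>. X \<omega> ^ (2 * q) \<partial>Q) = a ^ q * normal_moment q" by (simp add: Yq normal_moment_def)
qed

lemma gauss2_measurable:
  assumes "gauss2 \<mu> a b c"
  shows "f \<in> borel_measurable borel \<Longrightarrow> f \<in> borel_measurable \<mu>"
proof -
  have "sets \<mu> = sets borel" using assms by (simp add: gauss2_def)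
  then show "f \<in> borel_measurable borel \<Longrightarrow> f \<in> borel_measurable \<mu>"
    using measurable_cong_sets[of \<mu> borel borel borel] by blast
qed

lemma gauss2_moments:
  assumes g: "gauss2 \<mu> a b c"
  shows "integrable \<mu> (\<lambda>p. fst p ^ (2 * q))" "(\<integral>p. fst p ^ (2 * q) \<partial>\<mu>) = a ^ q * normal_moment q"
    "integrable \<mu> (\<lambda>p. snd p ^ (2 * q))" "(\<integral>p. snd p ^ (2 * q) \<partial>\<mu>) = c ^ q * normal_moment q"
proof -
  have P: "prob_space \<mu>" and ac: "0 \<le> a" "0 \<le> c" and
    ch: "\<And>s t. (\<integral>p. cis (s * fst p + t * snd p) \<partial>\<mu>) = complex_of_real (exp (- (s\<^sup>2 * a + 2 * s * t * b + t\<^sup>2 * c) / 2))"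
    using g by (auto simp: gauss2_def)
  have m: "fst \<in> borel_measurable \<mu>" "snd \<in> borel_measurable \<mu>"
    by (rule gauss2_measurable[OF g], simp add: borel_prod[symmetric])+
  have c1: "(\<integral>p. cis (s * fst p) \<partial>\<mu>) = complex_of_real (exp (- (s\<^sup>2 * a) / 2))" for s
    using ch[of s 0] by simp
  have c2: "(\<integral>p. cis (s * snd p) \<partial>\<mu>) = complex_of_real (exp (- (s\<^sup>2 * c) / 2))" for s
    using ch[of 0 s] by simp
  show "integrable \<mu> (\<lambda>p. fst p ^ (2 * q))" "(\<integral>p. fst p ^ (2 * q) \<partial>\<mu>) = a ^ q * normal_moment q"
    by (rule gaussian_even_moment[OF P m(1) ac(1) c1])+
  show "integrable \<mu> (\<lambda>p. snd p ^ (2 * q))" "(\<integral>p. snd p ^ (2 * q) \<partial>\<mu>) = c ^ q * normal_moment q"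
    by (rule gaussian_even_moment[OF P m(2) ac(2) c2])+
qed

lemma even_power_abs_mono:
  fixes x y :: real
  assumes "\<bar>x\<bar> \<le> \<bar>y\<bar>"
  shows "x ^ (2 * k) \<le> y ^ (2 * k)"
  using power_mono[OF assms abs_ge_zero, of "2 * k"] by (simp add: power_even_abs)

lemma square_add_le: "(x + y)\<^sup>2 \<le> 2 * x\<^sup>2 + 2 * (y::real)\<^sup>2"
  using sum_squares_bound[of x y] by (simp add: power2_sum)

locale growth =
  fixes sig :: "real \<Rightarrow> real" and A :: real and k :: nat
  assumes cont: "continuous_on UNIV sig" and A: "0 \<le> A"
    and growth: "\<And>x. (sig x)\<^sup>2 \<le> A * (1 + x ^ (2 * k))"
begin

text \<open>The exponent exceeds the growth of the square of sig by two, so that the quotient tends to 0 at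
  infinity.\<close>

definition wt :: "real \<Rightarrow> real" where
  "wt u = 1 + u ^ (2 * (k + 1))"

lemma wt_ge_1: "1 \<le> wt u"
  unfolding wt_def by (simp only: power_mult) simp

lemma sig_square_le_wt: "(sig u)\<^sup>2 \<le> 2 * A * wt u"
proof -
  have "u ^ (2 * k) \<le> 1 + u ^ (2 * (k + 1))"
  proof (cases "\<bar>u\<bar> \<le> 1")
    case True
    then have "u ^ (2 * k) \<le> 1 ^ (2 * k)" by (intro even_power_abs_mono) simp
    moreover have "0 \<le> u ^ (2 * (k + 1))" by (simp only: power_mult) simp
    ultimately show ?thesis by simp
  next
    case False
    then have "1 \<le> u\<^sup>2" by (simp add: abs_le_square_iff[of 1 u, simplified, symmetric])
    then have "u ^ (2 * k) * 1 \<le> u ^ (2 * k) * u\<^sup>2" by (intro mult_left_mono) (simp_all add: power_mult)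
    then show ?thesis by (simp add: power_add power2_eq_square mult_ac)
  qed
  moreover have "0 \<le> u ^ (2 * (k + 1))" by (simp only: power_mult) simp
  ultimately have "1 + u ^ (2 * k) \<le> 2 * wt u" unfolding wt_def distrib_left by simp
  then have "A * (1 + u ^ (2 * k)) \<le> A * (2 * wt u)" using A by (rule mult_left_mono)
  then show ?thesis using growth[of u] by simp
qed

text \<open>The function R sin(u/R) tends to u as R grows and never exceeds u in modulus.  Composing sig with it
  costs little on a bounded interval by continuity and little far away by the growth bound, relative to the weight;
  then Weierstrass applies, since sin(u/R) stays in [-1, 1] for all u.\<close>

lemma sin_polynomial_approx:
  assumes "0 < \<theta>"
  obtains R \<alpha> N where "0 < R" "\<And>u. (sig u - (\<Sum>i\<le>N. \<alpha> i * sin (u / R) ^ i))\<^sup>2 \<le> \<theta> * wt u"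
proof -
  \<comment> \<open>Beyond B the weight exceeds the growth of the square of sig by the factor
    needed.\<close>
  define B where "B = 1 + 32 * A / \<theta>"
  have B1: "1 \<le> B" using A assms by (simp add: B_def)
  have "32 * A / \<theta> \<le> B" by (simp add: B_def)
  also have "B \<le> B\<^sup>2" using B1 by (simp add: power2_eq_square)
  finally have "32 * A \<le> B\<^sup>2 * \<theta>" using assms by (simp add: pos_divide_le_eq)
  then have B: "8 * A \<le> \<theta> / 4 * B\<^sup>2" by (simp add: mult.commute)
  define \<eta> where "\<eta> = sqrt (\<theta> / 4)"
  have \<eta>: "0 < \<eta>" "\<eta>\<^sup>2 = \<theta> / 4" using assms by (simp_all add: \<eta>_def)
  have "uniformly_continuous_on {-B..B} sig"
    by (intro compact_uniformly_continuous continuous_on_subset[OF cont]) auto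
  then obtain \<delta> where \<delta>: "0 < \<delta>" "\<And>x y. x \<in> {-B..B} \<Longrightarrow> y \<in> {-B..B} \<Longrightarrow> dist y x < \<delta> \<Longrightarrow> dist (sig y) (sig x) < \<eta>"
    using \<eta>(1) unfolding uniformly_continuous_on_def by metis
  \<comment> \<open>By Taylor's formula R sin(u/R) differs from u by at most u^2 / (2 R), which is
    \<delta> / 2 at most on [-B, B].\<close>
  define R where "R = B\<^sup>2 / \<delta>"
  have R: "0 < R" using B1 \<delta>(1) by (simp add: R_def)
  have sin_le: "\<bar>R * sin (u / R)\<bar> \<le> \<bar>u\<bar>" for u
  proof -
    have "R * \<bar>sin (u / R)\<bar> \<le> R * \<bar>u / R\<bar>" using R by (intro mult_left_mono abs_sin_x_le_abs_x) auto
    then show ?thesis using R by (simp add: abs_mult)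
  qed
  have sin_near: "\<bar>R * sin (u / R) - u\<bar> < \<delta>" if "\<bar>u\<bar> \<le> B" for u
  proof -
    have "\<bar>sin (u / R) - (\<Sum>m<2. sin_coeff m * (u / R) ^ m)\<bar> \<le> inverse (fact 2) * \<bar>u / R\<bar> ^ 2"
      by (rule Maclaurin_sin_bound)
    then have "\<bar>sin (u / R) - u / R\<bar> \<le> (u / R)\<^sup>2 / 2" by (simp add: numeral_2_eq_2 sin_coeff_def)
    then have "R * \<bar>sin (u / R) - u / R\<bar> \<le> R * ((u / R)\<^sup>2 / 2)" using R by (intro mult_left_mono) auto
    moreover have "R * \<bar>sin (u / R) - u / R\<bar> = \<bar>R * sin (u / R) - u\<bar>"
      using R abs_mult[of R "sin (u / R) - u / R"] by (simp add: right_diff_distrib)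
    moreover have "R * ((u / R)\<^sup>2 / 2) = u\<^sup>2 / (2 * R)" using R by (simp add: power2_eq_square)
    moreover have "u\<^sup>2 / (2 * R) \<le> B\<^sup>2 / (2 * R)"
      using that B1 R by (intro divide_right_mono) (auto simp: abs_le_square_iff[symmetric])
    moreover have "B\<^sup>2 / (2 * R) = \<delta> / 2" using B1 \<delta>(1) by (simp add: R_def)
    ultimately show ?thesis using \<delta>(1) by linarith
  qed
  have stage1: "2 * (sig u - sig (R * sin (u / R)))\<^sup>2 \<le> \<theta> / 2 * wt u" for u
  proof (cases "\<bar>u\<bar> \<le> B")
    case True
    have "\<bar>R * sin (u / R)\<bar> \<le> B" using sin_le[of u] True by simp
    then have "dist (sig u) (sig (R * sin (u / R))) < \<eta>"
      using True sin_near[OF True] by (intro \<delta>(2)) (auto simp: abs_le_iff dist_real_def abs_minus_commute)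
    then have "\<bar>sig u - sig (R * sin (u / R))\<bar>\<^sup>2 \<le> \<eta>\<^sup>2" by (intro power_mono) (auto simp: dist_real_def)
    then have "(sig u - sig (R * sin (u / R)))\<^sup>2 \<le> \<theta> / 4" using \<eta>(2) by simp
    moreover have "\<theta> / 2 * 1 \<le> \<theta> / 2 * wt u" using assms by (intro mult_left_mono wt_ge_1) auto
    ultimately show ?thesis by simp
  next
    case False
    have u1: "1 \<le> \<bar>u\<bar>" using False B1 by simp
    have "(sig u - sig (R * sin (u / R)))\<^sup>2 \<le> 2 * (sig u)\<^sup>2 + 2 * (sig (R * sin (u / R)))\<^sup>2"
      using square_add_le[of "sig u" "- sig (R * sin (u / R))"] by simp
    also have "\<dots> \<le> 2 * (A * (1 + u ^ (2 * k))) + 2 * (A * (1 + (R * sin (u / R)) ^ (2 * k)))"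
      by (intro add_mono mult_left_mono growth) auto
    also have "\<dots> \<le> 2 * (A * (1 + u ^ (2 * k))) + 2 * (A * (1 + u ^ (2 * k)))"
      using A even_power_abs_mono[OF sin_le] by (intro add_mono mult_left_mono) auto
    also have "\<dots> = 4 * A * (1 + u ^ (2 * k))" by simp
    also have "\<dots> \<le> 4 * A * (2 * u ^ (2 * k))"
    proof (intro mult_left_mono)
      have "(1::real) ^ (2 * k) \<le> u ^ (2 * k)" using u1 by (intro even_power_abs_mono) simp
      then show "1 + u ^ (2 * k) \<le> 2 * u ^ (2 * k)" by simp
    qed (use A in simp)
    also have "\<dots> = 8 * A * u ^ (2 * k)" by simp
    also have "\<dots> \<le> (\<theta> / 4 * B\<^sup>2) * u ^ (2 * k)"
      by (intro mult_right_mono B) (simp add: power_mult)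
    also have "\<dots> \<le> (\<theta> / 4 * u\<^sup>2) * u ^ (2 * k)"
      using False B1 assms by (intro mult_right_mono mult_left_mono) (auto simp: power_mult abs_le_square_iff[symmetric])
    also have "\<dots> = \<theta> / 4 * u ^ (2 * (k + 1))" by (simp add: power_add power2_eq_square mult_ac)
    finally have "(sig u - sig (R * sin (u / R)))\<^sup>2 \<le> \<theta> / 4 * u ^ (2 * (k + 1))" .
    then show ?thesis using assms by (simp add: wt_def distrib_left)
  qed
  have "continuous_on {-1..1} (\<lambda>s. sig (R * s))"
    by (intro continuous_on_compose2[OF cont] continuous_intros) auto
  from Stone_Weierstrass_real_polynomial_function[OF compact_Icc this \<eta>(1)]
  obtain p where p: "real_polynomial_function p" "\<And>s. s \<in> {-1..1} \<Longrightarrow> \<bar>sig (R * s) - p s\<bar> < \<eta>" by metis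
  obtain \<alpha> N where pa: "p = (\<lambda>s. \<Sum>i\<le>N. \<alpha> i * s ^ i)" using p(1) real_polynomial_function_iff_sum by metis
  show ?thesis
  proof (rule that[OF R, of \<alpha> N])
    fix u
    have "\<bar>sig (R * sin (u / R)) - p (sin (u / R))\<bar>\<^sup>2 \<le> \<eta>\<^sup>2"
      using p(2)[of "sin (u / R)"] by (intro power_mono) auto
    then have "2 * (sig (R * sin (u / R)) - p (sin (u / R)))\<^sup>2 \<le> \<theta> / 2" using \<eta>(2) by simp
    moreover have "\<theta> / 2 * 1 \<le> \<theta> / 2 * wt u" using assms by (intro mult_left_mono wt_ge_1) auto
    ultimately have "2 * (sig u - sig (R * sin (u / R)))\<^sup>2 + 2 * (sig (R * sin (u / R)) - p (sin (u / R)))\<^sup>2 \<le> \<theta> * wt u"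
      using stage1[of u] by linarith
    then show "(sig u - (\<Sum>i\<le>N. \<alpha> i * sin (u / R) ^ i))\<^sup>2 \<le> \<theta> * wt u"
      using square_add_le[of "sig u - sig (R * sin (u / R))" "sig (R * sin (u / R)) - p (sin (u / R))"]
      unfolding pa by simp
  qed
qed

lemma sin_polynomial_product_approx:
  assumes "0 < \<epsilon>"
  obtains R \<alpha> N where "0 < R" "\<And>u v. \<bar>sig u * sig v - (\<Sum>i\<le>N. \<alpha> i * sin (u / R) ^ i) * (\<Sum>i\<le>N. \<alpha> i * sin (v / R) ^ i)\<bar>
    \<le> \<epsilon> * (wt u + wt v)"
proof -
  define \<theta> where "\<theta> = min 1 (\<epsilon>\<^sup>2 / (4 * A + 2))"
  have \<theta>: "0 < \<theta>" "\<theta> \<le> 1" using assms A by (auto simp: \<theta>_def add_nonneg_pos)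
  have "\<theta> \<le> \<epsilon>\<^sup>2 / (4 * A + 2)" by (simp add: \<theta>_def)
  then have \<theta>2: "\<theta> * (4 * A + 2) \<le> \<epsilon>\<^sup>2" using A by (simp add: pos_le_divide_eq)
  obtain R \<alpha> N where R: "0 < R" and ap: "\<And>u. (sig u - (\<Sum>i\<le>N. \<alpha> i * sin (u / R) ^ i))\<^sup>2 \<le> \<theta> * wt u"
    by (rule sin_polynomial_approx[OF \<theta>(1)]) rule
  define t where "t u = (\<Sum>i\<le>N. \<alpha> i * sin (u / R) ^ i)" for u
  have D: "(sig u - t u)\<^sup>2 \<le> \<theta> * wt u" for u using ap by (simp add: t_def)
  have T: "(t u)\<^sup>2 \<le> (4 * A + 2) * wt u" for u
  proof -
    have "(t u)\<^sup>2 \<le> 2 * (sig u)\<^sup>2 + 2 * (sig u - t u)\<^sup>2" using square_add_le[of "sig u" "- (sig u - t u)"] by (simp add: power2_commute)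
    moreover have "\<theta> * wt u \<le> 1 * wt u" using \<theta> wt_ge_1[of u] by (intro mult_right_mono) auto
    ultimately show ?thesis using D[of u] sig_square_le_wt[of u] by (simp add: algebra_simps)
  qed
  have prod: "\<bar>x * y\<bar> \<le> \<epsilon> * (wt u + wt v) / 2" if x: "x\<^sup>2 \<le> \<theta> * wt u" and y: "y\<^sup>2 \<le> (4 * A + 2) * wt v" for x y u v
  proof -
    have w: "0 \<le> wt u" "0 \<le> wt v" using wt_ge_1[of u] wt_ge_1[of v] by auto
    have "(x * y)\<^sup>2 \<le> (\<theta> * wt u) * ((4 * A + 2) * wt v)"
      unfolding power_mult_distrib using x y w \<theta> by (intro mult_mono) auto
    also have "\<dots> = (\<theta> * (4 * A + 2)) * (wt u * wt v)" by (simp only: mult_ac)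
    also have "\<dots> \<le> \<epsilon>\<^sup>2 * (wt u * wt v)" using \<theta>2 w by (intro mult_right_mono) auto
    also have "\<dots> \<le> \<epsilon>\<^sup>2 * ((wt u + wt v) / 2)\<^sup>2"
    proof (intro mult_left_mono)
      show "wt u * wt v \<le> ((wt u + wt v) / 2)\<^sup>2"
        using sum_squares_bound[of "wt u" "wt v"] by (simp add: power2_eq_square field_simps)
    qed simp
    also have "\<dots> = (\<epsilon> * (wt u + wt v) / 2)\<^sup>2" by (simp add: power_mult_distrib power_divide)
    finally have "\<bar>x * y\<bar>\<^sup>2 \<le> (\<epsilon> * (wt u + wt v) / 2)\<^sup>2" by simp
    then show ?thesis by (rule power2_le_imp_le) (use assms w in simp)
  qed
  show ?thesis
  proof (rule that[OF R, of \<alpha> N])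
    fix u v
    have s: "(sig v)\<^sup>2 \<le> (4 * A + 2) * wt v"
    proof -
      have "2 * A * wt v \<le> (4 * A + 2) * wt v" using A wt_ge_1[of v] by (intro mult_right_mono) auto
      then show ?thesis using sig_square_le_wt[of v] by linarith
    qed
    have "sig u * sig v - t u * t v = (sig u - t u) * sig v + (sig v - t v) * t u" by (simp add: algebra_simps)
    then have "\<bar>sig u * sig v - t u * t v\<bar> \<le> \<bar>(sig u - t u) * sig v\<bar> + \<bar>(sig v - t v) * t u\<bar>"
      by (simp only: abs_triangle_ineq)
    also have "\<dots> \<le> \<epsilon> * (wt u + wt v) / 2 + \<epsilon> * (wt v + wt u) / 2"
      by (intro add_mono prod D s T)
    finally show "\<bar>sig u * sig v - (\<Sum>i\<le>N. \<alpha> i * sin (u / R) ^ i) * (\<Sum>i\<le>N. \<alpha> i * sin (v / R) ^ i)\<bar> \<le> \<epsilon> * (wt u + wt v)"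
      unfolding t_def by (simp add: add.commute)
  qed
qed

lemma gauss2_integrable_wt:
  assumes "gauss2 \<mu> a b c"
  shows "integrable \<mu> (\<lambda>p. wt (fst p) + wt (snd p))"
    "(\<integral>p. wt (fst p) + wt (snd p) \<partial>\<mu>) = 2 + (a ^ (k + 1) + c ^ (k + 1)) * normal_moment (k + 1)"
proof -
  interpret prob_space \<mu> using assms by (simp add: gauss2_def)
  note m = gauss2_moments[OF assms, of "k + 1"]
  show "integrable \<mu> (\<lambda>p. wt (fst p) + wt (snd p))" unfolding wt_def using m by auto
  show "(\<integral>p. wt (fst p) + wt (snd p) \<partial>\<mu>) = 2 + (a ^ (k + 1) + c ^ (k + 1)) * normal_moment (k + 1)"
    unfolding wt_def using m by (simp add: prob_space distrib_right)
qed

lemma sig_product_bound: "\<bar>sig u * sig v\<bar> \<le> A * (wt u + wt v)"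
proof -
  have "2 * \<bar>sig u\<bar> * \<bar>sig v\<bar> \<le> \<bar>sig u\<bar>\<^sup>2 + \<bar>sig v\<bar>\<^sup>2" by (rule sum_squares_bound)
  then have "2 * \<bar>sig u * sig v\<bar> \<le> (sig u)\<^sup>2 + (sig v)\<^sup>2" by (simp add: abs_mult)
  then show ?thesis using sig_square_le_wt[of u] sig_square_le_wt[of v] by (simp add: distrib_left)
qed

lemma sig_measurable [measurable]: "sig \<in> borel_measurable borel"
  by (rule borel_measurable_continuous_onI[OF cont])

lemma gauss2_integrable_product:
  assumes "gauss2 \<mu> a b c"
  shows "integrable \<mu> (\<lambda>p. sig (fst p) * sig (snd p))"
    "\<bar>\<integral>p. sig (fst p) * sig (snd p) \<partial>\<mu>\<bar> \<le> A * (2 + (a ^ (k + 1) + c ^ (k + 1)) * normal_moment (k + 1))"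
proof -
  have i: "integrable \<mu> (\<lambda>p. A * (wt (fst p) + wt (snd p)))" using gauss2_integrable_wt(1)[OF assms] by simp
  have m: "(\<lambda>p. sig (fst p) * sig (snd p)) \<in> borel_measurable \<mu>"
    by (rule gauss2_measurable[OF assms]) (simp add: borel_prod[symmetric])
  have w: "0 \<le> A * (wt u + wt v)" for u v using A wt_ge_1[of u] wt_ge_1[of v] by simp
  show int: "integrable \<mu> (\<lambda>p. sig (fst p) * sig (snd p))"
    by (rule Bochner_Integration.integrable_bound[OF i m]) (use sig_product_bound w in \<open>auto intro: order_trans\<close>)
  have "\<bar>\<integral>p. sig (fst p) * sig (snd p) \<partial>\<mu>\<bar> \<le> (\<integral>p. \<bar>sig (fst p) * sig (snd p)\<bar> \<partial>\<mu>)" by (rule integral_abs_bound)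
  also have "\<dots> \<le> (\<integral>p. A * (wt (fst p) + wt (snd p)) \<partial>\<mu>)"
    using int i sig_product_bound by (intro integral_mono) auto
  finally show "\<bar>\<integral>p. sig (fst p) * sig (snd p) \<partial>\<mu>\<bar> \<le> A * (2 + (a ^ (k + 1) + c ^ (k + 1)) * normal_moment (k + 1))"
    using gauss2_integrable_wt(2)[OF assms] by simp
qed

end

lemma sin_eq_cis: "complex_of_real (sin x) = (cis x - cis (- x)) / (2 * \<i>)"
  by (simp add: complex_eq_iff Re_divide Im_divide power2_eq_square)

text \<open>A sine is a difference of two exponentials that shift the frequency by 1/R, so the powers are
  removed by induction until the characteristic function remains.\<close>

lemma gauss2_trig_tendsto:
  assumes g: "\<And>n. gauss2 (\<mu> n) (a n) (b n) (c n)" and g0: "gauss2 \<mu>0 a0 b0 c0"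
    and lim: "a \<longlonglongrightarrow> a0" "b \<longlonglongrightarrow> b0" "c \<longlonglongrightarrow> c0"
  shows "(\<lambda>n. \<integral>p. cis (s * fst p + t * snd p) * complex_of_real (sin (fst p / R)) ^ i * complex_of_real (sin (snd p / R)) ^ j \<partial>\<mu> n)
    \<longlonglongrightarrow> (\<integral>p. cis (s * fst p + t * snd p) * complex_of_real (sin (fst p / R)) ^ i * complex_of_real (sin (snd p / R)) ^ j \<partial>\<mu>0)"
proof -
  define F where "F i j s t = (\<lambda>p. cis (s * fst p + t * snd p) * complex_of_real (sin (fst p / R)) ^ i * complex_of_real (sin (snd p / R)) ^ j)"
    for i j s t
  have Fm: "F i j s t \<in> borel_measurable borel" for i j s t
    unfolding F_def by (intro borel_measurable_continuous_onI) (auto intro!: continuous_intros simp: cis_conv_exp divide_inverse)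
  have Fb: "norm (F i j s t p) \<le> 1" for i j s t p
    unfolding F_def norm_mult norm_power norm_cis norm_of_real mult_1_left
    by (intro mult_le_one power_le_one zero_le_power) auto
  have Fi: "integrable \<nu> (F i j s t)" if "gauss2 \<nu> a' b' c'" for \<nu> a' b' c' i j s t
  proof -
    interpret prob_space \<nu> using that by (simp add: gauss2_def)
    show ?thesis using Fb gauss2_measurable[OF that Fm] by (intro integrable_const_bound[of _ 1]) auto
  qed
  have stepi: "F (Suc i) j s t = (\<lambda>p. (F i j (s + 1 / R) t p - F i j (s - 1 / R) t p) / (2 * \<i>))" for i j s t
  proof
    fix p :: "real \<times> real"
    have "cis ((s + 1 / R) * fst p + t * snd p) = cis (s * fst p + t * snd p) * cis (fst p / R)"
      "cis ((s - 1 / R) * fst p + t * snd p) = cis (s * fst p + t * snd p) * cis (- (fst p / R))"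
      by (simp_all add: cis_mult algebra_simps)
    then show "F (Suc i) j s t p = (F i j (s + 1 / R) t p - F i j (s - 1 / R) t p) / (2 * \<i>)"
      unfolding F_def power_Suc sin_eq_cis[of "fst p / R"] by (simp add: algebra_simps diff_divide_distrib)
  qed
  have stepj: "F i (Suc j) s t = (\<lambda>p. (F i j s (t + 1 / R) p - F i j s (t - 1 / R) p) / (2 * \<i>))" for i j s t
  proof
    fix p :: "real \<times> real"
    have "cis (s * fst p + (t + 1 / R) * snd p) = cis (s * fst p + t * snd p) * cis (snd p / R)"
      "cis (s * fst p + (t - 1 / R) * snd p) = cis (s * fst p + t * snd p) * cis (- (snd p / R))"
      by (simp_all add: cis_mult algebra_simps)
    then show "F i (Suc j) s t p = (F i j s (t + 1 / R) p - F i j s (t - 1 / R) p) / (2 * \<i>)"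
      unfolding F_def power_Suc sin_eq_cis[of "snd p / R"] by (simp add: algebra_simps diff_divide_distrib)
  qed
  have base: "(\<lambda>n. \<integral>p. F 0 0 s t p \<partial>\<mu> n) \<longlonglongrightarrow> (\<integral>p. F 0 0 s t p \<partial>\<mu>0)" for s t
  proof -
    have "(\<integral>p. F 0 0 s t p \<partial>\<mu> n) = complex_of_real (exp (- (s\<^sup>2 * a n + 2 * s * t * b n + t\<^sup>2 * c n) / 2))" for n
      using g[of n] by (simp add: F_def gauss2_def)
    moreover have "(\<integral>p. F 0 0 s t p \<partial>\<mu>0) = complex_of_real (exp (- (s\<^sup>2 * a0 + 2 * s * t * b0 + t\<^sup>2 * c0) / 2))"
      using g0 by (simp add: F_def gauss2_def)
    ultimately show ?thesis by (simp only:) (intro tendsto_intros lim, simp)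
  qed
  have j0: "(\<lambda>n. \<integral>p. F 0 j s t p \<partial>\<mu> n) \<longlonglongrightarrow> (\<integral>p. F 0 j s t p \<partial>\<mu>0)" for j s t
  proof (induction j arbitrary: s t)
    case (Suc j)
    have "(\<lambda>n. ((\<integral>p. F 0 j s (t + 1 / R) p \<partial>\<mu> n) - (\<integral>p. F 0 j s (t - 1 / R) p \<partial>\<mu> n)) / (2 * \<i>))
      \<longlonglongrightarrow> ((\<integral>p. F 0 j s (t + 1 / R) p \<partial>\<mu>0) - (\<integral>p. F 0 j s (t - 1 / R) p \<partial>\<mu>0)) / (2 * \<i>)"
      by (intro tendsto_divide tendsto_diff Suc tendsto_const) simp
    then show ?case unfolding stepj using Fi[OF g] Fi[OF g0] by simp
  qed (rule base)
  have "(\<lambda>n. \<integral>p. F i j s t p \<partial>\<mu> n) \<longlonglongrightarrow> (\<integral>p. F i j s t p \<partial>\<mu>0)" for s t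
  proof (induction i arbitrary: s t)
    case (Suc i)
    have "(\<lambda>n. ((\<integral>p. F i j (s + 1 / R) t p \<partial>\<mu> n) - (\<integral>p. F i j (s - 1 / R) t p \<partial>\<mu> n)) / (2 * \<i>))
      \<longlonglongrightarrow> ((\<integral>p. F i j (s + 1 / R) t p \<partial>\<mu>0) - (\<integral>p. F i j (s - 1 / R) t p \<partial>\<mu>0)) / (2 * \<i>)"
      by (intro tendsto_divide tendsto_diff Suc tendsto_const) simp
    then show ?case unfolding stepi using Fi[OF g] Fi[OF g0] by simp
  qed (rule j0)
  then show ?thesis unfolding F_def by blast
qed

context growth
begin

text \<open>The product of activations is trigonometric up to a small multiple of the weight, and the Gaussian
  integral of the weight is explicit and converges with the covariances.\<close>

lemma gauss2_product_tendsto: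
  assumes g: "\<And>n. gauss2 (\<mu> n) (a n) (b n) (c n)" and g0: "gauss2 \<mu>0 a0 b0 c0"
    and lim: "a \<longlonglongrightarrow> a0" "b \<longlonglongrightarrow> b0" "c \<longlonglongrightarrow> c0"
  shows "(\<lambda>n. \<integral>p. sig (fst p) * sig (snd p) \<partial>\<mu> n) \<longlonglongrightarrow> (\<integral>p. sig (fst p) * sig (snd p) \<partial>\<mu>0)"
proof (rule LIMSEQ_I)
  fix e :: real assume "0 < e"
  define w where "w a c = 2 + (a ^ (k + 1) + c ^ (k + 1)) * normal_moment (k + 1)" for a c
  have wlim: "(\<lambda>n. w (a n) (c n)) \<longlonglongrightarrow> w a0 c0" unfolding w_def by (intro tendsto_intros lim)
  have w0: "0 < w a0 c0"
  proof -
    have "0 \<le> a0" "0 \<le> c0" using g0 by (auto simp: gauss2_def)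
    then have "0 \<le> (a0 ^ (k + 1) + c0 ^ (k + 1)) * normal_moment (k + 1)"
      by (intro mult_nonneg_nonneg add_nonneg_nonneg zero_le_power normal_moment_nonneg)
    then show ?thesis by (simp add: w_def)
  qed
  define \<epsilon> where "\<epsilon> = e / (4 * w a0 c0)"
  have "0 < \<epsilon>" using \<open>0 < e\<close> w0 by (simp add: \<epsilon>_def)
  obtain R \<alpha> N where "0 < R" and ap: "\<And>u v. \<bar>sig u * sig v - (\<Sum>i\<le>N. \<alpha> i * sin (u / R) ^ i) * (\<Sum>i\<le>N. \<alpha> i * sin (v / R) ^ i)\<bar>
    \<le> \<epsilon> * (wt u + wt v)" by (rule sin_polynomial_product_approx[OF \<open>0 < \<epsilon>\<close>]) rule
  define f where "f p = sig (fst p) * sig (snd p)" for p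
  define G where "G i j p = sin (fst p / R) ^ i * sin (snd p / R) ^ j" for i j :: nat and p :: "real \<times> real"
  define h where "h p = (\<Sum>i\<le>N. \<Sum>j\<le>N. (\<alpha> i * \<alpha> j) * G i j p)" for p
  have hp: "h p = (\<Sum>i\<le>N. \<alpha> i * sin (fst p / R) ^ i) * (\<Sum>i\<le>N. \<alpha> i * sin (snd p / R) ^ i)" for p
    unfolding h_def G_def sum_product by (simp add: mult_ac)
  have Gi: "integrable \<nu> (G i j)" if "gauss2 \<nu> a' b' c'" for \<nu> a' b' c' i j
  proof -
    interpret prob_space \<nu> using that by (simp add: gauss2_def)
    have "G i j \<in> borel_measurable borel"
      unfolding G_def by (intro borel_measurable_continuous_onI) (auto intro!: continuous_intros simp: divide_inverse)
    moreover have "norm (G i j p) \<le> 1" for p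
      unfolding G_def real_norm_def abs_mult power_abs
      by (intro mult_le_one power_le_one zero_le_power) auto
    ultimately show ?thesis using gauss2_measurable[OF that] by (intro integrable_const_bound[of _ 1]) auto
  qed
  have Gl: "(\<lambda>n. \<integral>p. G i j p \<partial>\<mu> n) \<longlonglongrightarrow> (\<integral>p. G i j p \<partial>\<mu>0)" for i j
  proof -
    have "(\<lambda>n. \<integral>p. complex_of_real (G i j p) \<partial>\<mu> n) \<longlonglongrightarrow> (\<integral>p. complex_of_real (G i j p) \<partial>\<mu>0)"
      using gauss2_trig_tendsto[OF g g0 lim, of 0 0 R i j] by (simp add: G_def)
    then show ?thesis unfolding integral_complex_of_real tendsto_of_real_iff .
  qed
  have hi: "integrable \<nu> h" "(\<integral>p. h p \<partial>\<nu>) = (\<Sum>i\<le>N. \<Sum>j\<le>N. (\<alpha> i * \<alpha> j) * (\<integral>p. G i j p \<partial>\<nu>))"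
    if "gauss2 \<nu> a' b' c'" for \<nu> a' b' c'
    unfolding h_def using Gi[OF that] by simp_all
  have hl: "(\<lambda>n. \<integral>p. h p \<partial>\<mu> n) \<longlonglongrightarrow> (\<integral>p. h p \<partial>\<mu>0)"
    unfolding hi(2)[OF g] hi(2)[OF g0] by (intro tendsto_intros Gl)
  have near: "\<bar>(\<integral>p. f p \<partial>\<nu>) - (\<integral>p. h p \<partial>\<nu>)\<bar> \<le> \<epsilon> * w a' c'" if "gauss2 \<nu> a' b' c'" for \<nu> a' b' c'
  proof -
    have fi: "integrable \<nu> f" unfolding f_def by (rule gauss2_integrable_product(1)[OF that])
    have "\<bar>(\<integral>p. f p \<partial>\<nu>) - (\<integral>p. h p \<partial>\<nu>)\<bar> = \<bar>\<integral>p. f p - h p \<partial>\<nu>\<bar>" using fi hi(1)[OF that] by simp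
    also have "\<dots> \<le> (\<integral>p. \<bar>f p - h p\<bar> \<partial>\<nu>)" by (rule integral_abs_bound)
    also have "\<dots> \<le> (\<integral>p. \<epsilon> * (wt (fst p) + wt (snd p)) \<partial>\<nu>)"
    proof (rule integral_mono)
      show "integrable \<nu> (\<lambda>p. \<bar>f p - h p\<bar>)" using fi hi(1)[OF that] by simp
      show "integrable \<nu> (\<lambda>p. \<epsilon> * (wt (fst p) + wt (snd p)))" using gauss2_integrable_wt(1)[OF that] by simp
      show "\<bar>f p - h p\<bar> \<le> \<epsilon> * (wt (fst p) + wt (snd p))" for p using ap by (simp add: f_def hp)
    qed
    also have "\<dots> = \<epsilon> * w a' c'" using gauss2_integrable_wt(2)[OF that] by (simp add: w_def)
    finally show ?thesis .
  qed
  have "(\<lambda>n. \<bar>(\<integral>p. h p \<partial>\<mu> n) - (\<integral>p. h p \<partial>\<mu>0)\<bar> + \<epsilon> * w (a n) (c n)) \<longlonglongrightarrow> \<bar>(\<integral>p. h p \<partial>\<mu>0) - (\<integral>p. h p \<partial>\<mu>0)\<bar> + \<epsilon> * w a0 c0"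
    by (intro tendsto_intros hl wlim)
  then have "(\<lambda>n. \<bar>(\<integral>p. h p \<partial>\<mu> n) - (\<integral>p. h p \<partial>\<mu>0)\<bar> + \<epsilon> * w (a n) (c n)) \<longlonglongrightarrow> e / 4"
    using w0 by (simp add: \<epsilon>_def)
  then have "\<forall>\<^sub>F n in sequentially. \<bar>(\<integral>p. h p \<partial>\<mu> n) - (\<integral>p. h p \<partial>\<mu>0)\<bar> + \<epsilon> * w (a n) (c n) < e / 2"
    using \<open>0 < e\<close> by (intro order_tendstoD) auto
  then obtain n0 where n0: "\<And>n. n \<ge> n0 \<Longrightarrow> \<bar>(\<integral>p. h p \<partial>\<mu> n) - (\<integral>p. h p \<partial>\<mu>0)\<bar> + \<epsilon> * w (a n) (c n) < e / 2"
    by (auto simp: eventually_sequentially)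
  have "\<epsilon> * w a0 c0 = e / 4" using w0 by (simp add: \<epsilon>_def)
  then have "\<bar>(\<integral>p. f p \<partial>\<mu> n) - (\<integral>p. f p \<partial>\<mu>0)\<bar> < e" if "n \<ge> n0" for n
    using near[OF g, of n] near[OF g0] n0[OF that] \<open>0 < e\<close> by linarith
  then show "\<exists>n0. \<forall>n\<ge>n0. norm ((\<integral>p. sig (fst p) * sig (snd p) \<partial>\<mu> n) - (\<integral>p. sig (fst p) * sig (snd p) \<partial>\<mu>0)) < e"
    by (auto simp: f_def)
qed

lemma gauss2_product_continuous:
  assumes g0: "gauss2 \<mu>0 a0 b0 c0" and "0 < \<epsilon>"
  obtains \<delta> where "0 < \<delta>" "\<And>\<mu> a b c. gauss2 \<mu> a b c \<Longrightarrow> (a - a0)\<^sup>2 + (b - b0)\<^sup>2 + (c - c0)\<^sup>2 < \<delta> \<Longrightarrow>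
    \<bar>(\<integral>p. sig (fst p) * sig (snd p) \<partial>\<mu>) - (\<integral>p. sig (fst p) * sig (snd p) \<partial>\<mu>0)\<bar> < \<epsilon>"
proof (rule ccontr)
  assume contra: "\<not> thesis"
  define E where "E \<mu> = (\<integral>p. sig (fst p) * sig (snd p) \<partial>\<mu>)" for \<mu>
  have "\<exists>\<mu> a b c. gauss2 \<mu> a b c \<and> (a - a0)\<^sup>2 + (b - b0)\<^sup>2 + (c - c0)\<^sup>2 < 1 / Suc n \<and> \<not> \<bar>E \<mu> - E \<mu>0\<bar> < \<epsilon>" for n
    using contra that[of "1 / Suc n"] unfolding E_def by force
  then obtain \<mu> a b c where g: "\<And>n. gauss2 (\<mu> n) (a n) (b n) (c n)"
    and d: "\<And>n. (a n - a0)\<^sup>2 + (b n - b0)\<^sup>2 + (c n - c0)\<^sup>2 < 1 / Suc n" and far: "\<And>n. \<not> \<bar>E (\<mu> n) - E \<mu>0\<bar> < \<epsilon>"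
    by metis
  have lim0: "(\<lambda>n. 1 / Suc n) \<longlonglongrightarrow> (0::real)" by (rule LIMSEQ_Suc[OF lim_1_over_n])
  have sqz: "f \<longlonglongrightarrow> f0" if "\<And>n. (f n - f0)\<^sup>2 \<le> 1 / Suc n" for f :: "nat \<Rightarrow> real" and f0
  proof -
    have "(\<lambda>n. (f n - f0)\<^sup>2) \<longlonglongrightarrow> 0"
      by (rule real_tendsto_sandwich[OF always_eventually[OF allI[OF zero_le_power2]]
            always_eventually[OF allI[OF that]] tendsto_const lim0])
    from tendsto_real_sqrt[OF this] have "(\<lambda>n. \<bar>f n - f0\<bar>) \<longlonglongrightarrow> 0" by simp
    then show ?thesis by (rule LIM_zero_cancel[OF tendsto_rabs_zero_cancel])
  qed
  have "(a n - a0)\<^sup>2 \<le> 1 / Suc n" "(b n - b0)\<^sup>2 \<le> 1 / Suc n" "(c n - c0)\<^sup>2 \<le> 1 / Suc n" for n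
    using d[of n] zero_le_power2[of "a n - a0"] zero_le_power2[of "b n - b0"] zero_le_power2[of "c n - c0"] by linarith+
  then have "(\<lambda>n. E (\<mu> n)) \<longlonglongrightarrow> E \<mu>0" unfolding E_def by (intro gauss2_product_tendsto[OF g g0] sqz)
  from LIMSEQ_D[OF this \<open>0 < \<epsilon>\<close>] far show False by auto
qed

text \<open>An estimate that survives taking expectations over random covariances: near the reference
  covariance the integral is continuous, and away from it the squared distance of the covariances
  pays for the crude moment bound.\<close>

lemma gauss2_product_stability:
  assumes g0: "gauss2 \<mu>0 a0 b0 c0" and "0 < \<epsilon>"
  obtains \<kappa> where "0 \<le> \<kappa>" "\<And>\<mu> a b c. gauss2 \<mu> a b c \<Longrightarrow>
    ((\<integral>p. sig (fst p) * sig (snd p) \<partial>\<mu>) - (\<integral>p. sig (fst p) * sig (snd p) \<partial>\<mu>0))\<^sup>2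
    \<le> \<epsilon> * (1 + a ^ (4 * (k + 1)) + c ^ (4 * (k + 1))) + \<kappa> * ((a - a0)\<^sup>2 + (b - b0)\<^sup>2 + (c - c0)\<^sup>2)"
proof -
  define E where "E \<mu> = (\<integral>p. sig (fst p) * sig (snd p) \<partial>\<mu>)" for \<mu>
  define m where "m = normal_moment (k + 1)"
  define C where "C = A * (2 + m) + \<bar>E \<mu>0\<bar>"
  have m0: "0 \<le> m" by (simp add: m_def normal_moment_nonneg)
  have C0: "0 \<le> C" using A m0 by (simp add: C_def)
  \<comment> \<open>The factor 27 comes from (1 + x + y)^4 <= 27 (1 + x^4 + y^4).\<close>
  define \<epsilon>' where "\<epsilon>' = \<epsilon> / (27 * C ^ 4 + 1)"
  have C4: "0 < 27 * C ^ 4 + 1" using C0 by (simp add: add_nonneg_pos)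
  have e': "0 < \<epsilon>'" using \<open>0 < \<epsilon>\<close> C4 by (simp add: \<epsilon>'_def)
  have e'C: "\<epsilon>' * (27 * C ^ 4) \<le> \<epsilon>"
  proof -
    have "\<epsilon>' * (27 * C ^ 4) \<le> \<epsilon>' * (27 * C ^ 4 + 1)" using e' by simp
    also have "\<dots> = \<epsilon>" using C4 by (simp add: \<epsilon>'_def)
    finally show ?thesis .
  qed
  have "0 < sqrt \<epsilon>" using \<open>0 < \<epsilon>\<close> by simp
  obtain \<delta> where \<delta>: "0 < \<delta>"
    "\<And>\<mu> a b c. gauss2 \<mu> a b c \<Longrightarrow> (a - a0)\<^sup>2 + (b - b0)\<^sup>2 + (c - c0)\<^sup>2 < \<delta> \<Longrightarrow> \<bar>E \<mu> - E \<mu>0\<bar> < sqrt \<epsilon>"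
    by (rule gauss2_product_continuous[OF g0 \<open>0 < sqrt \<epsilon>\<close>, folded E_def]) rule
  define \<kappa> where "\<kappa> = 1 / (4 * \<epsilon>' * \<delta>)"
  have k0: "0 \<le> \<kappa>" using e' \<delta>(1) by (simp add: \<kappa>_def)
  have main: "(E \<mu> - E \<mu>0)\<^sup>2 \<le> \<epsilon> * (1 + a ^ (4 * (k + 1)) + c ^ (4 * (k + 1))) + \<kappa> * ((a - a0)\<^sup>2 + (b - b0)\<^sup>2 + (c - c0)\<^sup>2)"
    if g: "gauss2 \<mu> a b c" for \<mu> a b c
  proof -
    define d where "d = (a - a0)\<^sup>2 + (b - b0)\<^sup>2 + (c - c0)\<^sup>2"
    have d0: "0 \<le> d" by (simp add: d_def)
    have ac: "0 \<le> a" "0 \<le> c" using g by (auto simp: gauss2_def)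
    define x y where "x = a ^ (k + 1)" and "y = c ^ (k + 1)"
    have xy: "0 \<le> x" "0 \<le> y" using ac by (simp_all add: x_def y_def)
    have x4: "a ^ (4 * (k + 1)) = x ^ 4" "c ^ (4 * (k + 1)) = y ^ 4" by (simp_all only: x_def y_def power_mult[symmetric] mult.commute[of 4])
    show ?thesis
    proof (cases "d < \<delta>")
      case True
      have "\<bar>E \<mu> - E \<mu>0\<bar>\<^sup>2 \<le> (sqrt \<epsilon>)\<^sup>2" using \<delta>(2)[OF g] True by (intro power_mono) (auto simp: d_def)
      then have "(E \<mu> - E \<mu>0)\<^sup>2 \<le> \<epsilon> * 1" using \<open>0 < \<epsilon>\<close> by simp
      also have "\<dots> \<le> \<epsilon> * (1 + x ^ 4 + y ^ 4)" using \<open>0 < \<epsilon>\<close> xy by (intro mult_left_mono) auto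
      also have "\<dots> \<le> \<epsilon> * (1 + x ^ 4 + y ^ 4) + \<kappa> * d" using k0 d0 by simp
      finally show ?thesis by (simp only: x4 d_def)
    next
      case False
      define Z where "Z = (C * (1 + x + y))\<^sup>2"
      have "\<bar>E \<mu>\<bar> \<le> A * (2 + (x + y) * m)" using gauss2_integrable_product(2)[OF g] by (simp add: E_def x_def y_def m_def)
      also have "\<dots> \<le> A * (2 + m) * (1 + x + y)"
      proof -
        have "2 + (x + y) * m \<le> (2 + m) * (1 + x + y)" using m0 xy by (simp add: algebra_simps)
        then show ?thesis using A by (simp add: mult_left_mono mult.assoc)
      qed
      finally have "\<bar>E \<mu>\<bar> \<le> A * (2 + m) * (1 + x + y)" .
      moreover have "\<bar>E \<mu>0\<bar> * 1 \<le> \<bar>E \<mu>0\<bar> * (1 + x + y)" using xy by (intro mult_left_mono) auto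
      ultimately have "\<bar>E \<mu> - E \<mu>0\<bar> \<le> C * (1 + x + y)" unfolding C_def distrib_right by linarith
      then have Z: "(E \<mu> - E \<mu>0)\<^sup>2 \<le> Z" unfolding Z_def using power_mono[of "\<bar>E \<mu> - E \<mu>0\<bar>" _ 2] by simp
      \<comment> \<open>The crude bound is traded for its square with a small coefficient and a
        constant; the constant is paid for by d, which is at least \<delta> here.\<close>
      have "Z \<le> \<epsilon>' * Z\<^sup>2 + 1 / (4 * \<epsilon>')"
      proof -
        have "0 \<le> (2 * \<epsilon>' * Z - 1)\<^sup>2 / (4 * \<epsilon>')" using e' by simp
        also have "\<dots> = \<epsilon>' * Z\<^sup>2 - Z + 1 / (4 * \<epsilon>')" using e' by (simp add: power2_eq_square field_simps)
        finally show ?thesis by simp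
      qed
      moreover have "1 / (4 * \<epsilon>') \<le> \<kappa> * d"
      proof -
        have "1 / (4 * \<epsilon>') = \<kappa> * \<delta>" using \<delta>(1) e' by (simp add: \<kappa>_def)
        then show ?thesis using False k0 by (simp add: mult_left_mono)
      qed
      moreover have "\<epsilon>' * Z\<^sup>2 \<le> \<epsilon> * (1 + x ^ 4 + y ^ 4)"
      proof -
        have sq3: "(u + v + w)\<^sup>2 \<le> 3 * (u\<^sup>2 + v\<^sup>2 + w\<^sup>2)" for u v w :: real
          using zero_le_power2[of "u - v"] zero_le_power2[of "v - w"] zero_le_power2[of "u - w"]
          by (simp add: power2_eq_square algebra_simps)
        have "((1 + x + y)\<^sup>2)\<^sup>2 \<le> (3 * (1\<^sup>2 + x\<^sup>2 + y\<^sup>2))\<^sup>2" by (intro power_mono sq3) simp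
        also have "\<dots> = 9 * (1\<^sup>2 + x\<^sup>2 + y\<^sup>2)\<^sup>2" by (simp only: power_mult_distrib) simp
        also have "\<dots> \<le> 9 * (3 * ((1\<^sup>2)\<^sup>2 + (x\<^sup>2)\<^sup>2 + (y\<^sup>2)\<^sup>2))" by (intro mult_left_mono sq3) simp
        finally have p: "(1 + x + y) ^ 4 \<le> 27 * (1 + x ^ 4 + y ^ 4)" by simp
        have "\<epsilon>' * Z\<^sup>2 = \<epsilon>' * C ^ 4 * (1 + x + y) ^ 4" by (simp add: Z_def power_mult_distrib)
        also have "\<dots> \<le> \<epsilon>' * C ^ 4 * (27 * (1 + x ^ 4 + y ^ 4))" using e' C0 by (intro mult_left_mono p) auto
        also have "\<dots> = (\<epsilon>' * (27 * C ^ 4)) * (1 + x ^ 4 + y ^ 4)" by simp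
        also have "\<dots> \<le> \<epsilon> * (1 + x ^ 4 + y ^ 4)" using e'C xy by (intro mult_right_mono) auto
        finally show ?thesis .
      qed
      ultimately show ?thesis using Z unfolding x4 d_def[symmetric] by linarith
    qed
  qed
  show ?thesis using main by (intro that[OF k0]) (simp add: E_def)
qed

end

section \<open>Random networks of fixed width\<close>

lemma normal_eq_distr_std_normal:
  assumes "0 < \<sigma>"
  shows "density lborel (normal_density 0 \<sigma>) = distr std_normal_distribution lborel (\<lambda>z. \<sigma> * z)"
proof -
  interpret prob_space std_normal_distribution by (rule prob_space_normal_density) simp
  have "distributed std_normal_distribution lborel (\<lambda>x. x) std_normal_density"
    unfolding distributed_def by (auto intro!: distr_id2)
  from normal_density_affine[OF this zero_less_one, of \<sigma> 0] assms
  show ?thesis by (simp add: distributed_def)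
qed

lemma normal_characteristic:
  assumes "0 < \<sigma>"
  shows "(\<integral>z. cis (d * z) \<partial>density lborel (normal_density 0 \<sigma>)) = complex_of_real (exp (- (\<sigma>\<^sup>2 * d\<^sup>2) / 2))"
proof -
  have "(\<integral>z. cis (d * z) \<partial>density lborel (normal_density 0 \<sigma>)) = (\<integral>z. cis (d * (\<sigma> * z)) \<partial>std_normal_distribution)"
    unfolding normal_eq_distr_std_normal[OF assms]
    by (intro integral_distr) (auto simp: cis_conv_exp)
  also have "\<dots> = char std_normal_distribution (d * \<sigma>)"
    by (simp add: char_def cis_conv_exp mult.assoc)
  also have "\<dots> = complex_of_real (exp (- (d * \<sigma>)\<^sup>2 / 2))" by (simp only: char_std_normal_distribution)
  finally show ?thesis by (simp add: power_mult_distrib mult.commute)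
qed

text \<open>Jensen's inequality for the q-th power.\<close>

lemma power_average_le:
  fixes f :: "nat \<Rightarrow> real"
  assumes f: "\<And>i. i \<in> {1..n} \<Longrightarrow> 0 \<le> f i" and n: "0 < n"
  shows "((\<Sum>i=1..n. f i) / n) ^ q \<le> (\<Sum>i=1..n. f i ^ q) / n"
proof -
  have "convex_on {0::real..} (\<lambda>x. x ^ q)"
    using convex_power_odd convex_on_subset[OF convex_power_even] by (cases "even q") auto
  from convex_on_sum[OF _ _ this, of "{1..n}" "\<lambda>_. 1 / n" f]
  have "(\<Sum>i\<in>{1..n}. (1 / n) *\<^sub>R f i) ^ q \<le> (\<Sum>i\<in>{1..n}. 1 / n * f i ^ q)"
    using f n by auto
  then show ?thesis by (simp add: sum_divide_distrib)
qed

text \<open>With the input as activation of layer 0, the first layer obeys the same recursion as the others.\<close>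

definition act :: "(nat \<Rightarrow> 'n) \<Rightarrow> (real \<Rightarrow> real) \<Rightarrow> (nat \<Rightarrow> nat) \<Rightarrow> (nat \<Rightarrow> nat \<Rightarrow> nat \<Rightarrow> real) \<Rightarrow>
    nat \<Rightarrow> nat \<Rightarrow> real^'n::finite \<Rightarrow> real" where
  "act ix sig n w l j x = (if l = 0 then x $ ix j else sig (preact ix sig n w l j x))"

lemma preact_Suc:
  "preact ix sig n w (Suc l) i x = (\<Sum>j=1..n l. w l i j * act ix sig n w l j x) / sqrt (real (n l))"
  by (cases l) (simp_all add: act_def)

lemma preact_cong:
  assumes "\<And>l' i' j'. l' < l \<Longrightarrow> w l' i' j' = w' l' i' j'"
  shows "preact ix sig n w l i x = preact ix sig n w' l i x"
  using assms
proof (induction l arbitrary: i)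
  case (Suc l)
  have "act ix sig n w l j x = act ix sig n w' l j x" for j
    unfolding act_def using Suc by simp
  then show ?case unfolding preact_Suc using Suc.prems by simp
qed simp

lemma act_cong:
  assumes "\<And>l' i' j'. l' < l \<Longrightarrow> w l' i' j' = w' l' i' j'"
  shows "act ix sig n w l j x = act ix sig n w' l j x"
proof -
  have "preact ix sig n w l j x = preact ix sig n w' l j x" by (rule preact_cong) (rule assms)
  then show ?thesis by (simp add: act_def)
qed

locale network = growth sig A k for sig A k +
  fixes ix :: "nat \<Rightarrow> 'n::finite" and lam :: "nat \<Rightarrow> real" and n :: "nat \<Rightarrow> nat" and L :: nat
  assumes lam: "\<And>l. 0 < lam l"
begin

text \<open>All weights form one family, indexed by layer, target neuron and source neuron, whose joint law is a
  product measure.\<close>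

definition I :: "(nat \<times> nat \<times> nat) set" where
  "I = {(l, i, j). l \<le> L \<and> i \<in> {1..n (Suc l)} \<and> j \<in> {1..n l}}"

definition Mw :: "nat \<times> nat \<times> nat \<Rightarrow> real measure" where
  "Mw t = density lborel (normal_density 0 (sqrt (1 / lam (fst t))))"

definition row :: "nat \<Rightarrow> nat \<Rightarrow> (nat \<times> nat \<times> nat) set" where
  "row l i = (\<lambda>j. (l, i, j)) ` {1..n l}"

definition curried :: "(nat \<times> nat \<times> nat \<Rightarrow> real) \<Rightarrow> nat \<Rightarrow> nat \<Rightarrow> nat \<Rightarrow> real" where
  "curried v l i j = v (l, i, j)"

definition pre :: "(nat \<times> nat \<times> nat \<Rightarrow> real) \<Rightarrow> nat \<Rightarrow> nat \<Rightarrow> real^'n \<Rightarrow> real" where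
  "pre v = preact ix sig n (curried v)"

definition activ :: "(nat \<times> nat \<times> nat \<Rightarrow> real) \<Rightarrow> nat \<Rightarrow> nat \<Rightarrow> real^'n \<Rightarrow> real" where
  "activ v = act ix sig n (curried v)"

text \<open>The kernel of layer l + 1 in the usual numbering; for l = 0 it is the input kernel.\<close>

definition ker :: "(nat \<times> nat \<times> nat \<Rightarrow> real) \<Rightarrow> nat \<Rightarrow> real^'n \<Rightarrow> real^'n \<Rightarrow> real" where
  "ker v l x y = (\<Sum>j=1..n l. activ v l j x * activ v l j y) / (lam l * real (n l))"

definition resample :: "(nat \<times> nat \<times> nat) set \<Rightarrow> (nat \<times> nat \<times> nat \<Rightarrow> real) \<Rightarrow> (nat \<times> nat \<times> nat \<Rightarrow> real) \<Rightarrow> nat \<times> nat \<times> nat \<Rightarrow> real" where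
  "resample R w v = (\<lambda>t. if t \<in> R then w t else v t)"

abbreviation "PM \<equiv> Pi\<^sub>M I Mw"

lemma finite_I: "finite I"
proof -
  have "I \<subseteq> (\<Union>l\<le>L. \<Union>i\<in>{1..n (Suc l)}. \<Union>j\<in>{1..n l}. {(l, i, j)})" by (auto simp: I_def)
  then show ?thesis by (rule finite_subset) auto
qed

lemma finite_row: "finite (row l i)"
  by (simp add: row_def)

lemma row_subset: "l \<le> L \<Longrightarrow> i \<in> {1..n (Suc l)} \<Longrightarrow> row l i \<subseteq> I"
  by (auto simp: row_def I_def)

lemma Mw_prob: "prob_space (Mw t)"
  unfolding Mw_def using lam by (intro prob_space_normal_density) simp

lemma sets_Mw [measurable_cong]: "sets (Mw t) = sets borel"
  by (simp add: Mw_def)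

sublocale product_prob_space Mw I
  by (rule product_prob_spaceI[OF Mw_prob])

lemma PiM_prob: "prob_space (Pi\<^sub>M J Mw)"
  by (rule prob_space_PiM[OF Mw_prob])

lemma coord_measurable: "(\<lambda>v. v t) \<in> borel_measurable (Pi\<^sub>M J Mw)"
proof (cases "t \<in> J")
  case True
  have "(\<lambda>v. v t) \<in> Pi\<^sub>M J Mw \<rightarrow>\<^sub>M Mw t" using True by (rule measurable_component_singleton)
  then show ?thesis using measurable_cong_sets[OF refl sets_Mw] by blast
next
  case False
  have "(\<lambda>v. v t) \<in> borel_measurable (Pi\<^sub>M J Mw) \<longleftrightarrow> (\<lambda>v. undefined::real) \<in> borel_measurable (Pi\<^sub>M J Mw)"
  proof (intro measurable_cong)
    fix w assume "w \<in> space (Pi\<^sub>M J Mw)"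
    then show "w t = undefined" using False unfolding space_PiM by (rule PiE_arb)
  qed
  then show ?thesis by simp
qed

lemma pre_measurable:
  assumes f: "\<And>t. (\<lambda>q. f q t) \<in> borel_measurable Q"
  shows "(\<lambda>q. pre (f q) l i x) \<in> borel_measurable Q"
proof (induction l arbitrary: i)
  case (Suc l)
  have a: "(\<lambda>q. act ix sig n (curried (f q)) l j x) \<in> borel_measurable Q" for j
    using measurable_compose[OF Suc sig_measurable] by (simp add: act_def pre_def)
  have "(\<lambda>q. curried (f q) l i j) \<in> borel_measurable Q" for j using f by (simp add: curried_def)
  then show ?case unfolding pre_def preact_Suc using a
    by (intro borel_measurable_divide borel_measurable_sum borel_measurable_times) auto
qed (simp add: pre_def)

lemma activ_measurable:
  assumes f: "\<And>t. (\<lambda>q. f q t) \<in> borel_measurable Q"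
  shows "(\<lambda>q. activ (f q) l j x) \<in> borel_measurable Q"
  using measurable_compose[OF pre_measurable[of f Q l j x, OF f] sig_measurable]
  by (simp add: activ_def act_def pre_def)

lemma ker_measurable:
  assumes f: "\<And>t. (\<lambda>q. f q t) \<in> borel_measurable Q"
  shows "(\<lambda>q. ker (f q) l x y) \<in> borel_measurable Q"
  unfolding ker_def
  by (intro borel_measurable_divide borel_measurable_sum borel_measurable_times activ_measurable f) auto

lemma resample_measurable:
  "(\<lambda>p. resample R (snd p) (fst p) t) \<in> borel_measurable (Pi\<^sub>M J Mw \<Otimes>\<^sub>M Pi\<^sub>M R Mw)"
proof (cases "t \<in> R")
  case True
  have "(\<lambda>p. snd p t) \<in> borel_measurable (Pi\<^sub>M J Mw \<Otimes>\<^sub>M Pi\<^sub>M R Mw)"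
    by (rule measurable_compose[OF measurable_snd coord_measurable])
  then show ?thesis using True by (simp add: resample_def)
next
  case False
  have "(\<lambda>p. fst p t) \<in> borel_measurable (Pi\<^sub>M J Mw \<Otimes>\<^sub>M Pi\<^sub>M R Mw)"
    by (rule measurable_compose[OF measurable_fst coord_measurable])
  then show ?thesis using False by (simp add: resample_def)
qed

lemma merge_resample:
  assumes "R \<subseteq> I" "v \<in> space PM"
  shows "merge (I - R) R (restrict v (I - R), w) = resample R w v"
proof
  fix t
  show "merge (I - R) R (restrict v (I - R), w) t = resample R w v t"
  proof (cases "t \<in> I")
    case False
    then have "v t = undefined" using assms(2) unfolding space_PiM by (rule PiE_arb[rotated])
    then show ?thesis using False assms(1) by (auto simp: merge_def resample_def)
  qed (simp add: merge_def resample_def)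
qed

lemma distr_restrict: "R \<subseteq> I \<Longrightarrow> distr PM (Pi\<^sub>M (I - R) Mw) (\<lambda>v. restrict v (I - R)) = Pi\<^sub>M (I - R) Mw"
  using finite_I by (intro distr_PiM_restrict_finite) auto

text \<open>An independent copy of the block R leaves the joint law unchanged.  With R the weights that enter
  one neuron, the inner integral is the conditional expectation given all other weights.\<close>

lemma integral_resample:
  fixes f :: "_ \<Rightarrow> real"
  assumes R: "R \<subseteq> I" and f: "integrable PM f"
  shows "(\<integral>v. f v \<partial>PM) = (\<integral>v. (\<integral>w. f (resample R w v) \<partial>Pi\<^sub>M R Mw) \<partial>PM)"
proof -
  have fin: "finite (I - R)" "finite R" using finite_I R finite_subset by auto
  have un: "(I - R) \<union> R = I" using R by auto
  define g where "g b = (\<integral>w. f (merge (I - R) R (b, w)) \<partial>Pi\<^sub>M R Mw)" for b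
  have "(\<integral>v. f v \<partial>PM) = (\<integral>b. g b \<partial>Pi\<^sub>M (I - R) Mw)"
    unfolding g_def by (rule product_integral_fold[of "I - R" R f, unfolded un, OF _ fin f]) auto
  also have "\<dots> = (\<integral>b. g b \<partial>distr PM (Pi\<^sub>M (I - R) Mw) (\<lambda>v. restrict v (I - R)))"
    by (simp add: distr_restrict[OF R])
  also have "\<dots> = (\<integral>v. g (restrict v (I - R)) \<partial>PM)"
  proof (rule integral_distr)
    show "(\<lambda>v. restrict v (I - R)) \<in> PM \<rightarrow>\<^sub>M Pi\<^sub>M (I - R) Mw" by (rule measurable_restrict_subset) auto
    have "(\<lambda>p. f (merge (I - R) R p)) \<in> borel_measurable (Pi\<^sub>M (I - R) Mw \<Otimes>\<^sub>M Pi\<^sub>M R Mw)"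
      by (rule measurable_compose[OF measurable_merge[of "I - R" R Mw, unfolded un] borel_measurable_integrable[OF f]])
    then show "g \<in> borel_measurable (Pi\<^sub>M (I - R) Mw)"
      unfolding g_def using prob_space_imp_sigma_finite[OF PiM_prob]
      by (intro sigma_finite_measure.borel_measurable_lebesgue_integral) (auto simp: case_prod_unfold)
  qed
  also have "\<dots> = (\<integral>v. (\<integral>w. f (resample R w v) \<partial>Pi\<^sub>M R Mw) \<partial>PM)"
    unfolding g_def using merge_resample[OF R] by (intro Bochner_Integration.integral_cong) auto
  finally show ?thesis .
qed

lemma nn_integral_resample:
  assumes R: "R \<subseteq> I" and f: "f \<in> borel_measurable PM"
  shows "(\<integral>\<^sup>+v. f v \<partial>PM) = (\<integral>\<^sup>+v. (\<integral>\<^sup>+w. f (resample R w v) \<partial>Pi\<^sub>M R Mw) \<partial>PM)"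
proof -
  have fin: "finite (I - R)" "finite R" using finite_I R finite_subset by auto
  have un: "(I - R) \<union> R = I" using R by auto
  define g where "g b = (\<integral>\<^sup>+w. f (merge (I - R) R (b, w)) \<partial>Pi\<^sub>M R Mw)" for b
  have "(\<integral>\<^sup>+v. f v \<partial>PM) = (\<integral>\<^sup>+b. g b \<partial>Pi\<^sub>M (I - R) Mw)"
    unfolding g_def by (rule product_nn_integral_fold[of "I - R" R f, unfolded un, OF _ fin f]) auto
  also have "\<dots> = (\<integral>\<^sup>+b. g b \<partial>distr PM (Pi\<^sub>M (I - R) Mw) (\<lambda>v. restrict v (I - R)))"
    by (simp add: distr_restrict[OF R])
  also have "\<dots> = (\<integral>\<^sup>+v. g (restrict v (I - R)) \<partial>PM)"
  proof (rule nn_integral_distr)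
    show "(\<lambda>v. restrict v (I - R)) \<in> PM \<rightarrow>\<^sub>M Pi\<^sub>M (I - R) Mw" by (rule measurable_restrict_subset) auto
    have "(\<lambda>p. f (merge (I - R) R p)) \<in> borel_measurable (Pi\<^sub>M (I - R) Mw \<Otimes>\<^sub>M Pi\<^sub>M R Mw)"
      by (rule measurable_compose[OF measurable_merge[of "I - R" R Mw, unfolded un] f])
    then have "g \<in> borel_measurable (Pi\<^sub>M (I - R) Mw)"
      unfolding g_def using prob_space_imp_sigma_finite[OF PiM_prob]
      by (intro sigma_finite_measure.borel_measurable_nn_integral) (auto simp: case_prod_unfold)
    then show "g \<in> borel_measurable (distr PM (Pi\<^sub>M (I - R) Mw) (\<lambda>v. restrict v (I - R)))" by simp
  qed
  also have "\<dots> = (\<integral>\<^sup>+v. (\<integral>\<^sup>+w. f (resample R w v) \<partial>Pi\<^sub>M R Mw) \<partial>PM)"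
    unfolding g_def using merge_resample[OF R] by (intro nn_integral_cong) auto
  finally show ?thesis .
qed

lemma pre_resample_row:
  "pre (resample (row l i) w v) (Suc l) i x = (\<Sum>j=1..n l. w (l, i, j) * activ v l j x) / sqrt (real (n l))"
proof -
  have "act ix sig n (curried (resample (row l i) w v)) l j x = activ v l j x" for j
    unfolding activ_def by (rule act_cong) (auto simp: curried_def resample_def row_def)
  then show ?thesis
    unfolding pre_def preact_Suc by (intro arg_cong2[where f="(/)"] sum.cong refl)
      (auto simp: curried_def resample_def row_def)
qed

lemma pre_resample_other_row:
  assumes "i' \<noteq> i"
  shows "pre (resample (row l i) w v) (Suc l) i' x = pre v (Suc l) i' x"
proof -
  have "act ix sig n (curried (resample (row l i) w v)) l j x = act ix sig n (curried v) l j x" for j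
    by (rule act_cong) (auto simp: curried_def resample_def row_def)
  then show ?thesis
    unfolding pre_def preact_Suc using assms by (simp add: curried_def resample_def row_def image_iff)
qed

lemma resample_twice_pre:
  assumes "i' \<noteq> i"
  shows "pre (resample (row l i) w (resample (row l i') w' v)) (Suc l) i x = pre (resample (row l i) w v) (Suc l) i x"
proof -
  have "activ (resample (row l i') w' v) l j x = activ v l j x" for j
    unfolding activ_def by (rule act_cong) (auto simp: curried_def resample_def row_def)
  then show ?thesis unfolding pre_resample_row by simp
qed

definition pair_law :: "nat \<Rightarrow> nat \<Rightarrow> real^'n \<Rightarrow> real^'n \<Rightarrow> (nat \<times> nat \<times> nat \<Rightarrow> real) \<Rightarrow> (real \<times> real) measure" where
  "pair_law l i x y v = distr (Pi\<^sub>M (row l i) Mw) borel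
     (\<lambda>w. (pre (resample (row l i) w v) (Suc l) i x, pre (resample (row l i) w v) (Suc l) i y))"

lemma pre_row_measurable: "(\<lambda>w. pre (resample R w v) l i x) \<in> borel_measurable (Pi\<^sub>M R Mw)"
proof (rule pre_measurable)
  show "(\<lambda>w. resample R w v t) \<in> borel_measurable (Pi\<^sub>M R Mw)" for t
    unfolding resample_def by (cases "t \<in> R") (simp_all add: coord_measurable)
qed

lemma pair_measurable:
  "(\<lambda>w. (pre (resample R w v) l i x, pre (resample R w v) l i y)) \<in> Pi\<^sub>M R Mw \<rightarrow>\<^sub>M borel"
  unfolding borel_prod[symmetric] by (intro measurable_Pair pre_row_measurable)

lemma ker_nonneg: "0 \<le> ker v l x x"
  unfolding ker_def using lam[of l] by (intro divide_nonneg_nonneg sum_nonneg) auto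

text \<open>Given the earlier layers, a neuron is a linear combination of its independent Gaussian weights, so
  its characteristic function is a product of one-dimensional ones, and the squared coefficients add
  up to the kernel.\<close>

lemma gauss2_pair_law: "gauss2 (pair_law l i x y v) (ker v l x x) (ker v l x y) (ker v l y y)"
  unfolding gauss2_def
proof (intro conjI allI ker_nonneg)
  let ?R = "row l i"
  interpret R: prob_space "Pi\<^sub>M ?R Mw" by (rule PiM_prob)
  show "prob_space (pair_law l i x y v)" unfolding pair_law_def by (rule R.prob_space_distr[OF pair_measurable])
  show "sets (pair_law l i x y v) = sets borel" by (simp add: pair_law_def)
  fix s t
  define d where "d j = (s * activ v l j x + t * activ v l j y) / sqrt (real (n l))" for j
  have lin: "s * pre (resample ?R w v) (Suc l) i x + t * pre (resample ?R w v) (Suc l) i y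
      = (\<Sum>j=1..n l. d j * w (l, i, j))" for w
    unfolding pre_resample_row d_def
    by (simp add: sum_divide_distrib sum_distrib_left sum.distrib[symmetric] add_divide_distrib algebra_simps)
  have cis_sum: "cis (\<Sum>j\<in>J. g j) = (\<Prod>j\<in>J. cis (g j))" for J :: "nat set" and g
    by (induction J rule: infinite_finite_induct) (auto simp: cis_mult[symmetric])
  have inj: "inj_on (\<lambda>j. (l, i, j)) {1..n l}" by (auto simp: inj_on_def)
  have over_row: "(\<Prod>\<tau>\<in>?R. g \<tau>) = (\<Prod>j=1..n l. g (l, i, j))" for g :: "nat \<times> nat \<times> nat \<Rightarrow> complex"
    unfolding row_def prod.reindex[OF inj] by (simp add: o_def)
  have "(\<integral>p. cis (s * fst p + t * snd p) \<partial>pair_law l i x y v)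
      = (\<integral>w. cis (s * pre (resample ?R w v) (Suc l) i x + t * pre (resample ?R w v) (Suc l) i y) \<partial>Pi\<^sub>M ?R Mw)"
    unfolding pair_law_def
    by (subst integral_distr[OF pair_measurable])
      (auto intro!: borel_measurable_continuous_onI continuous_intros simp: cis_conv_exp)
  also have "\<dots> = (\<integral>w. (\<Prod>\<tau>\<in>?R. cis (d (snd (snd \<tau>)) * w \<tau>)) \<partial>Pi\<^sub>M ?R Mw)"
    unfolding lin cis_sum over_row by simp
  also have "\<dots> = (\<Prod>\<tau>\<in>?R. \<integral>z. cis (d (snd (snd \<tau>)) * z) \<partial>Mw \<tau>)"
  proof (rule product_integral_prod[OF finite_row])
    fix \<tau> :: "nat \<times> nat \<times> nat"
    have "(\<lambda>z. cis (d (snd (snd \<tau>)) * z)) \<in> borel_measurable borel"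
      by (intro borel_measurable_continuous_onI) (auto intro!: continuous_intros simp: cis_conv_exp)
    then have "(\<lambda>z. cis (d (snd (snd \<tau>)) * z)) \<in> borel_measurable (Mw \<tau>)"
      using measurable_cong_sets[OF sets_Mw refl] by blast
    then show "integrable (Mw \<tau>) (\<lambda>z. cis (d (snd (snd \<tau>)) * z))"
      by (intro finite_measure.integrable_const_bound[OF prob_space.finite_measure[OF Mw_prob], of _ 1]) auto
  qed
  also have "\<dots> = (\<Prod>\<tau>\<in>?R. complex_of_real (exp (- ((sqrt (1 / lam (fst \<tau>)))\<^sup>2 * (d (snd (snd \<tau>)))\<^sup>2) / 2)))"
    unfolding Mw_def using lam by (intro prod.cong refl normal_characteristic) simp
  also have "\<dots> = (\<Prod>j=1..n l. complex_of_real (exp (- (1 / lam l * (d j)\<^sup>2) / 2)))"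
    unfolding over_row using lam[of l] by simp
  also have "\<dots> = complex_of_real (exp (\<Sum>j=1..n l. - (1 / lam l * (d j)\<^sup>2) / 2))"
    by (simp add: exp_sum)
  also have "(\<Sum>j=1..n l. - (1 / lam l * (d j)\<^sup>2) / 2) = - (s\<^sup>2 * ker v l x x + 2 * s * t * ker v l x y + t\<^sup>2 * ker v l y y) / 2"
  proof -
    have "1 / lam l * (d j)\<^sup>2 = (s\<^sup>2 * (activ v l j x * activ v l j x) + 2 * s * t * (activ v l j x * activ v l j y)
        + t\<^sup>2 * (activ v l j y * activ v l j y)) / (lam l * real (n l))" for j
    proof -
      have "(s * a + t * b)\<^sup>2 = s\<^sup>2 * (a * a) + 2 * s * t * (a * b) + t\<^sup>2 * (b * b)" for a b
        by (simp add: power2_eq_square algebra_simps)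
      from this[of "activ v l j x" "activ v l j y"] lam[of l] show ?thesis
        unfolding d_def power_divide by (simp only: times_divide_times_eq mult_1_left) simp
    qed
    then have "(\<Sum>j=1..n l. 1 / lam l * (d j)\<^sup>2) = s\<^sup>2 * ker v l x x + 2 * s * t * ker v l x y + t\<^sup>2 * ker v l y y"
      unfolding ker_def by (simp add: sum_divide_distrib[symmetric] sum.distrib sum_distrib_left[symmetric] add_divide_distrib)
    moreover have "(\<Sum>j=1..n l. - (1 / lam l * (d j)\<^sup>2) / 2) = - (\<Sum>j=1..n l. 1 / lam l * (d j)\<^sup>2) / 2"
      by (simp only: sum_negf sum_divide_distrib[symmetric])
    ultimately show ?thesis by simp
  qed
  finally show "(\<integral>p. cis (s * fst p + t * snd p) \<partial>pair_law l i x y v)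
      = complex_of_real (exp (- (s\<^sup>2 * ker v l x x + 2 * s * t * ker v l x y + t\<^sup>2 * ker v l y y) / 2))" .
qed

text \<open>Integrating out the incoming weights first leaves the moment of a Gaussian variable with variance
  ker v l x x.\<close>

lemma pre_moment:
  assumes "l \<le> L" "i \<in> {1..n (Suc l)}"
  shows "(\<integral>\<^sup>+v. ennreal (pre v (Suc l) i x ^ (2 * q)) \<partial>PM)
    = ennreal (normal_moment q) * (\<integral>\<^sup>+v. ennreal (ker v l x x ^ q) \<partial>PM)"
proof -
  let ?R = "row l i"
  have "(\<integral>\<^sup>+v. ennreal (pre v (Suc l) i x ^ (2 * q)) \<partial>PM)
      = (\<integral>\<^sup>+v. (\<integral>\<^sup>+w. ennreal (pre (resample ?R w v) (Suc l) i x ^ (2 * q)) \<partial>Pi\<^sub>M ?R Mw) \<partial>PM)"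
    using pre_measurable[of "\<lambda>v. v" PM "Suc l" i x, OF coord_measurable]
    by (intro nn_integral_resample[OF row_subset[OF assms]]) simp
  also have "\<dots> = (\<integral>\<^sup>+v. ennreal (normal_moment q) * ennreal (ker v l x x ^ q) \<partial>PM)"
  proof (intro nn_integral_cong)
    fix v
    note g = gauss2_moments(1,2)[OF gauss2_pair_law[of l i x x v], of q]
    have m: "(\<lambda>p. fst p ^ (2 * q)) \<in> borel_measurable (borel :: (real \<times> real) measure)"
      by (simp add: borel_prod[symmetric])
    have pos: "0 \<le> z ^ (2 * q)" for z :: real by (simp add: power_mult)
    have "integrable (Pi\<^sub>M ?R Mw) (\<lambda>w. pre (resample ?R w v) (Suc l) i x ^ (2 * q))"
      using g(1) unfolding pair_law_def integrable_distr_eq[OF pair_measurable m] by simp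
    then have "(\<integral>\<^sup>+w. ennreal (pre (resample ?R w v) (Suc l) i x ^ (2 * q)) \<partial>Pi\<^sub>M ?R Mw)
        = ennreal (\<integral>w. pre (resample ?R w v) (Suc l) i x ^ (2 * q) \<partial>Pi\<^sub>M ?R Mw)"
      using pos by (intro nn_integral_eq_integral) auto
    also have "(\<integral>w. pre (resample ?R w v) (Suc l) i x ^ (2 * q) \<partial>Pi\<^sub>M ?R Mw) = ker v l x x ^ q * normal_moment q"
      using g(2) unfolding pair_law_def integral_distr[OF pair_measurable m] by simp
    also have "ennreal (ker v l x x ^ q * normal_moment q) = ennreal (normal_moment q) * ennreal (ker v l x x ^ q)"
      using ker_nonneg normal_moment_nonneg by (simp add: ennreal_mult mult.commute)
    finally show "(\<integral>\<^sup>+w. ennreal (pre (resample ?R w v) (Suc l) i x ^ (2 * q)) \<partial>Pi\<^sub>M ?R Mw)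
        = ennreal (normal_moment q) * ennreal (ker v l x x ^ q)" .
  qed
  also have "\<dots> = ennreal (normal_moment q) * (\<integral>\<^sup>+v. ennreal (ker v l x x ^ q) \<partial>PM)"
    using ker_measurable[of "\<lambda>v. v" PM l x x, OF coord_measurable] by (intro nn_integral_cmult) simp
  finally show ?thesis .
qed

lemma sig_power_le: "sig u ^ (2 * q) \<le> (2 * A) ^ q * (1 + u ^ (2 * (k * q)))"
proof -
  have "sig u ^ (2 * q) = ((sig u)\<^sup>2) ^ q" by (simp add: power_mult)
  also have "\<dots> \<le> (A * (1 + u ^ (2 * k))) ^ q" by (intro power_mono growth) simp
  also have "\<dots> = A ^ q * (1 + u ^ (2 * k)) ^ q" by (rule power_mult_distrib)
  also have "\<dots> \<le> A ^ q * (2 ^ q * (1 + (u ^ (2 * k)) ^ q))"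
  proof (intro mult_left_mono)
    define z where "z = u ^ (2 * k)"
    have z: "0 \<le> z" by (simp add: z_def power_mult)
    have "(1 + z) ^ q \<le> (2 * max 1 z) ^ q" using z by (intro power_mono) auto
    also have "\<dots> = 2 ^ q * max 1 z ^ q" by (rule power_mult_distrib)
    also have "max 1 z ^ q \<le> 1 + z ^ q" using z by (auto simp: max_def)
    finally show "(1 + u ^ (2 * k)) ^ q \<le> 2 ^ q * (1 + (u ^ (2 * k)) ^ q)" by (simp add: z_def)
  qed (use A in simp)
  also have "\<dots> = (2 * A) ^ q * (1 + u ^ (2 * (k * q)))"
    by (simp add: power_mult_distrib power_mult[symmetric] mult.assoc)
  finally show ?thesis .
qed

lemma sig_moment:
  assumes l: "l \<le> L" "i \<in> {1..n (Suc l)}"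
    and C: "0 \<le> C" "(\<integral>\<^sup>+v. ennreal (ker v l x x ^ (k * q)) \<partial>PM) \<le> ennreal C"
  shows "(\<integral>\<^sup>+v. ennreal (sig (pre v (Suc l) i x) ^ (2 * q)) \<partial>PM) \<le> ennreal ((2 * A) ^ q * (1 + normal_moment (k * q) * C))"
proof -
  interpret P: prob_space PM by (rule PiM_prob)
  have m: "(\<lambda>v. ennreal (pre v (Suc l) i x ^ (2 * (k * q)))) \<in> borel_measurable PM"
    using pre_measurable[of "\<lambda>v. v" PM "Suc l" i x, OF coord_measurable] by simp
  have pos: "0 \<le> z ^ (2 * q)" for z :: real and q by (simp add: power_mult)
  have A2: "0 \<le> (2 * A) ^ q" using A by simp
  have "(\<integral>\<^sup>+v. ennreal (sig (pre v (Suc l) i x) ^ (2 * q)) \<partial>PM)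
      \<le> (\<integral>\<^sup>+v. ennreal ((2 * A) ^ q) * (1 + ennreal (pre v (Suc l) i x ^ (2 * (k * q)))) \<partial>PM)"
  proof (intro nn_integral_mono)
    fix v
    have "ennreal (sig (pre v (Suc l) i x) ^ (2 * q)) \<le> ennreal ((2 * A) ^ q * (1 + pre v (Suc l) i x ^ (2 * (k * q))))"
      by (intro ennreal_leI sig_power_le)
    also have "\<dots> = ennreal ((2 * A) ^ q) * (1 + ennreal (pre v (Suc l) i x ^ (2 * (k * q))))"
      using A2 pos[of "pre v (Suc l) i x" "k * q"] by (simp only: ennreal_mult' ennreal_plus ennreal_1 zero_le_one)
    finally show "ennreal (sig (pre v (Suc l) i x) ^ (2 * q)) \<le> ennreal ((2 * A) ^ q) * (1 + ennreal (pre v (Suc l) i x ^ (2 * (k * q))))" .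
  qed
  also have "\<dots> = ennreal ((2 * A) ^ q) * (1 + (\<integral>\<^sup>+v. ennreal (pre v (Suc l) i x ^ (2 * (k * q))) \<partial>PM))"
    using m by (simp add: nn_integral_cmult nn_integral_add P.emeasure_space_1)
  also have "\<dots> \<le> ennreal ((2 * A) ^ q) * (1 + ennreal (normal_moment (k * q)) * ennreal C)"
    unfolding pre_moment[OF l] by (intro mult_left_mono add_left_mono C(2)) auto
  also have "\<dots> = ennreal ((2 * A) ^ q * (1 + normal_moment (k * q) * C))"
    using A2 C(1) normal_moment_nonneg[of "k * q"]
    by (simp only: ennreal_mult' ennreal_plus ennreal_1 zero_le_one mult_nonneg_nonneg)
  finally show ?thesis .
qed

text \<open>Jensen's inequality reduces the moment of the average to moments of single activations.  The order
  rises to k * q on the previous layer, which is why all moments are carried along.  The summand 1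
  covers an empty layer with q = 0, where 0 ^ 0 = 1.\<close>

lemma ker_moment_step:
  assumes l: "l \<le> L"
    and C: "0 \<le> C" "(\<integral>\<^sup>+v. ennreal (ker v l x x ^ (k * q)) \<partial>PM) \<le> ennreal C"
  shows "(\<integral>\<^sup>+v. ennreal (ker v (Suc l) x x ^ q) \<partial>PM)
    \<le> ennreal (1 + (1 / lam (Suc l)) ^ q * ((2 * A) ^ q * (1 + normal_moment (k * q) * C)))"
proof -
  interpret P: prob_space PM by (rule PiM_prob)
  let ?n = "n (Suc l)" and ?lm = "lam (Suc l)"
  define B where "B = (2 * A) ^ q * (1 + normal_moment (k * q) * C)"
  have B0: "0 \<le> B" using A C(1) normal_moment_nonneg[of "k * q"] by (simp add: B_def)
  have lq: "0 \<le> (1 / ?lm) ^ q" using lam[of "Suc l"] by simp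
  show ?thesis
  proof (cases "?n = 0")
    case True
    then have "ker v (Suc l) x x = 0" for v by (simp add: ker_def)
    then have "(\<integral>\<^sup>+v. ennreal (ker v (Suc l) x x ^ q) \<partial>PM) = ennreal (0 ^ q)" by (simp add: P.emeasure_space_1)
    also have "\<dots> \<le> ennreal (1 + (1 / ?lm) ^ q * B)"
      using lq B0 by (intro ennreal_leI) (simp add: power_0_left)
    finally show ?thesis by (simp add: B_def)
  next
    case False
    then have n0: "0 < ?n" by simp
    have pos: "0 \<le> z ^ (2 * q)" for z :: real and q by (simp add: power_mult)
    have m: "(\<lambda>v. sig (pre v (Suc l) i x)) \<in> borel_measurable PM" for i
      using measurable_compose[OF pre_measurable[of "\<lambda>v. v", OF coord_measurable] sig_measurable] by simp
    have le: "ker v (Suc l) x x ^ q \<le> ((1 / ?lm) ^ q / ?n) * (\<Sum>i=1..?n. sig (pre v (Suc l) i x) ^ (2 * q))" for v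
    proof -
      have "ker v (Suc l) x x = (1 / ?lm) * ((\<Sum>i=1..?n. (sig (pre v (Suc l) i x))\<^sup>2) / ?n)"
        by (simp add: ker_def activ_def act_def pre_def power2_eq_square)
      then have "ker v (Suc l) x x ^ q = (1 / ?lm) ^ q * ((\<Sum>i=1..?n. (sig (pre v (Suc l) i x))\<^sup>2) / ?n) ^ q"
        by (simp only: power_mult_distrib)
      also have "\<dots> \<le> (1 / ?lm) ^ q * ((\<Sum>i=1..?n. ((sig (pre v (Suc l) i x))\<^sup>2) ^ q) / ?n)"
        by (intro mult_left_mono power_average_le n0 lq) simp
      finally show ?thesis by (simp add: power_mult[symmetric])
    qed
    have "(\<integral>\<^sup>+v. ennreal (ker v (Suc l) x x ^ q) \<partial>PM)
        \<le> (\<integral>\<^sup>+v. ennreal ((1 / ?lm) ^ q / ?n) * (\<Sum>i=1..?n. ennreal (sig (pre v (Suc l) i x) ^ (2 * q))) \<partial>PM)"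
    proof (intro nn_integral_mono)
      fix v
      have "ennreal (ker v (Suc l) x x ^ q) \<le> ennreal (((1 / ?lm) ^ q / ?n) * (\<Sum>i=1..?n. sig (pre v (Suc l) i x) ^ (2 * q)))"
        by (intro ennreal_leI le)
      also have "\<dots> = ennreal ((1 / ?lm) ^ q / ?n) * (\<Sum>i=1..?n. ennreal (sig (pre v (Suc l) i x) ^ (2 * q)))"
        using lq pos by (simp only: sum_ennreal) (intro ennreal_mult' divide_nonneg_nonneg, auto)
      finally show "ennreal (ker v (Suc l) x x ^ q)
          \<le> ennreal ((1 / ?lm) ^ q / ?n) * (\<Sum>i=1..?n. ennreal (sig (pre v (Suc l) i x) ^ (2 * q)))" .
    qed
    also have "\<dots> = ennreal ((1 / ?lm) ^ q / ?n) * (\<Sum>i=1..?n. \<integral>\<^sup>+v. ennreal (sig (pre v (Suc l) i x) ^ (2 * q)) \<partial>PM)"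
    proof -
      have m': "(\<lambda>v. ennreal (sig (pre v (Suc l) i x) ^ (2 * q))) \<in> borel_measurable PM" for i using m[of i] by simp
      show ?thesis
        unfolding nn_integral_cmult[OF borel_measurable_sum[OF m']] nn_integral_sum[OF m'] ..
    qed
    also have "\<dots> \<le> ennreal ((1 / ?lm) ^ q / ?n) * (\<Sum>i=1..?n. ennreal B)"
      unfolding B_def by (intro mult_left_mono sum_mono sig_moment[OF l _ C]) auto
    also have "(\<Sum>i=1..?n. ennreal B) = ennreal (?n * B)" using B0 by (simp add: ennreal_mult' ennreal_of_nat_eq_real_of_nat)
    also have "ennreal ((1 / ?lm) ^ q / ?n) * ennreal (?n * B) = ennreal ((1 / ?lm) ^ q * B)"
    proof -
      have "((1 / ?lm) ^ q / ?n) * (?n * B) = (1 / ?lm) ^ q * B" using n0 by simp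
      then show ?thesis using lq B0 by (subst ennreal_mult[symmetric]) auto
    qed
    also have "\<dots> \<le> ennreal (1 + (1 / ?lm) ^ q * B)" by (intro ennreal_leI) simp
    finally show ?thesis by (simp add: B_def)
  qed
qed

definition cond_mean :: "nat \<Rightarrow> nat \<Rightarrow> real^'n \<Rightarrow> real^'n \<Rightarrow> (nat \<times> nat \<times> nat \<Rightarrow> real) \<Rightarrow> real" where
  "cond_mean l i x y v = (\<integral>w. sig (pre (resample (row l i) w v) (Suc l) i x)
     * sig (pre (resample (row l i) w v) (Suc l) i y) \<partial>Pi\<^sub>M (row l i) Mw)"

lemma product_measurable: "(\<lambda>p. sig (fst p) * sig (snd p)) \<in> borel_measurable (borel :: (real \<times> real) measure)"
  by (simp add: borel_prod[symmetric])

lemma cond_mean_pair_law: "cond_mean l i x y v = (\<integral>p. sig (fst p) * sig (snd p) \<partial>pair_law l i x y v)"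
  unfolding pair_law_def cond_mean_def integral_distr[OF pair_measurable product_measurable] by simp

lemma row_product_integrable:
  "integrable (Pi\<^sub>M (row l i) Mw) (\<lambda>w. sig (pre (resample (row l i) w v) (Suc l) i x) * sig (pre (resample (row l i) w v) (Suc l) i y))"
  using gauss2_integrable_product(1)[OF gauss2_pair_law[of l i x y v]]
  unfolding pair_law_def integrable_distr_eq[OF pair_measurable product_measurable] by simp

lemma sig_pre_measurable: "(\<lambda>v. sig (pre v l i x)) \<in> borel_measurable PM"
  by (rule measurable_compose[OF pre_measurable[of "\<lambda>v. v", OF coord_measurable] sig_measurable])

lemma cond_mean_measurable: "cond_mean l i x y \<in> borel_measurable PM"
proof -
  have "(\<lambda>p. sig (pre (resample (row l i) (snd p) (fst p)) (Suc l) i z)) \<in> borel_measurable (PM \<Otimes>\<^sub>M Pi\<^sub>M (row l i) Mw)" for z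
    by (rule measurable_compose[OF pre_measurable[of "\<lambda>p. resample (row l i) (snd p) (fst p)", OF resample_measurable] sig_measurable])
  then have "(\<lambda>p. sig (pre (resample (row l i) (snd p) (fst p)) (Suc l) i x) * sig (pre (resample (row l i) (snd p) (fst p)) (Suc l) i y))
      \<in> borel_measurable (PM \<Otimes>\<^sub>M Pi\<^sub>M (row l i) Mw)"
    by (intro borel_measurable_times)
  then show ?thesis
    unfolding cond_mean_def[abs_def] using prob_space_imp_sigma_finite[OF PiM_prob]
    by (intro sigma_finite_measure.borel_measurable_lebesgue_integral) (auto simp: case_prod_unfold)
qed

lemma cond_mean_resample_other_row: "i' \<noteq> i \<Longrightarrow> cond_mean l i x y (resample (row l i') w v) = cond_mean l i x y v"
  unfolding cond_mean_def by (simp add: resample_twice_pre)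

text \<open>Expand the square of the average.  The off-diagonal terms factor through the conditional means,
  whose distance to c is controlled by B; the diagonal terms are too few to matter.\<close>

lemma ker_variance_step:
  assumes l: "l \<le> L" and n0: "0 < n (Suc l)"
    and V: "\<And>i. i \<in> {1..n (Suc l)} \<Longrightarrow> integrable PM (\<lambda>v. (sig (pre v (Suc l) i x) * sig (pre v (Suc l) i y))\<^sup>2)"
      "\<And>i. i \<in> {1..n (Suc l)} \<Longrightarrow> (\<integral>v. (sig (pre v (Suc l) i x) * sig (pre v (Suc l) i y))\<^sup>2 \<partial>PM) \<le> V"
    and B: "integrable PM B" "\<And>i v. (cond_mean l i x y v - c)\<^sup>2 \<le> B v"
  shows "integrable PM (\<lambda>v. (ker v (Suc l) x y - c / lam (Suc l))\<^sup>2)"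
    and "(\<integral>v. (ker v (Suc l) x y - c / lam (Suc l))\<^sup>2 \<partial>PM)
      \<le> (1 / lam (Suc l))\<^sup>2 * ((\<integral>v. B v \<partial>PM) + (2 * V + 2 * c\<^sup>2) / n (Suc l))"
proof -
  interpret P: prob_space PM by (rule PiM_prob)
  let ?n = "n (Suc l)" and ?lm = "lam (Suc l)"
  define Y where "Y i v = sig (pre v (Suc l) i x) * sig (pre v (Suc l) i y)" for i v
  define Z where "Z i v = Y i v - c" for i v
  define m where "m i v = cond_mean l i x y v - c" for i v
  have Ym: "Y i \<in> borel_measurable PM" for i
    unfolding Y_def[abs_def] by (intro borel_measurable_times sig_pre_measurable)
  have Zm: "Z i \<in> borel_measurable PM" for i unfolding Z_def[abs_def] using Ym[of i] by simp
  have mm: "m i \<in> borel_measurable PM" for i unfolding m_def[abs_def] using cond_mean_measurable[of l i x y] by simp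
  have Zle: "(Z i v)\<^sup>2 \<le> 2 * (Y i v)\<^sup>2 + 2 * c\<^sup>2" for i v
    unfolding Z_def using square_add_le[of "Y i v" "- c"] by simp
  have Vint: "integrable PM (\<lambda>v. 2 * (Y i v)\<^sup>2 + 2 * c\<^sup>2)" if "i \<in> {1..?n}" for i
    using V(1)[OF that] unfolding Y_def by simp
  have Zint: "integrable PM (\<lambda>v. (Z i v)\<^sup>2)" if "i \<in> {1..?n}" for i
    by (rule Bochner_Integration.integrable_bound[OF Vint[OF that]]) (use Zm Zle in \<open>auto intro: order_trans\<close>)
  have ZV: "(\<integral>v. (Z i v)\<^sup>2 \<partial>PM) \<le> 2 * V + 2 * c\<^sup>2" if "i \<in> {1..?n}" for i
  proof -
    have "(\<integral>v. (Z i v)\<^sup>2 \<partial>PM) \<le> (\<integral>v. 2 * (Y i v)\<^sup>2 + 2 * c\<^sup>2 \<partial>PM)"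
      by (intro integral_mono Zint Vint that Zle)
    also have "\<dots> = 2 * (\<integral>v. (Y i v)\<^sup>2 \<partial>PM) + 2 * c\<^sup>2"
      using V(1)[OF that] unfolding Y_def by (simp add: P.prob_space)
    finally show ?thesis using V(2)[OF that] unfolding Y_def by linarith
  qed
  have mint: "integrable PM (\<lambda>v. (m i v)\<^sup>2)" for i
  proof (rule Bochner_Integration.integrable_bound[OF B(1)])
    show "(\<lambda>v. (m i v)\<^sup>2) \<in> borel_measurable PM" using mm[of i] by simp
    have "(m i v)\<^sup>2 \<le> \<bar>B v\<bar>" for v using B(2)[of i v] unfolding m_def by linarith
    then show "AE v in PM. norm ((m i v)\<^sup>2) \<le> norm (B v)" by (intro AE_I2) simp
  qed
  have prod_int: "integrable PM (\<lambda>v. f v * g v)"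
    if "f \<in> borel_measurable PM" "g \<in> borel_measurable PM" "integrable PM (\<lambda>v. (f v)\<^sup>2)" "integrable PM (\<lambda>v. (g v)\<^sup>2)"
    for f g :: "(nat \<times> nat \<times> nat \<Rightarrow> real) \<Rightarrow> real"
    using L2_integrable_mult[of f PM g] that by (simp add: L2_def)
  have ZZ: "integrable PM (\<lambda>v. Z i v * Z j v)" if "i \<in> {1..?n}" "j \<in> {1..?n}" for i j
    by (intro prod_int Zm Zint that)
  have off: "(\<integral>v. Z i v * Z j v \<partial>PM) \<le> (\<integral>v. B v \<partial>PM)" if i: "i \<in> {1..?n}" and j: "j \<in> {1..?n}" and ne: "i \<noteq> j" for i j
  proof -
    have Zi: "Z i (resample (row l i) w v) = Y i (resample (row l i) w v) - c" for w v by (simp add: Z_def)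
    have Zj: "Z j (resample (row l i) w v) = Z j v" for w v
      unfolding Z_def Y_def using ne by (simp add: pre_resample_other_row)
    have row_mean: "(\<integral>w. Z i (resample (row l i) w v) \<partial>Pi\<^sub>M (row l i) Mw) = m i v" for i v
    proof -
      interpret R: prob_space "Pi\<^sub>M (row l i) Mw" by (rule PiM_prob)
      show ?thesis unfolding Z_def Y_def m_def cond_mean_def
        using row_product_integrable[of l i v x y] by (simp add: R.prob_space)
    qed
    \<comment> \<open>Integrate out the weights of neuron i, then those of neuron j.\<close>
    have "(\<integral>v. Z i v * Z j v \<partial>PM) = (\<integral>v. (\<integral>w. Z i (resample (row l i) w v) * Z j v \<partial>Pi\<^sub>M (row l i) Mw) \<partial>PM)"
      by (subst integral_resample[OF row_subset[OF l i] ZZ[OF i j]]) (simp add: Zj)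
    also have "\<dots> = (\<integral>v. m i v * Z j v \<partial>PM)" by (simp add: row_mean)
    also have "\<dots> = (\<integral>v. (\<integral>w. m i v * Z j (resample (row l j) w v) \<partial>Pi\<^sub>M (row l j) Mw) \<partial>PM)"
      by (subst integral_resample[OF row_subset[OF l j] prod_int[OF mm Zm mint Zint[OF j]]])
        (use ne in \<open>simp add: m_def cond_mean_resample_other_row\<close>)
    also have "\<dots> = (\<integral>v. m i v * m j v \<partial>PM)" by (simp add: row_mean)
    also have "\<dots> \<le> (\<integral>v. B v \<partial>PM)"
    proof (rule integral_mono[OF prod_int[OF mm mm mint mint] B(1)])
      fix v
      have "2 * (m i v * m j v) \<le> (m i v)\<^sup>2 + (m j v)\<^sup>2" using sum_squares_bound[of "m i v" "m j v"] by simp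
      then show "m i v * m j v \<le> B v" using B(2)[of i v] B(2)[of j v] by (simp add: m_def)
    qed
    finally show ?thesis .
  qed
  have B0: "0 \<le> (\<integral>v. B v \<partial>PM)" using B(2) by (intro integral_nonneg_AE AE_I2) (meson order_trans zero_le_power2)
  have V0: "0 \<le> 2 * V + 2 * c\<^sup>2"
    using ZV[of 1] n0 order_trans[OF integral_nonneg_AE[of "\<lambda>v. (Z 1 v)\<^sup>2" PM]] by auto
  have eq: "(ker v (Suc l) x y - c / ?lm)\<^sup>2 = (1 / ?lm)\<^sup>2 * ((\<Sum>i=1..?n. \<Sum>j=1..?n. Z i v * Z j v) / (real ?n)\<^sup>2)" for v
  proof -
    have "(\<Sum>i=1..?n. Z i v) = (\<Sum>i=1..?n. Y i v) - ?n * c" by (simp add: Z_def sum_subtractf)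
    then have "(1 / ?lm) * ((\<Sum>i=1..?n. Z i v) / ?n) = (1 / ?lm) * ((\<Sum>i=1..?n. Y i v) / ?n - c)"
      using n0 by (simp add: diff_divide_distrib)
    also have "\<dots> = ker v (Suc l) x y - c / ?lm"
      by (simp add: ker_def Y_def activ_def act_def pre_def right_diff_distrib)
    finally have "ker v (Suc l) x y - c / ?lm = (1 / ?lm) * ((\<Sum>i=1..?n. Z i v) / ?n)" by simp
    then show ?thesis by (simp only: power_mult_distrib power_divide) (simp add: power2_eq_square sum_product)
  qed
  show "integrable PM (\<lambda>v. (ker v (Suc l) x y - c / ?lm)\<^sup>2)"
    unfolding eq using ZZ by (intro integrable_mult_right integrable_divide Bochner_Integration.integrable_sum) auto
  have "(\<integral>v. (ker v (Suc l) x y - c / ?lm)\<^sup>2 \<partial>PM)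
      = (1 / ?lm)\<^sup>2 * ((\<Sum>i=1..?n. \<Sum>j=1..?n. \<integral>v. Z i v * Z j v \<partial>PM) / (real ?n)\<^sup>2)"
  proof -
    have "(\<integral>v. (\<Sum>i=1..?n. \<Sum>j=1..?n. Z i v * Z j v) \<partial>PM) = (\<Sum>i=1..?n. \<integral>v. (\<Sum>j=1..?n. Z i v * Z j v) \<partial>PM)"
      by (intro Bochner_Integration.integral_sum Bochner_Integration.integrable_sum ZZ)
    also have "\<dots> = (\<Sum>i=1..?n. \<Sum>j=1..?n. \<integral>v. Z i v * Z j v \<partial>PM)"
      by (intro sum.cong refl Bochner_Integration.integral_sum ZZ)
    finally show ?thesis unfolding eq by simp
  qed
  also have "\<dots> \<le> (1 / ?lm)\<^sup>2 * ((\<Sum>i=1..?n. \<Sum>j=1..?n. (\<integral>v. B v \<partial>PM) + (if i = j then 2 * V + 2 * c\<^sup>2 else 0)) / (real ?n)\<^sup>2)"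
  proof (intro mult_left_mono divide_right_mono sum_mono)
    fix i j assume ij: "i \<in> {1..?n}" "j \<in> {1..?n}"
    show "(\<integral>v. Z i v * Z j v \<partial>PM) \<le> (\<integral>v. B v \<partial>PM) + (if i = j then 2 * V + 2 * c\<^sup>2 else 0)"
      using ZV[OF ij(1)] B0 off[OF ij] by (cases "i = j") (auto simp: power2_eq_square)
  qed auto
  also have "(\<Sum>i=1..?n. \<Sum>j=1..?n. (\<integral>v. B v \<partial>PM) + (if i = j then 2 * V + 2 * c\<^sup>2 else 0))
      = (real ?n)\<^sup>2 * (\<integral>v. B v \<partial>PM) + ?n * (2 * V + 2 * c\<^sup>2)"
    by (simp add: sum.distrib power2_eq_square algebra_simps)
  also have "((real ?n)\<^sup>2 * (\<integral>v. B v \<partial>PM) + ?n * (2 * V + 2 * c\<^sup>2)) / (real ?n)\<^sup>2 = (\<integral>v. B v \<partial>PM) + (2 * V + 2 * c\<^sup>2) / ?n"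
    using n0 by (simp add: add_divide_distrib power2_eq_square)
  finally show "(\<integral>v. (ker v (Suc l) x y - c / ?lm)\<^sup>2 \<partial>PM) \<le> (1 / ?lm)\<^sup>2 * ((\<integral>v. B v \<partial>PM) + (2 * V + 2 * c\<^sup>2) / ?n)" .
qed

lemma nonneg_integrable_bound:
  assumes "f \<in> borel_measurable PM" "\<And>v. 0 \<le> f v" "(\<integral>\<^sup>+v. ennreal (f v) \<partial>PM) \<le> ennreal C" "0 \<le> C"
  shows "integrable PM f" "(\<integral>v. f v \<partial>PM) \<le> C"
proof -
  have "(\<integral>\<^sup>+v. ennreal (f v) \<partial>PM) < \<infinity>" using assms(3) le_less_trans by fastforce
  then show i: "integrable PM f" using assms(1,2) by (intro integrableI_nonneg) auto
  have "ennreal (\<integral>v. f v \<partial>PM) = (\<integral>\<^sup>+v. ennreal (f v) \<partial>PM)"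
    using i assms(2) by (intro nn_integral_eq_integral[symmetric]) auto
  then have "ennreal (\<integral>v. f v \<partial>PM) \<le> ennreal C" using assms(3) by simp
  then show "(\<integral>v. f v \<partial>PM) \<le> C" using assms(4) by (simp only: ennreal_le_iff)
qed

text \<open>One layer of the law of large numbers: the stability estimate, evaluated at the random covariances of
  the layer, controls the conditional means.\<close>

lemma ker_mean_square_step:
  assumes l: "l \<le> L" and n0: "0 < n (Suc l)"
    and C: "\<And>q. 0 \<le> C q" "\<And>q. (\<integral>\<^sup>+v. ennreal (ker v l x x ^ q) \<partial>PM) \<le> ennreal (C q)"
      "\<And>q. (\<integral>\<^sup>+v. ennreal (ker v l y y ^ q) \<partial>PM) \<le> ennreal (C q)"
    and g0: "gauss2 \<mu>0 a0 b0 c0" and \<epsilon>: "0 \<le> \<epsilon>"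
    and stab: "0 \<le> \<kappa>" "\<And>\<mu> a b c. gauss2 \<mu> a b c \<Longrightarrow>
      ((\<integral>p. sig (fst p) * sig (snd p) \<partial>\<mu>) - (\<integral>p. sig (fst p) * sig (snd p) \<partial>\<mu>0))\<^sup>2
      \<le> \<epsilon> * (1 + a ^ (4 * (k + 1)) + c ^ (4 * (k + 1))) + \<kappa> * ((a - a0)\<^sup>2 + (b - b0)\<^sup>2 + (c - c0)\<^sup>2)"
    and int: "integrable PM (\<lambda>v. (ker v l x x - a0)\<^sup>2)" "integrable PM (\<lambda>v. (ker v l x y - b0)\<^sup>2)"
      "integrable PM (\<lambda>v. (ker v l y y - c0)\<^sup>2)"
    and c: "c = (\<integral>p. sig (fst p) * sig (snd p) \<partial>\<mu>0)"
  shows "integrable PM (\<lambda>v. (ker v (Suc l) x y - c / lam (Suc l))\<^sup>2)"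
    and "(\<integral>v. (ker v (Suc l) x y - c / lam (Suc l))\<^sup>2 \<partial>PM)
      \<le> (1 / lam (Suc l))\<^sup>2 * (\<epsilon> * (1 + 2 * C (4 * (k + 1)))
        + \<kappa> * ((\<integral>v. (ker v l x x - a0)\<^sup>2 \<partial>PM) + (\<integral>v. (ker v l x y - b0)\<^sup>2 \<partial>PM) + (\<integral>v. (ker v l y y - c0)\<^sup>2 \<partial>PM))
        + (2 * ((2 * A)\<^sup>2 * (1 + normal_moment (k * 2) * C (k * 2))) + 2 * c\<^sup>2) / n (Suc l))"
proof -
  interpret P: prob_space PM by (rule PiM_prob)
  define V where "V = (2 * A)\<^sup>2 * (1 + normal_moment (k * 2) * C (k * 2))"
  define p where "p = 4 * (k + 1)"
  have V0: "0 \<le> V" using normal_moment_nonneg[of "k * 2"] C(1) by (simp add: V_def)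
  have kp: "integrable PM (\<lambda>v. ker v l z z ^ p)" "(\<integral>v. ker v l z z ^ p \<partial>PM) \<le> C p"
    if "(\<integral>\<^sup>+v. ennreal (ker v l z z ^ p) \<partial>PM) \<le> ennreal (C p)" for z
    using ker_measurable[of "\<lambda>v. v" PM l z z, OF coord_measurable] ker_nonneg[of _ l z] C(1)[of p] that
    by (intro nonneg_integrable_bound; simp)+
  define B where "B v = \<epsilon> * (1 + ker v l x x ^ p + ker v l y y ^ p)
      + \<kappa> * ((ker v l x x - a0)\<^sup>2 + (ker v l x y - b0)\<^sup>2 + (ker v l y y - c0)\<^sup>2)" for v
  have Bint: "integrable PM B" unfolding B_def[abs_def] using kp(1)[OF C(2)] kp(1)[OF C(3)] int by simp
  have "(\<integral>v. B v \<partial>PM) = \<epsilon> * (1 + (\<integral>v. ker v l x x ^ p \<partial>PM) + (\<integral>v. ker v l y y ^ p \<partial>PM))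
      + \<kappa> * ((\<integral>v. (ker v l x x - a0)\<^sup>2 \<partial>PM) + (\<integral>v. (ker v l x y - b0)\<^sup>2 \<partial>PM) + (\<integral>v. (ker v l y y - c0)\<^sup>2 \<partial>PM))"
    unfolding B_def using kp(1)[OF C(2)] kp(1)[OF C(3)] int by (simp add: P.prob_space)
  also have "\<dots> \<le> \<epsilon> * (1 + C p + C p)
      + \<kappa> * ((\<integral>v. (ker v l x x - a0)\<^sup>2 \<partial>PM) + (\<integral>v. (ker v l x y - b0)\<^sup>2 \<partial>PM) + (\<integral>v. (ker v l y y - c0)\<^sup>2 \<partial>PM))"
    by (intro add_mono mult_left_mono order_refl kp(2) C(2,3) \<epsilon>)
  also have "1 + C p + C p = 1 + 2 * C p" by simp
  finally have BB: "(\<integral>v. B v \<partial>PM) \<le> \<epsilon> * (1 + 2 * C p)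
      + \<kappa> * ((\<integral>v. (ker v l x x - a0)\<^sup>2 \<partial>PM) + (\<integral>v. (ker v l x y - b0)\<^sup>2 \<partial>PM) + (\<integral>v. (ker v l y y - c0)\<^sup>2 \<partial>PM))" .
  have mB: "(cond_mean l i x y v - c)\<^sup>2 \<le> B v" for i v
    unfolding cond_mean_pair_law c B_def p_def by (rule stab(2)[OF gauss2_pair_law])
  have four: "integrable PM (\<lambda>v. sig (pre v (Suc l) i z) ^ (2 * 2))" "(\<integral>v. sig (pre v (Suc l) i z) ^ (2 * 2) \<partial>PM) \<le> V"
    if i: "i \<in> {1..n (Suc l)}" and z: "(\<integral>\<^sup>+v. ennreal (ker v l z z ^ (k * 2)) \<partial>PM) \<le> ennreal (C (k * 2))" for i z
  proof -
    have "(\<integral>\<^sup>+v. ennreal (sig (pre v (Suc l) i z) ^ (2 * 2)) \<partial>PM) \<le> ennreal V"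
      unfolding V_def by (rule sig_moment[OF l i C(1) z])
    moreover have "0 \<le> sig u ^ (2 * 2)" for u by (simp only: power_mult) simp
    ultimately show "integrable PM (\<lambda>v. sig (pre v (Suc l) i z) ^ (2 * 2))" "(\<integral>v. sig (pre v (Suc l) i z) ^ (2 * 2) \<partial>PM) \<le> V"
      using V0 sig_pre_measurable[of "Suc l" i z] by (intro nonneg_integrable_bound; simp)+
  qed
  have le: "(s * t)\<^sup>2 \<le> (s ^ (2 * 2) + t ^ (2 * 2)) / 2" for s t :: real
    using sum_squares_bound[of "s\<^sup>2" "t\<^sup>2"] by (simp add: power_mult_distrib power_mult)
  have V1: "integrable PM (\<lambda>v. (sig (pre v (Suc l) i x) * sig (pre v (Suc l) i y))\<^sup>2)"
    and V2: "(\<integral>v. (sig (pre v (Suc l) i x) * sig (pre v (Suc l) i y))\<^sup>2 \<partial>PM) \<le> V" if i: "i \<in> {1..n (Suc l)}" for i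
  proof -
    have bi: "integrable PM (\<lambda>v. (sig (pre v (Suc l) i x) ^ (2 * 2) + sig (pre v (Suc l) i y) ^ (2 * 2)) / 2)"
      using four(1)[OF i C(2)] four(1)[OF i C(3)] by simp
    show int: "integrable PM (\<lambda>v. (sig (pre v (Suc l) i x) * sig (pre v (Suc l) i y))\<^sup>2)"
    proof (rule Bochner_Integration.integrable_bound[OF bi])
      show "(\<lambda>v. (sig (pre v (Suc l) i x) * sig (pre v (Suc l) i y))\<^sup>2) \<in> borel_measurable PM"
        using sig_pre_measurable[of "Suc l" i x] sig_pre_measurable[of "Suc l" i y] by simp
      show "AE v in PM. norm ((sig (pre v (Suc l) i x) * sig (pre v (Suc l) i y))\<^sup>2)
          \<le> norm ((sig (pre v (Suc l) i x) ^ (2 * 2) + sig (pre v (Suc l) i y) ^ (2 * 2)) / 2)"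
        using le order_trans[OF le abs_ge_self] by (intro AE_I2) (simp only: real_norm_def abs_power2)
    qed
    have "(\<integral>v. (sig (pre v (Suc l) i x) * sig (pre v (Suc l) i y))\<^sup>2 \<partial>PM)
        \<le> (\<integral>v. (sig (pre v (Suc l) i x) ^ (2 * 2) + sig (pre v (Suc l) i y) ^ (2 * 2)) / 2 \<partial>PM)"
      by (rule integral_mono[OF int bi le])
    also have "\<dots> = ((\<integral>v. sig (pre v (Suc l) i x) ^ (2 * 2) \<partial>PM) + (\<integral>v. sig (pre v (Suc l) i y) ^ (2 * 2) \<partial>PM)) / 2"
      using four(1)[OF i C(2)] four(1)[OF i C(3)] by simp
    also have "\<dots> \<le> (V + V) / 2"
      by (intro divide_right_mono add_mono four(2)[OF i C(2)] four(2)[OF i C(3)]) simp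
    finally show "(\<integral>v. (sig (pre v (Suc l) i x) * sig (pre v (Suc l) i y))\<^sup>2 \<partial>PM) \<le> V" by simp
  qed
  note step = ker_variance_step[OF l n0 V1 V2 Bint mB]
  show "integrable PM (\<lambda>v. (ker v (Suc l) x y - c / lam (Suc l))\<^sup>2)" by (rule step(1))
  have "(1 / lam (Suc l))\<^sup>2 * ((\<integral>v. B v \<partial>PM) + (2 * V + 2 * c\<^sup>2) / n (Suc l))
      \<le> (1 / lam (Suc l))\<^sup>2 * (\<epsilon> * (1 + 2 * C p)
        + \<kappa> * ((\<integral>v. (ker v l x x - a0)\<^sup>2 \<partial>PM) + (\<integral>v. (ker v l x y - b0)\<^sup>2 \<partial>PM) + (\<integral>v. (ker v l y y - c0)\<^sup>2 \<partial>PM))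
        + (2 * V + 2 * c\<^sup>2) / n (Suc l))"
    using BB by (intro mult_left_mono) auto
  with step(2) show "(\<integral>v. (ker v (Suc l) x y - c / lam (Suc l))\<^sup>2 \<partial>PM)
      \<le> (1 / lam (Suc l))\<^sup>2 * (\<epsilon> * (1 + 2 * C (4 * (k + 1)))
        + \<kappa> * ((\<integral>v. (ker v l x x - a0)\<^sup>2 \<partial>PM) + (\<integral>v. (ker v l x y - b0)\<^sup>2 \<partial>PM) + (\<integral>v. (ker v l y y - c0)\<^sup>2 \<partial>PM))
        + (2 * ((2 * A)\<^sup>2 * (1 + normal_moment (k * 2) * C (k * 2))) + 2 * c\<^sup>2) / n (Suc l))"
    unfolding V_def p_def by linarith
qed

end

section \<open>The limit kernels\<close>

text \<open>An even integer exponent turns the growth bound into a polynomial, whose Gaussian moments are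
  explicit.\<close>

lemma polynomial_growth_even:
  fixes sig :: "real \<Rightarrow> real"
  assumes "0 < r" and g: "\<And>x. (sig x)\<^sup>2 \<le> A * (1 + \<bar>x\<bar> powr r)"
  obtains A' k where "0 \<le> A'" "\<And>x. (sig x)\<^sup>2 \<le> A' * (1 + x ^ (2 * k))"
proof -
  have A: "0 \<le> A" using g[of 0] order_trans[OF zero_le_power2[of "sig 0"]] by simp
  obtain k :: nat where k: "r \<le> real (2 * k)"
  proof -
    obtain m :: nat where "r \<le> real m" using real_arch_simple by blast
    then have "r \<le> real (2 * m)" by simp
    then show ?thesis by (rule that)
  qed
  have le: "\<bar>x\<bar> powr r \<le> 1 + x ^ (2 * k)" for x :: real
  proof (cases "\<bar>x\<bar> \<le> 1")
    case True
    have "\<bar>x\<bar> powr r \<le> 1 powr r" using True \<open>0 < r\<close> by (intro powr_mono2) auto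
    moreover have "0 \<le> x ^ (2 * k)" by (simp add: power_mult)
    moreover have "1 powr r = (1::real)" by simp
    ultimately show ?thesis by linarith
  next
    case False
    then have "\<bar>x\<bar> powr r \<le> \<bar>x\<bar> powr real (2 * k)" using k by (intro powr_mono) auto
    also have "\<dots> = \<bar>x\<bar> ^ (2 * k)" using False by (intro powr_realpow) auto
    also have "\<dots> = x ^ (2 * k)" by (simp add: power_even_abs)
    finally show ?thesis by simp
  qed
  have "(sig x)\<^sup>2 \<le> 2 * A * (1 + x ^ (2 * k))" for x
  proof -
    have "0 \<le> x ^ (2 * k)" by (simp add: power_mult)
    moreover have "1 + p \<le> 2 * (1 + z)" if "0 \<le> z" "p \<le> 1 + z" for p z :: real using that by simp
    ultimately have "1 + \<bar>x\<bar> powr r \<le> 2 * (1 + x ^ (2 * k))" using le[of x] by blast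
    then have "A * (1 + \<bar>x\<bar> powr r) \<le> A * (2 * (1 + x ^ (2 * k)))" using A by (rule mult_left_mono)
    moreover have "A * (2 * z) = 2 * A * z" for z by simp
    ultimately show ?thesis using order_trans[OF g[of x]] by metis
  qed
  then show ?thesis using A by (intro that[of "2 * A" k]) auto
qed

lemma gaussian_rv_square_integrable:
  assumes P: "prob_space P" and X: "gaussian_rv P X"
  shows "X \<in> L2 P"
proof -
  interpret prob_space P by (rule P)
  have Xm: "X \<in> borel_measurable P" using X by (simp add: gaussian_rv_def)
  from X consider (const) \<mu> where "AE \<omega> in P. X \<omega> = \<mu>"
    | (normal) \<mu> s where "0 < s" "distributed P lborel X (normal_density \<mu> s)"
    by (auto simp: gaussian_rv_def)
  then have "integrable P (\<lambda>\<omega>. (X \<omega>)\<^sup>2)"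
  proof cases
    case const
    then have "AE \<omega> in P. (X \<omega>)\<^sup>2 = \<mu>\<^sup>2" by eventually_elim simp
    then show ?thesis using Xm by (subst integrable_cong_AE[of _ _ "\<lambda>_. \<mu>\<^sup>2"]) auto
  next
    case normal
    have "integrable lborel (\<lambda>x. normal_density \<mu> s x * (x - \<mu>) ^ 2 + 2 * \<mu> * (normal_density \<mu> s x * (x - \<mu>) ^ 1) + \<mu>\<^sup>2 * normal_density \<mu> s x)"
      using integrable_normal_moment[of s \<mu> 2] integrable_normal_moment[of s \<mu> 1] normal(1) by (intro Bochner_Integration.integrable_add integrable_mult_right) auto
    also have "(\<lambda>x. normal_density \<mu> s x * (x - \<mu>) ^ 2 + 2 * \<mu> * (normal_density \<mu> s x * (x - \<mu>) ^ 1) + \<mu>\<^sup>2 * normal_density \<mu> s x)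
        = (\<lambda>x. normal_density \<mu> s x * x\<^sup>2)" by (intro ext) (simp add: power2_eq_square algebra_simps)
    finally show ?thesis
      using distributed_integrable[OF normal(2), of "\<lambda>x. x\<^sup>2"] by simp
  qed
  then show ?thesis using Xm by (simp add: L2_def)
qed

lemma gaussian_rv_characteristic:
  assumes P: "prob_space P" and X: "gaussian_rv P X" and mean: "(\<integral>\<omega>. X \<omega> \<partial>P) = 0"
  shows "(\<integral>\<omega>. cis (X \<omega>) \<partial>P) = complex_of_real (exp (- (\<integral>\<omega>. (X \<omega>)\<^sup>2 \<partial>P) / 2))"
proof -
  interpret prob_space P by (rule P)
  have Xm: "X \<in> borel_measurable P" using X by (simp add: gaussian_rv_def)
  have cm: "cis \<in> borel_measurable borel"
    by (intro borel_measurable_continuous_onI) (auto intro!: continuous_intros simp: cis_conv_exp[abs_def])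
  from X consider (const) \<mu> where "AE \<omega> in P. X \<omega> = \<mu>"
    | (normal) \<mu> s where "0 < s" "distributed P lborel X (normal_density \<mu> s)"
    by (auto simp: gaussian_rv_def)
  then show ?thesis
  proof cases
    case const
    have "(\<integral>\<omega>. X \<omega> \<partial>P) = (\<integral>\<omega>. \<mu> \<partial>P)" using Xm const by (intro integral_cong_AE) auto
    then have "\<mu> = 0" using mean by (simp add: prob_space)
    then have z: "AE \<omega> in P. X \<omega> = 0" using const by simp
    have "(\<integral>\<omega>. cis (X \<omega>) \<partial>P) = (\<integral>\<omega>. 1 \<partial>P)"
      using z measurable_compose[OF Xm cm] by (intro integral_cong_AE) auto
    moreover have "(\<integral>\<omega>. (X \<omega>)\<^sup>2 \<partial>P) = (\<integral>\<omega>. 0 \<partial>P)"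
      using z Xm by (intro integral_cong_AE) auto
    ultimately show ?thesis by (simp add: prob_space)
  next
    case normal
    have \<mu>: "\<mu> = 0" using normal_distributed_expectation[OF normal(1,2)] mean by simp
    have var: "(\<integral>\<omega>. (X \<omega>)\<^sup>2 \<partial>P) = s\<^sup>2"
      using normal_distributed_variance[OF normal(1,2)] mean by simp
    have d: "distr P lborel X = density lborel (normal_density 0 s)"
      using normal(2) \<mu> by (simp add: distributed_def)
    have "(\<integral>\<omega>. cis (X \<omega>) \<partial>P) = (\<integral>z. cis (1 * z) \<partial>distr P lborel X)"
      using Xm cm by (subst integral_distr) auto
    also have "\<dots> = complex_of_real (exp (- (s\<^sup>2 * 1\<^sup>2) / 2))" unfolding d by (rule normal_characteristic[OF normal(1)])
    finally show ?thesis by (simp add: var)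
  qed
qed

text \<open>The characteristic function of the pair at (s, t) is that of one real Gaussian variable, a linear
  combination of the two values, and it is determined by the variance.\<close>

lemma gaussian_process_gauss2:
  assumes gp: "centered_gaussian_process Q U h K" and x: "x \<in> U" and y: "y \<in> U"
  shows "gauss2 (distr Q borel (\<lambda>v. (h x v, h y v))) (K x x) (K x y) (K y y)"
proof -
  have Q: "prob_space Q" and lin: "\<And>F c. finite F \<Longrightarrow> F \<subseteq> U \<Longrightarrow> gaussian_rv Q (\<lambda>\<omega>. \<Sum>x\<in>F. c x * h x \<omega>)"
    and mean: "\<And>x. x \<in> U \<Longrightarrow> (\<integral>\<omega>. h x \<omega> \<partial>Q) = 0"
    and cov: "\<And>x y. x \<in> U \<Longrightarrow> y \<in> U \<Longrightarrow> (\<integral>\<omega>. h x \<omega> * h y \<omega> \<partial>Q) = K x y"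
    using gp unfolding centered_gaussian_process_def by blast+
  interpret prob_space Q by (rule Q)
  have hg: "gaussian_rv Q (h z)" if "z \<in> U" for z
    using lin[of "{z}" "\<lambda>_. 1"] that by simp
  have hL: "h z \<in> L2 Q" if "z \<in> U" for z by (rule gaussian_rv_square_integrable[OF Q hg[OF that]])
  have hm: "h z \<in> borel_measurable Q" if "z \<in> U" for z by (rule L2_measurable[OF hL[OF that]])
  have hi: "integrable Q (h z)" if "z \<in> U" for z
    using L2_integrable_mult[OF hL[OF that] L2_const[of 1]] by simp
  have pm: "(\<lambda>v. (h x v, h y v)) \<in> Q \<rightarrow>\<^sub>M borel"
    unfolding borel_prod[symmetric] using hm x y by (intro measurable_Pair) auto
  have Kpos: "0 \<le> K z z" if "z \<in> U" for z
    using cov[OF that that] by (metis L2_inner_def L2_inner_nonneg)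
  show ?thesis
    unfolding gauss2_def
  proof (intro conjI allI Kpos x y)
    show "prob_space (distr Q borel (\<lambda>v. (h x v, h y v)))" by (rule prob_space_distr[OF pm])
    show "sets (distr Q borel (\<lambda>v. (h x v, h y v))) = sets borel" by simp
    fix s t
    let ?X = "\<lambda>v. s * h x v + t * h y v"
    have X: "gaussian_rv Q ?X"
    proof (cases "x = y")
      case True
      then show ?thesis using lin[of "{x}" "\<lambda>_. s + t"] x by (simp add: distrib_right)
    next
      case False
      then show ?thesis using lin[of "{x, y}" "\<lambda>z. if z = x then s else t"] x y by simp
    qed
    have mX: "(\<integral>v. ?X v \<partial>Q) = 0" using hi x y mean by simp
    have "(\<integral>v. (?X v)\<^sup>2 \<partial>Q) = L2_inner Q ?X ?X" by (simp add: L2_inner_def power2_eq_square)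
    also have "\<dots> = s\<^sup>2 * L2_inner Q (h x) (h x) + 2 * s * t * L2_inner Q (h x) (h y) + t\<^sup>2 * L2_inner Q (h y) (h y)"
      by (rule L2_norm_lincomb_square[OF hL[OF x] hL[OF y]])
    also have "\<dots> = s\<^sup>2 * K x x + 2 * s * t * K x y + t\<^sup>2 * K y y"
      using cov x y by (simp add: L2_inner_def)
    finally have vX: "(\<integral>v. (?X v)\<^sup>2 \<partial>Q) = s\<^sup>2 * K x x + 2 * s * t * K x y + t\<^sup>2 * K y y" .
    have "(\<integral>p. cis (s * fst p + t * snd p) \<partial>distr Q borel (\<lambda>v. (h x v, h y v))) = (\<integral>v. cis (?X v) \<partial>Q)"
      by (subst integral_distr[OF pm])
        (auto intro!: borel_measurable_continuous_onI continuous_intros simp: cis_conv_exp)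
    then show "(\<integral>p. cis (s * fst p + t * snd p) \<partial>distr Q borel (\<lambda>v. (h x v, h y v)))
        = complex_of_real (exp (- (s\<^sup>2 * K x x + 2 * s * t * K x y + t\<^sup>2 * K y y) / 2))"
      using gaussian_rv_characteristic[OF Q X mX] vX by simp
  qed
qed

lemma compact_measure_lebesgue_on:
  fixes U :: "'a::euclidean_space set"
  assumes "compact U"
  shows "compact_measure (lebesgue_on U)"
proof -
  have Us: "U \<in> sets lebesgue" using assms by (simp add: compact_imp_closed borel_closed)
  show ?thesis
  proof (intro compact_measure.intro finite_measureI compact_measure_axioms.intro)
    have "emeasure (lebesgue_on U) (space (lebesgue_on U)) = emeasure lebesgue U"
      using Us by (simp add: emeasure_restrict_space)
    also have "\<dots> < \<infinity>" using emeasure_compact_finite[OF assms] assms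
      by (simp add: compact_imp_closed borel_closed)
    finally show "emeasure (lebesgue_on U) (space (lebesgue_on U)) \<noteq> \<infinity>" by simp
    show "compact (space (lebesgue_on U))" using assms by simp
    have "(\<lambda>x. x) \<in> lebesgue \<rightarrow>\<^sub>M borel" by (rule measurable_completion) simp
    then show "(\<lambda>x. x) \<in> borel_measurable (lebesgue_on U)" by (rule measurable_restrict_space1)
  qed
qed

section \<open>Convergence of the kernels along growing widths\<close>

locale wide_networks = growth sig A k for sig A k +
  fixes L :: nat and U :: "(real^'n::finite) set" and ix :: "nat \<Rightarrow> 'n" and lam :: "nat \<Rightarrow> real"
    and n :: "nat \<Rightarrow> nat \<Rightarrow> nat" and G :: "nat \<Rightarrow> 'v measure" and h :: "nat \<Rightarrow> real^'n \<Rightarrow> 'v \<Rightarrow> real"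
    and Kinf :: "nat \<Rightarrow> real^'n \<Rightarrow> real^'n \<Rightarrow> real"
  assumes U: "compact U"
    and ix: "bij_betw ix {1..CARD('n)} UNIV"
    and lam_pos: "\<And>l. 0 < lam l"
    and width_in: "\<And>N. n N 0 = CARD('n)"
    and width_lim: "\<And>l. l \<in> {1..L} \<Longrightarrow> filterlim (\<lambda>N. real (n N l)) at_top sequentially"
    and Kinf_1: "\<And>x y. x \<in> U \<Longrightarrow> y \<in> U \<Longrightarrow> Kinf 1 x y = input_kernel lam x y"
    and Kinf_gp: "\<And>l. l \<in> {1..L} \<Longrightarrow> centered_gaussian_process (G l) U (h l) (Kinf l)"
    and Kinf_rec: "\<And>l x y. l \<in> {2..L+1} \<Longrightarrow> x \<in> U \<Longrightarrow> y \<in> U \<Longrightarrow>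
          Kinf l x y = 1 / lam (l-1) * (\<integral>v. sig (h (l-1) x v) * sig (h (l-1) y v) \<partial>G (l-1))"
begin

sublocale net: network sig A k ix lam "n N" L for N
  by unfold_locales (rule lam_pos)

sublocale U: compact_measure "lebesgue_on U"
  by (rule compact_measure_lebesgue_on[OF U])

lemmas Kinf_1' = Kinf_1[unfolded One_nat_def]

definition limit_law :: "nat \<Rightarrow> real^'n \<Rightarrow> real^'n \<Rightarrow> (real \<times> real) measure" where
  "limit_law l x y = distr (G l) borel (\<lambda>v. (h l x v, h l y v))"

lemma limit_law_gauss2:
  assumes "l \<in> {1..L}" "x \<in> U" "y \<in> U"
  shows "gauss2 (limit_law l x y) (Kinf l x x) (Kinf l x y) (Kinf l y y)"
  unfolding limit_law_def by (rule gaussian_process_gauss2[OF Kinf_gp[OF assms(1)] assms(2,3)])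

lemma Kinf_Suc:
  assumes "l \<in> {1..L}" "x \<in> U" "y \<in> U"
  shows "Kinf (Suc l) x y = (\<integral>p. sig (fst p) * sig (snd p) \<partial>limit_law l x y) / lam l"
proof -
  have gp: "centered_gaussian_process (G l) U (h l) (Kinf l)" by (rule Kinf_gp[OF assms(1)])
  have m: "h l z \<in> borel_measurable (G l)" if "z \<in> U" for z
  proof -
    have "\<forall>F c. finite F \<and> F \<subseteq> U \<longrightarrow> gaussian_rv (G l) (\<lambda>\<omega>. \<Sum>x\<in>F. c x * h l x \<omega>)"
      using gp by (simp add: centered_gaussian_process_def)
    from this[rule_format, of "{z}" "\<lambda>_. 1"] that show ?thesis by (simp add: gaussian_rv_def)
  qed
  have pm: "(\<lambda>v. (h l x v, h l y v)) \<in> G l \<rightarrow>\<^sub>M borel"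
    unfolding borel_prod[symmetric] using m assms by (intro measurable_Pair) auto
  have "(\<integral>p. sig (fst p) * sig (snd p) \<partial>limit_law l x y) = (\<integral>v. sig (h l x v) * sig (h l y v) \<partial>G l)"
    unfolding limit_law_def integral_distr[OF pm net.product_measurable] by simp
  then show ?thesis using Kinf_rec[of "Suc l" x y] assms by simp
qed

lemma Kinf_symmetric:
  assumes "l \<in> {1..L+1}" "x \<in> U" "y \<in> U"
  shows "Kinf l x y = Kinf l y x"
proof (cases "l = 1")
  case True
  then show ?thesis using Kinf_1 assms by (simp add: input_kernel_def mult.commute)
next
  case False
  then have "l \<in> {2..L+1}" using assms by auto
  then show ?thesis using Kinf_rec[of l x y] Kinf_rec[of l y x] assms by (simp add: mult.commute)
qed

text \<open>By induction the covariances of the pair at (x, y) depend continuously on (x, y), and the Gaussian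
  expectation of the product depends continuously on the covariances.\<close>

lemma Kinf_continuous:
  "l \<le> L \<Longrightarrow> continuous_on (U \<times> U) (\<lambda>(x, y). Kinf (Suc l) x y)"
proof (induction l)
  case 0
  have "continuous_on (U \<times> U) (\<lambda>p. (\<Sum>i\<in>UNIV. fst p $ i * snd p $ i) / (lam 0 * real CARD('n)))"
    using lam_pos[of 0] by (intro continuous_intros) auto
  then show ?case by (rule continuous_on_eq) (auto simp: Kinf_1' input_kernel_def)
next
  case (Suc l)
  then have l: "Suc l \<in> {1..L}" and c: "continuous_on (U \<times> U) (\<lambda>(x, y). Kinf (Suc l) x y)" by auto
  show ?case
    unfolding continuous_on_sequentially
  proof (intro allI ballI impI, elim conjE)
    fix p :: "nat \<Rightarrow> (real^'n) \<times> (real^'n)" and a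
    assume a: "a \<in> U \<times> U" and p: "\<forall>m. p m \<in> U \<times> U" and lim: "p \<longlonglongrightarrow> a"
    have conv: "(\<lambda>m. Kinf (Suc l) (f (p m)) (g (p m))) \<longlonglongrightarrow> Kinf (Suc l) (f a) (g a)"
      if fg: "\<And>q. q \<in> U \<times> U \<Longrightarrow> (f q, g q) \<in> U \<times> U" and flim: "(\<lambda>m. (f (p m), g (p m))) \<longlonglongrightarrow> (f a, g a)" for f g
      using continuous_on_tendsto_compose[OF c flim fg[OF a]] fg p by simp
    have l1: "(\<lambda>m. Kinf (Suc l) (fst (p m)) (fst (p m))) \<longlonglongrightarrow> Kinf (Suc l) (fst a) (fst a)"
      by (rule conv) (auto intro!: tendsto_intros lim)
    have l2: "(\<lambda>m. Kinf (Suc l) (fst (p m)) (snd (p m))) \<longlonglongrightarrow> Kinf (Suc l) (fst a) (snd a)"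
      by (rule conv) (auto intro!: tendsto_intros lim)
    have l3: "(\<lambda>m. Kinf (Suc l) (snd (p m)) (snd (p m))) \<longlonglongrightarrow> Kinf (Suc l) (snd a) (snd a)"
      by (rule conv) (auto intro!: tendsto_intros lim)
    have pU: "fst (p m) \<in> U" "snd (p m) \<in> U" for m using p by (auto simp: mem_Times_iff)
    have aU: "fst a \<in> U" "snd a \<in> U" using a by auto
    have "(\<lambda>m. (\<integral>q. sig (fst q) * sig (snd q) \<partial>limit_law (Suc l) (fst (p m)) (snd (p m))) / lam (Suc l))
        \<longlonglongrightarrow> (\<integral>q. sig (fst q) * sig (snd q) \<partial>limit_law (Suc l) (fst a) (snd a)) / lam (Suc l)"
      using lam_pos[of "Suc l"]
      by (intro tendsto_divide tendsto_const gauss2_product_tendsto[OF limit_law_gauss2[OF l pU] limit_law_gauss2[OF l aU] l1 l2 l3]) simp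
    then show "((\<lambda>(x, y). Kinf (Suc (Suc l)) x y) \<circ> p) \<longlonglongrightarrow> (\<lambda>(x, y). Kinf (Suc (Suc l)) x y) a"
      using Kinf_Suc[OF l pU] Kinf_Suc[OF l aU] by (simp add: o_def case_prod_unfold)
  qed
qed

lemma Kinf_sym_kernel: "l \<le> L \<Longrightarrow> U.sym_kernel (Kinf (Suc l))"
  unfolding U.sym_kernel_def using Kinf_continuous[of l] Kinf_symmetric[of "Suc l"] by simp

lemma ker_0: "net.ker N v 0 x y = input_kernel lam x y"
proof -
  have "(\<Sum>j=1..CARD('n). x $ ix j * y $ ix j) = (\<Sum>i\<in>UNIV. x $ i * y $ i)"
    using sum.reindex_bij_betw[OF ix, of "\<lambda>i. x $ i * y $ i"] by simp
  then show ?thesis by (simp add: net.ker_def net.activ_def act_def input_kernel_def width_in)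
qed

text \<open>One bound C serves all widths and all inputs, since a layer enters the next only through C.\<close>

lemma ker_moments_bounded:
  assumes "l \<le> L"
  shows "\<exists>C. (\<forall>q. 0 \<le> C q) \<and> (\<forall>N. \<forall>x\<in>U. \<forall>q. (\<integral>\<^sup>+v. ennreal (net.ker N v l x x ^ q) \<partial>net.PM N) \<le> ennreal (C q))"
  using assms
proof (induction l)
  case 0
  obtain B where B: "0 \<le> B" "\<And>x y. x \<in> U \<Longrightarrow> y \<in> U \<Longrightarrow> \<bar>Kinf 1 x y\<bar> \<le> B"
    using U.sym_kernel_bound[OF Kinf_sym_kernel[of 0]] by auto
  have "(\<integral>\<^sup>+v. ennreal (net.ker N v 0 x x ^ q) \<partial>net.PM N) \<le> ennreal (B ^ q)" if x: "x \<in> U" for N x q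
  proof -
    have "net.ker N v 0 x x ^ q \<le> B ^ q" for v
      using net.ker_nonneg[of N v 0 x] B(2)[OF x x] Kinf_1[OF x x] by (intro power_mono) (auto simp: ker_0)
    then have "(\<integral>\<^sup>+v. ennreal (net.ker N v 0 x x ^ q) \<partial>net.PM N) \<le> (\<integral>\<^sup>+v. ennreal (B ^ q) \<partial>net.PM N)"
      by (intro nn_integral_mono ennreal_leI)
    then show ?thesis by (simp add: net.P.emeasure_space_1)
  qed
  then show ?case using B(1) by (intro exI[of _ "\<lambda>q. B ^ q"]) auto
next
  case (Suc l)
  then have "l \<le> L" by simp
  from Suc.IH[OF this] obtain C where C: "\<And>q. 0 \<le> C q"
    "\<And>N x q. x \<in> U \<Longrightarrow> (\<integral>\<^sup>+v. ennreal (net.ker N v l x x ^ q) \<partial>net.PM N) \<le> ennreal (C q)"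
    by blast
  define C' where "C' q = 1 + (1 / lam (Suc l)) ^ q * ((2 * A) ^ q * (1 + normal_moment (k * q) * C (k * q)))" for q
  have "0 \<le> C' q" for q
    using lam_pos[of "Suc l"] A C(1) normal_moment_nonneg unfolding C'_def
    by (intro add_nonneg_nonneg mult_nonneg_nonneg zero_le_power) auto
  moreover have "(\<integral>\<^sup>+v. ennreal (net.ker N v (Suc l) x x ^ q) \<partial>net.PM N) \<le> ennreal (C' q)" if "x \<in> U" for N x q
    unfolding C'_def using Suc.prems by (intro net.ker_moment_step C(1) C(2)[OF that]) simp
  ultimately show ?case by (intro exI[of _ C']) auto
qed

text \<open>In the induction step the stability parameter \<eta> is fixed first, so that its contribution stays
  below half of \<epsilon> for every N; the other terms vanish with the error of the previous layer and
  with the inverse width.\<close>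

lemma ker_mean_square_tendsto:
  assumes "l \<le> L"
  shows "(\<forall>N. \<forall>x\<in>U. \<forall>y\<in>U. integrable (net.PM N) (\<lambda>v. (net.ker N v l x y - Kinf (Suc l) x y)\<^sup>2)) \<and>
    (\<forall>x\<in>U. \<forall>y\<in>U. (\<lambda>N. \<integral>v. (net.ker N v l x y - Kinf (Suc l) x y)\<^sup>2 \<partial>net.PM N) \<longlonglongrightarrow> 0)"
  using assms
proof (induction l)
  case 0
  then show ?case by (simp add: ker_0 Kinf_1')
next
  case (Suc l)
  then have l: "Suc l \<in> {1..L}" and lL: "l \<le> L" by auto
  have int: "integrable (net.PM N) (\<lambda>v. (net.ker N v l x y - Kinf (Suc l) x y)\<^sup>2)" if "x \<in> U" "y \<in> U" for N x y
    using Suc lL that by auto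
  have lim: "(\<lambda>N. \<integral>v. (net.ker N v l x y - Kinf (Suc l) x y)\<^sup>2 \<partial>net.PM N) \<longlonglongrightarrow> 0" if "x \<in> U" "y \<in> U" for x y
    using Suc lL that by auto
  obtain C where C: "\<And>q. 0 \<le> C q" "\<And>N x q. x \<in> U \<Longrightarrow> (\<integral>\<^sup>+v. ennreal (net.ker N v l x x ^ q) \<partial>net.PM N) \<le> ennreal (C q)"
    using ker_moments_bounded[OF lL] by blast
  have K: "Kinf (Suc (Suc l)) x y = (\<integral>p. sig (fst p) * sig (snd p) \<partial>limit_law (Suc l) x y) / lam (Suc l)"
    if "x \<in> U" "y \<in> U" for x y by (rule Kinf_Suc[OF l that])
  have int': "integrable (net.PM N) (\<lambda>v. (net.ker N v (Suc l) x y - Kinf (Suc (Suc l)) x y)\<^sup>2)"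
    if x: "x \<in> U" and y: "y \<in> U" for N x y
  proof (cases "n N (Suc l) = 0")
    case True
    show ?thesis using True by (simp add: net.ker_def)
  next
    case False
    then have n0: "0 < n N (Suc l)" by simp
    obtain \<kappa> where \<kappa>: "0 \<le> \<kappa>" "\<And>\<mu> a b c. gauss2 \<mu> a b c \<Longrightarrow>
      ((\<integral>p. sig (fst p) * sig (snd p) \<partial>\<mu>) - (\<integral>p. sig (fst p) * sig (snd p) \<partial>limit_law (Suc l) x y))\<^sup>2
      \<le> 1 * (1 + a ^ (4 * (k + 1)) + c ^ (4 * (k + 1)))
        + \<kappa> * ((a - Kinf (Suc l) x x)\<^sup>2 + (b - Kinf (Suc l) x y)\<^sup>2 + (c - Kinf (Suc l) y y)\<^sup>2)"
      by (rule gauss2_product_stability[OF limit_law_gauss2[OF l x y] zero_less_one]) rule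
    show ?thesis
      unfolding K[OF x y]
      by (rule net.ker_mean_square_step(1)[OF lL n0 C(1) C(2)[OF x] C(2)[OF y] limit_law_gauss2[OF l x y] zero_le_one \<kappa>
            int[OF x x] int[OF x y] int[OF y y] refl])
  qed
  have lim': "(\<lambda>N. \<integral>v. (net.ker N v (Suc l) x y - Kinf (Suc (Suc l)) x y)\<^sup>2 \<partial>net.PM N) \<longlonglongrightarrow> 0"
    if x: "x \<in> U" and y: "y \<in> U" for x y
  proof (rule LIMSEQ_I)
    fix \<epsilon> :: real assume e: "0 < \<epsilon>"
    define E where "E N = (\<integral>v. (net.ker N v (Suc l) x y - Kinf (Suc (Suc l)) x y)\<^sup>2 \<partial>net.PM N)" for N
    define c where "c = (\<integral>p. sig (fst p) * sig (snd p) \<partial>limit_law (Suc l) x y)"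
    define p where "p = 4 * (k + 1)"
    define r where "r = (1 / lam (Suc l))\<^sup>2"
    have r: "0 < r" using lam_pos[of "Suc l"] by (simp add: r_def)
    define d where "d = 2 * r * (1 + 2 * C p)"
    define \<eta> where "\<eta> = \<epsilon> / d"
    have den: "0 < d" unfolding d_def using r C(1)[of p] by (intro mult_pos_pos add_pos_nonneg) auto
    have \<eta>: "0 < \<eta>" using e den by (simp add: \<eta>_def)
    have "\<eta> * d = \<epsilon>" using den by (simp add: \<eta>_def)
    then have \<eta>e: "r * (\<eta> * (1 + 2 * C p)) = \<epsilon> / 2" by (simp add: d_def mult_ac)
    obtain \<kappa> where \<kappa>: "0 \<le> \<kappa>" "\<And>\<mu> a b c. gauss2 \<mu> a b c \<Longrightarrow>
      ((\<integral>p. sig (fst p) * sig (snd p) \<partial>\<mu>) - (\<integral>p. sig (fst p) * sig (snd p) \<partial>limit_law (Suc l) x y))\<^sup>2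
      \<le> \<eta> * (1 + a ^ (4 * (k + 1)) + c ^ (4 * (k + 1)))
        + \<kappa> * ((a - Kinf (Suc l) x x)\<^sup>2 + (b - Kinf (Suc l) x y)\<^sup>2 + (c - Kinf (Suc l) y y)\<^sup>2)"
      by (rule gauss2_product_stability[OF limit_law_gauss2[OF l x y] \<eta>]) rule
    define V where "V = 2 * ((2 * A)\<^sup>2 * (1 + normal_moment (k * 2) * C (k * 2))) + 2 * c\<^sup>2"
    define S where "S N = (\<integral>v. (net.ker N v l x x - Kinf (Suc l) x x)\<^sup>2 \<partial>net.PM N)
      + (\<integral>v. (net.ker N v l x y - Kinf (Suc l) x y)\<^sup>2 \<partial>net.PM N) + (\<integral>v. (net.ker N v l y y - Kinf (Suc l) y y)\<^sup>2 \<partial>net.PM N)" for N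
    have step: "E N \<le> r * (\<eta> * (1 + 2 * C p) + \<kappa> * S N + V / n N (Suc l))" if "0 < n N (Suc l)" for N
      unfolding E_def r_def S_def V_def p_def K[OF x y] c_def
      by (rule net.ker_mean_square_step(2)[OF lL that C(1) C(2)[OF x] C(2)[OF y] limit_law_gauss2[OF l x y] less_imp_le[OF \<eta>] \<kappa>
            int[OF x x] int[OF x y] int[OF y y] refl])
    have "S \<longlonglongrightarrow> 0 + 0 + 0" unfolding S_def by (intro tendsto_add lim x y)
    then have Sl: "S \<longlonglongrightarrow> 0" by simp
    have Vl: "(\<lambda>N. V / real (n N (Suc l))) \<longlonglongrightarrow> 0"
      by (intro real_tendsto_divide_at_top[OF tendsto_const] width_lim l)
    have "(\<lambda>N. r * (\<eta> * (1 + 2 * C p) + \<kappa> * S N + V / n N (Suc l))) \<longlonglongrightarrow> r * (\<eta> * (1 + 2 * C p) + \<kappa> * 0 + 0)"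
      by (intro tendsto_intros Sl Vl)
    then have "(\<lambda>N. r * (\<eta> * (1 + 2 * C p) + \<kappa> * S N + V / n N (Suc l))) \<longlonglongrightarrow> \<epsilon> / 2" using \<eta>e by simp
    from order_tendstoD(2)[OF this, of \<epsilon>] e
    have "\<forall>\<^sub>F N in sequentially. r * (\<eta> * (1 + 2 * C p) + \<kappa> * S N + V / n N (Suc l)) < \<epsilon>" by simp
    moreover have "\<forall>\<^sub>F N in sequentially. 1 \<le> real (n N (Suc l))"
      using width_lim[OF l] unfolding filterlim_at_top by blast
    ultimately have "\<forall>\<^sub>F N in sequentially. norm (E N - 0) < \<epsilon>"
    proof eventually_elim
      case (elim N)
      have "0 \<le> E N" unfolding E_def by (intro integral_nonneg_AE) simp
      moreover have "0 < n N (Suc l)" using elim(2) by simp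
      ultimately show ?case using step[of N] elim(1) by simp
    qed
    then show "\<exists>N0. \<forall>N\<ge>N0. norm ((\<integral>v. (net.ker N v (Suc l) x y - Kinf (Suc (Suc l)) x y)\<^sup>2 \<partial>net.PM N) - 0) < \<epsilon>"
      by (simp add: E_def eventually_sequentially)
  qed
  show ?case using int' lim' by blast
qed

text \<open>A bound that is uniform in N, x and y, as a dominating constant for integration over U.\<close>

lemma ker_mean_square_bounded:
  assumes "l \<le> L"
  obtains C where "0 \<le> C" "\<And>N x y. x \<in> U \<Longrightarrow> y \<in> U \<Longrightarrow> (\<integral>v. (net.ker N v l x y - Kinf (Suc l) x y)\<^sup>2 \<partial>net.PM N) \<le> C"
proof -
  obtain C where C: "\<And>q. 0 \<le> C q" "\<And>N x q. x \<in> U \<Longrightarrow> (\<integral>\<^sup>+v. ennreal (net.ker N v l x x ^ q) \<partial>net.PM N) \<le> ennreal (C q)"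
    using ker_moments_bounded[OF assms] by blast
  obtain B where B: "0 \<le> B" "\<And>x y. x \<in> U \<Longrightarrow> y \<in> U \<Longrightarrow> \<bar>Kinf (Suc l) x y\<bar> \<le> B"
    using U.sym_kernel_bound[OF Kinf_sym_kernel[OF assms]] by auto
  show ?thesis
  proof (rule that[of "2 * C 2 + 2 * B\<^sup>2"])
    show "0 \<le> 2 * C 2 + 2 * B\<^sup>2" using C(1)[of 2] by simp
    fix N x y assume x: "x \<in> U" and y: "y \<in> U"
    have km: "(\<lambda>v. net.ker N v l z z ^ 2) \<in> borel_measurable (net.PM N)" for z
      using net.ker_measurable[of "\<lambda>v. v" "net.PM N" N l z z, OF net.coord_measurable] by simp
    have k2: "integrable (net.PM N) (\<lambda>v. net.ker N v l z z ^ 2)" "(\<integral>v. net.ker N v l z z ^ 2 \<partial>net.PM N) \<le> C 2" if "z \<in> U" for z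
      by (rule net.nonneg_integrable_bound[OF km _ C(2)[OF that] C(1)], simp)+
    have pt: "(net.ker N v l x y - Kinf (Suc l) x y)\<^sup>2 \<le> net.ker N v l x x ^ 2 + net.ker N v l y y ^ 2 + 2 * B\<^sup>2" for v
    proof -
      have kxy: "\<bar>net.ker N v l x y\<bar> \<le> (net.ker N v l x x + net.ker N v l y y) / 2"
      proof -
        have "2 * \<bar>\<Sum>j=1..n N l. net.activ N v l j x * net.activ N v l j y\<bar>
            \<le> (\<Sum>j=1..n N l. 2 * \<bar>net.activ N v l j x * net.activ N v l j y\<bar>)"
          unfolding sum_distrib_left[symmetric] by (intro mult_left_mono sum_abs) simp
        also have "\<dots> \<le> (\<Sum>j=1..n N l. net.activ N v l j x * net.activ N v l j x + net.activ N v l j y * net.activ N v l j y)"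
        proof (rule sum_mono)
          fix j
          show "2 * \<bar>net.activ N v l j x * net.activ N v l j y\<bar> \<le> net.activ N v l j x * net.activ N v l j x + net.activ N v l j y * net.activ N v l j y"
            using sum_squares_bound[of "\<bar>net.activ N v l j x\<bar>" "\<bar>net.activ N v l j y\<bar>"]
            by (simp add: abs_mult power2_eq_square)
        qed
        finally have "\<bar>\<Sum>j=1..n N l. net.activ N v l j x * net.activ N v l j y\<bar>
          \<le> ((\<Sum>j=1..n N l. net.activ N v l j x * net.activ N v l j x) + (\<Sum>j=1..n N l. net.activ N v l j y * net.activ N v l j y)) / 2"
          by (simp add: sum.distrib)
        then have "\<bar>\<Sum>j=1..n N l. net.activ N v l j x * net.activ N v l j y\<bar> / (lam l * n N l)
          \<le> ((\<Sum>j=1..n N l. net.activ N v l j x * net.activ N v l j x) + (\<Sum>j=1..n N l. net.activ N v l j y * net.activ N v l j y)) / 2 / (lam l * n N l)"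
          using lam_pos[of l] by (intro divide_right_mono) auto
        then show ?thesis using lam_pos[of l] by (simp add: net.ker_def abs_mult add_divide_distrib)
      qed
      have "(net.ker N v l x y)\<^sup>2 \<le> ((net.ker N v l x x + net.ker N v l y y) / 2)\<^sup>2"
        using power_mono[OF kxy abs_ge_zero, of 2] by simp
      also have "\<dots> \<le> (net.ker N v l x x ^ 2 + net.ker N v l y y ^ 2) / 2"
        using sum_squares_bound[of "net.ker N v l x x" "net.ker N v l y y"] by (simp add: power2_eq_square field_simps)
      finally have k: "(net.ker N v l x y)\<^sup>2 \<le> (net.ker N v l x x ^ 2 + net.ker N v l y y ^ 2) / 2" .
      have "(Kinf (Suc l) x y)\<^sup>2 \<le> B\<^sup>2" using power_mono[OF B(2)[OF x y] abs_ge_zero, of 2] by simp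
      then show ?thesis using k square_add_le[of "net.ker N v l x y" "- Kinf (Suc l) x y"] by simp
    qed
    have "(\<integral>v. (net.ker N v l x y - Kinf (Suc l) x y)\<^sup>2 \<partial>net.PM N)
        \<le> (\<integral>v. net.ker N v l x x ^ 2 + net.ker N v l y y ^ 2 + 2 * B\<^sup>2 \<partial>net.PM N)"
      using ker_mean_square_tendsto[OF assms] x y k2(1) by (intro integral_mono pt) auto
    also have "\<dots> = (\<integral>v. net.ker N v l x x ^ 2 \<partial>net.PM N) + (\<integral>v. net.ker N v l y y ^ 2 \<partial>net.PM N) + 2 * B\<^sup>2"
      using k2(1)[OF x] k2(1)[OF y] by (simp add: net.P.prob_space)
    also have "\<dots> \<le> 2 * C 2 + 2 * B\<^sup>2" using k2(2)[OF x] k2(2)[OF y] by simp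
    finally show "(\<integral>v. (net.ker N v l x y - Kinf (Suc l) x y)\<^sup>2 \<partial>net.PM N) \<le> 2 * C 2 + 2 * B\<^sup>2" .
  qed
qed

end

text \<open>Allows a weight family to be cut down to the index set of the network.\<close>

lemma preact_cong_range:
  assumes "\<And>l' i' j'. l' < l \<Longrightarrow> i' \<in> {1..n (Suc l')} \<Longrightarrow> j' \<in> {1..n l'} \<Longrightarrow> w l' i' j' = w' l' i' j'"
    and "0 < l \<Longrightarrow> i \<in> {1..n l}"
  shows "preact ix sig n w l i x = preact ix sig n w' l i x"
  using assms
proof (induction l arbitrary: i)
  case (Suc l)
  have "act ix sig n w l j x = act ix sig n w' l j x" if "j \<in> {1..n l}" for j
  proof -
    have "preact ix sig n w l j x = preact ix sig n w' l j x"
      using Suc.prems that by (intro Suc.IH) auto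
    then show ?thesis by (simp add: act_def)
  qed
  then show ?case
    unfolding preact_Suc using Suc.prems by (intro arg_cong2[where f="(/)"] sum.cong refl) auto
qed simp

context network
begin

text \<open>Continuity jointly in the weights, with the product topology, and in the input.  It serves both for
  joint measurability and for the dependence of the operators on the weights.\<close>

lemma pre_continuous: "continuous_on UNIV (\<lambda>p. pre (fst p) l i (snd p))"
proof (induction l arbitrary: i)
  case 0
  show ?case by (simp add: pre_def) (intro continuous_intros)
next
  case (Suc l)
  have a: "continuous_on UNIV (\<lambda>p. activ (fst p) l j (snd p))" for j
  proof (cases "l = 0")
    case True
    then show ?thesis by (simp add: activ_def act_def) (intro continuous_intros)
  next
    case False
    then show ?thesis
      using continuous_on_compose2[OF cont Suc[of j]] by (simp add: activ_def act_def pre_def)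
  qed
  have c: "continuous_on UNIV (\<lambda>p. (fst p) t)" for t :: "nat \<times> nat \<times> nat"
    by (rule continuous_on_compose2[OF continuous_on_product_coordinates[of t] continuous_on_fst[OF continuous_on_id] subset_UNIV])
  have "continuous_on UNIV (\<lambda>p. (\<Sum>j=1..n l. (fst p) (l, i, j) * activ (fst p) l j (snd p)) * inverse (sqrt (real (n l))))"
    by (intro continuous_intros a c)
  then show ?case by (simp add: pre_def preact_Suc activ_def curried_def divide_inverse)
qed

lemma activ_continuous: "continuous_on UNIV (\<lambda>p. activ (fst p) l j (snd p))"
proof (cases "l = 0")
  case True
  then show ?thesis by (simp add: activ_def act_def) (intro continuous_intros)
next
  case False
  then show ?thesis
    using continuous_on_compose2[OF cont pre_continuous[of l j]] by (simp add: activ_def act_def pre_def)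
qed

lemma ker_continuous: "continuous_on UNIV (\<lambda>p. ker (fst p) l (fst (snd p)) (snd (snd p)))"
proof -
  have p1: "continuous_on UNIV (\<lambda>p :: _ \<times> (real^'n) \<times> (real^'n). (fst p, fst (snd p)))"
    and p2: "continuous_on UNIV (\<lambda>p :: _ \<times> (real^'n) \<times> (real^'n). (fst p, snd (snd p)))"
    by (intro continuous_intros)+
  have 1: "continuous_on UNIV (\<lambda>p :: (nat \<times> nat \<times> nat \<Rightarrow> real) \<times> (real^'n) \<times> (real^'n). activ (fst p) l j (fst (snd p)))" for j
    using continuous_on_compose2[OF activ_continuous[of l j] p1 subset_UNIV] by simp
  have 2: "continuous_on UNIV (\<lambda>p :: (nat \<times> nat \<times> nat \<Rightarrow> real) \<times> (real^'n) \<times> (real^'n). activ (fst p) l j (snd (snd p)))" for j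
    using continuous_on_compose2[OF activ_continuous[of l j] p2 subset_UNIV] by simp
  have "continuous_on UNIV (\<lambda>p. (\<Sum>j=1..n l. activ (fst p) l j (fst (snd p)) * activ (fst p) l j (snd (snd p)))
      * inverse (lam l * real (n l)))"
    by (intro continuous_intros 1 2)
  then show ?thesis by (simp add: ker_def divide_inverse)
qed

end

section \<open>Convergence in probability of the kernel operators\<close>

locale wide_random_networks = wide_networks sig A k L U ix lam n G h Kinf
  for sig A k L U and ix :: "nat \<Rightarrow> 'n::finite" and lam n and G :: "nat \<Rightarrow> 'v measure" and h Kinf +
  fixes P :: "nat \<Rightarrow> 'w measure" and W :: "nat \<Rightarrow> nat \<Rightarrow> nat \<Rightarrow> nat \<Rightarrow> 'w \<Rightarrow> real"
  assumes L1: "1 \<le> L"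
    and P: "\<And>N. prob_space (P N)"
    and W_indep: "\<And>N. prob_space.indep_vars (P N) (\<lambda>_. borel) (\<lambda>(l, i, j). W N l i j)
          {(l, i, j). l \<le> L \<and> i \<in> {1..n N (Suc l)} \<and> j \<in> {1..n N l}}"
    and W_normal: "\<And>N l i j. l \<le> L \<Longrightarrow> i \<in> {1..n N (Suc l)} \<Longrightarrow> j \<in> {1..n N l} \<Longrightarrow>
          distributed (P N) lborel (W N l i j) (normal_density 0 (sqrt (1 / lam l)))"
begin

definition weights :: "nat \<Rightarrow> 'w \<Rightarrow> nat \<times> nat \<times> nat \<Rightarrow> real" where
  "weights N \<omega> = (\<lambda>t\<in>net.I N. (case t of (l, i, j) \<Rightarrow> W N l i j) \<omega>)"

lemma W_measurable: "t \<in> net.I N \<Longrightarrow> (case t of (l, i, j) \<Rightarrow> W N l i j) \<in> borel_measurable (P N)"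
  using W_indep[of N] unfolding prob_space.indep_vars_def[OF P] net.I_def by blast

lemma weights_law:
  assumes "net.I N \<noteq> {}"
  shows "distr (P N) (net.PM N) (weights N) = net.PM N"
proof -
  interpret Q: prob_space "P N" by (rule P)
  let ?X = "\<lambda>t. case t of (l, i, j) \<Rightarrow> W N l i j"
  have ind: "Q.indep_vars (\<lambda>_. borel) ?X (net.I N)" using W_indep[of N] unfolding net.I_def .
  have "distr (P N) (\<Pi>\<^sub>M t\<in>net.I N. borel) (\<lambda>\<omega>. \<lambda>t\<in>net.I N. ?X t \<omega>) = (\<Pi>\<^sub>M t\<in>net.I N. distr (P N) borel (?X t))"
    using ind Q.indep_vars_iff_distr_eq_PiM'[OF assms, of ?X "\<lambda>_. borel"] W_measurable by blast
  also have "\<dots> = net.PM N"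
  proof (rule PiM_cong[OF refl])
    fix t assume t: "t \<in> net.I N"
    obtain l i j where tt: "t = (l, i, j)" by (cases t) auto
    have d: "distributed (P N) lborel (W N l i j) (normal_density 0 (sqrt (1 / lam l)))"
      using t tt by (intro W_normal) (auto simp: net.I_def)
    have "distr (P N) borel (W N l i j) = distr (P N) lborel (W N l i j)"
      by (rule distr_cong) auto
    then show "distr (P N) borel (?X t) = net.Mw t"
      using d by (simp add: tt distributed_def net.Mw_def)
  qed
  finally have "distr (P N) (\<Pi>\<^sub>M t\<in>net.I N. borel) (weights N) = net.PM N"
    by (simp add: weights_def[abs_def])
  moreover have "distr (P N) (net.PM N) (weights N) = distr (P N) (\<Pi>\<^sub>M t\<in>net.I N. borel) (weights N)"
    by (intro distr_cong refl sets_PiM_cong net.sets_Mw)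
  ultimately show ?thesis by simp
qed

lemma weights_PiM_measurable: "weights N \<in> P N \<rightarrow>\<^sub>M net.PM N"
proof -
  have "weights N \<in> P N \<rightarrow>\<^sub>M (\<Pi>\<^sub>M t\<in>net.I N. borel)"
    unfolding weights_def[abs_def] by (rule measurable_restrict[OF W_measurable])
  moreover have "sets (net.PM N) = sets (\<Pi>\<^sub>M t\<in>net.I N. borel)"
    by (intro sets_PiM_cong refl net.sets_Mw)
  ultimately show ?thesis using measurable_cong_sets[OF refl] by blast
qed

lemma weights_borel_measurable: "weights N \<in> borel_measurable (P N)"
proof (rule measurable_coordinatewise_then_product)
  fix t
  show "(\<lambda>\<omega>. weights N \<omega> t) \<in> borel_measurable (P N)"
    using W_measurable[of t N] by (cases "t \<in> net.I N") (simp_all add: weights_def split_beta)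
qed

lemma layer_kernel_eq_ker:
  assumes "l \<in> {1..L}"
  shows "layer_kernel ix sig lam (n N) (\<lambda>k i j. W N k i j \<omega>) (Suc l) x y = net.ker N (weights N \<omega>) l x y"
proof -
  have "preact ix sig (n N) (\<lambda>k i j. W N k i j \<omega>) l i z = preact ix sig (n N) (net.curried (weights N \<omega>)) l i z"
    if "i \<in> {1..n N l}" for i z
    using assms that by (intro preact_cong_range) (auto simp: net.curried_def weights_def net.I_def)
  then show ?thesis
    using assms by (simp add: layer_kernel_def net.ker_def net.activ_def act_def)
qed

lemma ker_trace_psd: "U.trace_psd (net.ker N v l)"
proof (rule U.gram_kernel_trace_psd)
  show "0 \<le> 1 / (lam l * real (n N l))" using lam_pos[of l] by simp
  show "net.ker N v l x y = 1 / (lam l * real (n N l)) * (\<Sum>i\<in>{1..n N l}. net.activ N v l i x * net.activ N v l i y)" for x y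
    by (simp add: net.ker_def)
  show "continuous_on (space (lebesgue_on U)) (net.activ N v l i)" for i
    using continuous_on_compose2[OF net.activ_continuous[of N l i], of "space (lebesgue_on U)" "\<lambda>x. (v, x)"]
    by (simp add: continuous_on_const continuous_on_Pair)
qed

lemma ker_sym_kernel: "U.sym_kernel (net.ker N v l)"
  using ker_trace_psd by (simp add: U.trace_psd_def)

definition kernel_error :: "nat \<Rightarrow> nat \<Rightarrow> 'w \<Rightarrow> real" where
  "kernel_error l N \<omega> = U.square_dist (net.ker N (weights N \<omega>) l) (Kinf (Suc l))
     + U.diagonal_dist (net.ker N (weights N \<omega>) l) (Kinf (Suc l))"

text \<open>Two sample points under an arbitrary finite measure Q cover U x U and its diagonal at once.  The
  expectation is moved inside by Fubini's theorem, and dominated convergence over Q applies.\<close>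

lemma sampled_error_tendsto:
  fixes Q :: "'q measure"
  assumes l: "l \<in> {1..L}" and "finite_measure Q"
    and X: "X \<in> Q \<rightarrow>\<^sub>M borel" "\<And>q. q \<in> space Q \<Longrightarrow> X q \<in> U"
    and Y: "Y \<in> Q \<rightarrow>\<^sub>M borel" "\<And>q. q \<in> space Q \<Longrightarrow> Y q \<in> U"
  shows "(\<lambda>N. \<integral>\<^sup>+\<omega>. (\<integral>\<^sup>+q. ennreal ((net.ker N (weights N \<omega>) l (X q) (Y q) - Kinf (Suc l) (X q) (Y q))\<^sup>2) \<partial>Q) \<partial>P N) \<longlonglongrightarrow> 0"
    and "(\<lambda>(\<omega>, q). ennreal ((net.ker N (weights N \<omega>) l (X q) (Y q) - Kinf (Suc l) (X q) (Y q))\<^sup>2)) \<in> borel_measurable (P N \<Otimes>\<^sub>M Q)"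
proof -
  interpret Q: finite_measure Q by fact
  have lL: "l \<le> L" using l by simp
  define f where "f N \<omega> q = ennreal ((net.ker N (weights N \<omega>) l (X q) (Y q) - Kinf (Suc l) (X q) (Y q))\<^sup>2)" for N \<omega> q
  have Km: "(\<lambda>q. Kinf (Suc l) (X q) (Y q)) \<in> borel_measurable Q"
  proof -
    have "(\<lambda>q. (X q, Y q)) \<in> Q \<rightarrow>\<^sub>M restrict_space borel (U \<times> U)"
    proof (rule measurable_restrict_space2)
      show "(\<lambda>q. (X q, Y q)) \<in> Q \<rightarrow>\<^sub>M borel" unfolding borel_prod[symmetric] by (intro measurable_Pair X(1) Y(1))
    qed (use X(2) Y(2) in auto)
    from measurable_compose[OF this borel_measurable_continuous_on_restrict[OF Kinf_continuous[OF lL]]]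
    show ?thesis by simp
  qed
  have joint: "(\<lambda>p. net.ker N (weights N (fst p)) l (X (snd p)) (Y (snd p))) \<in> borel_measurable (P N \<Otimes>\<^sub>M Q)" for N
  proof -
    have "(\<lambda>p. (weights N (fst p), (X (snd p), Y (snd p)))) \<in> P N \<Otimes>\<^sub>M Q \<rightarrow>\<^sub>M borel \<Otimes>\<^sub>M (borel \<Otimes>\<^sub>M borel)"
      by (intro measurable_Pair measurable_compose[OF measurable_fst weights_borel_measurable]
          measurable_compose[OF measurable_snd X(1)] measurable_compose[OF measurable_snd Y(1)])
    then have "(\<lambda>p. (weights N (fst p), (X (snd p), Y (snd p)))) \<in> P N \<Otimes>\<^sub>M Q \<rightarrow>\<^sub>M borel"
      by (simp add: borel_prod)
    from measurable_compose[OF this borel_measurable_continuous_onI[OF net.ker_continuous[of N l]]]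
    show ?thesis by simp
  qed
  have fm: "(\<lambda>(\<omega>, q). f N \<omega> q) \<in> borel_measurable (P N \<Otimes>\<^sub>M Q)" for N
    unfolding f_def case_prod_unfold
    by (intro measurable_compose[OF _ measurable_ennreal] borel_measurable_power borel_measurable_diff
        joint measurable_compose[OF measurable_snd Km])
  then show "(\<lambda>(\<omega>, q). ennreal ((net.ker N (weights N \<omega>) l (X q) (Y q) - Kinf (Suc l) (X q) (Y q))\<^sup>2)) \<in> borel_measurable (P N \<Otimes>\<^sub>M Q)"
    by (simp add: f_def)
  have swap: "(\<integral>\<^sup>+\<omega>. (\<integral>\<^sup>+q. f N \<omega> q \<partial>Q) \<partial>P N) = (\<integral>\<^sup>+q. (\<integral>\<^sup>+\<omega>. f N \<omega> q \<partial>P N) \<partial>Q)" for N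
  proof -
    interpret PN: prob_space "P N" by (rule P)
    interpret pair_sigma_finite "P N" Q by standard
    show ?thesis by (rule Fubini'[OF fm, symmetric])
  qed
  define e where "e N x y = (\<integral>v. (net.ker N v l x y - Kinf (Suc l) x y)\<^sup>2 \<partial>net.PM N)" for N x y
  have law: "(\<integral>\<^sup>+\<omega>. f N \<omega> q \<partial>P N) = ennreal (e N (X q) (Y q))" if ne: "net.I N \<noteq> {}" and q: "q \<in> space Q" for N q
  proof -
    define g where "g v = ennreal ((net.ker N v l (X q) (Y q) - Kinf (Suc l) (X q) (Y q))\<^sup>2)" for v
    have gm: "g \<in> borel_measurable (net.PM N)"
      unfolding g_def[abs_def] using net.ker_measurable[of "\<lambda>v. v" "net.PM N" N l "X q" "Y q", OF net.coord_measurable] by simp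
    have "(\<integral>\<^sup>+\<omega>. f N \<omega> q \<partial>P N) = (\<integral>\<^sup>+v. g v \<partial>distr (P N) (net.PM N) (weights N))"
      using gm by (subst nn_integral_distr[OF weights_PiM_measurable]) (simp_all add: f_def g_def)
    also have "\<dots> = (\<integral>\<^sup>+v. g v \<partial>net.PM N)" by (simp add: weights_law[OF ne])
    also have "\<dots> = ennreal (e N (X q) (Y q))"
      unfolding g_def e_def using ker_mean_square_tendsto[OF lL] X(2)[OF q] Y(2)[OF q]
      by (intro nn_integral_eq_integral) auto
    finally show ?thesis .
  qed
  \<comment> \<open>The law of the weights is the product measure once the index set is nonempty,
    which holds as soon as the first hidden layer has a neuron.\<close>
  have "filterlim (\<lambda>N. real (n N 1)) at_top sequentially" using L1 by (intro width_lim) simp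
  then have "\<forall>\<^sub>F N in sequentially. 1 \<le> real (n N 1)" unfolding filterlim_at_top by blast
  then obtain N0 where N0: "\<And>N. N \<ge> N0 \<Longrightarrow> 1 \<le> n N 1" by (auto simp: eventually_sequentially)
  have ne: "net.I N \<noteq> {}" if "N \<ge> N0" for N
  proof -
    have "(0, 1, 1) \<in> net.I N" using N0[OF that] by (simp add: net.I_def width_in Suc_le_eq)
    then show ?thesis by auto
  qed
  obtain C where C: "0 \<le> C" "\<And>N x y. x \<in> U \<Longrightarrow> y \<in> U \<Longrightarrow> e N x y \<le> C"
    by (rule ker_mean_square_bounded[OF lL, folded e_def]) rule
  have "(\<lambda>N. \<integral>\<^sup>+q. (\<integral>\<^sup>+\<omega>. f (N + N0) \<omega> q \<partial>P (N + N0)) \<partial>Q) \<longlonglongrightarrow> (\<integral>\<^sup>+q. 0 \<partial>Q)"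
  proof (rule nn_integral_dominated_convergence[where w="\<lambda>_. ennreal C"])
    show "(\<lambda>q. \<integral>\<^sup>+\<omega>. f (N + N0) \<omega> q \<partial>P (N + N0)) \<in> borel_measurable Q" for N
    proof -
      interpret PN: prob_space "P (N + N0)" by (rule P)
      have "(\<lambda>(q, \<omega>). f (N + N0) \<omega> q) \<in> borel_measurable (Q \<Otimes>\<^sub>M P (N + N0))"
        using measurable_compose[OF measurable_pair_swap' fm[of "N + N0"]] by (simp add: case_prod_unfold)
      then show ?thesis by (rule PN.borel_measurable_nn_integral)
    qed
    show "AE q in Q. (\<integral>\<^sup>+\<omega>. f (N + N0) \<omega> q \<partial>P (N + N0)) \<le> ennreal C" for N
      using law[OF ne] C(2) X(2) Y(2) by (intro AE_I2) (simp add: ennreal_leI)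
    show "AE q in Q. (\<lambda>N. \<integral>\<^sup>+\<omega>. f (N + N0) \<omega> q \<partial>P (N + N0)) \<longlonglongrightarrow> 0"
    proof (rule AE_I2)
      fix q assume q: "q \<in> space Q"
      have "(\<lambda>N. e N (X q) (Y q)) \<longlonglongrightarrow> 0"
        unfolding e_def using ker_mean_square_tendsto[OF lL] X(2)[OF q] Y(2)[OF q] by blast
      then have "(\<lambda>N. ennreal (e (N + N0) (X q) (Y q))) \<longlonglongrightarrow> ennreal 0"
        by (intro tendsto_ennrealI LIMSEQ_ignore_initial_segment)
      then show "(\<lambda>N. \<integral>\<^sup>+\<omega>. f (N + N0) \<omega> q \<partial>P (N + N0)) \<longlonglongrightarrow> 0"
        using law[OF ne q] by simp
    qed
    show "(\<integral>\<^sup>+q. ennreal C \<partial>Q) < \<infinity>"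
      by (simp add: Q.emeasure_eq_measure flip: ennreal_mult'')
  qed auto
  then have "(\<lambda>N. \<integral>\<^sup>+\<omega>. (\<integral>\<^sup>+q. f (N + N0) \<omega> q \<partial>Q) \<partial>P (N + N0)) \<longlonglongrightarrow> 0"
    unfolding swap by simp
  from LIMSEQ_offset[OF this]
  show "(\<lambda>N. \<integral>\<^sup>+\<omega>. (\<integral>\<^sup>+q. ennreal ((net.ker N (weights N \<omega>) l (X q) (Y q) - Kinf (Suc l) (X q) (Y q))\<^sup>2) \<partial>Q) \<partial>P N) \<longlonglongrightarrow> 0"
    unfolding f_def .
qed

lemma kernel_error_nn_integral:
  assumes l: "l \<le> L"
  shows "ennreal (kernel_error l N \<omega>)
    = (\<integral>\<^sup>+p. ennreal ((net.ker N (weights N \<omega>) l (fst p) (snd p) - Kinf (Suc l) (fst p) (snd p))\<^sup>2) \<partial>(lebesgue_on U \<Otimes>\<^sub>M lebesgue_on U))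
    + (\<integral>\<^sup>+x. ennreal ((net.ker N (weights N \<omega>) l x x - Kinf (Suc l) x x)\<^sup>2) \<partial>lebesgue_on U)"
proof -
  let ?K = "net.ker N (weights N \<omega>) l"
  have d: "U.sym_kernel (\<lambda>x y. ?K x y - Kinf (Suc l) x y)"
    by (rule U.sym_kernel_diff[OF ker_sym_kernel Kinf_sym_kernel[OF l]])
  have 1: "(\<integral>\<^sup>+p. ennreal ((?K (fst p) (snd p) - Kinf (Suc l) (fst p) (snd p))\<^sup>2) \<partial>(lebesgue_on U \<Otimes>\<^sub>M lebesgue_on U))
      = ennreal (U.square_dist ?K (Kinf (Suc l)))"
    unfolding U.square_dist_def using L2_integrable_square[OF U.sym_kernel_product_L2[OF d]]
    by (intro nn_integral_eq_integral) auto
  have 2: "(\<integral>\<^sup>+x. ennreal ((?K x x - Kinf (Suc l) x x)\<^sup>2) \<partial>lebesgue_on U) = ennreal (U.diagonal_dist ?K (Kinf (Suc l)))"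
    unfolding U.diagonal_dist_def using L2_integrable_square[OF U.continuous_L2[OF U.diagonal_continuous[OF d]]]
    by (intro nn_integral_eq_integral) auto
  have "0 \<le> U.square_dist ?K (Kinf (Suc l))" "0 \<le> U.diagonal_dist ?K (Kinf (Suc l))"
    by (simp_all add: U.square_dist_def U.diagonal_dist_def)
  then show ?thesis unfolding 1 2 kernel_error_def by (rule ennreal_plus)
qed

lemma kernel_error_tendsto:
  assumes l: "l \<in> {1..L}"
  shows "(\<lambda>N. \<integral>\<^sup>+\<omega>. ennreal (kernel_error l N \<omega>) \<partial>P N) \<longlonglongrightarrow> 0"
    and "(\<lambda>\<omega>. ennreal (kernel_error l N \<omega>)) \<in> borel_measurable (P N)"
proof -
  let ?M = "lebesgue_on U"
  have lL: "l \<le> L" using l by simp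
  have fin: "finite_measure (?M \<Otimes>\<^sub>M ?M)"
    by (intro finite_measure_pair_measure U.finite_measure_axioms)
  have X: "fst \<in> ?M \<Otimes>\<^sub>M ?M \<rightarrow>\<^sub>M borel" "snd \<in> ?M \<Otimes>\<^sub>M ?M \<rightarrow>\<^sub>M borel"
    by (rule measurable_compose[OF measurable_fst U.id_measurable], rule measurable_compose[OF measurable_snd U.id_measurable])
  have XU: "fst q \<in> U" "snd q \<in> U" if "q \<in> space (?M \<Otimes>\<^sub>M ?M)" for q
    using that by (auto simp: space_pair_measure)
  have idU: "x \<in> U" if "x \<in> space ?M" for x using that by simp
  note pairs = sampled_error_tendsto[OF l fin X(1) XU(1) X(2) XU(2)]
  note diag = sampled_error_tendsto[OF l U.finite_measure_axioms U.id_measurable idU U.id_measurable idU]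
  have m1: "(\<lambda>\<omega>. \<integral>\<^sup>+p. ennreal ((net.ker N (weights N \<omega>) l (fst p) (snd p) - Kinf (Suc l) (fst p) (snd p))\<^sup>2) \<partial>(?M \<Otimes>\<^sub>M ?M))
      \<in> borel_measurable (P N)" for N
  proof -
    interpret finite_measure "?M \<Otimes>\<^sub>M ?M" by (rule fin)
    show ?thesis by (rule borel_measurable_nn_integral[OF pairs(2)])
  qed
  have m2: "(\<lambda>\<omega>. \<integral>\<^sup>+x. ennreal ((net.ker N (weights N \<omega>) l x x - Kinf (Suc l) x x)\<^sup>2) \<partial>?M) \<in> borel_measurable (P N)" for N
    by (rule U.borel_measurable_nn_integral[OF diag(2)])
  show "(\<lambda>\<omega>. ennreal (kernel_error l N \<omega>)) \<in> borel_measurable (P N)" for N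
    unfolding kernel_error_nn_integral[OF lL] using m1 m2 by (rule borel_measurable_add)
  have "(\<lambda>N. (\<integral>\<^sup>+\<omega>. (\<integral>\<^sup>+p. ennreal ((net.ker N (weights N \<omega>) l (fst p) (snd p) - Kinf (Suc l) (fst p) (snd p))\<^sup>2) \<partial>(?M \<Otimes>\<^sub>M ?M)) \<partial>P N)
      + (\<integral>\<^sup>+\<omega>. (\<integral>\<^sup>+x. ennreal ((net.ker N (weights N \<omega>) l x x - Kinf (Suc l) x x)\<^sup>2) \<partial>?M) \<partial>P N)) \<longlonglongrightarrow> 0 + 0"
    by (intro tendsto_add pairs(1) diag(1))
  then show "(\<lambda>N. \<integral>\<^sup>+\<omega>. ennreal (kernel_error l N \<omega>) \<partial>P N) \<longlonglongrightarrow> 0"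
    unfolding kernel_error_nn_integral[OF lL] nn_integral_add[OF m1 m2] by simp
qed

text \<open>The expected error tends to 0, so some realisation of the networks has a Gram kernel as close to the
  limit kernel as desired.\<close>

lemma Kinf_trace_psd:
  assumes l: "l \<in> {1..L}"
  shows "U.trace_psd (Kinf (Suc l))"
proof (rule U.trace_psd_closed)
  have lL: "l \<le> L" using l by simp
  show "U.sym_kernel (Kinf (Suc l))" by (rule Kinf_sym_kernel[OF lL])
  fix \<epsilon> :: real assume e: "0 < \<epsilon>"
  have "\<forall>\<^sub>F N in sequentially. (\<integral>\<^sup>+\<omega>. ennreal (kernel_error l N \<omega>) \<partial>P N) < ennreal \<epsilon>"
    using e by (intro order_tendstoD(2)[OF kernel_error_tendsto(1)[OF l]]) simp
  then obtain N where N: "(\<integral>\<^sup>+\<omega>. ennreal (kernel_error l N \<omega>) \<partial>P N) < ennreal \<epsilon>"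
    by (auto simp: eventually_sequentially)
  interpret PN: prob_space "P N" by (rule P)
  have "\<exists>\<omega>\<in>space (P N). kernel_error l N \<omega> < \<epsilon>"
  proof (rule ccontr)
    assume "\<not> (\<exists>\<omega>\<in>space (P N). kernel_error l N \<omega> < \<epsilon>)"
    then have "(\<integral>\<^sup>+\<omega>. ennreal \<epsilon> \<partial>P N) \<le> (\<integral>\<^sup>+\<omega>. ennreal (kernel_error l N \<omega>) \<partial>P N)"
      by (intro nn_integral_mono ennreal_leI) (auto simp: not_less)
    then show False using N by (simp add: PN.emeasure_space_1)
  qed
  then obtain \<omega> where "kernel_error l N \<omega> < \<epsilon>" by auto
  moreover have "0 \<le> U.square_dist (net.ker N (weights N \<omega>) l) (Kinf (Suc l))"
    "0 \<le> U.diagonal_dist (net.ker N (weights N \<omega>) l) (Kinf (Suc l))"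
    by (simp_all add: U.square_dist_def U.diagonal_dist_def)
  ultimately show "\<exists>K'. U.trace_psd K' \<and> U.square_dist K' (Kinf (Suc l)) < \<epsilon> \<and> U.diagonal_dist K' (Kinf (Suc l)) < \<epsilon>"
    by (intro exI[of _ "net.ker N (weights N \<omega>) l"]) (auto simp: ker_trace_psd kernel_error_def)
qed

definition operator_error :: "nat \<Rightarrow> nat \<Rightarrow> (nat \<times> nat \<times> nat \<Rightarrow> real) \<Rightarrow> ennreal" where
  "operator_error l N v = trace_norm (lebesgue_on U)
     (\<lambda>f x. integral_operator (lebesgue_on U) (net.ker N v l) f x - integral_operator (lebesgue_on U) (Kinf (Suc l)) f x)"

lemma operator_error_SUP:
  assumes "l \<le> L"
  shows "operator_error l N v = (SUP F\<in>{F. finite F \<and> orthonormal (lebesgue_on U) F}.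
    ennreal (\<Sum>f\<in>F. \<bar>U.form (net.ker N v l) f f - U.form (Kinf (Suc l)) f f\<bar>))"
  unfolding operator_error_def by (rule U.trace_norm_diff[OF ker_sym_kernel Kinf_sym_kernel[OF assms]])

text \<open>Close to a given weight configuration the kernels are uniformly close on the compact set U x U, so
  their Hilbert-Schmidt distance is small.\<close>

lemma form_continuous:
  assumes f: "f \<in> L2 (lebesgue_on U)"
  shows "continuous_on UNIV (\<lambda>v. U.form (net.ker N v l) f f)"
proof -
  let ?M = "lebesgue_on U"
  have "isCont (\<lambda>v. U.form (net.ker N v l) f f) v0" for v0
    unfolding isCont_def
  proof (rule tendstoI)
    fix \<epsilon> :: real assume e: "0 < \<epsilon>"
    define B where "B = L2_norm ?M f * L2_norm ?M f * sqrt (measure (?M \<Otimes>\<^sub>M ?M) (space (?M \<Otimes>\<^sub>M ?M)))"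
    have B: "0 \<le> B" by (simp add: B_def)
    define \<delta> where "\<delta> = \<epsilon> / (B + 1)"
    have d: "0 < \<delta>" using e B by (simp add: \<delta>_def)
    have "\<delta> * B < \<delta> * (B + 1)" using d by simp
    also have "\<dots> = \<epsilon>" using B by (simp add: \<delta>_def)
    finally have dB: "\<delta> * B < \<epsilon>" .
    have "continuous_on (UNIV \<times> (U \<times> U)) (\<lambda>p. net.ker N (fst p) l (fst (snd p)) (snd (snd p)))"
      by (rule continuous_on_subset[OF net.ker_continuous]) simp
    then obtain X0 where X0: "v0 \<in> X0" "open X0" and near': "\<forall>v\<in>X0 \<inter> UNIV. \<forall>p\<in>U \<times> U.
        dist (net.ker N (fst (v, p)) l (fst (snd (v, p))) (snd (snd (v, p))))
          (net.ker N (fst (v0, p)) l (fst (snd (v0, p))) (snd (snd (v0, p)))) \<le> \<delta>"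
      by (rule continuous_on_prod_compactE[OF _ compact_Times[OF U U] UNIV_I[of v0] d])
    have near: "dist (net.ker N v l (fst p) (snd p)) (net.ker N v0 l (fst p) (snd p)) \<le> \<delta>"
      if "v \<in> X0" "p \<in> U \<times> U" for v p
      using near'[rule_format, of v p] that by simp
    have "dist (U.form (net.ker N v l) f f) (U.form (net.ker N v0 l) f f) < \<epsilon>" if v: "v \<in> X0" for v
    proof -
      interpret PM: finite_measure "?M \<Otimes>\<^sub>M ?M"
        by (intro finite_measure_pair_measure U.finite_measure_axioms)
      let ?D = "\<lambda>x y. net.ker N v l x y - net.ker N v0 l x y"
      have D: "U.sym_kernel ?D" by (rule U.sym_kernel_diff[OF ker_sym_kernel ker_sym_kernel])
      have "U.square_dist (net.ker N v l) (net.ker N v0 l) \<le> (\<integral>p. \<delta>\<^sup>2 \<partial>(?M \<Otimes>\<^sub>M ?M))"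
        unfolding U.square_dist_def
      proof (rule integral_mono)
        show "integrable (?M \<Otimes>\<^sub>M ?M) (\<lambda>p. (?D (fst p) (snd p))\<^sup>2)"
          by (rule L2_integrable_square[OF U.sym_kernel_product_L2[OF D]])
        fix p assume "p \<in> space (?M \<Otimes>\<^sub>M ?M)"
        then have "p \<in> U \<times> U" by (auto simp: space_pair_measure)
        then have "\<bar>?D (fst p) (snd p)\<bar> \<le> \<delta>" using near[OF v] by (simp add: dist_real_def)
        then show "(?D (fst p) (snd p))\<^sup>2 \<le> \<delta>\<^sup>2" using power_mono[of "\<bar>?D (fst p) (snd p)\<bar>" \<delta> 2] by simp
      qed simp
      also have "\<dots> = \<delta>\<^sup>2 * measure (?M \<Otimes>\<^sub>M ?M) (space (?M \<Otimes>\<^sub>M ?M))" by simp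
      finally have "U.square_dist (net.ker N v l) (net.ker N v0 l) \<le> \<delta>\<^sup>2 * measure (?M \<Otimes>\<^sub>M ?M) (space (?M \<Otimes>\<^sub>M ?M))" .
      from real_sqrt_le_mono[OF this] d
      have "sqrt (U.square_dist (net.ker N v l) (net.ker N v0 l)) \<le> \<delta> * sqrt (measure (?M \<Otimes>\<^sub>M ?M) (space (?M \<Otimes>\<^sub>M ?M)))"
        by (simp add: real_sqrt_mult)
      then have "sqrt (U.square_dist (net.ker N v l) (net.ker N v0 l)) * (L2_norm ?M f * L2_norm ?M f)
          \<le> \<delta> * sqrt (measure (?M \<Otimes>\<^sub>M ?M) (space (?M \<Otimes>\<^sub>M ?M))) * (L2_norm ?M f * L2_norm ?M f)"
        by (rule mult_right_mono) simp
      also have "\<dots> = \<delta> * B" by (simp add: B_def)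
      finally show ?thesis
        using U.form_close[OF ker_sym_kernel[of N v l] ker_sym_kernel[of N v0 l] f f] dB by (simp add: dist_real_def)
    qed
    then show "\<forall>\<^sub>F v in at v0. dist (U.form (net.ker N v l) f f) (U.form (net.ker N v0 l) f f) < \<epsilon>"
      using X0 by (auto simp: eventually_at_topological)
  qed
  then show ?thesis by (simp add: continuous_on_eq_continuous_at)
qed

text \<open>The trace norm is lower semicontinuous in the weights, being a supremum of continuous functions, so
  its superlevel sets are open in the weights.\<close>

lemma operator_error_event:
  assumes l: "l \<le> L" and "0 < \<epsilon>"
  shows "{\<omega>\<in>space (P N). operator_error l N (weights N \<omega>) > ennreal \<epsilon>} \<in> sets (P N)"
proof -
  define \<F> where "\<F> = {F. finite F \<and> orthonormal (lebesgue_on U) F}"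
  define s where "s F v = (\<Sum>f\<in>F. \<bar>U.form (net.ker N v l) f f - U.form (Kinf (Suc l)) f f\<bar>)" for F v
  define V where "V = (\<Union>F\<in>\<F>. {v. \<epsilon> < s F v})"
  have "open {v. \<epsilon> < s F v}" if "F \<in> \<F>" for F
  proof (rule open_Collect_less[OF continuous_on_const])
    show "continuous_on UNIV (s F)"
      unfolding s_def using that
      by (intro continuous_intros form_continuous) (auto simp: \<F>_def dest: orthonormal_L2)
  qed
  then have "open V" unfolding V_def by blast
  then have "weights N -` V \<inter> space (P N) \<in> sets (P N)"
    by (intro measurable_sets[OF weights_borel_measurable]) simp
  moreover have "operator_error l N v > ennreal \<epsilon> \<longleftrightarrow> v \<in> V" for v
    unfolding operator_error_SUP[OF l] less_SUP_iff V_def \<F>_def s_def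
    using \<open>0 < \<epsilon>\<close> by (auto simp: ennreal_less_iff)
  then have "{\<omega>\<in>space (P N). operator_error l N (weights N \<omega>) > ennreal \<epsilon>} = weights N -` V \<inter> space (P N)"
    by auto
  ultimately show ?thesis by simp
qed

text \<open>If the operators differ by more than \<epsilon> then the kernels differ by at least some \<delta>, and
  Markov's inequality bounds the probability of that.\<close>

lemma operator_error_tendsto:
  assumes l: "l \<in> {1..L}" and e: "0 < \<epsilon>"
  shows "(\<lambda>N. emeasure (P N) {\<omega>\<in>space (P N). operator_error l N (weights N \<omega>) > ennreal \<epsilon>}) \<longlonglongrightarrow> 0"
proof -
  have lL: "l \<le> L" using l by simp
  obtain \<delta> where \<delta>: "0 < \<delta>" and close: "\<And>K F. U.trace_psd K \<Longrightarrow> U.square_dist K (Kinf (Suc l)) \<le> \<delta> \<Longrightarrow>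
      U.diagonal_dist K (Kinf (Suc l)) \<le> \<delta> \<Longrightarrow> finite F \<Longrightarrow> orthonormal (lebesgue_on U) F \<Longrightarrow>
      (\<Sum>f\<in>F. \<bar>U.form K f f - U.form (Kinf (Suc l)) f f\<bar>) \<le> \<epsilon>"
    by (rule U.trace_psd_continuity[OF Kinf_trace_psd[OF l] e]) rule
  have sub: "{\<omega>\<in>space (P N). operator_error l N (weights N \<omega>) > ennreal \<epsilon>}
      \<subseteq> {\<omega>\<in>space (P N). 1 \<le> ennreal (1 / \<delta>) * ennreal (kernel_error l N \<omega>)}" for N
  proof (rule subsetI, rule ccontr)
    fix \<omega> assume \<omega>: "\<omega> \<in> {\<omega>\<in>space (P N). operator_error l N (weights N \<omega>) > ennreal \<epsilon>}"
      and n: "\<omega> \<notin> {\<omega>\<in>space (P N). 1 \<le> ennreal (1 / \<delta>) * ennreal (kernel_error l N \<omega>)}"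
    let ?K = "net.ker N (weights N \<omega>) l"
    have nn: "0 \<le> U.square_dist ?K (Kinf (Suc l))" "0 \<le> U.diagonal_dist ?K (Kinf (Suc l))"
      by (simp_all add: U.square_dist_def U.diagonal_dist_def)
    have "ennreal (1 / \<delta>) * ennreal (kernel_error l N \<omega>) = ennreal (1 / \<delta> * kernel_error l N \<omega>)"
      using \<delta> by (intro ennreal_mult'[symmetric]) simp
    then have "kernel_error l N \<omega> < \<delta>"
      using n \<omega> \<delta> by (auto simp: not_le ennreal_less_one_iff field_simps)
    then have "U.square_dist ?K (Kinf (Suc l)) \<le> \<delta>" "U.diagonal_dist ?K (Kinf (Suc l)) \<le> \<delta>"
      using nn by (simp_all add: kernel_error_def)
    then have "operator_error l N (weights N \<omega>) \<le> ennreal \<epsilon>"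
      unfolding operator_error_SUP[OF lL] by (intro SUP_least ennreal_leI close ker_trace_psd) auto
    then show False using \<omega> by auto
  qed
  have le: "emeasure (P N) {\<omega>\<in>space (P N). operator_error l N (weights N \<omega>) > ennreal \<epsilon>}
      \<le> ennreal (1 / \<delta>) * (\<integral>\<^sup>+\<omega>. ennreal (kernel_error l N \<omega>) \<partial>P N)" for N
  proof -
    have m: "(\<lambda>\<omega>. ennreal (kernel_error l N \<omega>)) \<in> borel_measurable (P N)" by (rule kernel_error_tendsto(2)[OF l])
    have "{\<omega>\<in>space (P N). 1 \<le> ennreal (1 / \<delta>) * ennreal (kernel_error l N \<omega>)} \<in> sets (P N)"
      using m by measurable
    then have "emeasure (P N) {\<omega>\<in>space (P N). operator_error l N (weights N \<omega>) > ennreal \<epsilon>}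
        \<le> emeasure (P N) {\<omega>\<in>space (P N). 1 \<le> ennreal (1 / \<delta>) * ennreal (kernel_error l N \<omega>)}"
      by (rule emeasure_mono[OF sub])
    also have "\<dots> \<le> ennreal (1 / \<delta>) * (\<integral>\<^sup>+\<omega>. ennreal (kernel_error l N \<omega>) * indicator (space (P N)) \<omega> \<partial>P N)"
      using m by (intro nn_integral_Markov_inequality) auto
    finally show ?thesis by simp
  qed
  have "(\<lambda>N. ennreal (1 / \<delta>) * (\<integral>\<^sup>+\<omega>. ennreal (kernel_error l N \<omega>) \<partial>P N)) \<longlonglongrightarrow> ennreal (1 / \<delta>) * 0"
    by (intro ennreal_tendsto_cmult kernel_error_tendsto(1)[OF l]) simp
  then have "(\<lambda>N. ennreal (1 / \<delta>) * (\<integral>\<^sup>+\<omega>. ennreal (kernel_error l N \<omega>) \<partial>P N)) \<longlonglongrightarrow> 0" by simp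
  from tendsto_sandwich[OF _ _ tendsto_const this]
  show ?thesis using le by simp
qed

theorem operators_tendsto_in_probability:
  "tendsto_in_probability
     ({2..L+1} \<rightarrow> trace_class_nonneg_sym (lebesgue_on U))
     (trace_dist (lebesgue_on U) {2..L+1})
     P
     (\<lambda>N \<omega> l. integral_operator (lebesgue_on U) (layer_kernel ix sig lam (n N) (\<lambda>k i j. W N k i j \<omega>) l))
     (\<lambda>l. integral_operator (lebesgue_on U) (Kinf l))"
  unfolding tendsto_in_probability_def
proof (intro conjI allI ballI impI)
  have lk: "layer_kernel ix sig lam (n N) (\<lambda>k i j. W N k i j \<omega>) (Suc l) = net.ker N (weights N \<omega>) l"
    if "l \<in> {1..L}" for N \<omega> l
    using layer_kernel_eq_ker[OF that] by (intro ext)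
  have Suc_range: "{2..L+1} = Suc ` {1..L}" by (simp add: image_Suc_atLeastAtMost numeral_2_eq_2)
  show "(\<lambda>l. integral_operator (lebesgue_on U) (layer_kernel ix sig lam (n N) (\<lambda>k i j. W N k i j \<omega>) l))
      \<in> {2..L+1} \<rightarrow> trace_class_nonneg_sym (lebesgue_on U)" for N \<omega>
  proof (rule Pi_I)
    fix x assume "x \<in> {2..L+1}"
    then obtain l where "x = Suc l" "l \<in> {1..L}" unfolding Suc_range by blast
    then show "integral_operator (lebesgue_on U) (layer_kernel ix sig lam (n N) (\<lambda>k i j. W N k i j \<omega>) x)
        \<in> trace_class_nonneg_sym (lebesgue_on U)"
      by (simp only: lk) (rule U.trace_psd_trace_class[OF ker_trace_psd])
  qed
  show "(\<lambda>l. integral_operator (lebesgue_on U) (Kinf l)) \<in> {2..L+1} \<rightarrow> trace_class_nonneg_sym (lebesgue_on U)"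
  proof (rule Pi_I)
    fix x assume "x \<in> {2..L+1}"
    then obtain l where "x = Suc l" "l \<in> {1..L}" unfolding Suc_range by blast
    then show "integral_operator (lebesgue_on U) (Kinf x) \<in> trace_class_nonneg_sym (lebesgue_on U)"
      using U.trace_psd_trace_class[OF Kinf_trace_psd] by simp
  qed
  fix \<epsilon> :: real assume e: "0 < \<epsilon>"
  let ?d = "\<lambda>N \<omega>. trace_dist (lebesgue_on U) {2..L+1}
    (\<lambda>l. integral_operator (lebesgue_on U) (layer_kernel ix sig lam (n N) (\<lambda>k i j. W N k i j \<omega>) l))
    (\<lambda>l. integral_operator (lebesgue_on U) (Kinf l))"
  have d: "?d N \<omega> = (SUP l\<in>{1..L}. operator_error l N (weights N \<omega>))" for N \<omega>
    unfolding trace_dist_def Suc_range image_image operator_error_def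
    by (intro SUP_cong refl) (simp add: lk)
  have ev: "{\<omega>\<in>space (P N). ?d N \<omega> > ennreal \<epsilon>} = (\<Union>l\<in>{1..L}. {\<omega>\<in>space (P N). operator_error l N (weights N \<omega>) > ennreal \<epsilon>})" for N
    unfolding d less_SUP_iff by auto
  have meas: "{\<omega>\<in>space (P N). operator_error l N (weights N \<omega>) > ennreal \<epsilon>} \<in> sets (P N)" if "l \<in> {1..L}" for l N
    using that e by (intro operator_error_event) auto
  show "{\<omega>\<in>space (P N). ?d N \<omega> > ennreal \<epsilon>} \<in> sets (P N)" for N
    unfolding ev using meas by (intro sets.finite_UN) auto
  have "(\<lambda>N. \<Sum>l\<in>{1..L}. emeasure (P N) {\<omega>\<in>space (P N). operator_error l N (weights N \<omega>) > ennreal \<epsilon>}) \<longlonglongrightarrow> (\<Sum>l\<in>{1..L}. 0)"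
    by (intro tendsto_sum operator_error_tendsto e)
  then have lim: "(\<lambda>N. \<Sum>l\<in>{1..L}. emeasure (P N) {\<omega>\<in>space (P N). operator_error l N (weights N \<omega>) > ennreal \<epsilon>}) \<longlonglongrightarrow> 0" by simp
  have "(\<lambda>N. emeasure (P N) {\<omega>\<in>space (P N). ?d N \<omega> > ennreal \<epsilon>}) \<longlonglongrightarrow> 0"
  proof (rule tendsto_sandwich[OF _ _ tendsto_const lim])
    show "\<forall>\<^sub>F N in sequentially. emeasure (P N) {\<omega>\<in>space (P N). ?d N \<omega> > ennreal \<epsilon>}
        \<le> (\<Sum>l\<in>{1..L}. emeasure (P N) {\<omega>\<in>space (P N). operator_error l N (weights N \<omega>) > ennreal \<epsilon>})"
      unfolding ev using meas by (intro always_eventually allI emeasure_subadditive_finite) auto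
  qed simp
  then have "(\<lambda>N. emeasure (P N) {\<omega>\<in>space (P N). ?d N \<omega> > ennreal \<epsilon>}) \<longlonglongrightarrow> ennreal 0" by simp
  from tendsto_enn2real[OF this]
  show "(\<lambda>N. measure (P N) {\<omega>\<in>space (P N). ?d N \<omega> > ennreal \<epsilon>}) \<longlonglongrightarrow> 0"
    by (simp add: measure_def)
qed

end

theorem proposition3p1:
  fixes L D :: nat
    and U :: "(real^'n) set"
    and ix :: "nat \<Rightarrow> 'n"
    and lam :: "nat \<Rightarrow> real"
    and sig :: "real \<Rightarrow> real"
    and A r :: real
    and n :: "nat \<Rightarrow> nat \<Rightarrow> nat"
    and m :: "nat \<Rightarrow> real"
    and P :: "nat \<Rightarrow> 'w measure"
    and W :: "nat \<Rightarrow> nat \<Rightarrow> nat \<Rightarrow> nat \<Rightarrow> 'w \<Rightarrow> real"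
    and G :: "nat \<Rightarrow> 'v measure"
    and h :: "nat \<Rightarrow> real^'n \<Rightarrow> 'v \<Rightarrow> real"
    and Kinf :: "nat \<Rightarrow> real^'n \<Rightarrow> real^'n \<Rightarrow> real"
  assumes L: "1 \<le> L" and D: "1 \<le> D"
    and U: "compact U"
    and ix: "bij_betw ix {1..CARD('n)} UNIV"
    and lam: "\<And>l. l \<le> L \<Longrightarrow> 0 < lam l"
    \<comment> \<open>the weights of the N-th network\<close>
    and P: "\<And>N. prob_space (P N)"
    and W_indep: "\<And>N. prob_space.indep_vars (P N) (\<lambda>_. borel) (\<lambda>(l, i, j). W N l i j)
          {(l, i, j). l \<le> L \<and> i \<in> {1..n N (Suc l)} \<and> j \<in> {1..n N l}}"
    and W_normal: "\<And>N l i j. l \<le> L \<Longrightarrow> i \<in> {1..n N (Suc l)} \<Longrightarrow> j \<in> {1..n N l} \<Longrightarrow>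
          distributed (P N) lborel (W N l i j) (normal_density 0 (sqrt (1 / lam l)))"
    \<comment> \<open>the activation function\<close>
    and sig_cont: "continuous_on UNIV sig"
    and sig_growth: "0 < r" "\<And>x. (sig x)\<^sup>2 \<le> A * (1 + \<bar>x\<bar> powr r)"
    \<comment> \<open>the widths\<close>
    and width_in: "\<And>N. n N 0 = CARD('n)"
    and width_out: "\<And>N. n N (Suc L) = D"
    and width_lim: "\<And>l. l \<in> {1..L} \<Longrightarrow> 0 < m l \<and> (\<lambda>N. real (n N l) / real N) \<longlonglongrightarrow> m l"
    \<comment> \<open>the limit kernels\<close>
    and Kinf_1: "\<And>x y. x \<in> U \<Longrightarrow> y \<in> U \<Longrightarrow> Kinf 1 x y = input_kernel lam x y"
    and Kinf_gp: "\<And>l. l \<in> {1..L} \<Longrightarrow> centered_gaussian_process (G l) U (h l) (Kinf l)"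
    and Kinf_rec: "\<And>l x y. l \<in> {2..L+1} \<Longrightarrow> x \<in> U \<Longrightarrow> y \<in> U \<Longrightarrow>
          Kinf l x y = 1 / lam (l-1) * (\<integral>v. sig (h (l-1) x v) * sig (h (l-1) y v) \<partial>G (l-1))"
  shows "tendsto_in_probability
           ({2..L+1} \<rightarrow> trace_class_nonneg_sym (lebesgue_on U))
           (trace_dist (lebesgue_on U) {2..L+1})
           P
           (\<lambda>N \<omega> l. integral_operator (lebesgue_on U)
              (layer_kernel ix sig lam (n N) (\<lambda>k i j. W N k i j \<omega>) l))
           (\<lambda>l. integral_operator (lebesgue_on U) (Kinf l))"
proof -
  obtain A' k where g: "0 \<le> A'" "\<And>x. (sig x)\<^sup>2 \<le> A' * (1 + x ^ (2 * k))"
    using polynomial_growth_even[OF sig_growth] by blast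
  \<comment> \<open>Continuing lam by 1 beyond L makes it positive at every index and leaves the
    kernels up to layer L + 1 as they are.\<close>
  define lam' where "lam' l = (if l \<le> L then lam l else 1)" for l
  have lam'_eq: "lam' l = lam l" if "l \<le> L" for l using that by (simp add: lam'_def)
  have width_div: "filterlim (\<lambda>N. real (n N l)) at_top sequentially" if "l \<in> {1..L}" for l
  proof -
    have "filterlim (\<lambda>N. real (n N l) / real N * real N) at_top sequentially"
      using width_lim[OF that] by (intro filterlim_tendsto_pos_mult_at_top filterlim_real_sequentially) auto
    moreover have "\<forall>\<^sub>F N in sequentially. real (n N l) / real N * real N = real (n N l)"
      using eventually_gt_at_top[of 0] by eventually_elim simp
    ultimately show ?thesis by (simp cong: filterlim_cong)
  qed
  interpret wide_random_networks sig A' k L U ix lam' n G h Kinf P W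
  proof (intro wide_random_networks.intro wide_networks.intro growth.intro
      wide_networks_axioms.intro wide_random_networks_axioms.intro)
    show "0 < lam' l" for l using lam by (simp add: lam'_def)
    show "Kinf 1 x y = input_kernel lam' x y" if "x \<in> U" "y \<in> U" for x y
      using Kinf_1[OF that] by (simp add: input_kernel_def lam'_eq)
    show "Kinf l x y = 1 / lam' (l-1) * (\<integral>v. sig (h (l-1) x v) * sig (h (l-1) y v) \<partial>G (l-1))"
      if "l \<in> {2..L+1}" "x \<in> U" "y \<in> U" for l x y
    proof -
      have "lam' (l-1) = lam (l-1)" using that(1) by (intro lam'_eq) auto
      then show ?thesis by (simp only: Kinf_rec[OF that])
    qed
    show "distributed (P N) lborel (W N l i j) (normal_density 0 (sqrt (1 / lam' l)))"
      if "l \<le> L" "i \<in> {1..n N (Suc l)}" "j \<in> {1..n N l}" for N l i j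
      using W_normal[OF that] that(1) by (simp add: lam'_eq)
  qed (fact sig_cont g U ix width_in width_div Kinf_gp L P W_indep)+
  have layers: "layer_kernel ix sig lam (n N) w l = layer_kernel ix sig lam' (n N) w l"
    if "l \<in> {2..L+1}" for N w l
  proof -
    have "lam' (l-1) = lam (l-1)" using that by (intro lam'_eq) auto
    then show ?thesis by (intro ext) (simp only: layer_kernel_def)
  qed
  have "trace_dist (lebesgue_on U) {2..L+1}
      (\<lambda>l. integral_operator (lebesgue_on U) (layer_kernel ix sig lam (n N) w l)) T =
    trace_dist (lebesgue_on U) {2..L+1}
      (\<lambda>l. integral_operator (lebesgue_on U) (layer_kernel ix sig lam' (n N) w l)) T" for N w T
    unfolding trace_dist_def by (intro SUP_cong refl) (simp add: layers)
  moreover have "(\<lambda>l. integral_operator (lebesgue_on U) (layer_kernel ix sig lam (n N) w l)) \<in> {2..L+1} \<rightarrow> X \<longleftrightarrow>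
    (\<lambda>l. integral_operator (lebesgue_on U) (layer_kernel ix sig lam' (n N) w l)) \<in> {2..L+1} \<rightarrow> X" for N w X
    unfolding Pi_def by (auto simp: layers)
  ultimately show ?thesis
    using operators_tendsto_in_probability unfolding tendsto_in_probability_def by simp
qed

end
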